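(* Let $G$ be an infinitesimal group scheme of height at most $r$ over $k$. The full subcategory $\ker(\mathcal{H}^{[1]})$ of the stable module category $\underline{\mathrm{mod}}(G)$, consisting of those finite-dimensional $G$-modules $M$ with $\mathcal{H}^{[1]}(M)=0$, is a thick subcategory of $\underline{\mathrm{mod}}(G)$.
   Context: $k$ is an algebraically closed field of characteristic $p>0$. A group scheme $G$ over $k$ is infinitesimal of height at most $r$ if its coordinate algebra $k[G]$ is a finite-dimensional local ring and $x^{p^r}=0$ for all $x$ in the maximal ideal. Its group algebra is $kG=\mathrm{Hom}_k(k[G],k)$; a $G$-module is a $kG$-module. $\mathbb{G}_{a(r)}$ is the $r$-th Frobenius kernel of the additive group: $k[\mathbb{G}_{a(r)}]=k[t]/t^{p^r}$ with $t$ primitive, and $k\mathbb{G}_{a(r)}=k[u_1,\dots,u_r]/(u_1^p,\dots,u_r^p)$ with $u_i$ dual to $t^{p^{i-1}}$ in the monomial basis. $V(G)=\operatorname{Spec}k[V(G)]$ is the affine scheme representing the functor $R\mapsto \mathrm{Hom}_{R\text{-grp}}(\mathbb{G}_{a(r),R},G_R)$ on commutative $k$-algebras. The ring $k[V(G)]$ is a finitely generated connected graded $k$-algebra with generators in degrees $p^i$, $0\le i<r$; the grading comes from the action of $\mathbb{A}^1$ on $V(G)$ in which $b\in R$ acts by precomposition with the endomorphism $t\mapsto bt$ of $\mathbb{G}_{a(r),R}$. $\mathbb{P}(G)=\operatorname{Proj}(k[V(G)]/\mathfrak{N})$, with $\mathfrak{N}$ the nilradical. The universal one-parameter subgroup $\mathcal{U}_G:\mathbb{G}_{a(r),k[V(G)]}\to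 G_{k[V(G)]}$ (corresponding to the identity of $k[V(G)]$) induces a map $\mathcal{U}_{G,*}$ on group algebras; put $\Theta_G=\mathcal{U}_{G,*}(1\otimes u_r)\in k[V(G)]\otimes_k kG$. For a finite-dimensional $G$-module $M$ let $\widetilde{M}=\mathcal{O}_{\mathbb{P}(G)}\otimes_k M$; the action of $\Theta_G$ on $k[V(G)]\otimes_k M$ is homogeneous of degree $p^{r-1}$ and induces the global operator $\Theta_M:\widetilde{M}\to\widetilde{M}(p^{r-1})$. (The sheaves $\mathcal{O}_{\mathbb{P}(G)}(dp^{r-1})$, $d\in\mathbb{Z}$, are invertible, and $\Theta_M^p=0$.) $\ker\Theta_M\subseteq\widetilde{M}$ is the kernel of $\Theta_M$, and $\operatorname{im}\Theta_M^{p-1}\subseteq\widetilde{M}$ is the image of the $(p-1)$-fold composite $\widetilde{M}(-(p-1)p^{r-1})\to\widetilde{M}$ of shifts of $\Theta_M$. $\mathcal{H}^{[1]}(M)=\ker\Theta_M/\operatorname{im}\Theta_M^{p-1}$. If $M$ is projective then $\mathcal{H}^{[1]}(M)=0$, so $\mathcal{H}^{[1]}$ is a functor from $\underline{\mathrm{mod}}(G)$ to coherent sheaves on $\mathbb{P}(G)$. The stable module category $\underline{\mathrm{mod}}(G)$ has the finite-dimensional $G$-modules as objects, and its Hom-sets are $\mathrm{Hom}_G(M,N)$ modulo homomorphisms factoring through a projective. It is triangulated: the shift is $\Omega^{-1}$ (inverse of the Heller shift $\Omega$, where $\Omega(M)$ is the kernel of the projective cover of $M$), and triangles are those isomorphic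 to $N\to M\to M/N\to\Omega^{-1}(N)$ for short exact sequences $0\to N\to M\to M/N\to 0$ of finite-dimensional $G$-modules. A full subcategory is thick if it is closed under isomorphisms, shifts and direct summands, and whenever $X\to Y\to Z\to\Omega^{-1}(X)$ is a triangle with $X,Y$ in the subcategory then $Z$ is also in it. *)

theory Defs
  imports
    "HOL-Library.Poly_Mapping"
    "HOL-Computational_Algebra.Polynomial"
    "HOL-Algebra.QuotRing"
    "HOL-Algebra.Module"
begin

section \<open>Algebras and tensor products over the base field\<close>

text \<open>
  The base field is a type \<open>'k\<close>. All other objects are structures with an explicit
  carrier; a commutative \<open>'k\<close>-algebra is a structure \<open>R\<close> with \<open>algebra kk R\<close>, where \<open>kk\<close> is \<open>'k\<close> as
  an algebra over itself. Ring fields of a structure which is only used as a module are irrelevant.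
\<close>

definition kk :: "('k::field, 'k) module" where
  "kk = \<lparr>carrier = UNIV, monoid.mult = (*), one = 1, ring.zero = 0, add = (+), module.smult = (*)\<rparr>"

definition alg_hom ::
  "('k, 'a, 'x) module_scheme \<Rightarrow> ('k, 'b, 'y) module_scheme \<Rightarrow> ('a \<Rightarrow> 'b) set" where
  "alg_hom A B = {h \<in> ring_hom A B. \<forall>c. \<forall>x\<in>carrier A. h (c \<odot>\<^bsub>A\<^esub> x) = c \<odot>\<^bsub>B\<^esub> h x}"

definition fin_dim :: "('k::field, 'm, 'x) module_scheme \<Rightarrow> bool" where
  "fin_dim V \<longleftrightarrow> (\<exists>X. finite X \<and> X \<subseteq> carrier V \<and>
     (\<forall>v\<in>carrier V. \<exists>c. v = (\<Oplus>\<^bsub>V\<^esub>x\<in>X. c x \<odot>\<^bsub>V\<^esub> x)))"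

text \<open>
  \<open>V \<otimes> W\<close> is the space of formal linear combinations of pairs \<open>(v, w)\<close> modulo the subspace
  \<open>tensor_null V W\<close> of bilinearity relations. Its elements are cosets, and operations on them are
  written as unions over representatives of cosets that coincide. For algebras \<open>V\<close>, \<open>W\<close> the
  multiplication is that of the tensor product algebra.
\<close>

definition formal :: "('k::field, 'v, 'x) module_scheme \<Rightarrow> ('k, 'w, 'y) module_scheme \<Rightarrow>
    (('v \<times> 'w) \<Rightarrow>\<^sub>0 'k) set" where
  "formal V W = {x. Poly_Mapping.keys x \<subseteq> carrier V \<times> carrier W}"

definition fscale :: "'k::field \<Rightarrow> ('i \<Rightarrow>\<^sub>0 'k) \<Rightarrow> ('i \<Rightarrow>\<^sub>0 'k)" where
  "fscale c x = Poly_Mapping.map ((*) c) x"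

inductive_set tensor_null ::
  "('k::field, 'v, 'x) module_scheme \<Rightarrow> ('k, 'w, 'y) module_scheme \<Rightarrow> (('v \<times> 'w) \<Rightarrow>\<^sub>0 'k) set"
  for V :: "('k::field, 'v, 'x) module_scheme" and W :: "('k, 'w, 'y) module_scheme" where
  zero: "0 \<in> tensor_null V W"
| add: "x \<in> tensor_null V W \<Longrightarrow> y \<in> tensor_null V W \<Longrightarrow> x + y \<in> tensor_null V W"
| scale: "x \<in> tensor_null V W \<Longrightarrow> fscale c x \<in> tensor_null V W"
| add_left: "v \<in> carrier V \<Longrightarrow> v' \<in> carrier V \<Longrightarrow> w \<in> carrier W \<Longrightarrow>
    Poly_Mapping.single (v \<oplus>\<^bsub>V\<^esub> v', w) 1
      - Poly_Mapping.single (v, w) 1 - Poly_Mapping.single (v', w) 1 \<in> tensor_null V W"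
| add_right: "v \<in> carrier V \<Longrightarrow> w \<in> carrier W \<Longrightarrow> w' \<in> carrier W \<Longrightarrow>
    Poly_Mapping.single (v, w \<oplus>\<^bsub>W\<^esub> w') 1
      - Poly_Mapping.single (v, w) 1 - Poly_Mapping.single (v, w') 1 \<in> tensor_null V W"
| smult_left: "v \<in> carrier V \<Longrightarrow> w \<in> carrier W \<Longrightarrow>
    Poly_Mapping.single (c \<odot>\<^bsub>V\<^esub> v, w) 1 - Poly_Mapping.single (v, w) c \<in> tensor_null V W"
| smult_right: "v \<in> carrier V \<Longrightarrow> w \<in> carrier W \<Longrightarrow>
    Poly_Mapping.single (v, c \<odot>\<^bsub>W\<^esub> w) 1 - Poly_Mapping.single (v, w) c \<in> tensor_null V W"

definition tcoset :: "('k::field, 'v, 'x) module_scheme \<Rightarrow> ('k, 'w, 'y) module_scheme \<Rightarrow>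
    (('v \<times> 'w) \<Rightarrow>\<^sub>0 'k) \<Rightarrow> (('v \<times> 'w) \<Rightarrow>\<^sub>0 'k) set" where
  "tcoset V W x = {y \<in> formal V W. y - x \<in> tensor_null V W}"

definition formal_mult :: "('k::field, 'v, 'x) module_scheme \<Rightarrow> ('k, 'w, 'y) module_scheme \<Rightarrow>
    (('v \<times> 'w) \<Rightarrow>\<^sub>0 'k) \<Rightarrow> (('v \<times> 'w) \<Rightarrow>\<^sub>0 'k) \<Rightarrow> (('v \<times> 'w) \<Rightarrow>\<^sub>0 'k)" where
  "formal_mult V W x y =
     (\<Sum>(a, b)\<in>Poly_Mapping.keys x. \<Sum>(c, d)\<in>Poly_Mapping.keys y.
        Poly_Mapping.single (a \<otimes>\<^bsub>V\<^esub> c, b \<otimes>\<^bsub>W\<^esub> d)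
          (Poly_Mapping.lookup x (a, b) * Poly_Mapping.lookup y (c, d)))"

definition tens :: "('k::field, 'v, 'x) module_scheme \<Rightarrow> ('k, 'w, 'y) module_scheme \<Rightarrow>
    'v \<Rightarrow> 'w \<Rightarrow> (('v \<times> 'w) \<Rightarrow>\<^sub>0 'k) set" where
  "tens V W v w = tcoset V W (Poly_Mapping.single (v, w) 1)"

definition tensor :: "('k::field, 'v, 'x) module_scheme \<Rightarrow> ('k, 'w, 'y) module_scheme \<Rightarrow>
    ('k, (('v \<times> 'w) \<Rightarrow>\<^sub>0 'k) set) module" where
  "tensor V W = \<lparr>
     carrier = tcoset V W ` formal V W,
     monoid.mult = (\<lambda>X Y. \<Union>x\<in>X. \<Union>y\<in>Y. tcoset V W (formal_mult V W x y)),
     one = tens V W \<one>\<^bsub>V\<^esub> \<one>\<^bsub>W\<^esub>,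
     ring.zero = tcoset V W 0,
     add = (\<lambda>X Y. \<Union>x\<in>X. \<Union>y\<in>Y. tcoset V W (x + y)),
     module.smult = (\<lambda>c X. \<Union>x\<in>X. tcoset V W (fscale c x))\<rparr>"

text \<open>
  The linear map \<open>V \<otimes> W \<rightarrow> Y\<close> with \<open>v \<otimes> w \<mapsto> \<beta> v w\<close>, for a bilinear map \<open>\<beta>\<close>; it does not depend
  on the representative.
\<close>

definition tensor_lift :: "('k::field, 'y, 'z) module_scheme \<Rightarrow> ('v \<Rightarrow> 'w \<Rightarrow> 'y) \<Rightarrow>
    (('v \<times> 'w) \<Rightarrow>\<^sub>0 'k) set \<Rightarrow> 'y" where
  "tensor_lift Y \<beta> X =
     (let x = (SOME x. x \<in> X) in
      \<Oplus>\<^bsub>Y\<^esub>i\<in>Poly_Mapping.keys x. Poly_Mapping.lookup x i \<odot>\<^bsub>Y\<^esub> \<beta> (fst i) (snd i))"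


section \<open>Infinitesimal group schemes and their group algebras\<close>

text \<open>An affine group scheme \<open>G\<close> is given by its coordinate Hopf algebra \<open>k[G]\<close>.\<close>

record (overloaded) ('k::zero, 'h) hopf = "('k, 'h) module" +
  comult :: "'h \<Rightarrow> (('h \<times> 'h) \<Rightarrow>\<^sub>0 'k) set"
  counit :: "'h \<Rightarrow> 'k"
  antipode :: "'h \<Rightarrow> 'h"

definition affine_group_scheme :: "('k::field, 'h) hopf \<Rightarrow> bool" where
  "affine_group_scheme G \<longleftrightarrow>
     algebra kk G \<and>
     comult G \<in> alg_hom G (tensor G G) \<and>
     counit G \<in> alg_hom G kk \<and>
     antipode G \<in> alg_hom G G \<and>
     (\<forall>f\<in>carrier G.
        tensor_lift (tensor G (tensor G G))
          (\<lambda>a b. tensor_lift (tensor G (tensor G G))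
                   (\<lambda>c d. tens G (tensor G G) c (tens G G d b)) (comult G a)) (comult G f)
        = tensor_lift (tensor G (tensor G G))
          (\<lambda>a b. tens G (tensor G G) a (comult G b)) (comult G f)) \<and>
     (\<forall>f\<in>carrier G. tensor_lift G (\<lambda>a b. counit G a \<odot>\<^bsub>G\<^esub> b) (comult G f) = f) \<and>
     (\<forall>f\<in>carrier G. tensor_lift G (\<lambda>a b. counit G b \<odot>\<^bsub>G\<^esub> a) (comult G f) = f) \<and>
     (\<forall>f\<in>carrier G. tensor_lift G (\<lambda>a b. antipode G a \<otimes>\<^bsub>G\<^esub> b) (comult G f)
        = counit G f \<odot>\<^bsub>G\<^esub> \<one>\<^bsub>G\<^esub>) \<and>
     (\<forall>f\<in>carrier G. tensor_lift G (\<lambda>a b. a \<otimes>\<^bsub>G\<^esub> antipode G b) (comult G f)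
        = counit G f \<odot>\<^bsub>G\<^esub> \<one>\<^bsub>G\<^esub>)"

definition infinitesimal_group_scheme :: "nat \<Rightarrow> nat \<Rightarrow> ('k::field, 'h) hopf \<Rightarrow> bool" where
  "infinitesimal_group_scheme p r G \<longleftrightarrow>
     affine_group_scheme G \<and> fin_dim G \<and>
     (\<exists>!\<mm>. maximalideal \<mm> G) \<and>
     (\<forall>\<mm>. maximalideal \<mm> G \<longrightarrow> (\<forall>x\<in>\<mm>. x [^]\<^bsub>G\<^esub> (p ^ r) = \<zero>\<^bsub>G\<^esub>))"

definition group_algebra :: "('k::field, 'h) hopf \<Rightarrow> ('k, 'h \<Rightarrow> 'k) module" where
  "group_algebra G = \<lparr>
     carrier = {\<alpha> \<in> extensional (carrier G).
       (\<forall>x\<in>carrier G. \<forall>y\<in>carrier G. \<alpha> (x \<oplus>\<^bsub>G\<^esub> y) = \<alpha> x + \<alpha> y) \<and>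
       (\<forall>c. \<forall>x\<in>carrier G. \<alpha> (c \<odot>\<^bsub>G\<^esub> x) = c * \<alpha> x)},
     monoid.mult = (\<lambda>\<alpha> \<beta>. \<lambda>f\<in>carrier G. tensor_lift kk (\<lambda>a b. \<alpha> a * \<beta> b) (comult G f)),
     one = restrict (counit G) (carrier G),
     ring.zero = (\<lambda>f\<in>carrier G. 0),
     add = (\<lambda>\<alpha> \<beta>. \<lambda>f\<in>carrier G. \<alpha> f + \<beta> f),
     module.smult = (\<lambda>c \<alpha>. \<lambda>f\<in>carrier G. c * \<alpha> f)\<rparr>"


section \<open>One-parameter subgroups and their representing algebra\<close>

text \<open>\<open>R[t]/t^q\<close>, an element being the family of its coefficients.\<close>

definition trunc_poly :: "nat \<Rightarrow> ('k, 'a, 'x) module_scheme \<Rightarrow> ('k, nat \<Rightarrow> 'a) module" where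
  "trunc_poly q R = \<lparr>
     carrier = {..<q} \<rightarrow>\<^sub>E carrier R,
     monoid.mult = (\<lambda>a b. \<lambda>j\<in>{..<q}. \<Oplus>\<^bsub>R\<^esub>i\<in>{..j}. a i \<otimes>\<^bsub>R\<^esub> b (j - i)),
     one = (\<lambda>j\<in>{..<q}. if j = 0 then \<one>\<^bsub>R\<^esub> else \<zero>\<^bsub>R\<^esub>),
     ring.zero = (\<lambda>j\<in>{..<q}. \<zero>\<^bsub>R\<^esub>),
     add = (\<lambda>a b. \<lambda>j\<in>{..<q}. a j \<oplus>\<^bsub>R\<^esub> b j),
     module.smult = (\<lambda>c a. \<lambda>j\<in>{..<q}. c \<odot>\<^bsub>R\<^esub> a j)\<rparr>"

text \<open>
  A homomorphism of \<open>R\<close>-groups from the \<open>r\<close>-th Frobenius kernel of the additive group to \<open>G\<close>, given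
  by the restriction \<open>\<nu>\<close> of its comorphism \<open>R \<otimes> k[G] \<rightarrow> R[t]/t^(p^r)\<close> to \<open>k[G]\<close>. The last clause is
  \<open>\<Delta>(\<nu> f) = (\<nu> \<otimes> \<nu>)(\<Delta> f)\<close>, read off at the basis element \<open>t^i \<otimes> t^j\<close> of the tensor square of
  \<open>R[t]/t^(p^r)\<close> over \<open>R\<close>: as \<open>t\<close> is primitive, this coefficient of \<open>\<Delta>(t^n)\<close> is \<open>n choose i\<close> if
  \<open>n = i + j\<close> and \<open>0\<close> otherwise.
\<close>

definition one_param_subgroup ::
  "nat \<Rightarrow> nat \<Rightarrow> ('k::field, 'h) hopf \<Rightarrow> ('k, 'a) module \<Rightarrow> ('h \<Rightarrow> nat \<Rightarrow> 'a) \<Rightarrow> bool" where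
  "one_param_subgroup p r G R \<nu> \<longleftrightarrow>
     \<nu> \<in> alg_hom G (trunc_poly (p ^ r) R) \<and>
     (\<forall>f\<in>carrier G. \<nu> f 0 = counit G f \<odot>\<^bsub>R\<^esub> \<one>\<^bsub>R\<^esub>) \<and>
     (\<forall>f\<in>carrier G. \<forall>i<p ^ r. \<forall>j<p ^ r.
        (if i + j < p ^ r then add_pow R ((i + j) choose i) (\<nu> f (i + j)) else \<zero>\<^bsub>R\<^esub>)
        = tensor_lift R (\<lambda>a b. \<nu> a i \<otimes>\<^bsub>R\<^esub> \<nu> b j) (comult G f))"

text \<open>Precomposition with the endomorphism \<open>t \<mapsto> b t\<close>.\<close>

definition rescale :: "nat \<Rightarrow> ('k, 'a) module \<Rightarrow> 'a \<Rightarrow> ('h \<Rightarrow> nat \<Rightarrow> 'a) \<Rightarrow> ('h \<Rightarrow> nat \<Rightarrow> 'a)" where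
  "rescale q R b \<nu> = (\<lambda>f. \<lambda>j\<in>{..<q}. b [^]\<^bsub>R\<^esub> j \<otimes>\<^bsub>R\<^esub> \<nu> f j)"

text \<open>\<open>\<psi> : A \<rightarrow> R\<close> carries the one-parameter subgroup \<open>U\<close> over \<open>A\<close> to \<open>\<nu>\<close>.\<close>

definition classifies :: "nat \<Rightarrow> ('k::field, 'h) hopf \<Rightarrow> ('k, 'a) module \<Rightarrow> ('h \<Rightarrow> nat \<Rightarrow> 'a) \<Rightarrow>
    ('k, 'a) module \<Rightarrow> ('h \<Rightarrow> nat \<Rightarrow> 'a) \<Rightarrow> ('a \<Rightarrow> 'a) \<Rightarrow> bool" where
  "classifies q G A U R \<nu> \<psi> \<longleftrightarrow>
     \<psi> \<in> alg_hom A R \<and> (\<forall>f\<in>carrier G. \<forall>j<q. \<psi> (U f j) = \<nu> f j)"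

text \<open>
  \<open>A = k[V(G)]\<close> with universal one-parameter subgroup \<open>U\<close>. The test algebras \<open>R\<close> have carriers in
  the same type as \<open>A\<close>. If this type contains a copy of \<open>k\<close>, then every finitely generated
  \<open>k\<close>-algebra has an isomorphic copy in it (\<open>k\<close> being infinite), which includes the true \<open>k[V(G)]\<close>,
  and so \<open>A\<close> is isomorphic to it.
\<close>

definition represents_V ::
  "nat \<Rightarrow> nat \<Rightarrow> ('k::field, 'h) hopf \<Rightarrow> ('k, 'a) module \<Rightarrow> ('h \<Rightarrow> nat \<Rightarrow> 'a) \<Rightarrow> bool" where
  "represents_V p r G A U \<longleftrightarrow>
     algebra kk A \<and> one_param_subgroup p r G A U \<and>
     (\<forall>R \<nu>. algebra kk R \<and> one_param_subgroup p r G R \<nu> \<longrightarrow>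
        (\<exists>!\<psi>. \<psi> \<in> extensional (carrier A) \<and> classifies (p ^ r) G A U R \<nu> \<psi>))"

text \<open>
  The grading of \<open>k[V(G)]\<close>: a function \<open>a\<close> on \<open>V(G)\<close> has degree \<open>n\<close> iff \<open>a(\<nu> \<circ> b) = b^n a(\<nu>)\<close> for
  all points \<open>\<nu>\<close> of \<open>V(G)\<close> over all \<open>R\<close> and all \<open>b \<in> R\<close>, where \<open>a(\<nu>)\<close> is the image of \<open>a\<close> under the
  homomorphism classifying \<open>\<nu>\<close>.
\<close>

definition V_degree :: "nat \<Rightarrow> nat \<Rightarrow> ('k::field, 'h) hopf \<Rightarrow> ('k, 'a) module \<Rightarrow>
    ('h \<Rightarrow> nat \<Rightarrow> 'a) \<Rightarrow> nat \<Rightarrow> 'a set" where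
  "V_degree p r G A U n = {a \<in> carrier A. \<forall>R \<nu> b \<psi> \<psi>'.
     algebra kk R \<and> one_param_subgroup p r G R \<nu> \<and> b \<in> carrier R \<and>
     classifies (p ^ r) G A U R \<nu> \<psi> \<and>
     classifies (p ^ r) G A U R (rescale (p ^ r) R b \<nu>) \<psi>' \<longrightarrow>
     \<psi>' a = b [^]\<^bsub>R\<^esub> n \<otimes>\<^bsub>R\<^esub> \<psi> a}"

definition nilradical :: "('a, 'x) ring_scheme \<Rightarrow> 'a set" where
  "nilradical R = {a \<in> carrier R. \<exists>n::nat. a [^]\<^bsub>R\<^esub> n = \<zero>\<^bsub>R\<^esub>}"

definition reduced_alg :: "('k, 'a) module \<Rightarrow> ('k, 'a set) module" where
  "reduced_alg A = ring.extend (A Quot nilradical A)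
     (module.fields (\<lambda>c X. \<Union>x\<in>X. nilradical A +>\<^bsub>A\<^esub> (c \<odot>\<^bsub>A\<^esub> x)))"

definition reduced_degree :: "nat \<Rightarrow> nat \<Rightarrow> ('k::field, 'h) hopf \<Rightarrow> ('k, 'a) module \<Rightarrow>
    ('h \<Rightarrow> nat \<Rightarrow> 'a) \<Rightarrow> nat \<Rightarrow> 'a set set" where
  "reduced_degree p r G A U n = (\<lambda>a. nilradical A +>\<^bsub>A\<^esub> a) ` V_degree p r G A U n"


section \<open>The operator \<open>\<Theta>\<close>\<close>

text \<open>
  \<open>u_i\<close> as a linear functional on \<open>A[t]/t^(p^r)\<close>; it is dual to \<open>t^(p^(i-1))\<close> in the monomial basis.
\<close>

definition dual_u :: "nat \<Rightarrow> nat \<Rightarrow> (nat \<Rightarrow> 'a) \<Rightarrow> 'a" where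
  "dual_u p i a = a (p ^ (i - 1))"

text \<open>
  The map on group algebras induced by \<open>U\<close> is precomposition of functionals with the comorphism of
  \<open>U\<close>. So \<open>\<Theta> = U_*(1 \<otimes> u_r)\<close> is the element of \<open>A \<otimes> kG\<close> which, as a functional on \<open>k[G]\<close> with
  values in \<open>A\<close>, is \<open>f \<mapsto> u_r(U f)\<close>.
\<close>

definition Theta :: "nat \<Rightarrow> nat \<Rightarrow> ('k::field, 'h) hopf \<Rightarrow> ('k, 'a) module \<Rightarrow>
    ('h \<Rightarrow> nat \<Rightarrow> 'a) \<Rightarrow> (('a \<times> ('h \<Rightarrow> 'k)) \<Rightarrow>\<^sub>0 'k) set" where
  "Theta p r G A U = (THE X. X \<in> carrier (tensor A (group_algebra G)) \<and>
     (\<forall>f\<in>carrier G. tensor_lift A (\<lambda>a \<alpha>. \<alpha> f \<odot>\<^bsub>A\<^esub> a) X = dual_u p r (U f)))"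

text \<open>Modules over a not necessarily commutative finite-dimensional \<open>'k\<close>-algebra \<open>B\<close>, such as \<open>kG\<close>.\<close>

record ('k, 'b, 'm) bmod = "('k, 'm) module" +
  act :: "'b \<Rightarrow> 'm \<Rightarrow> 'm"

definition fd_module :: "('k::field, 'b) module \<Rightarrow> ('k, 'b, 'm) bmod \<Rightarrow> bool" where
  "fd_module B M \<longleftrightarrow>
     module kk M \<and> fin_dim M \<and>
     (\<forall>\<alpha>\<in>carrier B. \<forall>x\<in>carrier M. act M \<alpha> x \<in> carrier M) \<and>
     (\<forall>\<alpha>\<in>carrier B. \<forall>x\<in>carrier M. \<forall>y\<in>carrier M.
        act M \<alpha> (x \<oplus>\<^bsub>M\<^esub> y) = act M \<alpha> x \<oplus>\<^bsub>M\<^esub> act M \<alpha> y) \<and>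
     (\<forall>\<alpha>\<in>carrier B. \<forall>\<beta>\<in>carrier B. \<forall>x\<in>carrier M.
        act M (\<alpha> \<oplus>\<^bsub>B\<^esub> \<beta>) x = act M \<alpha> x \<oplus>\<^bsub>M\<^esub> act M \<beta> x) \<and>
     (\<forall>\<alpha>\<in>carrier B. \<forall>c. \<forall>x\<in>carrier M.
        act M \<alpha> (c \<odot>\<^bsub>M\<^esub> x) = c \<odot>\<^bsub>M\<^esub> act M \<alpha> x \<and>
        act M (c \<odot>\<^bsub>B\<^esub> \<alpha>) x = c \<odot>\<^bsub>M\<^esub> act M \<alpha> x) \<and>
     (\<forall>\<alpha>\<in>carrier B. \<forall>\<beta>\<in>carrier B. \<forall>x\<in>carrier M.
        act M (\<alpha> \<otimes>\<^bsub>B\<^esub> \<beta>) x = act M \<alpha> (act M \<beta> x)) \<and>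
     (\<forall>x\<in>carrier M. act M \<one>\<^bsub>B\<^esub> x = x)"

text \<open>The graded \<open>S\<close>-module \<open>S \<otimes> M\<close> for \<open>S = k[V(G)]/\<NN>\<close>, and the action of \<open>\<Theta>\<close> on it.\<close>

definition ext_module :: "('k::field, 's) module \<Rightarrow> ('k, 'b, 'm) bmod \<Rightarrow>
    ('s, (('s \<times> 'm) \<Rightarrow>\<^sub>0 'k) set) module" where
  "ext_module S M = ring.extend (ring.truncate (tensor S M))
     (module.fields (\<lambda>s. tensor_lift (tensor S M) (\<lambda>s' m. tens S M (s \<otimes>\<^bsub>S\<^esub> s') m)))"

definition ext_degree :: "('k::field, 's) module \<Rightarrow> (nat \<Rightarrow> 's set) \<Rightarrow> ('k, 'b, 'm) bmod \<Rightarrow>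
    int \<Rightarrow> (('s \<times> 'm) \<Rightarrow>\<^sub>0 'k) set set" where
  "ext_degree S Sg M n =
     (if n < 0 then {\<zero>\<^bsub>tensor S M\<^esub>}
      else tcoset S M ` {x. Poly_Mapping.keys x \<subseteq> Sg (nat n) \<times> carrier M})"

definition Theta_act :: "nat \<Rightarrow> nat \<Rightarrow> ('k::field, 'h) hopf \<Rightarrow> ('k, 'a) module \<Rightarrow>
    ('h \<Rightarrow> nat \<Rightarrow> 'a) \<Rightarrow> ('k, 'h \<Rightarrow> 'k, 'm) bmod \<Rightarrow>
    (('a set \<times> 'm) \<Rightarrow>\<^sub>0 'k) set \<Rightarrow> (('a set \<times> 'm) \<Rightarrow>\<^sub>0 'k) set" where
  "Theta_act p r G A U M =
     (let S = reduced_alg A; T = tensor S M in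
      tensor_lift T (\<lambda>s m. tensor_lift T
        (\<lambda>a \<alpha>. tens S M ((nilradical A +>\<^bsub>A\<^esub> a) \<otimes>\<^bsub>S\<^esub> s) (act M \<alpha> m)) (Theta p r G A U)))"


section \<open>Proj and sheaves associated to graded modules\<close>

text \<open>
  \<open>S\<close> is a graded ring with components \<open>Sg n\<close>, and \<open>F\<close> a graded \<open>S\<close>-module with components \<open>Fg n\<close>.
\<close>

definition Proj :: "('s, 'x) ring_scheme \<Rightarrow> (nat \<Rightarrow> 's set) \<Rightarrow> 's set set" where
  "Proj S Sg = {P. primeideal P S \<and> P = genideal S (P \<inter> (\<Union>n. Sg n)) \<and>
                   \<not> (\<Union>n\<in>{0<..}. Sg n) \<subseteq> P}"

definition Proj_open :: "('s, 'x) ring_scheme \<Rightarrow> (nat \<Rightarrow> 's set) \<Rightarrow> 's set set \<Rightarrow> bool" where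
  "Proj_open S Sg U \<longleftrightarrow> (\<exists>E \<subseteq> (\<Union>n. Sg n). U = {P \<in> Proj S Sg. \<not> E \<subseteq> P})"

text \<open>
  The fraction \<open>m/f\<close> as an element of the stalk at \<open>P\<close> of the sheaf associated to the twist \<open>F(d)\<close>,
  i.e.\ of the degree \<open>d\<close> part of the homogeneous localization of \<open>F\<close> at \<open>P\<close>.
\<close>

definition hfrac :: "(nat \<Rightarrow> 's set) \<Rightarrow> ('s, 'f) module \<Rightarrow> (int \<Rightarrow> 'f set) \<Rightarrow> int \<Rightarrow>
    's set \<Rightarrow> 'f \<Rightarrow> 's \<Rightarrow> ('f \<times> 's) set" where
  "hfrac Sg F Fg d P m f = {(m', f'). \<exists>n. f' \<in> Sg n - P \<and> m' \<in> Fg (int n + d) \<and>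
     (\<exists>h\<in>(\<Union>n. Sg n) - P. h \<odot>\<^bsub>F\<^esub> ((f' \<odot>\<^bsub>F\<^esub> m) \<ominus>\<^bsub>F\<^esub> (f \<odot>\<^bsub>F\<^esub> m')) = \<zero>\<^bsub>F\<^esub>)}"

text \<open>Sections over \<open>U\<close> of the sheaf associated to \<open>F(d)\<close>.\<close>

definition sections :: "('s, 'x) ring_scheme \<Rightarrow> (nat \<Rightarrow> 's set) \<Rightarrow> ('s, 'f) module \<Rightarrow>
    (int \<Rightarrow> 'f set) \<Rightarrow> int \<Rightarrow> 's set set \<Rightarrow> ('s set \<Rightarrow> ('f \<times> 's) set) set" where
  "sections S Sg F Fg d U = {s \<in> extensional U. \<forall>P\<in>U. \<exists>V.
     Proj_open S Sg V \<and> P \<in> V \<and> V \<subseteq> U \<and>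
     (\<exists>n. \<exists>f\<in>Sg n. \<exists>m\<in>Fg (int n + d). \<forall>Q\<in>V. f \<notin> Q \<and> s Q = hfrac Sg F Fg d Q m f)}"

definition zero_section :: "('s, 'x) ring_scheme \<Rightarrow> (nat \<Rightarrow> 's set) \<Rightarrow> ('s, 'f) module \<Rightarrow>
    (int \<Rightarrow> 'f set) \<Rightarrow> int \<Rightarrow> 's set set \<Rightarrow> ('s set \<Rightarrow> ('f \<times> 's) set)" where
  "zero_section S Sg F Fg d U = (\<lambda>P\<in>U. hfrac Sg F Fg d P \<zero>\<^bsub>F\<^esub> \<one>\<^bsub>S\<^esub>)"

definition stalk_add :: "('s, 'x) ring_scheme \<Rightarrow> (nat \<Rightarrow> 's set) \<Rightarrow> ('s, 'f) module \<Rightarrow>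
    (int \<Rightarrow> 'f set) \<Rightarrow> int \<Rightarrow> 's set \<Rightarrow> ('f \<times> 's) set \<Rightarrow> ('f \<times> 's) set \<Rightarrow> ('f \<times> 's) set" where
  "stalk_add S Sg F Fg d P x y = (\<Union>(m, f)\<in>x. \<Union>(m', f')\<in>y.
     hfrac Sg F Fg d P ((f' \<odot>\<^bsub>F\<^esub> m) \<oplus>\<^bsub>F\<^esub> (f \<odot>\<^bsub>F\<^esub> m')) (f \<otimes>\<^bsub>S\<^esub> f'))"

text \<open>
  The map on sections induced by a homogeneous \<open>S\<close>-linear endomorphism \<open>T\<close> of \<open>F\<close>; \<open>d\<close> is the twist
  of the target.
\<close>

definition induced_map :: "(nat \<Rightarrow> 's set) \<Rightarrow> ('s, 'f) module \<Rightarrow> (int \<Rightarrow> 'f set) \<Rightarrow>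
    ('f \<Rightarrow> 'f) \<Rightarrow> int \<Rightarrow> 's set set \<Rightarrow> ('s set \<Rightarrow> ('f \<times> 's) set) \<Rightarrow> ('s set \<Rightarrow> ('f \<times> 's) set)" where
  "induced_map Sg F Fg T d U s = (\<lambda>P\<in>U. \<Union>(m, f)\<in>s P. hfrac Sg F Fg d P (T m) f)"

text \<open>
  The \<open>j\<close>-fold composite, for \<open>T\<close> homogeneous of degree \<open>e\<close>, going from the twist by \<open>d\<close> to the
  twist by \<open>d + j e\<close>.
\<close>

primrec induced_pow :: "(nat \<Rightarrow> 's set) \<Rightarrow> ('s, 'f) module \<Rightarrow> (int \<Rightarrow> 'f set) \<Rightarrow> ('f \<Rightarrow> 'f) \<Rightarrow>
    int \<Rightarrow> int \<Rightarrow> 's set set \<Rightarrow> nat \<Rightarrow> ('s set \<Rightarrow> ('f \<times> 's) set) \<Rightarrow> ('s set \<Rightarrow> ('f \<times> 's) set)" where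
  "induced_pow Sg F Fg T e d U 0 s = s"
| "induced_pow Sg F Fg T e d U (Suc j) s =
     induced_map Sg F Fg T (d + int (Suc j) * e) U (induced_pow Sg F Fg T e d U j s)"

definition kernel_sections :: "('s, 'x) ring_scheme \<Rightarrow> (nat \<Rightarrow> 's set) \<Rightarrow> ('s, 'f) module \<Rightarrow>
    (int \<Rightarrow> 'f set) \<Rightarrow> ('f \<Rightarrow> 'f) \<Rightarrow> int \<Rightarrow> 's set set \<Rightarrow> ('s set \<Rightarrow> ('f \<times> 's) set) set" where
  "kernel_sections S Sg F Fg T e U =
     {s \<in> sections S Sg F Fg 0 U. induced_map Sg F Fg T e U s = zero_section S Sg F Fg e U}"

text \<open>
  Sections of the image sheaf of the \<open>j\<close>-fold composite into the untwisted sheaf: the sections that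
  locally are images.
\<close>

definition image_sections :: "('s, 'x) ring_scheme \<Rightarrow> (nat \<Rightarrow> 's set) \<Rightarrow> ('s, 'f) module \<Rightarrow>
    (int \<Rightarrow> 'f set) \<Rightarrow> ('f \<Rightarrow> 'f) \<Rightarrow> int \<Rightarrow> nat \<Rightarrow> 's set set \<Rightarrow> ('s set \<Rightarrow> ('f \<times> 's) set) set" where
  "image_sections S Sg F Fg T e j U =
     {s \<in> sections S Sg F Fg 0 U. \<forall>P\<in>U. \<exists>V. Proj_open S Sg V \<and> P \<in> V \<and> V \<subseteq> U \<and>
        (\<exists>t\<in>sections S Sg F Fg (- (int j * e)) V.
           restrict s V = induced_pow Sg F Fg T e (- (int j * e)) V j t)}"

text \<open>
  For subsheaves \<open>\<B> \<subseteq> \<K>\<close> of the untwisted sheaf associated to \<open>F\<close>: the stalk of \<open>\<B>\<close> at \<open>P\<close>, as a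
  subgroup of the stalk of the ambient sheaf, and the sections of the quotient sheaf \<open>\<K>/\<B>\<close>, i.e.\ of
  the sheaf associated to \<open>U \<mapsto> \<K>(U)/\<B>(U)\<close>. They are the families of cosets of stalks which locally
  come from sections of \<open>\<K>\<close>.
\<close>

definition sub_stalk :: "('s, 'x) ring_scheme \<Rightarrow> (nat \<Rightarrow> 's set) \<Rightarrow>
    ('s set set \<Rightarrow> ('s set \<Rightarrow> ('f \<times> 's) set) set) \<Rightarrow> 's set \<Rightarrow> ('f \<times> 's) set set" where
  "sub_stalk S Sg \<B> P = {b P | b V. Proj_open S Sg V \<and> P \<in> V \<and> b \<in> \<B> V}"

definition quotient_sections :: "('s, 'x) ring_scheme \<Rightarrow> (nat \<Rightarrow> 's set) \<Rightarrow> ('s, 'f) module \<Rightarrow>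
    (int \<Rightarrow> 'f set) \<Rightarrow> ('s set set \<Rightarrow> ('s set \<Rightarrow> ('f \<times> 's) set) set) \<Rightarrow>
    ('s set set \<Rightarrow> ('s set \<Rightarrow> ('f \<times> 's) set) set) \<Rightarrow> 's set set \<Rightarrow>
    ('s set \<Rightarrow> ('f \<times> 's) set set) set" where
  "quotient_sections S Sg F Fg \<K> \<B> U = {\<sigma> \<in> extensional U. \<forall>P\<in>U. \<exists>V.
     Proj_open S Sg V \<and> P \<in> V \<and> V \<subseteq> U \<and>
     (\<exists>t\<in>\<K> V. \<forall>Q\<in>V. \<sigma> Q = stalk_add S Sg F Fg 0 Q (t Q) ` sub_stalk S Sg \<B> Q)}"

definition quotient_sheaf_zero :: "('s, 'x) ring_scheme \<Rightarrow> (nat \<Rightarrow> 's set) \<Rightarrow> ('s, 'f) module \<Rightarrow>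
    (int \<Rightarrow> 'f set) \<Rightarrow> ('s set set \<Rightarrow> ('s set \<Rightarrow> ('f \<times> 's) set) set) \<Rightarrow>
    ('s set set \<Rightarrow> ('s set \<Rightarrow> ('f \<times> 's) set) set) \<Rightarrow> bool" where
  "quotient_sheaf_zero S Sg F Fg \<K> \<B> \<longleftrightarrow> (\<forall>U. Proj_open S Sg U \<longrightarrow>
     quotient_sections S Sg F Fg \<K> \<B> U = {restrict (sub_stalk S Sg \<B>) U})"

text \<open>
  \<open>\<H>^[1](M) = 0\<close>. For finite-dimensional \<open>M\<close> the twisted sheaf \<open>\<O>(d) \<otimes> M\<close> on \<open>Proj S\<close> is the sheaf
  associated to \<open>(S \<otimes> M)(d)\<close>.
\<close>

definition H1_zero :: "nat \<Rightarrow> nat \<Rightarrow> ('k::field, 'h) hopf \<Rightarrow> ('k, 'a) module \<Rightarrow>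
    ('h \<Rightarrow> nat \<Rightarrow> 'a) \<Rightarrow> ('k, 'h \<Rightarrow> 'k, 'm) bmod \<Rightarrow> bool" where
  "H1_zero p r G A U M =
     (let S = reduced_alg A; Sg = reduced_degree p r G A U;
          F = ext_module S M; Fg = ext_degree S Sg M;
          T = Theta_act p r G A U M; e = int (p ^ (r - 1))
      in quotient_sheaf_zero S Sg F Fg
           (kernel_sections S Sg F Fg T e) (image_sections S Sg F Fg T e (p - 1)))"


section \<open>The stable module category and thick subcategories\<close>

definition mod_hom :: "('k, 'b) module \<Rightarrow> ('k, 'b, 'm) bmod \<Rightarrow> ('k, 'b, 'm) bmod \<Rightarrow>
    ('m \<Rightarrow> 'm) set" where
  "mod_hom B M N = {f \<in> carrier M \<rightarrow> carrier N.
     (\<forall>x\<in>carrier M. \<forall>y\<in>carrier M. f (x \<oplus>\<^bsub>M\<^esub> y) = f x \<oplus>\<^bsub>N\<^esub> f y) \<and>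
     (\<forall>c. \<forall>x\<in>carrier M. f (c \<odot>\<^bsub>M\<^esub> x) = c \<odot>\<^bsub>N\<^esub> f x) \<and>
     (\<forall>\<alpha>\<in>carrier B. \<forall>x\<in>carrier M. f (act M \<alpha> x) = act N \<alpha> (f x))}"

definition projective :: "('k::field, 'b) module \<Rightarrow> ('k, 'b, 'm) bmod \<Rightarrow> bool" where
  "projective B P \<longleftrightarrow> fd_module B P \<and>
     (\<forall>M N g f. fd_module B M \<and> fd_module B N \<and> g \<in> mod_hom B M N \<and> g ` carrier M = carrier N \<and>
        f \<in> mod_hom B P N \<longrightarrow> (\<exists>h\<in>mod_hom B P M. \<forall>x\<in>carrier P. g (h x) = f x))"

text \<open>Equality of morphisms \<open>M \<rightarrow> N\<close> in the stable module category.\<close>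

definition stable_eq :: "('k::field, 'b) module \<Rightarrow> ('k, 'b, 'm) bmod \<Rightarrow> ('k, 'b, 'm) bmod \<Rightarrow>
    ('m \<Rightarrow> 'm) \<Rightarrow> ('m \<Rightarrow> 'm) \<Rightarrow> bool" where
  "stable_eq B M N f g \<longleftrightarrow> (\<exists>P. projective B P \<and>
     (\<exists>a\<in>mod_hom B M P. \<exists>b\<in>mod_hom B P N. \<forall>x\<in>carrier M. f x \<ominus>\<^bsub>N\<^esub> g x = b (a x)))"

definition stable_iso :: "('k::field, 'b) module \<Rightarrow> ('k, 'b, 'm) bmod \<Rightarrow> ('k, 'b, 'm) bmod \<Rightarrow>
    ('m \<Rightarrow> 'm) \<Rightarrow> bool" where
  "stable_iso B M N f \<longleftrightarrow> f \<in> mod_hom B M N \<and>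
     (\<exists>g\<in>mod_hom B N M. stable_eq B M M (g \<circ> f) id \<and> stable_eq B N N (f \<circ> g) id)"

definition stable_biproduct :: "('k::field, 'b) module \<Rightarrow> ('k, 'b, 'm) bmod \<Rightarrow>
    ('k, 'b, 'm) bmod \<Rightarrow> ('k, 'b, 'm) bmod \<Rightarrow> bool" where
  "stable_biproduct B X Y Z \<longleftrightarrow>
     (\<exists>i\<in>mod_hom B Y X. \<exists>p\<in>mod_hom B X Y. \<exists>j\<in>mod_hom B Z X. \<exists>q\<in>mod_hom B X Z.
        stable_eq B Y Y (p \<circ> i) id \<and> stable_eq B Z Z (q \<circ> j) id \<and>
        stable_eq B Z Y (p \<circ> j) (\<lambda>_. \<zero>\<^bsub>Y\<^esub>) \<and> stable_eq B Y Z (q \<circ> i) (\<lambda>_. \<zero>\<^bsub>Z\<^esub>) \<and>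
        stable_eq B X X (\<lambda>x. i (p x) \<oplus>\<^bsub>X\<^esub> j (q x)) id)"

definition short_exact :: "('k::field, 'b) module \<Rightarrow> ('k, 'b, 'm) bmod \<Rightarrow> ('m \<Rightarrow> 'm) \<Rightarrow>
    ('k, 'b, 'm) bmod \<Rightarrow> ('m \<Rightarrow> 'm) \<Rightarrow> ('k, 'b, 'm) bmod \<Rightarrow> bool" where
  "short_exact B N f M g L \<longleftrightarrow> fd_module B N \<and> fd_module B M \<and> fd_module B L \<and>
     f \<in> mod_hom B N M \<and> g \<in> mod_hom B M L \<and> inj_on f (carrier N) \<and>
     f ` carrier N = {x \<in> carrier M. g x = \<zero>\<^bsub>L\<^esub>} \<and> g ` carrier M = carrier L"

definition projective_cover :: "('k::field, 'b) module \<Rightarrow> ('k, 'b, 'm) bmod \<Rightarrow> ('m \<Rightarrow> 'm) \<Rightarrow>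
    ('k, 'b, 'm) bmod \<Rightarrow> bool" where
  "projective_cover B P \<pi> M \<longleftrightarrow>
     projective B P \<and> fd_module B M \<and> \<pi> \<in> mod_hom B P M \<and> \<pi> ` carrier P = carrier M \<and>
     (\<forall>Q. submodule Q kk P \<and> (\<forall>\<alpha>\<in>carrier B. \<forall>x\<in>Q. act P \<alpha> x \<in> Q) \<and> \<pi> ` Q = carrier M \<longrightarrow>
        Q = carrier P)"

text \<open>
  The kernel of \<open>\<pi>\<close>; if \<open>\<pi> : P \<rightarrow> M\<close> is a projective cover, this is the Heller shift \<open>\<Omega>(M)\<close>. As
  projective covers are unique only up to isomorphism, \<open>\<Omega>\<close> and its inverse are treated below as
  relations ranging over all choices.
\<close>

definition Heller :: "('k, 'b, 'm) bmod \<Rightarrow> ('m \<Rightarrow> 'm) \<Rightarrow> ('k, 'b, 'm) bmod \<Rightarrow>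
    ('k, 'b, 'm) bmod" where
  "Heller P \<pi> M = P\<lparr>carrier := {x \<in> carrier P. \<pi> x = \<zero>\<^bsub>M\<^esub>}\<rparr>"

text \<open>\<open>t\<close> restricts to a representative \<open>\<Omega>(M) \<rightarrow> \<Omega>(N)\<close> of \<open>\<Omega>(f)\<close>, where \<open>f : M \<rightarrow> N\<close>.\<close>

definition lifts :: "('k, 'b) module \<Rightarrow> ('k, 'b, 'm) bmod \<Rightarrow> ('m \<Rightarrow> 'm) \<Rightarrow>
    ('k, 'b, 'm) bmod \<Rightarrow> ('m \<Rightarrow> 'm) \<Rightarrow> ('m \<Rightarrow> 'm) \<Rightarrow> ('m \<Rightarrow> 'm) \<Rightarrow> bool" where
  "lifts B P \<pi> Q \<rho> f t \<longleftrightarrow> t \<in> mod_hom B P Q \<and> (\<forall>x\<in>carrier P. \<rho> (t x) = f (\<pi> x))"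

text \<open>\<open>C = \<Omega>\<inverse>(X)\<close>, by means of the stable isomorphism \<open>\<theta> : \<Omega>(C) \<rightarrow> X\<close>.\<close>

definition Omega_inv :: "('k::field, 'b) module \<Rightarrow> ('k, 'b, 'm) bmod \<Rightarrow> ('k, 'b, 'm) bmod \<Rightarrow>
    ('m \<Rightarrow> 'm) \<Rightarrow> ('k, 'b, 'm) bmod \<Rightarrow> ('m \<Rightarrow> 'm) \<Rightarrow> bool" where
  "Omega_inv B X P \<pi> C \<theta> \<longleftrightarrow>
     projective_cover B P \<pi> C \<and> fd_module B X \<and> stable_iso B (Heller P \<pi> C) X \<theta>"

text \<open>
  \<open>e : C \<rightarrow> C'\<close> represents \<open>\<Omega>\<inverse>(a)\<close> for \<open>a : X \<rightarrow> X'\<close>, where \<open>C = \<Omega>\<inverse>(X)\<close> and \<open>C' = \<Omega>\<inverse>(X')\<close>.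
\<close>

definition Omega_inv_map :: "('k::field, 'b) module \<Rightarrow>
    ('k, 'b, 'm) bmod \<Rightarrow> ('m \<Rightarrow> 'm) \<Rightarrow> ('k, 'b, 'm) bmod \<Rightarrow> ('m \<Rightarrow> 'm) \<Rightarrow>
    ('k, 'b, 'm) bmod \<Rightarrow> ('k, 'b, 'm) bmod \<Rightarrow> ('m \<Rightarrow> 'm) \<Rightarrow> ('k, 'b, 'm) bmod \<Rightarrow> ('m \<Rightarrow> 'm) \<Rightarrow>
    ('m \<Rightarrow> 'm) \<Rightarrow> ('m \<Rightarrow> 'm) \<Rightarrow> bool" where
  "Omega_inv_map B P \<pi> C \<theta> X' P' \<pi>' C' \<theta>' a e \<longleftrightarrow>
     e \<in> mod_hom B C C' \<and>
     (\<exists>t. lifts B P \<pi> P' \<pi>' e t \<and> stable_eq B (Heller P \<pi> C) X' (\<theta>' \<circ> t) (a \<circ> \<theta>))"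

text \<open>
  The connecting morphism \<open>w : L \<rightarrow> \<Omega>\<inverse>(N) = C\<close> of a short exact sequence \<open>0 \<rightarrow> N \<rightarrow> M \<rightarrow> L \<rightarrow> 0\<close>.
  It corresponds to the morphism \<open>\<delta> : \<Omega>(L) \<rightarrow> N\<close> obtained by lifting the projective cover
  \<open>Q \<rightarrow> L\<close> to \<open>s : Q \<rightarrow> M\<close> and restricting \<open>s\<close> to \<open>\<Omega>(L)\<close>.
\<close>

definition connecting :: "('k::field, 'b) module \<Rightarrow> ('k, 'b, 'm) bmod \<Rightarrow> ('m \<Rightarrow> 'm) \<Rightarrow>
    ('k, 'b, 'm) bmod \<Rightarrow> ('m \<Rightarrow> 'm) \<Rightarrow> ('k, 'b, 'm) bmod \<Rightarrow>
    ('k, 'b, 'm) bmod \<Rightarrow> ('m \<Rightarrow> 'm) \<Rightarrow> ('k, 'b, 'm) bmod \<Rightarrow> ('m \<Rightarrow> 'm) \<Rightarrow> ('m \<Rightarrow> 'm) \<Rightarrow> bool" where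
  "connecting B N f M g L P \<pi> C \<theta> w \<longleftrightarrow>
     w \<in> mod_hom B L C \<and>
     (\<exists>Q \<rho> s \<delta> t. projective_cover B Q \<rho> L \<and>
        s \<in> mod_hom B Q M \<and> (\<forall>x\<in>carrier Q. g (s x) = \<rho> x) \<and>
        \<delta> \<in> mod_hom B (Heller Q \<rho> L) N \<and> (\<forall>x\<in>carrier (Heller Q \<rho> L). f (\<delta> x) = s x) \<and>
        lifts B Q \<rho> P \<pi> w t \<and> stable_eq B (Heller Q \<rho> L) N (\<theta> \<circ> t) \<delta>)"

text \<open>
  Triangles \<open>X \<rightarrow> Y \<rightarrow> Z \<rightarrow> \<Omega>\<inverse>(X) = C\<close>: those isomorphic to the ones given by short exact sequences.
\<close>

definition triangle :: "('k::field, 'b) module \<Rightarrow> ('k, 'b, 'm) bmod \<Rightarrow> ('k, 'b, 'm) bmod \<Rightarrow>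
    ('k, 'b, 'm) bmod \<Rightarrow> ('k, 'b, 'm) bmod \<Rightarrow> ('m \<Rightarrow> 'm) \<Rightarrow> ('k, 'b, 'm) bmod \<Rightarrow> ('m \<Rightarrow> 'm) \<Rightarrow>
    ('m \<Rightarrow> 'm) \<Rightarrow> ('m \<Rightarrow> 'm) \<Rightarrow> ('m \<Rightarrow> 'm) \<Rightarrow> bool" where
  "triangle B X Y Z P \<pi> C \<theta> u v w \<longleftrightarrow>
     fd_module B X \<and> fd_module B Y \<and> fd_module B Z \<and> Omega_inv B X P \<pi> C \<theta> \<and>
     u \<in> mod_hom B X Y \<and> v \<in> mod_hom B Y Z \<and> w \<in> mod_hom B Z C \<and>
     (\<exists>N f M g L P' \<pi>' C' \<theta>' w' a b c e.
        short_exact B N f M g L \<and> Omega_inv B N P' \<pi>' C' \<theta>' \<and>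
        connecting B N f M g L P' \<pi>' C' \<theta>' w' \<and>
        stable_iso B X N a \<and> stable_iso B Y M b \<and> stable_iso B Z L c \<and>
        Omega_inv_map B P \<pi> C \<theta> N P' \<pi>' C' \<theta>' a e \<and>
        stable_eq B X M (b \<circ> u) (f \<circ> a) \<and> stable_eq B Y L (c \<circ> v) (g \<circ> b) \<and>
        stable_eq B Z C' (e \<circ> w) (w' \<circ> c))"

text \<open>A full subcategory of the stable module category is given by its set \<open>\<C>\<close> of objects.\<close>

definition thick :: "('k::field, 'b) module \<Rightarrow> ('k, 'b, 'm) bmod set \<Rightarrow> bool" where
  "thick B \<C> \<longleftrightarrow>
     \<C> \<subseteq> {M. fd_module B M} \<and>
     (\<forall>X Y f. X \<in> \<C> \<and> fd_module B Y \<and> stable_iso B X Y f \<longrightarrow> Y \<in> \<C>) \<and>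
     (\<forall>X P \<pi>. X \<in> \<C> \<and> projective_cover B P \<pi> X \<longrightarrow> Heller P \<pi> X \<in> \<C>) \<and>
     (\<forall>X P \<pi> C \<theta>. X \<in> \<C> \<and> Omega_inv B X P \<pi> C \<theta> \<longrightarrow> C \<in> \<C>) \<and>
     (\<forall>X Y Z. X \<in> \<C> \<and> fd_module B Y \<and> fd_module B Z \<and> stable_biproduct B X Y Z \<longrightarrow> Y \<in> \<C>) \<and>
     (\<forall>X Y Z P \<pi> C \<theta> u v w. X \<in> \<C> \<and> Y \<in> \<C> \<and> triangle B X Y Z P \<pi> C \<theta> u v w \<longrightarrow> Z \<in> \<C>)"

end

theory Submission
 imports Defs
begin

text \<open>
 Since stalks are localizations, \<open>H^[1](M) = 0\<close> says that \<open>ker \<Theta> = im \<Theta>^(p-1)\<close> on \<open>S \<otimes> M\<close>, up to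
 homogeneous scalars outside \<open>P\<close>, at every point \<open>P\<close> of \<open>Proj S\<close>, where \<open>S\<close> is the reduced ring of
 functions on the one-parameter subgroups (\<open>quotient_sheaf_zero_iff\<close>, \<open>acyclic_at\<close>). Call such an
 \<open>M\<close> acyclic.

 Acyclicity passes between the terms of short exact sequences. A sequence of modules splits over
 the field, so it stays exact over \<open>S\<close>. An operator with \<open>T^p = 0\<close> and \<open>ker T = im T^(p-1)\<close> also
 satisfies \<open>ker T^(p-1) = im T\<close> (\<open>acyclic_iterate\<close>), and with both equalities a diagram chase shows
 that if the middle term and one of the outer terms are acyclic then so is the other one
 (\<open>acyclic_quotient\<close>, \<open>acyclic_sub\<close>). Acyclicity also passes to a retract up to maps through an
 acyclic module (\<open>acyclic_retract\<close>). Every closure property of a thick subcategory is a combination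
 of these facts, provided that projective modules are acyclic (\<open>thick_acyclic\<close>).

 A projective module is a retract of a coinduced one, of the form \<open>Hom(k[G], M)\<close>, on which the ring
 \<open>k[G]\<close> also acts, by multiplication, compatibly with \<open>G\<close> (\<open>hopf_module\<close>). Write \<open>u f j\<close> for the
 coefficient of \<open>t^j\<close> in the pullback of \<open>f\<close> along the universal one-parameter subgroup. These
 coefficients generate \<open>S\<close>, and comultiplication relates them by binomial coefficients, so at \<open>P\<close>
 there is a least \<open>i\<close> such that \<open>u f (p^i)\<close> is not in \<open>P\<close> for some \<open>f\<close>
 (\<open>exists_minimal_level\<close>). Now \<open>S \<otimes> k[G]\<close> acts on \<open>S \<otimes> Hom(k[G], M)\<close>, and the divided powers
 of the universal subgroup act on it as divided derivatives. For a suitable power \<open>z\<close> of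
 \<open>f - f(1)\<close>, multiplication by the derivatives of \<open>z\<close> of orders \<open>e - p^i + m e\<close>, where
 \<open>e = p^(r-1)\<close> and \<open>m < p\<close>, gives operators \<open>x m\<close> with \<open>[x m, \<Theta>] = (m + 1) x (m + 1)\<close> modulo \<open>P\<close>. The last
 one, \<open>x (p-1)\<close>, is invertible at \<open>P\<close>: its \<open>p^r\<close>-th power is multiplication by a scalar, because the \<open>p^r\<close>-th
 power map sends \<open>k[G]\<close> to \<open>k\<close> as \<open>G\<close> has height at most \<open>r\<close> (\<open>mu_power\<close>), and this scalar is not in
 \<open>P\<close> (\<open>leading_power\<close>).

 Such operators force acyclicity (\<open>acyclic_of_commutators\<close>). The \<open>(p-1)\<close>-fold commutator \<open>N\<close> of \<open>x 0\<close>
 with \<open>\<Theta>\<close> commutes with \<open>\<Theta>\<close>, since \<open>\<Theta>^p = 0\<close> and the characteristic is \<open>p\<close>. It is \<open>(p-1)! x (p-1)\<close>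
 modulo \<open>P\<close>, hence invertible up to scalars outside \<open>P\<close> by Nakayama's lemma (\<open>elimination\<close>). On
 \<open>ker \<Theta>\<close> it agrees up to sign with \<open>\<Theta>^(p-1) x 0\<close>. So \<open>ker \<Theta> = N (ker \<Theta>)\<close>, up to such scalars, lies
 in \<open>im \<Theta>^(p-1)\<close>.
\<close>

text \<open>Plain subscripts as structure indices keep formulas over several structures readable.\<close>

syntax "_index" :: "logic => index" ("\<^sub>_" [1000] 1000)

section \<open>Vector spaces with a carrier, linear maps and coordinates\<close>

lemma kk_simps [simp]:
 "carrier kk = UNIV" "x \<otimes>\<^sub>kk y = x * y" "\<one>\<^sub>kk = 1" "\<zero>\<^sub>kk = 0" "x \<oplus>\<^sub>kk y = x + y"
 "x \<odot>\<^sub>kk y = x * y"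
 by (simp_all add: kk_def)

lemma cring_kk [simp]: "cring (kk :: ('k::field, 'k) module)"
proof (rule cringI)
 show "abelian_group (kk :: ('k, 'k) module)"
  by (rule abelian_groupI) (auto simp: add.assoc add.commute intro: exI[of _ "- x" for x] left_minus)
 show "comm_monoid (kk :: ('k, 'k) module)"
  by (rule comm_monoidI) (auto simp: mult.assoc mult.commute)
qed (auto simp: algebra_simps)

lemma a_inv_kk [simp]: "\<ominus>\<^sub>kk x = - (x::'k::field)"
proof -
 interpret cring "kk :: ('k, 'k) module" by simp
 have "- x \<oplus>\<^sub>kk x = \<zero>\<^sub>kk" by simp
 then show ?thesis by (metis minus_equality UNIV_I kk_simps(1))
qed

lemma finsum_kk [simp]: "finsum (kk :: ('k::field, 'k) module) f A = sum f A"
proof -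
 interpret cring "kk :: ('k, 'k) module" by simp
 show ?thesis
  by (induction A rule: infinite_finite_induct) auto
qed

lemma module_kk_kk [simp]: "module kk (kk :: ('k::field, 'k) module)"
proof -
 interpret cring "kk :: ('k, 'k) module" by simp
 show ?thesis by (rule moduleI) (auto simp: algebra_simps is_abelian_group)
qed

locale vspace = fixes V :: "('k::field, 'v, 'x) module_scheme" (structure)
 assumes module_kk: "module kk V"

sublocale vspace \<subseteq> module kk V by (rule module_kk)

definition klin :: "('k::field, 'v, 'x) module_scheme => ('k, 'w, 'y) module_scheme => ('v => 'w) => bool"
 where "klin V W \<phi> \<longleftrightarrow> \<phi> : carrier V \<rightarrow> carrier W \<and>
  (\<forall>x\<in>carrier V. \<forall>y\<in>carrier V. \<phi> (x \<oplus>\<^sub>V y) = \<phi> x \<oplus>\<^sub>W \<phi> y) \<and>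
  (\<forall>c. \<forall>x\<in>carrier V. \<phi> (c \<odot>\<^sub>V x) = c \<odot>\<^sub>W \<phi> x)"

lemma klin_closed: "klin V W \<phi> ==> x : carrier V ==> \<phi> x : carrier W"
 and klin_add: "klin V W \<phi> ==> x : carrier V ==> y : carrier V ==> \<phi> (x \<oplus>\<^sub>V y) = \<phi> x \<oplus>\<^sub>W \<phi> y"
 and klin_smult: "klin V W \<phi> ==> x : carrier V ==> \<phi> (c \<odot>\<^sub>V x) = c \<odot>\<^sub>W \<phi> x"
 by (auto simp: klin_def)

lemma klinI:
 "(!!x. x : carrier V ==> \<phi> x : carrier W) ==>
  (!!x y. x : carrier V ==> y : carrier V ==> \<phi> (x \<oplus>\<^sub>V y) = \<phi> x \<oplus>\<^sub>W \<phi> y) ==>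
  (!!c x. x : carrier V ==> \<phi> (c \<odot>\<^sub>V x) = c \<odot>\<^sub>W \<phi> x) ==> klin V W \<phi>"
 by (auto simp: klin_def)

text \<open>Linear maps over the field and over \<open>S\<close> share their lemmas on sums through their additivity.\<close>

definition additive :: "('a, 'x) ring_scheme => ('b, 'y) ring_scheme => ('a => 'b) => bool" where
 "additive V W h \<longleftrightarrow> h : carrier V \<rightarrow> carrier W \<and>
  (\<forall>x\<in>carrier V. \<forall>y\<in>carrier V. h (x \<oplus>\<^sub>V y) = h x \<oplus>\<^sub>W h y)"

lemma klin_additive: "klin V W \<phi> ==> additive V W \<phi>"
 by (auto simp: klin_def additive_def)

lemma additive_zero:
 assumes "abelian_group V" "abelian_group W" "additive V W h"
 shows "h \<zero>\<^sub>V = \<zero>\<^sub>W"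
proof -
 interpret V: abelian_group V by fact
 interpret W: abelian_group W by fact
 have "h \<zero>\<^sub>V \<oplus>\<^sub>W h \<zero>\<^sub>V = h \<zero>\<^sub>V"
  using assms(3) unfolding additive_def by (metis V.l_zero V.zero_closed)
 then show ?thesis
  using assms(3) unfolding additive_def by (metis PiE V.zero_closed W.add.l_cancel_one)
qed

lemma additive_minus:
 assumes "abelian_group V" "abelian_group W" "additive V W h" "x : carrier V"
 shows "h (\<ominus>\<^sub>V x) = \<ominus>\<^sub>W h x"
proof -
 interpret V: abelian_group V by fact
 interpret W: abelian_group W by fact
 have x: "\<ominus>\<^sub>V x : carrier V" using assms(4) by simp
 have cl: "h x : carrier W" "h (\<ominus>\<^sub>V x) : carrier W"
  using assms(3,4) x unfolding additive_def by auto
 have "h (\<ominus>\<^sub>V x) \<oplus>\<^sub>W h x = h (\<ominus>\<^sub>V x \<oplus>\<^sub>V x)"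
  using assms(3,4) x unfolding additive_def by simp
 also have "... = \<zero>\<^sub>W" using additive_zero[OF assms(1-3)] assms(4) by (simp add: V.l_neg)
 finally show ?thesis using cl W.minus_equality by metis
qed

lemma additive_diff:
 assumes "abelian_group V" "abelian_group W" "additive V W h" "x : carrier V" "y : carrier V"
 shows "h (x \<ominus>\<^sub>V y) = h x \<ominus>\<^sub>W h y"
proof -
 interpret V: abelian_group V by fact
 interpret W: abelian_group W by fact
 show ?thesis using assms additive_minus[OF assms(1-3,5)] unfolding additive_def
  by (simp add: V.minus_eq W.minus_eq)
qed

lemma additive_finsum:
 assumes "abelian_group V" "abelian_group W" "additive V W h" "f : I \<rightarrow> carrier V"
 shows "h (finsum V f I) = finsum W (\<lambda>i. h (f i)) I"
proof -
 interpret V: abelian_group V by fact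
 interpret W: abelian_group W by fact
 have h: "h x : carrier W" if "x : carrier V" for x
  using that assms(3) by (auto simp: additive_def)
 show ?thesis using assms(4)
 proof (induction I rule: infinite_finite_induct)
  case (infinite A)
  then show ?case using additive_zero[OF assms(1-3)] by (simp add: V.finsum_infinite W.finsum_infinite)
 next
  case empty
  then show ?case using additive_zero[OF assms(1-3)] by simp
 next
  case (insert x F)
  then have "finsum V f F : carrier V" by (intro V.finsum_closed) auto
  with insert show ?case
   using assms(3) h by (simp add: V.finsum_insert W.finsum_insert Pi_iff additive_def)
 qed
qed

lemma (in abelian_monoid) finsum_swap:
 assumes "finite I" "finite J" "!!i j. i : I ==> j : J ==> f i j : carrier G"
 shows "(\<Oplus>i\<in>I. \<Oplus>j\<in>J. f i j) = (\<Oplus>j\<in>J. \<Oplus>i\<in>I. f i j)"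
 using assms(1,3)
proof (induction I rule: finite_induct)
 case empty
 then show ?case by simp
next
 case (insert x F)
 have "(\<Oplus>i\<in>insert x F. \<Oplus>j\<in>J. f i j) = (\<Oplus>j\<in>J. f x j) \<oplus> (\<Oplus>i\<in>F. \<Oplus>j\<in>J. f i j)"
  using insert by (intro finsum_insert) (auto intro!: finsum_closed)
 also have "... = (\<Oplus>j\<in>J. f x j) \<oplus> (\<Oplus>j\<in>J. \<Oplus>i\<in>F. f i j)"
  using insert by simp
 also have "... = (\<Oplus>j\<in>J. f x j \<oplus> (\<Oplus>i\<in>F. f i j))"
  using insert by (intro finsum_addf[symmetric]) (auto intro!: finsum_closed)
 also have "... = (\<Oplus>j\<in>J. \<Oplus>i\<in>insert x F. f i j)"
  using insert by (intro finsum_cong') (auto intro!: finsum_insert[symmetric] finsum_closed)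
 finally show ?case .
qed

lemma (in abelian_group) ag: "abelian_group G" by (rule abelian_group_axioms)

lemma (in abelian_group) diff_zero_eq:
 assumes "x : carrier G" "y : carrier G"
 shows "x \<ominus> y = \<zero> \<longleftrightarrow> x = y"
 using assms minus_equality[of x "\<ominus> y"] by (auto simp: minus_eq r_neg)

lemma (in abelian_group) additive_finsum_maps:
 assumes "abelian_group V" "!!i. i : I ==> additive V G (f i)"
 shows "additive V G (\<lambda>z. \<Oplus>i\<in>I. f i z)"
 unfolding additive_def
proof (intro conjI ballI funcsetI)
 have cl: "f i z : carrier G" if "i : I" "z : carrier V" for i z
  using assms(2)[OF that(1)] that(2) by (auto simp: additive_def)
 fix x assume x: "x : carrier V"
 then show "(\<Oplus>i\<in>I. f i x) : carrier G" using cl by (intro finsum_closed) auto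
 fix y assume y: "y : carrier V"
 have "(\<Oplus>i\<in>I. f i (x \<oplus>\<^sub>V y)) = (\<Oplus>i\<in>I. f i x \<oplus> f i y)"
  using cl x y assms(2) by (intro finsum_cong' refl) (auto simp: additive_def)
 also have "... = (\<Oplus>i\<in>I. f i x) \<oplus> (\<Oplus>i\<in>I. f i y)"
  using cl x y by (intro finsum_addf) auto
 finally show "(\<Oplus>i\<in>I. f i (x \<oplus>\<^sub>V y)) = (\<Oplus>i\<in>I. f i x) \<oplus> (\<Oplus>i\<in>I. f i y)" .
qed

lemma module_kk_kk_abelian [simp]: "abelian_group (kk :: ('k::field, 'k) module)"
 using module.axioms(2)[OF module_kk_kk] .

definition bilin :: "('k::field, 'v, 'x) module_scheme => ('k, 'w, 'y) module_scheme =>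
  ('k, 'u, 'z) module_scheme => ('v => 'w => 'u) => bool" where
 "bilin V W Y \<beta> \<longleftrightarrow> (\<forall>v\<in>carrier V. klin W Y (\<beta> v)) \<and> (\<forall>w\<in>carrier W. klin V Y (\<lambda>v. \<beta> v w))"

text \<open>
 A finite-dimensional space is used through coordinates: finitely many vectors \<open>x\<close> and
 functionals \<open>c x\<close> with \<open>v = \<Sum> c x v x\<close> for all \<open>v\<close>.
\<close>

definition coordinates :: "('k::field, 'v, 'x) module_scheme => 'v set => ('v => 'v => 'k) => bool" where
 "coordinates V X c \<longleftrightarrow> finite X \<and> X \<subseteq> carrier V \<and> (\<forall>x\<in>X. klin V kk (c x)) \<and>
   (\<forall>v\<in>carrier V. v = (\<Oplus>\<^sub>V x\<in>X. c x v \<odot>\<^sub>V x))"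

lemma (in vspace) finsum_smult_add:
 assumes "finite X" "X \<subseteq> carrier V"
 shows "(\<Oplus>x\<in>X. (a x + b x) \<odot> x) = (\<Oplus>x\<in>X. a x \<odot> x) \<oplus> (\<Oplus>x\<in>X. b x \<odot> x)"
proof -
 have "(\<Oplus>x\<in>X. (a x + b x) \<odot> x) = (\<Oplus>x\<in>X. a x \<odot> x \<oplus> b x \<odot> x)"
 proof (intro M.finsum_cong' refl)
  show "(\<lambda>x. a x \<odot> x \<oplus> b x \<odot> x) : X \<rightarrow> carrier V" using assms by auto
  fix i assume "i : X"
  then show "(a i + b i) \<odot> i = a i \<odot> i \<oplus> b i \<odot> i"
   using assms smult_l_distr[of "a i" "b i" i] by auto
 qed
 also have "... = (\<Oplus>x\<in>X. a x \<odot> x) \<oplus> (\<Oplus>x\<in>X. b x \<odot> x)"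
  using assms by (intro M.finsum_addf) auto
 finally show ?thesis .
qed

lemma (in vspace) finsum_smult_scale:
 assumes "finite X" "X \<subseteq> carrier V"
 shows "(\<Oplus>x\<in>X. (a * b x) \<odot> x) = a \<odot> (\<Oplus>x\<in>X. b x \<odot> x)"
proof -
 have "a \<odot> (\<Oplus>x\<in>X. b x \<odot> x) = (\<Oplus>x\<in>X. a \<odot> (b x \<odot> x))"
  using assms by (intro finsum_smult_ldistr) auto
 also have "... = (\<Oplus>x\<in>X. (a * b x) \<odot> x)"
  using assms smult_assoc1 by (intro M.finsum_cong' refl) auto
 finally show ?thesis by simp
qed

text \<open>A spanning set of least cardinality is linearly independent, which makes coordinates linear.\<close>

lemma (in vspace) fin_dim_coordinates:
 assumes "fin_dim V"
 shows "\<exists>X c. coordinates V X c"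
proof -
 define spans where "spans X \<longleftrightarrow> finite X \<and> X \<subseteq> carrier V \<and>
   (\<forall>v\<in>carrier V. \<exists>c. v = (\<Oplus>x\<in>X. c x \<odot> x))" for X
 have "\<exists>X. spans X" using assms unfolding fin_dim_def spans_def by blast
 then obtain X where X: "spans X" and min: "!!Y. spans Y ==> card X \<le> card Y"
  using ex_has_least_nat[of spans _ card] by blast
 have fin: "finite X" and sub: "X \<subseteq> carrier V" using X by (auto simp: spans_def)
 define lc where "lc a Y = (\<Oplus>x\<in>Y. a x \<odot> x)" for a :: "'v => 'k" and Y
 have indep: "\<forall>x\<in>X. e x = 0" if e: "lc e X = \<zero>" for e
 proof (rule ccontr)
  assume "\<not> (\<forall>x\<in>X. e x = 0)"
  then obtain x0 where x0: "x0 : X" "e x0 \<noteq> 0" by auto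
  define Y where "Y = X - {x0}"
  have Y: "finite Y" "Y \<subseteq> carrier V" "x0 \<notin> Y" "x0 : carrier V" "X = insert x0 Y"
   using fin sub x0 by (auto simp: Y_def)
  have split: "lc a X = a x0 \<odot> x0 \<oplus> lc a Y" for a
   unfolding lc_def Y(5) using Y(1-4) by (intro M.finsum_insert) auto
  have cl: "lc a Y : carrier V" for a
   unfolding lc_def using Y by (intro M.finsum_closed) auto
  have "e x0 \<odot> x0 = \<ominus> lc e Y"
   using e split[of e] cl Y(4) by (metis M.minus_equality UNIV_I kk_simps(1) smult_closed)
  then have "(1 / e x0) \<odot> (e x0 \<odot> x0) = (1 / e x0) \<odot> (\<ominus> lc e Y)" by simp
  moreover have "(1 / e x0) \<odot> (e x0 \<odot> x0) = x0"
   using smult_assoc1[of "1 / e x0" "e x0" x0] Y(4) x0(2) smult_one[of x0] by simp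
  moreover have "(1 / e x0) \<odot> (\<ominus> lc e Y) = (- 1 / e x0) \<odot> lc e Y"
   using smult_r_minus[of "1 / e x0" "lc e Y"] smult_l_minus[of "1 / e x0" "lc e Y"] cl by simp
  ultimately have x0_eq: "x0 = lc (\<lambda>x. (- 1 / e x0) * e x) Y"
   unfolding lc_def using finsum_smult_scale[OF Y(1,2), of "- 1 / e x0" e] by simp
  have "spans Y"
   unfolding spans_def
  proof (intro conjI ballI)
   fix v assume "v : carrier V"
   then obtain a where a: "v = lc a X" using X by (auto simp: spans_def lc_def)
   have "a x0 \<odot> x0 = lc (\<lambda>x. a x0 * ((- 1 / e x0) * e x)) Y"
    using x0_eq finsum_smult_scale[OF Y(1,2), of "a x0" "\<lambda>x. (- 1 / e x0) * e x"]
    unfolding lc_def by simp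
   with a split[of a] have "v = lc (\<lambda>x. a x0 * ((- 1 / e x0) * e x)) Y \<oplus> lc a Y" by simp
   then have "v = lc (\<lambda>x. a x0 * ((- 1 / e x0) * e x) + a x) Y"
    unfolding lc_def by (simp only: finsum_smult_add[OF Y(1,2)])
   then show "\<exists>c. v = (\<Oplus>x\<in>Y. c x \<odot> x)"
    unfolding lc_def by (rule exI[of _ "\<lambda>x. a x0 * ((- 1 / e x0) * e x) + a x"])
  qed (use Y in auto)
  then have "card X \<le> card Y" by (rule min)
  moreover have "card Y < card X" using fin x0(1) unfolding Y_def by (rule card_Diff1_less)
  ultimately show False by simp
 qed
 have uniq: "\<forall>x\<in>X. a x = b x" if "lc a X = lc b X" for a b
 proof -
  have cl: "lc a X : carrier V" for a
   unfolding lc_def using fin sub by (intro M.finsum_closed) auto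
  have "lc (\<lambda>x. (-1) * b x) X = \<ominus> lc b X"
   using finsum_smult_scale[OF fin sub, of "-1" b] smult_l_minus[of 1 "lc b X"] cl[of b]
    smult_one[of "lc b X"] unfolding lc_def by simp
  then have "lc (\<lambda>x. a x + (-1) * b x) X = \<zero>"
   using finsum_smult_add[OF fin sub, of a "\<lambda>x. (-1) * b x"] that cl[of b]
   unfolding lc_def by (simp add: M.r_neg)
  from indep[OF this] show ?thesis by simp
 qed
 define cf where "cf v = (SOME a. v = lc a X)" for v
 have cf: "v = lc (cf v) X" if "v : carrier V" for v
 proof -
  have "\<exists>a. v = lc a X" using X that unfolding spans_def lc_def by blast
  from someI_ex[OF this] show ?thesis by (simp add: cf_def)
 qed
 have "coordinates V X (\<lambda>x v. cf v x)"
  unfolding coordinates_def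
 proof (intro conjI ballI)
  fix v assume "v : carrier V" then show "v = (\<Oplus>x\<in>X. cf v x \<odot> x)"
   using cf by (simp add: lc_def)
 next
  fix x assume x: "x : X"
  show "klin V kk (\<lambda>v. cf v x)"
  proof (rule klinI)
   fix u v assume uv: "u : carrier V" "v : carrier V"
   have "lc (cf (u \<oplus> v)) X = lc (\<lambda>x. cf u x + cf v x) X"
    using cf[of "u \<oplus> v"] cf[of u] cf[of v] uv finsum_smult_add[OF fin sub, of "cf u" "cf v"]
    unfolding lc_def by simp
   from uniq[OF this] x show "cf (u \<oplus> v) x = cf u x \<oplus>\<^sub>kk cf v x" by simp
  next
   fix c v assume v: "v : carrier V"
   have "lc (cf (c \<odot> v)) X = lc (\<lambda>x. c * cf v x) X"
    using cf[of "c \<odot> v"] cf[of v] v finsum_smult_scale[OF fin sub, of c "cf v"]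
    unfolding lc_def by simp
   from uniq[OF this] x show "cf (c \<odot> v) x = c \<odot>\<^sub>kk cf v x" by simp
  qed simp
 qed (use fin sub in auto)
 then show ?thesis by blast
qed

section \<open>Tensor products\<close>

abbreviation "keys \<equiv> Poly_Mapping.keys"
abbreviation "lookup \<equiv> Poly_Mapping.lookup"
abbreviation "single \<equiv> Poly_Mapping.single"

definition ev :: "('k::field, 'u, 'z) module_scheme => ('v => 'w => 'u) => (('v \<times> 'w) \<Rightarrow>\<^sub>0 'k) => 'u" where
 "ev Y \<beta> x = (\<Oplus>\<^sub>Y i\<in>keys x. lookup x i \<odot>\<^sub>Y \<beta> (fst i) (snd i))"

lemma lookup_fscale [simp]: "lookup (fscale c x) i = c * lookup x i"
 by (simp add: fscale_def map.rep_eq when_def)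

lemma keys_fscale: "keys (fscale c x) \<subseteq> keys x"
 by (auto simp: in_keys_iff)

lemma fscale_add: "fscale c (x + y) = fscale c x + fscale c y"
 and fscale_diff: "fscale c (x - y) = fscale c x - fscale c y"
 and fscale_add_left: "fscale (c + d) x = fscale c x + fscale d x"
 and fscale_fscale: "fscale c (fscale d x) = fscale (c * d) x"
 and fscale_1 [simp]: "fscale 1 x = x"
 and fscale_0 [simp]: "fscale c 0 = 0"
 and fscale_minus1: "fscale (-1) x = - x"
 and fscale_single: "fscale c (single i d) = single i (c * d)"
 by (auto intro!: poly_mapping_eqI simp: lookup_add lookup_minus lookup_single when_def algebra_simps)

locale tensor_pair = V: vspace V + W: vspace W
 for V :: "('k::field, 'v, 'x) module_scheme" and W :: "('k, 'w, 'y) module_scheme"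
begin

lemma formal_0 [simp]: "0 : formal V W"
 by (simp add: formal_def)

lemma formal_add: "x : formal V W ==> y : formal V W ==> x + y : formal V W"
 using keys_add[of x y] by (auto simp: formal_def)

lemma formal_diff: "x : formal V W ==> y : formal V W ==> x - y : formal V W"
 using keys_diff[of x y] by (auto simp: formal_def)

lemma formal_scale: "x : formal V W ==> fscale c x : formal V W"
 using keys_fscale[of c x] by (auto simp: formal_def)

lemma formal_single: "v : carrier V ==> w : carrier W ==> single (v, w) c : formal V W"
 by (auto simp: formal_def)

lemma null_formal: "x : tensor_null V W ==> x : formal V W"
 by (induction rule: tensor_null.induct)
  (auto intro!: formal_add formal_diff formal_scale formal_single)

lemma null_minus: "x : tensor_null V W ==> - x : tensor_null V W"
 by (drule tensor_null.scale[where c = "-1"]) (simp add: fscale_minus1)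

lemma null_diff: "x : tensor_null V W ==> y : tensor_null V W ==> x - y : tensor_null V W"
 using tensor_null.add[OF _ null_minus] by (metis diff_conv_add_uminus)

lemma formal_induct [consumes 1, case_names zero add]:
 assumes "x : formal V W" "P 0"
  and "!!x v w c. x : formal V W ==> P x ==> v : carrier V ==> w : carrier W ==>
   P (single (v, w) c + x)"
 shows "P x"
proof -
 have "P (\<Sum>i\<in>K. single i (f i)) \<and> (\<Sum>i\<in>K. single i (f i)) : formal V W"
  if "finite K" "K \<subseteq> carrier V \<times> carrier W" for K and f :: "_ => 'k"
  using that
 proof (induction K rule: finite_induct)
  case (insert i F)
  then show ?case using assms(3) by (cases i) (auto intro: formal_add formal_single)
 qed (use assms in auto)
 moreover have "(\<Sum>i\<in>keys x. single i (lookup x i)) = x"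
  by (rule poly_mapping_eqI)
   (auto simp: lookup_sum lookup_single when_def in_keys_iff sum.If_cases Int_def)
 moreover have "keys x \<subseteq> carrier V \<times> carrier W" using assms(1) by (simp add: formal_def)
 ultimately show ?thesis by (metis finite_keys)
qed

end

text \<open>Evaluation of a formal combination at a bilinear map respects the defining relations.\<close>

locale tensor_bilin = tensor_pair V W + Y: vspace Y
 for V :: "('k::field, 'v, 'x) module_scheme" and W :: "('k, 'w, 'y) module_scheme"
  and Y :: "('k, 'u, 'z) module_scheme" +
 fixes \<beta> :: "'v => 'w => 'u"
 assumes bilin: "bilin V W Y \<beta>"
begin

lemma beta_closed [simp]: "v : carrier V ==> w : carrier W ==> \<beta> v w : carrier Y"
 using bilin by (auto simp: bilin_def klin_def)

lemma beta_add_left: "v : carrier V ==> v' : carrier V ==> w : carrier W ==>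
   \<beta> (v \<oplus>\<^sub>V v') w = \<beta> v w \<oplus>\<^sub>Y \<beta> v' w"
 and beta_add_right: "v : carrier V ==> w : carrier W ==> w' : carrier W ==>
   \<beta> v (w \<oplus>\<^sub>W w') = \<beta> v w \<oplus>\<^sub>Y \<beta> v w'"
 and beta_smult_left: "v : carrier V ==> w : carrier W ==> \<beta> (c \<odot>\<^sub>V v) w = c \<odot>\<^sub>Y \<beta> v w"
 and beta_smult_right: "v : carrier V ==> w : carrier W ==> \<beta> v (c \<odot>\<^sub>W w) = c \<odot>\<^sub>Y \<beta> v w"
 using bilin by (auto simp: bilin_def klin_def)

lemma ev_superset:
 assumes "finite K" "keys x \<subseteq> K" "K \<subseteq> carrier V \<times> carrier W"
 shows "ev Y \<beta> x = (\<Oplus>\<^sub>Y i\<in>K. lookup x i \<odot>\<^sub>Y \<beta> (fst i) (snd i))"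
 unfolding ev_def
 by (rule Y.M.add.finprod_mono_neutral_cong_left)
  (use assms in "auto simp: in_keys_iff Y.smult_l_null[simplified]")

lemma ev_closed [simp]: "x : formal V W ==> ev Y \<beta> x : carrier Y"
 unfolding ev_def formal_def by (intro Y.M.finsum_closed) auto

lemma ev_add: assumes "x : formal V W" "y : formal V W"
 shows "ev Y \<beta> (x + y) = ev Y \<beta> x \<oplus>\<^sub>Y ev Y \<beta> y"
proof -
 let ?K = "keys x \<union> keys y"
 have K: "finite ?K" "?K \<subseteq> carrier V \<times> carrier W" using assms by (auto simp: formal_def)
 have "ev Y \<beta> (x + y) = (\<Oplus>\<^sub>Y i\<in>?K. lookup (x + y) i \<odot>\<^sub>Y \<beta> (fst i) (snd i))"
  using K keys_add[of x y] by (intro ev_superset) auto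
 also have "... = (\<Oplus>\<^sub>Y i\<in>?K. lookup x i \<odot>\<^sub>Y \<beta> (fst i) (snd i) \<oplus>\<^sub>Y
   lookup y i \<odot>\<^sub>Y \<beta> (fst i) (snd i))"
  using K Y.smult_l_distr by (intro Y.M.finsum_cong' refl) (auto simp: lookup_add)
 also have "... = ev Y \<beta> x \<oplus>\<^sub>Y ev Y \<beta> y"
  using K ev_superset[of ?K x] ev_superset[of ?K y] by (subst Y.M.finsum_addf) auto
 finally show ?thesis .
qed

lemma ev_scale: assumes "x : formal V W"
 shows "ev Y \<beta> (fscale c x) = c \<odot>\<^sub>Y ev Y \<beta> x"
proof -
 let ?K = "keys x"
 have K: "finite ?K" "?K \<subseteq> carrier V \<times> carrier W" using assms by (auto simp: formal_def)
 have "ev Y \<beta> (fscale c x) = (\<Oplus>\<^sub>Y i\<in>?K. lookup (fscale c x) i \<odot>\<^sub>Y \<beta> (fst i) (snd i))"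
  using K keys_fscale[of c x] by (intro ev_superset) auto
 also have "... = (\<Oplus>\<^sub>Y i\<in>?K. c \<odot>\<^sub>Y (lookup x i \<odot>\<^sub>Y \<beta> (fst i) (snd i)))"
  using K Y.smult_assoc1 by (intro Y.M.finsum_cong' refl) auto
 also have "... = c \<odot>\<^sub>Y ev Y \<beta> x"
  unfolding ev_def using K by (intro Y.finsum_smult_ldistr[symmetric]) auto
 finally show ?thesis .
qed

lemma ev_diff: assumes "x : formal V W" "y : formal V W"
 shows "ev Y \<beta> (x - y) = ev Y \<beta> x \<ominus>\<^sub>Y ev Y \<beta> y"
proof -
 have "ev Y \<beta> (x + fscale (-1) y) = ev Y \<beta> x \<oplus>\<^sub>Y (-1) \<odot>\<^sub>Y ev Y \<beta> y"
  using assms by (simp add: ev_add ev_scale formal_scale)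
 moreover have "(-1) \<odot>\<^sub>Y ev Y \<beta> y = \<ominus>\<^sub>Y ev Y \<beta> y"
  using Y.smult_l_minus[of 1 "ev Y \<beta> y"] Y.smult_one[of "ev Y \<beta> y"] assms by simp
 ultimately show ?thesis by (simp add: fscale_minus1 Y.M.minus_eq)
qed

lemma ev_single: "v : carrier V ==> w : carrier W ==>
  ev Y \<beta> (single (v, w) c) = c \<odot>\<^sub>Y \<beta> v w"
 using ev_superset[of "{(v, w)}" "single (v, w) c"]
 by (simp add: Y.M.finsum_insert)

lemma ev_null: "x : tensor_null V W ==> ev Y \<beta> x = \<zero>\<^sub>Y"
proof (induction rule: tensor_null.induct)
 case zero then show ?case by (simp add: ev_def)
next
 case (add x y) then show ?case by (simp add: ev_add null_formal)
next
 case (scale x c) then show ?case using Y.smult_r_null[of c] by (simp add: ev_scale null_formal)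
next
 case (add_left v v' w)
 then show ?case
  using Y.smult_one
  by (simp add: ev_diff ev_single formal_single formal_diff beta_add_left Y.M.minus_eq Y.M.a_ac
   Y.M.r_neg Y.M.r_neg1 Y.M.r_neg2)
next
 case (add_right v w w')
 then show ?case
  using Y.smult_one
  by (simp add: ev_diff ev_single formal_single formal_diff beta_add_right Y.M.minus_eq Y.M.a_ac
   Y.M.r_neg Y.M.r_neg1 Y.M.r_neg2)
next
 case (smult_left v w c)
 then show ?case
  using Y.smult_one[of "c \<odot>\<^sub>Y \<beta> v w"]
  by (simp add: ev_diff ev_single formal_single beta_smult_left Y.M.minus_eq Y.M.r_neg)
next
 case (smult_right v w c)
 then show ?case
  using Y.smult_one[of "c \<odot>\<^sub>Y \<beta> v w"]
  by (simp add: ev_diff ev_single formal_single beta_smult_right Y.M.minus_eq Y.M.r_neg)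
qed

end

context tensor_pair
begin

lemma tcoset_self: "x : formal V W ==> x : tcoset V W x"
 by (simp add: tcoset_def tensor_null.zero)

lemma tcoset_eq_iff:
 assumes "x : formal V W" "y : formal V W"
 shows "tcoset V W x = tcoset V W y \<longleftrightarrow> x - y : tensor_null V W"
proof
 assume "tcoset V W x = tcoset V W y"
 then have "x : tcoset V W y" using tcoset_self[OF assms(1)] by simp
 then show "x - y : tensor_null V W" by (simp add: tcoset_def)
next
 assume *: "x - y : tensor_null V W"
 have "z - x : tensor_null V W \<longleftrightarrow> z - y : tensor_null V W" for z
  using tensor_null.add[OF _ *, of "z - x"] null_diff[OF _ *, of "z - y"] by auto
 then show "tcoset V W x = tcoset V W y" by (simp add: tcoset_def)
qed

lemma carrier_tensor: "carrier (tensor V W) = tcoset V W ` formal V W"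
 by (simp add: tensor_def)

lemma zero_tensor: "\<zero>\<^sub>(tensor V W) = tcoset V W 0"
 by (simp add: tensor_def)

lemma add_tensor:
 assumes "x : formal V W" "y : formal V W"
 shows "tcoset V W x \<oplus>\<^sub>(tensor V W) tcoset V W y = tcoset V W (x + y)"
proof -
 have "tcoset V W (x' + y') = tcoset V W (x + y)"
  if "x' : tcoset V W x" "y' : tcoset V W y" for x' y'
 proof -
  have *: "x' + y' - (x + y) = (x' - x) + (y' - y)" by simp
  show ?thesis using that assms
   by (subst tcoset_eq_iff) (auto simp: tcoset_def * intro: formal_add tensor_null.add)
 qed
 then have "(\<Union>x'\<in>tcoset V W x. \<Union>y'\<in>tcoset V W y. tcoset V W (x' + y')) = tcoset V W (x + y)"
  using tcoset_self[OF assms(1)] tcoset_self[OF assms(2)] by blast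
 then show ?thesis by (simp add: tensor_def)
qed

lemma smult_tensor:
 assumes "x : formal V W"
 shows "c \<odot>\<^sub>(tensor V W) tcoset V W x = tcoset V W (fscale c x)"
proof -
 have "tcoset V W (fscale c x') = tcoset V W (fscale c x)" if "x' : tcoset V W x" for x'
 proof -
  have "fscale c x' - fscale c x = fscale c (x' - x)" by (simp add: fscale_diff)
  then show ?thesis using that assms
   by (subst tcoset_eq_iff) (auto simp: tcoset_def intro: formal_scale tensor_null.scale)
 qed
 then have "(\<Union>x'\<in>tcoset V W x. tcoset V W (fscale c x')) = tcoset V W (fscale c x)"
  using tcoset_self[OF assms(1)] by blast
 then show ?thesis by (simp add: tensor_def)
qed

lemma abelian_group_tensor: "abelian_group (tensor V W)"
proof (rule abelian_groupI)
 fix X assume "X : carrier (tensor V W)"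
 then obtain x where "X = tcoset V W x" "x : formal V W" by (auto simp: carrier_tensor)
 then show "\<exists>Y\<in>carrier (tensor V W). Y \<oplus>\<^sub>(tensor V W) X = \<zero>\<^sub>(tensor V W)"
  using formal_diff[of 0 x]
  by (intro bexI[of _ "tcoset V W (- x)"]) (auto simp: carrier_tensor add_tensor zero_tensor)
qed (auto simp: carrier_tensor zero_tensor add_tensor add_ac formal_add)

lemma vspace_tensor: "vspace (tensor V W)"
proof (rule vspace.intro, rule moduleI)
 show "abelian_group (tensor V W)" by (rule abelian_group_tensor)
qed (auto simp: carrier_tensor smult_tensor add_tensor formal_scale formal_add fscale_add
  fscale_add_left fscale_fscale)

lemma tens_closed: "v : carrier V ==> w : carrier W ==> tens V W v w : carrier (tensor V W)"
 by (simp add: tens_def carrier_tensor formal_single)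

lemma tens_add_left: "v : carrier V ==> v' : carrier V ==> w : carrier W ==>
  tens V W (v \<oplus>\<^sub>V v') w = tens V W v w \<oplus>\<^sub>(tensor V W) tens V W v' w"
 using tensor_null.add_left[of v V v' w W]
 by (simp add: tens_def add_tensor formal_single formal_add tcoset_eq_iff diff_diff_eq)

lemma tens_add_right: "v : carrier V ==> w : carrier W ==> w' : carrier W ==>
  tens V W v (w \<oplus>\<^sub>W w') = tens V W v w \<oplus>\<^sub>(tensor V W) tens V W v w'"
 using tensor_null.add_right[of v V w W w']
 by (simp add: tens_def add_tensor formal_single formal_add tcoset_eq_iff diff_diff_eq)

lemma tens_smult_left: "v : carrier V ==> w : carrier W ==>
  tens V W (c \<odot>\<^sub>V v) w = c \<odot>\<^sub>(tensor V W) tens V W v w"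
 using tensor_null.smult_left[of v V w W c]
 by (simp add: tens_def smult_tensor formal_single tcoset_eq_iff fscale_single)

lemma tens_smult_right: "v : carrier V ==> w : carrier W ==>
  tens V W v (c \<odot>\<^sub>W w) = c \<odot>\<^sub>(tensor V W) tens V W v w"
 using tensor_null.smult_right[of v V w W c]
 by (simp add: tens_def smult_tensor formal_single tcoset_eq_iff fscale_single)

lemma bilin_tens: "bilin V W (tensor V W) (tens V W)"
 by (auto simp: bilin_def klin_def tens_closed tens_add_left tens_add_right tens_smult_left tens_smult_right)

lemma tensor_induct [consumes 1, case_names tens add]:
 assumes "X : carrier (tensor V W)"
  and "!!v w. v : carrier V ==> w : carrier W ==> P (tens V W v w)"
  and "!!X Y. X : carrier (tensor V W) ==> Y : carrier (tensor V W) ==> P X ==> P Y ==>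
   P (X \<oplus>\<^sub>(tensor V W) Y)"
 shows "P X"
proof -
 interpret T: vspace "tensor V W" by (rule vspace_tensor)
 obtain x where x: "X = tcoset V W x" "x : formal V W" using assms(1) by (auto simp: carrier_tensor)
 have "P (tcoset V W x)" using x(2)
 proof (induction rule: formal_induct)
  case zero
  have "tens V W \<zero>\<^sub>V \<zero>\<^sub>W = \<zero>\<^sub>(tensor V W)"
   using tens_smult_left[of "\<zero>\<^sub>V" "\<zero>\<^sub>W" 0] V.smult_r_null[of 0]
    T.smult_l_null[simplified, of "tens V W \<zero>\<^sub>V \<zero>\<^sub>W"] tens_closed[of "\<zero>\<^sub>V" "\<zero>\<^sub>W"] by simp
  then show ?case using assms(2)[of "\<zero>\<^sub>V" "\<zero>\<^sub>W"] by (simp add: zero_tensor)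
 next
  case (add x v w c)
  have "tcoset V W (single (v, w) c) = tens V W (c \<odot>\<^sub>V v) w"
   using add by (simp add: tens_smult_left) (simp add: tens_def smult_tensor formal_single fscale_single)
  moreover have "tcoset V W (single (v, w) c + x) =
    tcoset V W (single (v, w) c) \<oplus>\<^sub>(tensor V W) tcoset V W x"
   using add by (simp add: add_tensor formal_single)
  ultimately show ?case
   using add assms(2)[of "c \<odot>\<^sub>V v" w] assms(3)[of "tens V W (c \<odot>\<^sub>V v) w" "tcoset V W x"]
   by (simp add: tens_closed) (simp add: carrier_tensor)
 qed
 then show ?thesis using x by simp
qed

text \<open>Additive maps out of a tensor product are determined by the pure tensors.\<close>

lemma tensor_ext:
 assumes "abelian_group Y" "additive (tensor V W) Y f" "additive (tensor V W) Y g"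
  and "!!v w. v : carrier V ==> w : carrier W ==> f (tens V W v w) = g (tens V W v w)"
  and "X : carrier (tensor V W)"
 shows "f X = g X"
 using assms(5)
proof (induction rule: tensor_induct)
 case (add X Y)
 then show ?case using assms(2,3) by (simp add: additive_def)
qed (use assms in auto)

end

context tensor_bilin
begin

lemma lift_tcoset:
 assumes "x : formal V W"
 shows "tensor_lift Y \<beta> (tcoset V W x) = ev Y \<beta> x"
proof -
 define y where "y = (SOME y. y : tcoset V W x)"
 have "y : tcoset V W x" unfolding y_def by (rule someI) (rule tcoset_self[OF assms])
 then have y: "y : formal V W" "y - x : tensor_null V W" by (auto simp: tcoset_def)
 have "ev Y \<beta> y \<ominus>\<^sub>Y ev Y \<beta> x = \<zero>\<^sub>Y"
  using ev_null[OF y(2)] y(1) assms by (simp add: ev_diff)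
 then have "ev Y \<beta> y = ev Y \<beta> x" using y(1) assms by (simp add: Y.M.diff_zero_eq)
 then show ?thesis by (simp add: tensor_lift_def ev_def y_def)
qed

lemma lift_tens: "v : carrier V ==> w : carrier W ==> tensor_lift Y \<beta> (tens V W v w) = \<beta> v w"
 using Y.smult_one[of "\<beta> v w"] by (simp add: tens_def lift_tcoset formal_single ev_single)

lemma lift_klin: "klin (tensor V W) Y (tensor_lift Y \<beta>)"
proof (rule klinI)
 fix X Z assume "X : carrier (tensor V W)" "Z : carrier (tensor V W)"
 then obtain x z where "X = tcoset V W x" "x : formal V W" "Z = tcoset V W z" "z : formal V W"
  by (auto simp: carrier_tensor)
 then show "tensor_lift Y \<beta> (X \<oplus>\<^sub>(tensor V W) Z) = tensor_lift Y \<beta> X \<oplus>\<^sub>Y tensor_lift Y \<beta> Z"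
  by (simp add: add_tensor lift_tcoset formal_add ev_add)
next
 fix c X assume "X : carrier (tensor V W)"
 then obtain x where "X = tcoset V W x" "x : formal V W"
  by (auto simp: carrier_tensor)
 then show "tensor_lift Y \<beta> (c \<odot>\<^sub>(tensor V W) X) = c \<odot>\<^sub>Y tensor_lift Y \<beta> X"
  by (simp add: smult_tensor lift_tcoset formal_scale ev_scale)
next
 fix X assume "X : carrier (tensor V W)"
 then obtain x where "X = tcoset V W x" "x : formal V W"
  by (auto simp: carrier_tensor)
 then show "tensor_lift Y \<beta> X : carrier Y" by (simp add: lift_tcoset)
qed

lemma lift_cong:
 assumes "!!v w. v : carrier V ==> w : carrier W ==> \<gamma> v w = \<beta> v w" "X : carrier (tensor V W)"
 shows "tensor_lift Y \<gamma> X = tensor_lift Y \<beta> X"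
proof -
 obtain x where x: "X = tcoset V W x" "x : formal V W"
  using assms(2) by (auto simp: carrier_tensor)
 interpret g: tensor_bilin V W Y \<gamma>
  using bilin assms(1) by unfold_locales (auto simp: bilin_def klin_def)
 show ?thesis unfolding x(1) lift_tcoset[OF x(2)] g.lift_tcoset[OF x(2)] ev_def
  using x(2) assms(1) by (intro Y.M.finsum_cong' refl) (auto simp: formal_def)
qed

end

lemma tensor_bilinI:
 "vspace V ==> vspace W ==> vspace Y ==> bilin V W Y \<beta> ==> tensor_bilin V W Y \<beta>"
 by (simp add: tensor_bilin_def tensor_pair_def tensor_bilin_axioms_def)

lemma tensor_pairI: "vspace V ==> vspace W ==> tensor_pair V W"
 by (simp add: tensor_pair_def)

locale tensor_algebras = tensor_pair V W + VA: algebra kk V + WA: algebra kk W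
 for V :: "('k::field, 'v, 'x) module_scheme" and W :: "('k, 'w, 'y) module_scheme"
begin

definition fm :: "('v \<times> 'w) => ('v \<times> 'w) => ('v \<times> 'w)" where
 "fm i j = (fst i \<otimes>\<^sub>V fst j, snd i \<otimes>\<^sub>W snd j)"

lemma formal_mult_superset:
 assumes "finite K" "keys x \<subseteq> K" "finite L" "keys y \<subseteq> L"
 shows "formal_mult V W x y = (\<Sum>i\<in>K. \<Sum>j\<in>L. single (fm i j)
   (lookup x i * lookup y j))"
proof -
 have "formal_mult V W x y = (\<Sum>i\<in>keys x. \<Sum>j\<in>keys y.
   single (fm i j) (lookup x i * lookup y j))"
  by (simp add: formal_mult_def fm_def case_prod_unfold)
 also have "... = (\<Sum>i\<in>keys x. \<Sum>j\<in>L. single (fm i j)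
   (lookup x i * lookup y j))"
  using assms by (intro sum.cong refl sum.mono_neutral_left) (auto simp: in_keys_iff)
 also have "... = (\<Sum>i\<in>K. \<Sum>j\<in>L. single (fm i j)
   (lookup x i * lookup y j))"
  using assms by (intro sum.mono_neutral_left) (auto simp: in_keys_iff)
 finally show ?thesis .
qed

lemma fm_add_left: "formal_mult V W (x + x') y = formal_mult V W x y + formal_mult V W x' y"
 using formal_mult_superset[of "keys x \<union> keys x'" "x + x'" "keys y" y]
  formal_mult_superset[of "keys x \<union> keys x'" x "keys y" y]
  formal_mult_superset[of "keys x \<union> keys x'" x' "keys y" y]
  keys_add[of x x']
 by (simp add: lookup_add distrib_right single_add sum.distrib)

lemma fm_add_right: "formal_mult V W x (y + y') = formal_mult V W x y + formal_mult V W x y'"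
 using formal_mult_superset[of "keys x" x "keys y \<union> keys y'" "y + y'"]
  formal_mult_superset[of "keys x" x "keys y \<union> keys y'" y]
  formal_mult_superset[of "keys x" x "keys y \<union> keys y'" y']
  keys_add[of y y']
 by (simp add: lookup_add distrib_left single_add sum.distrib)

lemma fscale_sum: "fscale c (sum f I) = (\<Sum>i\<in>I. fscale c (f i))"
 by (induction I rule: infinite_finite_induct) (auto simp: fscale_add)

lemma fm_scale_left: "formal_mult V W (fscale c x) y = fscale c (formal_mult V W x y)"
 using formal_mult_superset[of "keys x" "fscale c x" "keys y" y]
  formal_mult_superset[of "keys x" x "keys y" y] keys_fscale[of c x]
 by (simp add: fscale_sum fscale_single mult.assoc)

lemma fm_scale_right: "formal_mult V W x (fscale c y) = fscale c (formal_mult V W x y)"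
 using formal_mult_superset[of "keys x" x "keys y" "fscale c y"]
  formal_mult_superset[of "keys x" x "keys y" y] keys_fscale[of c y]
 by (simp add: fscale_sum fscale_single mult.left_commute)

lemma fm_diff_left: "formal_mult V W (x - x') y = formal_mult V W x y - formal_mult V W x' y"
 using fm_add_left[of x "fscale (-1) x'" y] fm_scale_left[of "-1" x' y] by (simp add: fscale_minus1)

lemma fm_diff_right: "formal_mult V W x (y - y') = formal_mult V W x y - formal_mult V W x y'"
 using fm_add_right[of x y "fscale (-1) y'"] fm_scale_right[of x "-1" y'] by (simp add: fscale_minus1)

lemma fm_single: "formal_mult V W (single (a, b) s) (single (c, d) t) =
  single (a \<otimes>\<^sub>V c, b \<otimes>\<^sub>W d) (s * t)"
 using formal_mult_superset[of "{(a, b)}" "single (a, b) s" "{(c, d)}" "single (c, d) t"]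
 by (simp add: fm_def)

lemma fm_0: "formal_mult V W 0 y = 0" "formal_mult V W x 0 = 0"
 by (simp_all add: formal_mult_def)

lemma fm_formal: assumes "x : formal V W" "y : formal V W" shows "formal_mult V W x y : formal V W"
 using assms(1)
proof (induction rule: formal_induct)
 case (add x a b s)
 note x = add
 have "formal_mult V W (single (a, b) s) y : formal V W" using assms(2)
  by (induction rule: formal_induct)
   (use x in "auto simp: fm_0 fm_add_right fm_single intro!: formal_add formal_single")
 with add show ?case by (simp add: fm_add_left formal_add)
qed (simp add: fm_0)

lemma null_single_right:
 assumes c: "c : carrier V" "d : carrier W" and "x : tensor_null V W"
 shows "formal_mult V W x (single (c, d) t) : tensor_null V W"
proof -
 have *: "formal_mult V W x (single (c, d) 1) : tensor_null V W"
  using assms(3)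
 proof (induction rule: tensor_null.induct)
  case (add_left v v' w)
  then show ?case using c tensor_null.add_left[of "v \<otimes>\<^sub>V c" V "v' \<otimes>\<^sub>V c" "w \<otimes>\<^sub>W d" W]
   by (simp add: fm_diff_left fm_single VA.l_distr)
 next
  case (add_right v w w')
  then show ?case using c tensor_null.add_right[of "v \<otimes>\<^sub>V c" V "w \<otimes>\<^sub>W d" W "w' \<otimes>\<^sub>W d"]
   by (simp add: fm_diff_left fm_single WA.l_distr)
 next
  case (smult_left v w s)
  then show ?case using c tensor_null.smult_left[of "v \<otimes>\<^sub>V c" V "w \<otimes>\<^sub>W d" W s]
   by (simp add: fm_diff_left fm_single VA.smult_assoc2)
 next
  case (smult_right v w s)
  then show ?case using c tensor_null.smult_right[of "v \<otimes>\<^sub>V c" V "w \<otimes>\<^sub>W d" W s]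
   by (simp add: fm_diff_left fm_single WA.smult_assoc2)
 qed (auto simp: fm_0 fm_add_left fm_scale_left intro: tensor_null.intros)
 have "formal_mult V W x (single (c, d) t) =
   fscale t (formal_mult V W x (single (c, d) 1))"
  by (simp add: fm_scale_right[symmetric] fscale_single)
 then show ?thesis using * by (simp add: tensor_null.scale)
qed

lemma fm_comm:
 assumes "x : formal V W" "y : formal V W"
 shows "formal_mult V W x y = formal_mult V W y x"
 using assms(1)
proof (induction rule: formal_induct)
 case (add x a b s)
 note x = add
 have "formal_mult V W (single (a, b) s) y = formal_mult V W y (single (a, b) s)"
  using assms(2)
  by (induction rule: formal_induct)
   (use x in "auto simp: fm_0 fm_add_left fm_add_right fm_single VA.m_comm WA.m_comm mult.commute")
 then show ?case using add by (simp add: fm_add_left fm_add_right)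
qed (simp add: fm_0)

lemma fm_null_left:
 assumes "x : tensor_null V W" "y : formal V W"
 shows "formal_mult V W x y : tensor_null V W"
 using assms(2)
 by (induction rule: formal_induct)
  (use assms(1) in "auto simp: fm_0 fm_add_right intro: tensor_null.intros null_single_right")

lemma mult_tensor:
 assumes "x : formal V W" "y : formal V W"
 shows "tcoset V W x \<otimes>\<^sub>(tensor V W) tcoset V W y = tcoset V W (formal_mult V W x y)"
proof -
 have "tcoset V W (formal_mult V W x' y') = tcoset V W (formal_mult V W x y)"
  if "x' : tcoset V W x" "y' : tcoset V W y" for x' y'
 proof -
  have m: "x' : formal V W" "y' : formal V W" "x' - x : tensor_null V W" "y' - y : tensor_null V W"
   using that by (auto simp: tcoset_def)
  have "formal_mult V W x' y' - formal_mult V W x y =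
    formal_mult V W (x' - x) y' + formal_mult V W x (y' - y)"
   by (simp add: fm_diff_left fm_diff_right)
  moreover have "formal_mult V W x (y' - y) = formal_mult V W (y' - y) x"
   using assms m by (intro fm_comm formal_diff)
  ultimately show ?thesis using assms m
   by (subst tcoset_eq_iff) (auto intro!: fm_formal tensor_null.add fm_null_left)
 qed
 then have "(\<Union>x'\<in>tcoset V W x. \<Union>y'\<in>tcoset V W y. tcoset V W (formal_mult V W x' y')) =
   tcoset V W (formal_mult V W x y)"
  using tcoset_self[OF assms(1)] tcoset_self[OF assms(2)] by blast
 then show ?thesis by (simp add: tensor_def)
qed

lemma mult_tens: "a : carrier V ==> b : carrier W ==> c : carrier V ==> d : carrier W ==>
  tens V W a b \<otimes>\<^sub>(tensor V W) tens V W c d = tens V W (a \<otimes>\<^sub>V c) (b \<otimes>\<^sub>W d)"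
 by (simp add: tens_def mult_tensor formal_single fm_single)

lemma mult_closed:
 "X : carrier (tensor V W) ==> Y : carrier (tensor V W) ==> X \<otimes>\<^sub>(tensor V W) Y : carrier (tensor V W)"
 by (auto simp: carrier_tensor mult_tensor fm_formal)

lemma mult_distr:
 "X : carrier (tensor V W) ==> X' : carrier (tensor V W) ==> Y : carrier (tensor V W) ==>
  (X \<oplus>\<^sub>(tensor V W) X') \<otimes>\<^sub>(tensor V W) Y = X \<otimes>\<^sub>(tensor V W) Y \<oplus>\<^sub>(tensor V W) X' \<otimes>\<^sub>(tensor V W) Y"
 "X : carrier (tensor V W) ==> X' : carrier (tensor V W) ==> Y : carrier (tensor V W) ==>
  Y \<otimes>\<^sub>(tensor V W) (X \<oplus>\<^sub>(tensor V W) X') = Y \<otimes>\<^sub>(tensor V W) X \<oplus>\<^sub>(tensor V W) Y \<otimes>\<^sub>(tensor V W) X'"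
 by (auto simp: carrier_tensor mult_tensor add_tensor fm_formal formal_add fm_add_left fm_add_right)

end

section \<open>Graded modules with an operator and their sheaves\<close>

locale graded_module = module S F
 for S :: "('s, 'x) ring_scheme" and F :: "('s, 'f) module" (structure) +
 fixes Sg :: "nat => 's set" and Fg :: "int => 'f set"
 assumes Sg_sub: "Sg n \<subseteq> carrier S"
  and Sg_one: "\<one>\<^sub>S : Sg 0"
  and Sg_mult: "a : Sg m ==> b : Sg n ==> a \<otimes>\<^sub>S b : Sg (m + n)"
  and Fg_sub: "Fg i \<subseteq> carrier F"
  and Fg_zero: "\<zero> : Fg i"
  and Fg_add: "x : Fg i ==> y : Fg i ==> x \<oplus> y : Fg i"
  and Fg_minus: "x : Fg i ==> \<ominus> x : Fg i"
  and Fg_smult: "a : Sg m ==> x : Fg i ==> a \<odot> x : Fg (int m + i)"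
begin

lemma Sg_closed [simp]: "a : Sg n ==> a : carrier S"
 using Sg_sub by auto

lemma Fg_closed [simp]: "x : Fg i ==> x : carrier F"
 using Fg_sub by auto

lemma Fg_diff: "x : Fg i ==> y : Fg i ==> x \<ominus> y : Fg i"
 by (simp add: M.minus_eq Fg_add Fg_minus)

lemma Fg_smult': "a : Sg m ==> x : Fg i ==> l = int m + i ==> a \<odot> x : Fg l"
 using Fg_smult by simp

lemma Sg_pow: "a : Sg m ==> a [^]\<^sub>S (n::nat) : Sg (n * m)"
proof (induction n)
 case (Suc n)
 then show ?case using Sg_mult[of "a [^]\<^sub>S n" "n * m" a m] by (simp add: add.commute)
qed (simp add: Sg_one)

lemma smult_comm: "a : carrier S ==> b : carrier S ==> x : carrier F ==>
  a \<odot> (b \<odot> x) = b \<odot> (a \<odot> x)"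
 by (simp add: smult_assoc1[symmetric] R.m_comm)

lemma smult_diff: "a : carrier S ==> x : carrier F ==> y : carrier F ==>
  a \<odot> (x \<ominus> y) = a \<odot> x \<ominus> a \<odot> y"
 by (simp add: M.minus_eq smult_r_distr smult_r_minus)

end

lemma (in primeideal) notin_mult:
 "a : carrier R ==> b : carrier R ==> a \<notin> I ==> b \<notin> I ==> a \<otimes> b \<notin> I"
 using I_prime by blast

lemma (in primeideal) one_notin: "\<one> \<notin> I"
 using I_notcarr one_imp_carrier by blast

lemma (in primeideal) notin_pow: "a : carrier R ==> a \<notin> I ==> a [^] (n::nat) \<notin> I"
proof (induction n)
 case (Suc n)
 then show ?case using notin_mult[of "a [^] n" a] by simp
qed (simp add: one_notin)

text \<open>
 A homogeneous fraction is valid at \<open>P\<close> if it lies in the degree \<open>d\<close> part of the localization; the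
 stalks in the definition of a sheaf section are the classes of valid fractions.
\<close>

definition valid_frac :: "(nat => 's set) => (int => 'f set) => int => 's set => 'f => 's => bool" where
 "valid_frac Sg Fg d P m f \<longleftrightarrow> (\<exists>n. f : Sg n - P \<and> m : Fg (int n + d))"

locale graded_module_at = graded_module S F Sg Fg
 for S :: "('s, 'x) ring_scheme" and F :: "('s, 'f) module" (structure) and Sg Fg +
 fixes P :: "'s set"
 assumes prime: "primeideal P S"
begin

abbreviation "germ d \<equiv> hfrac Sg F Fg d P"
abbreviation "valid d \<equiv> valid_frac Sg Fg d P"
abbreviation "add_germs \<equiv> stalk_add S Sg F Fg 0 P"


lemma one_notin: "\<one>\<^sub>S \<notin> P" using primeideal.one_notin[OF prime] .

lemma notin_mult: "a : carrier S ==> b : carrier S ==> a \<notin> P ==> b \<notin> P ==> a \<otimes>\<^sub>S b \<notin> P"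
 using primeideal.notin_mult[OF prime] .

lemma notin_pow: "a : carrier S ==> a \<notin> P ==> a [^]\<^sub>S (n::nat) \<notin> P"
 using primeideal.notin_pow[OF prime] .

lemma prod_notin: "a : Sg m - P ==> b : Sg n - P ==> l = m + n ==> a \<otimes>\<^sub>S b : Sg l - P"
 using notin_mult[of a b] by (auto intro: Sg_mult)

lemma hfrac_mem:
 assumes "m : carrier F" "f : carrier S"
 shows "(m', f') : germ d m f \<longleftrightarrow> valid d m' f' \<and>
   (\<exists>n. \<exists>h\<in>Sg n - P. h \<odot> (f' \<odot> m) = h \<odot> (f \<odot> m'))"
proof -
 have "h \<odot> ((f' \<odot> m) \<ominus> (f \<odot> m')) = \<zero> \<longleftrightarrow> h \<odot> (f' \<odot> m) = h \<odot> (f \<odot> m')"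
  if "h : Sg n" "f' : Sg n'" "m' : Fg l" for h n n' l
  using that assms by (simp add: smult_diff M.diff_zero_eq)
 note key = this
 show ?thesis
 proof
  assume "(m', f') : germ d m f"
  then show "valid d m' f' \<and>
    (\<exists>n. \<exists>h\<in>Sg n - P. h \<odot> (f' \<odot> m) = h \<odot> (f \<odot> m'))"
   unfolding hfrac_def valid_frac_def using key by (auto 0 3)
 next
  assume "valid d m' f' \<and>
    (\<exists>n. \<exists>h\<in>Sg n - P. h \<odot> (f' \<odot> m) = h \<odot> (f \<odot> m'))"
  then obtain n l h where *: "f' : Sg n - P" "m' : Fg (int n + d)" "h : Sg l - P"
    "h \<odot> (f' \<odot> m) = h \<odot> (f \<odot> m')"
   unfolding valid_frac_def by blast
  then have "h \<odot> ((f' \<odot> m) \<ominus> (f \<odot> m')) = \<zero>" using key by blast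
  with * show "(m', f') : germ d m f" unfolding hfrac_def by blast
 qed
qed

lemma valid_closed:
 assumes "valid d m f" shows "m : carrier F" "f : carrier S" "f \<notin> P"
 using assms by (auto simp: valid_frac_def)

lemma hfrac_self: "valid d m f ==> (m, f) : germ d m f"
 using one_notin Sg_one by (subst hfrac_mem) (auto dest: valid_closed)

lemma hfrac_trans:
 assumes v: "valid d m f" "valid d m' f'"
  and eq: "h : Sg n - P" "h \<odot> (f' \<odot> m) = h \<odot> (f \<odot> m')"
  and m'': "(m'', f'') : germ d m' f'"
 shows "(m'', f'') : germ d m f"
proof -
 note [simp] = valid_closed[OF v(1)] valid_closed[OF v(2)]
 obtain k l where v'': "valid d m'' f''" and k: "k : Sg l - P"
  and eq': "k \<odot> (f'' \<odot> m') = k \<odot> (f' \<odot> m'')"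
  using m'' by (auto simp: hfrac_mem)
 note [simp] = valid_closed[OF v'']
 obtain n' where n': "f' : Sg n'" using v(2) by (auto simp: valid_frac_def)
 have [simp]: "h : carrier S" "k : carrier S" using eq(1) k by auto
 let ?h = "h \<otimes>\<^sub>S k \<otimes>\<^sub>S f'"
 have "?h \<odot> (f'' \<odot> m) = k \<odot> (f'' \<odot> (h \<odot> (f' \<odot> m)))"
  by (simp add: smult_assoc1[symmetric] R.m_ac)
 also have "... = h \<odot> (f \<odot> (k \<odot> (f'' \<odot> m')))"
  unfolding eq(2) by (simp add: smult_assoc1[symmetric] R.m_ac)
 also have "... = ?h \<odot> (f \<odot> m'')"
  unfolding eq' by (simp add: smult_assoc1[symmetric] R.m_ac)
 finally have "?h \<odot> (f'' \<odot> m) = ?h \<odot> (f \<odot> m'')" .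
 moreover have "?h : Sg (n + l + n') - P"
  using prod_notin[OF prod_notin[OF eq(1) k refl], of f' n'] n' valid_closed(3)[OF v(2)] by simp
 ultimately show ?thesis using v'' by (subst hfrac_mem) auto
qed

lemma hfrac_eqI:
 assumes v: "valid d m f" "valid d m' f'"
  and eq: "h : Sg n - P" "h \<odot> (f' \<odot> m) = h \<odot> (f \<odot> m')"
 shows "germ d m f = germ d m' f'"
proof -
 have "x : germ d m f \<longleftrightarrow> x : germ d m' f'" for x
  using hfrac_trans[OF v eq, of "fst x" "snd x"] hfrac_trans[OF v(2,1) eq(1) eq(2)[symmetric], of "fst x" "snd x"]
  unfolding prod.collapse by meson
 then show ?thesis by (rule Set.set_eqI)
qed

lemma hfrac_eqD:
 assumes v: "valid d m f" "valid d m' f'"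
  and eq: "germ d m f = germ d m' f'"
 shows "\<exists>n. \<exists>h\<in>Sg n - P. h \<odot> (f' \<odot> m) = h \<odot> (f \<odot> m')"
 using hfrac_self[OF v(2)] unfolding eq[symmetric]
 using v by (subst (asm) hfrac_mem) (auto dest: valid_closed)

lemma hfrac_mem_eq:
 assumes v: "valid d m f" and "(m', f') : germ d m f"
 shows "valid d m' f'" "germ d m' f' = germ d m f"
proof -
 show *: "valid d m' f'" using assms by (subst (asm) hfrac_mem) (auto dest: valid_closed)
 show "germ d m' f' = germ d m f"
 proof -
  obtain n h where "h : Sg n - P" "h \<odot> (f' \<odot> m) = h \<odot> (f \<odot> m')"
   using assms(2) hfrac_mem[OF valid_closed(1,2)[OF v], of m' f' d] by blast
  from hfrac_eqI[OF v * this] show ?thesis by simp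
 qed
qed

lemma valid_zero: "valid d \<zero> \<one>\<^sub>S"
 using Sg_one one_notin Fg_zero by (auto simp: valid_frac_def)

lemma valid_add:
 assumes v: "valid 0 m f" "valid 0 m' f'"
 shows "valid 0 ((f' \<odot> m) \<oplus> (f \<odot> m')) (f \<otimes>\<^sub>S f')"
proof -
 obtain n n' where n: "f : Sg n - P" "m : Fg (int n)" "f' : Sg n' - P" "m' : Fg (int n')"
  using v by (auto simp: valid_frac_def)
 then have "f \<otimes>\<^sub>S f' : Sg (n + n') - P" by (intro prod_notin) auto
 moreover have "(f' \<odot> m) \<oplus> (f \<odot> m') : Fg (int (n + n'))"
  using n by (auto intro!: Fg_add Fg_smult')
 ultimately show ?thesis by (auto simp: valid_frac_def)
qed

lemma stalk_add_hfrac: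
 assumes v: "valid 0 m f" "valid 0 m' f'"
 shows "add_germs (germ 0 m f) (germ 0 m' f') =
  germ 0 ((f' \<odot> m) \<oplus> (f \<odot> m')) (f \<otimes>\<^sub>S f')"
proof -
 note [simp] = valid_closed[OF v(1)] valid_closed[OF v(2)]
 have "germ 0 ((g' \<odot> a) \<oplus> (g \<odot> a')) (g \<otimes>\<^sub>S g') =
   germ 0 ((f' \<odot> m) \<oplus> (f \<odot> m')) (f \<otimes>\<^sub>S f')"
  if a: "(a, g) : germ 0 m f" "(a', g') : germ 0 m' f'" for a g a' g'
 proof -
  have w: "valid 0 a g" "valid 0 a' g'"
   using hfrac_mem_eq(1)[OF v(1) a(1)] hfrac_mem_eq(1)[OF v(2) a(2)] by auto
  note [simp] = valid_closed[OF w(1)] valid_closed[OF w(2)]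
  obtain n h n' h' where h: "h : Sg n - P" "h' : Sg n' - P"
   and e: "h \<odot> (g \<odot> m) = h \<odot> (f \<odot> a)" "h' \<odot> (g' \<odot> m') = h' \<odot> (f' \<odot> a')"
   using a by (auto simp: hfrac_mem)
  have [simp]: "h : carrier S" "h' : carrier S" using h by auto
  let ?k = "h \<otimes>\<^sub>S h'"
  have k: "?k : Sg (n + n') - P" using h by (intro prod_notin) auto
  have "?k \<odot> ((f \<otimes>\<^sub>S f') \<odot> ((g' \<odot> a) \<oplus> (g \<odot> a'))) =
    (h' \<otimes>\<^sub>S f' \<otimes>\<^sub>S g') \<odot> (h \<odot> (f \<odot> a)) \<oplus> (h \<otimes>\<^sub>S f \<otimes>\<^sub>S g) \<odot> (h' \<odot> (f' \<odot> a'))"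
   by (simp add: smult_assoc1[symmetric] R.m_ac smult_r_distr)
  also have "... = ?k \<odot> ((g \<otimes>\<^sub>S g') \<odot> ((f' \<odot> m) \<oplus> (f \<odot> m')))"
   unfolding e[symmetric] by (simp add: smult_assoc1[symmetric] R.m_ac smult_r_distr)
  finally show ?thesis by (rule hfrac_eqI[OF valid_add[OF w] valid_add[OF v] k])
 qed
 then show ?thesis
  unfolding stalk_add_def using hfrac_self[OF v(1)] hfrac_self[OF v(2)] by blast
qed

end

lemma Proj_prime: "P : Proj S Sg ==> primeideal P S"
 by (simp add: Proj_def)

context graded_module
begin

lemma at_point: "P : Proj S Sg ==> graded_module_at S F Sg Fg P"
 by (intro graded_module_at.intro graded_module_axioms graded_module_at_axioms.intro Proj_prime)

lemma Proj_open_D: "f : Sg n ==> Proj_open S Sg {P \<in> Proj S Sg. f \<notin> P}"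
 unfolding Proj_open_def by (rule exI[of _ "{f}"]) auto

lemma Proj_open_subset: "Proj_open S Sg U ==> P : U ==> P : Proj S Sg"
 by (auto simp: Proj_open_def)

lemma section_at:
 assumes "s : sections S Sg F Fg d U" "P : U"
 obtains m f where "valid_frac Sg Fg d P m f" "s P = hfrac Sg F Fg d P m f"
proof -
 obtain V n f m where "P : V" "f : Sg n" "m : Fg (int n + d)"
  "\<forall>Q\<in>V. f \<notin> Q \<and> s Q = hfrac Sg F Fg d Q m f"
  using assms unfolding sections_def by blast
 then show thesis by (intro that[of m f]) (auto simp: valid_frac_def)
qed

lemma frac_section:
 assumes "Proj_open S Sg V" "f : Sg n" "m : Fg (int n + d)" "!!Q. Q : V ==> f \<notin> Q"
 shows "(\<lambda>Q\<in>V. hfrac Sg F Fg d Q m f) : sections S Sg F Fg d V"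
proof -
 have "\<exists>n. \<exists>f'\<in>Sg n. \<exists>m'\<in>Fg (int n + d). \<forall>Q\<in>V. f' \<notin> Q \<and> (\<lambda>Q\<in>V. hfrac Sg F Fg d Q m f) Q = hfrac Sg F Fg d Q m' f'"
  by (rule exI[of _ n], rule bexI[of _ f], rule bexI[of _ m]) (use assms in auto)
 then show ?thesis using assms(1) unfolding sections_def by blast
qed

end

locale graded_operator = graded_module S F Sg Fg
 for S :: "('s, 'x) ring_scheme" and F :: "('s, 'f) module" (structure) and Sg Fg +
 fixes T :: "'f => 'f" and e :: nat
 assumes T_additive: "additive F F T"
  and T_smult: "a : carrier S ==> x : carrier F ==> T (a \<odot> x) = a \<odot> T x"
  and T_degree: "x : Fg i ==> T x : Fg (i + int e)"
begin

lemma T_closed [simp]: "x : carrier F ==> T x : carrier F"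
 using T_additive by (auto simp: additive_def)

lemma T_add: "x : carrier F ==> y : carrier F ==> T (x \<oplus> y) = T x \<oplus> T y"
 using T_additive by (auto simp: additive_def)

lemma T_pow_closed [simp]: "x : carrier F ==> (T ^^ j) x : carrier F"
 by (induction j) auto

lemma T_pow_add: "x : carrier F ==> y : carrier F ==> (T ^^ j) (x \<oplus> y) = (T ^^ j) x \<oplus> (T ^^ j) y"
 by (induction j) (auto simp: T_add)

lemma T_pow_additive: "additive F F (T ^^ j)"
 by (auto simp: additive_def T_pow_add)

lemma T_zero [simp]: "T \<zero> = \<zero>"
 using additive_zero[OF M.ag M.ag T_additive] .

lemma T_pow_zero [simp]: "(T ^^ j) \<zero> = \<zero>"
 by (induction j) auto

lemma T_diff: "x : carrier F ==> y : carrier F ==> T (x \<ominus> y) = T x \<ominus> T y"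
 using additive_diff[OF M.ag M.ag T_additive] .

lemma T_pow_diff: "x : carrier F ==> y : carrier F ==> (T ^^ j) (x \<ominus> y) = (T ^^ j) x \<ominus> (T ^^ j) y"
 using additive_diff[OF M.ag M.ag T_pow_additive] .

lemma T_pow_smult: "a : carrier S ==> x : carrier F ==> (T ^^ j) (a \<odot> x) = a \<odot> (T ^^ j) x"
 by (induction j) (auto simp: T_smult)

lemma T_pow_degree: "x : Fg i ==> l = i + int (j * e) ==> (T ^^ j) x : Fg l"
proof (induction j arbitrary: l)
 case (Suc j)
 then show ?case using T_degree[of "(T ^^ j) x" "i + int (j * e)"] by (simp add: algebra_simps)
qed simp

end

locale graded_operator_at = graded_operator S F Sg Fg T e + graded_module_at S F Sg Fg P
 for S :: "('s, 'x) ring_scheme" and F :: "('s, 'f) module" (structure) and Sg Fg T e P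
begin

lemma valid_T: "valid d m f ==> d' = d + int e ==> valid d' (T m) f"
 unfolding valid_frac_def using T_degree by (auto simp: algebra_simps) (metis add.assoc)

lemma T_hfrac:
 assumes v: "valid d m f" and d': "d' = d + int e"
 shows "(\<Union>(m', f')\<in>germ d m f. germ d' (T m') f') = germ d' (T m) f"
proof -
 note [simp] = valid_closed[OF v]
 have "germ d' (T m') f' = germ d' (T m) f" if mem: "(m', f') : germ d m f" for m' f'
 proof -
  note v' = hfrac_mem_eq(1)[OF v mem]
  note [simp] = valid_closed[OF v']
  obtain n h where h: "h : Sg n - P" "h \<odot> (f' \<odot> m) = h \<odot> (f \<odot> m')"
   using mem hfrac_mem[of m f m' f' d] by auto
  have [simp]: "h : carrier S" using h(1) by auto
  from h have "T (h \<odot> (f' \<odot> m)) = T (h \<odot> (f \<odot> m'))" by simp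
  then have "h \<odot> (f \<odot> T m') = h \<odot> (f' \<odot> T m)"
   using h(1) by (simp add: T_smult)
  then show ?thesis using h(1) valid_T[OF v d'] valid_T[OF v' d'] by (intro hfrac_eqI) auto
 qed
 then show ?thesis using hfrac_self[OF v] by blast
qed

lemma induced_map_at:
 assumes "valid d m f" "d' = d + int e" "P : U" "s P = germ d m f"
 shows "induced_map Sg F Fg T d' U s P = germ d' (T m) f"
 using T_hfrac[OF assms(1,2)] assms(3,4) by (simp add: induced_map_def)

lemma valid_T_pow: "valid d m f ==> d' = d + int (j * e) ==> valid d' ((T ^^ j) m) f"
 unfolding valid_frac_def using T_pow_degree by (metis add.assoc)

lemma induced_pow_at:
 assumes "valid d m f" "P : U" "s P = germ d m f"
 shows "induced_pow Sg F Fg T (int e) d U j s P = germ (d + int (j * e)) ((T ^^ j) m) f"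
proof (induction j)
 case 0 then show ?case using assms by simp
next
 case (Suc j)
 then show ?case
  using induced_map_at[OF valid_T_pow[OF assms(1) refl], of "d + int (Suc j) * int e" j U] assms(2)
  by (simp add: algebra_simps)
qed

definition image_stalk :: "nat => ('f \<times> 's) set set" where
 "image_stalk j = {germ 0 ((T ^^ j) z) f | z f. valid (- (int j * int e)) z f}"

lemma zero_in_image_stalk: "germ 0 \<zero> \<one>\<^sub>S : image_stalk j"
 unfolding image_stalk_def using valid_zero[of "- (int j * int e)"] T_pow_zero[of j] by force

lemma coset_image_stalk:
 assumes v: "valid 0 m f"
 shows "add_germs (germ 0 m f) ` image_stalk j = image_stalk j \<longleftrightarrow>
   germ 0 m f : image_stalk j"
proof
 assume *: "add_germs (germ 0 m f) ` image_stalk j = image_stalk j"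
 note [simp] = valid_closed[OF v]
 have "add_germs (germ 0 m f) (germ 0 \<zero> \<one>\<^sub>S) = germ 0 m f"
  by (simp add: stalk_add_hfrac[OF v valid_zero])
 then show "germ 0 m f : image_stalk j" using * zero_in_image_stalk[of j] by force
next
 assume "germ 0 m f : image_stalk j"
 then obtain z g where z: "valid (- (int j * int e)) z g"
  and eq: "germ 0 m f = germ 0 ((T ^^ j) z) g"
  by (auto simp: image_stalk_def)
 note [simp] = valid_closed[OF z]
 have vz: "valid 0 ((T ^^ j) z) g" using valid_T_pow[OF z, of 0 j] by simp
 have comb: "valid (- (int j * int e)) (a \<odot> x \<oplus> b \<odot> y) (c \<otimes>\<^sub>S c')"
  if "x : Fg (int n + - (int j * int e))" "y : Fg (int n' + - (int j * int e))"
   "c : Sg n - P" "c' : Sg n' - P" "a : Sg n'" "b : Sg n" for a x b y c c' n n'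
  unfolding valid_frac_def
 proof (intro exI[of _ "n + n'"] conjI)
  show "c \<otimes>\<^sub>S c' : Sg (n + n') - P" using that by (intro prod_notin) auto
  show "a \<odot> x \<oplus> b \<odot> y : Fg (int (n + n') + - (int j * int e))"
   using that by (auto intro!: Fg_add Fg_smult')
 qed
 show "add_germs (germ 0 m f) ` image_stalk j = image_stalk j"
  unfolding eq
 proof (intro Set.set_eqI iffI)
  fix b assume "b : add_germs (germ 0 ((T ^^ j) z) g) ` image_stalk j"
  then obtain w h where w: "valid (- (int j * int e)) w h"
   and b: "b = add_germs (germ 0 ((T ^^ j) z) g) (germ 0 ((T ^^ j) w) h)"
   by (auto simp: image_stalk_def)
  note [simp] = valid_closed[OF w]
  have vw: "valid 0 ((T ^^ j) w) h" using valid_T_pow[OF w, of 0 j] by simp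
  have "b = germ 0 ((T ^^ j) (h \<odot> z \<oplus> g \<odot> w)) (g \<otimes>\<^sub>S h)"
   unfolding b stalk_add_hfrac[OF vz vw] by (simp add: T_pow_add T_pow_smult)
  moreover have "valid (- (int j * int e)) (h \<odot> z \<oplus> g \<odot> w) (g \<otimes>\<^sub>S h)"
   using z w comb[of z _ w _ g h h g] by (auto simp: valid_frac_def)
  ultimately show "b : image_stalk j" unfolding image_stalk_def by blast
 next
  fix b assume "b : image_stalk j"
  then obtain w h where w: "valid (- (int j * int e)) w h"
   and b: "b = germ 0 ((T ^^ j) w) h"
   by (auto simp: image_stalk_def)
  note [simp] = valid_closed[OF w]
  have vw: "valid 0 ((T ^^ j) w) h" using valid_T_pow[OF w, of 0 j] by simp
  \<comment> \<open>the difference of \<open>b\<close> and the given element is again an image\<close>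
  let ?u = "g \<odot> w \<ominus> h \<odot> z"
  obtain n n' where n: "h : Sg n" "w : Fg (int n + - (int j * int e))"
    "g : Sg n'" "z : Fg (int n' + - (int j * int e))"
   using z w by (auto simp: valid_frac_def)
  have u: "valid (- (int j * int e)) ?u (h \<otimes>\<^sub>S g)"
   using n comb[of w n "\<ominus> z" n' h g g h] Fg_minus[OF n(4)]
   by (simp add: M.minus_eq smult_r_minus)
  have vu: "valid 0 ((T ^^ j) ?u) (h \<otimes>\<^sub>S g)" using valid_T_pow[OF u, of 0 j] by simp
  have "add_germs (germ 0 ((T ^^ j) z) g) (germ 0 ((T ^^ j) ?u) (h \<otimes>\<^sub>S g))
    = germ 0 (((h \<otimes>\<^sub>S g) \<odot> (T ^^ j) z) \<oplus> (g \<odot> (T ^^ j) ?u)) (g \<otimes>\<^sub>S (h \<otimes>\<^sub>S g))"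
   by (rule stalk_add_hfrac[OF vz vu])
  also have "... = b"
   unfolding b
  proof (rule hfrac_eqI[OF valid_add[OF vz vu] vw, of "\<one>\<^sub>S" 0])
   show "\<one>\<^sub>S : Sg 0 - P" using Sg_one one_notin by simp
   have "((h \<otimes>\<^sub>S g) \<odot> (T ^^ j) z) \<oplus> (g \<odot> (T ^^ j) ?u) = g \<odot> (g \<odot> (T ^^ j) w)"
   proof -
    have "g \<odot> (T ^^ j) ?u = g \<odot> (g \<odot> (T ^^ j) w) \<ominus> (h \<otimes>\<^sub>S g) \<odot> (T ^^ j) z"
     by (simp add: T_pow_diff T_pow_smult smult_diff smult_assoc1[symmetric] R.m_comm)
    then show ?thesis by (simp add: M.minus_eq M.a_lcomm M.r_neg)
   qed
   then show "\<one>\<^sub>S \<odot> (h \<odot> (((h \<otimes>\<^sub>S g) \<odot> (T ^^ j) z) \<oplus> (g \<odot> (T ^^ j) ?u))) =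
     \<one>\<^sub>S \<odot> ((g \<otimes>\<^sub>S (h \<otimes>\<^sub>S g)) \<odot> (T ^^ j) w)"
    by (simp add: smult_assoc1[symmetric] R.m_ac)
  qed
  finally show "b : add_germs (germ 0 ((T ^^ j) z) g) ` image_stalk j"
   using u unfolding image_stalk_def by (metis (mono_tags, lifting) image_eqI mem_Collect_eq)
 qed
qed

lemma sub_stalk_image:
 assumes P: "P : Proj S Sg"
 shows "sub_stalk S Sg (image_sections S Sg F Fg T (int e) j) P = image_stalk j"
proof (intro Set.set_eqI iffI)
 fix b assume "b : sub_stalk S Sg (image_sections S Sg F Fg T (int e) j) P"
 then obtain s V where V: "b = s P" "P : V" "s : image_sections S Sg F Fg T (int e) j V"
  by (auto simp: sub_stalk_def)
 then obtain W t where W: "P : W" "t : sections S Sg F Fg (- (int j * int e)) W"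
   "restrict s W = induced_pow Sg F Fg T (int e) (- (int j * int e)) W j t"
  by (auto simp: image_sections_def)
 obtain z f where z: "valid (- (int j * int e)) z f" "t P = germ (- (int j * int e)) z f"
  using section_at[OF W(2,1)] .
 have "b = (restrict s W) P" using V(1) W(1) by simp
 also have "... = germ 0 ((T ^^ j) z) f"
  using induced_pow_at[of _ z f W t j, OF z(1) W(1) z(2)] unfolding W(3) by simp
 finally show "b : image_stalk j" using z(1) unfolding image_stalk_def by blast
next
 fix b assume "b : image_stalk j"
 then obtain z f where z: "valid (- (int j * int e)) z f"
   and b: "b = germ 0 ((T ^^ j) z) f"
  by (auto simp: image_stalk_def)
 obtain n where n: "f : Sg n" "f \<notin> P" "z : Fg (int n + - (int j * int e))"
  using z by (auto simp: valid_frac_def)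
 let ?V = "{Q \<in> Proj S Sg. f \<notin> Q}"
 let ?t = "\<lambda>Q\<in>?V. hfrac Sg F Fg (- (int j * int e)) Q z f"
 let ?s = "\<lambda>Q\<in>?V. hfrac Sg F Fg 0 Q ((T ^^ j) z) f"
 have V: "Proj_open S Sg ?V" "P : ?V" using n P by (auto intro: Proj_open_D)
 have t: "?t : sections S Sg F Fg (- (int j * int e)) ?V"
  using n by (intro frac_section[OF V(1)]) auto
 have s: "?s : sections S Sg F Fg 0 ?V"
  using n by (intro frac_section[OF V(1)]) (auto intro: T_pow_degree)
 have ext: "induced_pow Sg F Fg T (int e) d ?V j u : extensional ?V"
  if "u : extensional ?V" for u d
  using that by (cases j) (auto simp: induced_map_def)
 have "restrict ?s ?V = induced_pow Sg F Fg T (int e) (- (int j * int e)) ?V j ?t"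
 proof (rule extensionalityI[of _ ?V])
  show "induced_pow Sg F Fg T (int e) (- (int j * int e)) ?V j ?t : extensional ?V"
   by (rule ext) auto
  fix Q assume Q: "Q : ?V"
  then interpret Q: graded_operator_at S F Sg Fg T e Q
   by (intro graded_operator_at.intro graded_operator_axioms at_point) auto
  have "valid_frac Sg Fg (- (int j * int e)) Q z f" using n Q by (auto simp: valid_frac_def)
  then show "restrict ?s ?V Q = induced_pow Sg F Fg T (int e) (- (int j * int e)) ?V j ?t Q"
   using Q.induced_pow_at[of "- (int j * int e)" z f ?V ?t j] Q by simp
 qed auto
 then have "?s : image_sections S Sg F Fg T (int e) j ?V"
  using s t V(1) unfolding image_sections_def by blast
 then show "b : sub_stalk S Sg (image_sections S Sg F Fg T (int e) j) P"
  unfolding sub_stalk_def using V b by (auto intro!: exI[of _ ?s])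
qed

end

context graded_operator
begin

lemma op_at: "P : Proj S Sg ==> graded_operator_at S F Sg Fg T e P"
 by (intro graded_operator_at.intro graded_operator_axioms at_point)

definition stalk_exact :: "nat => 's set => bool" where
 "stalk_exact j P \<longleftrightarrow> (\<forall>m f. valid_frac Sg Fg 0 P m f \<and> T m = \<zero> \<longrightarrow>
   (\<exists>z g. valid_frac Sg Fg (- (int j * int e)) P z g \<and>
    hfrac Sg F Fg 0 P m f = hfrac Sg F Fg 0 P ((T ^^ j) z) g))"

lemma kernel_section_in_stalk:
 assumes ex: "stalk_exact j P" and P: "P : U" "Proj_open S Sg U"
  and s: "s : kernel_sections S Sg F Fg T (int e) U"
 obtains m f where "valid_frac Sg Fg 0 P m f" "s P = hfrac Sg F Fg 0 P m f"
  "s P : graded_operator_at.image_stalk F Sg Fg T e P j"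
proof -
 interpret graded_operator_at S F Sg Fg T e P using P by (intro op_at Proj_open_subset)
 have s': "s : sections S Sg F Fg 0 U" "induced_map Sg F Fg T (int e) U s = zero_section S Sg F Fg (int e) U"
  using s by (auto simp: kernel_sections_def)
 obtain m f where v: "valid_frac Sg Fg 0 P m f" "s P = hfrac Sg F Fg 0 P m f"
  using section_at[OF s'(1) P(1)] .
 note [simp] = valid_closed[OF v(1)]
 have "hfrac Sg F Fg (int e) P (T m) f = hfrac Sg F Fg (int e) P \<zero> \<one>\<^sub>S"
  using induced_map_at[OF v(1), of "int e" U s] v(2) s'(2) P(1) by (simp add: zero_section_def)
 from hfrac_eqD[OF valid_T[OF v(1)] valid_zero this]
 obtain n h where h: "h : Sg n - P" "h \<odot> T m = \<zero>" by auto
 have [simp]: "h : carrier S" using h(1) by auto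
 obtain l where l: "f : Sg l - P" "m : Fg (int l)" using v(1) by (auto simp: valid_frac_def)
 have vh: "valid_frac Sg Fg 0 P (h \<odot> m) (h \<otimes>\<^sub>S f)"
  unfolding valid_frac_def using h(1) l by (intro exI[of _ "n + l"] conjI prod_notin[OF h(1) l(1)] Fg_smult') auto
 have "hfrac Sg F Fg 0 P m f = hfrac Sg F Fg 0 P (h \<odot> m) (h \<otimes>\<^sub>S f)"
  by (rule hfrac_eqI[OF v(1) vh, of "\<one>\<^sub>S" 0])
   (use Sg_one one_notin in "auto simp: smult_assoc1[symmetric] R.m_ac")
 moreover have "T (h \<odot> m) = \<zero>" using h by (simp add: T_smult)
 ultimately have "s P : image_stalk j"
  using ex vh v(2) unfolding stalk_exact_def image_stalk_def mem_Collect_eq by metis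
 with v show thesis by (rule that)
qed

lemma zero_section_kernel:
 assumes U: "Proj_open S Sg U"
 shows "zero_section S Sg F Fg 0 U : kernel_sections S Sg F Fg T (int e) U"
 unfolding kernel_sections_def
proof (intro CollectI conjI)
 have P1: "\<one>\<^sub>S \<notin> Q" if "Q : U" for Q
  using primeideal.one_notin Proj_prime[OF Proj_open_subset[OF U that]] by blast
 show "zero_section S Sg F Fg 0 U : sections S Sg F Fg 0 U"
  unfolding zero_section_def by (rule frac_section[OF U Sg_one]) (auto simp: Fg_zero P1)
 show "induced_map Sg F Fg T (int e) U (zero_section S Sg F Fg 0 U) = zero_section S Sg F Fg (int e) U"
 proof (rule extensionalityI[of _ U])
  fix Q assume Q: "Q : U"
  interpret Q: graded_operator_at S F Sg Fg T e Q using U Q by (intro op_at Proj_open_subset)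
  show "induced_map Sg F Fg T (int e) U (zero_section S Sg F Fg 0 U) Q = zero_section S Sg F Fg (int e) U Q"
   using Q.induced_map_at[OF Q.valid_zero, of "int e" 0 U "zero_section S Sg F Fg 0 U"] Q
   by (simp add: zero_section_def)
 qed (auto simp: induced_map_def zero_section_def)
qed

text \<open>
 A quotient of subsheaves is zero exactly if its stalks are; a single section of the kernel sheaf
 through a given germ detects the stalk.
\<close>

lemma quotient_sheaf_zero_iff:
 "quotient_sheaf_zero S Sg F Fg (kernel_sections S Sg F Fg T (int e)) (image_sections S Sg F Fg T (int e) j)
   \<longleftrightarrow> (\<forall>P\<in>Proj S Sg. stalk_exact j P)"
  (is "quotient_sheaf_zero S Sg F Fg ?K ?B \<longleftrightarrow> _")
proof
 assume zero: "quotient_sheaf_zero S Sg F Fg ?K ?B"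
 show "\<forall>P\<in>Proj S Sg. stalk_exact j P"
  unfolding stalk_exact_def
 proof (intro ballI allI impI)
  fix P m f assume P: "P : Proj S Sg" and m: "valid_frac Sg Fg 0 P m f \<and> T m = \<zero>"
  interpret graded_operator_at S F Sg Fg T e P using P by (rule op_at)
  obtain n where n: "f : Sg n" "f \<notin> P" "m : Fg (int n)" using m by (auto simp: valid_frac_def)
  let ?V = "{Q \<in> Proj S Sg. f \<notin> Q}"
  let ?s = "\<lambda>Q\<in>?V. hfrac Sg F Fg 0 Q m f"
  have V: "Proj_open S Sg ?V" "P : ?V" using n P by (auto intro: Proj_open_D)
  have s: "?s : sections S Sg F Fg 0 ?V"
   using n by (intro frac_section[OF V(1)]) auto
  have "induced_map Sg F Fg T (int e) ?V ?s = zero_section S Sg F Fg (int e) ?V"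
  proof (rule extensionalityI[of _ ?V])
   fix Q assume Q: "Q : ?V"
   then interpret Q: graded_operator_at S F Sg Fg T e Q by (intro op_at) auto
   have vQ: "valid_frac Sg Fg 0 Q m f" using n Q by (auto simp: valid_frac_def)
   have "hfrac Sg F Fg (int e) Q (T m) f = hfrac Sg F Fg (int e) Q \<zero> \<one>\<^sub>S"
    by (rule Q.hfrac_eqI[OF Q.valid_T[OF vQ] Q.valid_zero, of _ "\<one>\<^sub>S" 0])
     (use Sg_one Q.one_notin m n in auto)
   then show "induced_map Sg F Fg T (int e) ?V ?s Q = zero_section S Sg F Fg (int e) ?V Q"
    using Q.induced_map_at[OF vQ, of "int e" ?V ?s] Q by (simp add: zero_section_def)
  qed (auto simp: induced_map_def zero_section_def)
  with s have sK: "?s : ?K ?V" by (simp add: kernel_sections_def)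
  let ?\<sigma> = "\<lambda>Q\<in>?V. stalk_add S Sg F Fg 0 Q (?s Q) ` sub_stalk S Sg ?B Q"
  have "?\<sigma> : quotient_sections S Sg F Fg ?K ?B ?V"
   unfolding quotient_sections_def
  proof (intro CollectI conjI ballI)
   fix Q assume "Q : ?V"
   then show "\<exists>W. Proj_open S Sg W \<and> Q : W \<and> W \<subseteq> ?V \<and>
    (\<exists>t\<in>?K W. \<forall>Q\<in>W. ?\<sigma> Q = stalk_add S Sg F Fg 0 Q (t Q) ` sub_stalk S Sg ?B Q)"
    using V(1) sK by (intro exI[of _ ?V] conjI bexI[of _ ?s]) auto
  qed auto
  then have "?\<sigma> = restrict (sub_stalk S Sg ?B) ?V"
   using zero V(1) unfolding quotient_sheaf_zero_def by blast
  then have "?\<sigma> P = restrict (sub_stalk S Sg ?B) ?V P" by simp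
  then have "stalk_add S Sg F Fg 0 P (hfrac Sg F Fg 0 P m f) ` image_stalk j = image_stalk j"
   using V(2) sub_stalk_image[OF P, of j] by simp
  then have "hfrac Sg F Fg 0 P m f : image_stalk j" using coset_image_stalk m by blast
  then show "\<exists>z g. valid_frac Sg Fg (- (int j * int e)) P z g \<and>
    hfrac Sg F Fg 0 P m f = hfrac Sg F Fg 0 P ((T ^^ j) z) g"
   unfolding image_stalk_def by blast
 qed
next
 assume exact: "\<forall>P\<in>Proj S Sg. stalk_exact j P"
 have coset: "stalk_add S Sg F Fg 0 P (s P) ` sub_stalk S Sg ?B P = sub_stalk S Sg ?B P"
  if U: "Proj_open S Sg U" "P : U" "s : ?K U" for U P s
 proof -
  have P: "P : Proj S Sg" using U Proj_open_subset by blast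
  interpret graded_operator_at S F Sg Fg T e P using P by (rule op_at)
  obtain m f where "valid_frac Sg Fg 0 P m f" "s P = hfrac Sg F Fg 0 P m f" "s P : image_stalk j"
   using kernel_section_in_stalk[OF _ U(2,1,3)] exact P by blast
  then show ?thesis using coset_image_stalk[of m f j] sub_stalk_image[OF P, of j] by simp
 qed
 show "quotient_sheaf_zero S Sg F Fg ?K ?B"
  unfolding quotient_sheaf_zero_def
 proof (intro allI impI)
  fix U assume U: "Proj_open S Sg U"
  have "\<sigma> = restrict (sub_stalk S Sg ?B) U" if \<sigma>: "\<sigma> : quotient_sections S Sg F Fg ?K ?B U" for \<sigma>
  proof (rule extensionalityI[of _ U])
   fix P assume P: "P : U"
   then obtain V t where V: "Proj_open S Sg V" "P : V" "t : ?K V"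
    and "\<forall>Q\<in>V. \<sigma> Q = stalk_add S Sg F Fg 0 Q (t Q) ` sub_stalk S Sg ?B Q"
    using \<sigma> unfolding quotient_sections_def by blast
   then show "\<sigma> P = restrict (sub_stalk S Sg ?B) U P" using coset[OF V] P by simp
  qed (use \<sigma> in "auto simp: quotient_sections_def")
  moreover have "restrict (sub_stalk S Sg ?B) U : quotient_sections S Sg F Fg ?K ?B U"
   unfolding quotient_sections_def
  proof (intro CollectI conjI ballI)
   fix P assume P: "P : U"
   have "\<forall>Q\<in>U. restrict (sub_stalk S Sg ?B) U Q =
     stalk_add S Sg F Fg 0 Q (zero_section S Sg F Fg 0 U Q) ` sub_stalk S Sg ?B Q"
    using coset[OF U _ zero_section_kernel[OF U]] by simp
   then show "\<exists>V. Proj_open S Sg V \<and> P : V \<and> V \<subseteq> U \<and> (\<exists>t\<in>?K V. \<forall>Q\<in>V.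
     restrict (sub_stalk S Sg ?B) U Q = stalk_add S Sg F Fg 0 Q (t Q) ` sub_stalk S Sg ?B Q)"
    using U P zero_section_kernel[OF U] by blast
  qed auto
  ultimately show "quotient_sections S Sg F Fg ?K ?B U = {restrict (sub_stalk S Sg ?B) U}" by blast
 qed
qed

text \<open>
 Exactness at \<open>P\<close> without fractions. A fraction of degree \<open>0\<close> can be expanded until numerator and
 denominator have degrees divisible by \<open>e\<close>, and \<open>T^j\<close> raises degrees by \<open>j e\<close>, so only these degrees
 occur. Deriving this condition from exactness of the stalk takes an element of degree \<open>e\<close> outside \<open>P\<close>.
\<close>

definition acyclic_at :: "nat => 's set => bool" where
 "acyclic_at j P \<longleftrightarrow> (\<forall>n. \<forall>y\<in>Fg (int (n * e)). T y = \<zero> \<longrightarrow>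
   (\<exists>m k. \<exists>d\<in>Sg (m * e) - P. \<exists>z\<in>Fg (int (k * e)). k + j = m + n \<and> d \<odot> y = (T ^^ j) z))"

end

context graded_operator_at
begin

lemma pow_notin: "a : Sg m - P ==> l = n * m ==> a [^]\<^sub>S (n::nat) : Sg l - P"
 using Sg_pow[of a m n] notin_pow[of a n] by auto

lemma acyclic_imp_stalk_exact:
 assumes "acyclic_at j P" and e: "e > 0"
 shows "stalk_exact j P"
 unfolding stalk_exact_def
proof (intro allI impI)
 fix y f assume y: "valid 0 y f \<and> T y = \<zero>"
 obtain n where n: "f : Sg n - P" "y : Fg (int n)" using y by (auto simp: valid_frac_def)
 let ?a = "f [^]\<^sub>S (e - 1)"
 have a: "?a : Sg ((e - 1) * n) - P" using n by (intro pow_notin) auto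
 have [simp]: "f : carrier S" "y : carrier F" using n by auto
 have fa: "f \<otimes>\<^sub>S ?a = f [^]\<^sub>S e"
  using e R.nat_pow_Suc2[of f "e - 1"] by simp
 have en: "(e - 1) * n + n = n * e" using e by (cases e) (auto simp: algebra_simps)
 have "?a \<odot> y : Fg (int (n * e))" using a n by (intro Fg_smult'[of _ "(e - 1) * n"]) (auto simp: en[symmetric])
 moreover have "T (?a \<odot> y) = \<zero>" using y by (simp add: T_smult)
 ultimately obtain m k d z where d: "d : Sg (m * e) - P" and z: "z : Fg (int (k * e))" and k: "k + j = m + n"
   and eq: "d \<odot> (?a \<odot> y) = (T ^^ j) z"
  using assms(1) unfolding acyclic_at_def by blast
 have [simp]: "d : carrier S" "z : carrier F" using d z by auto
 let ?g = "d \<otimes>\<^sub>S f [^]\<^sub>S e"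
 have g: "?g : Sg ((m + n) * e) - P"
  by (rule prod_notin[OF d pow_notin[OF n(1) refl]]) (simp add: algebra_simps)
 have "valid (- (int j * int e)) z ?g"
  unfolding valid_frac_def using g z k[symmetric] by (intro exI[of _ "(m + n) * e"]) (simp add: algebra_simps)
 moreover from this have "valid 0 ((T ^^ j) z) ?g" using valid_T_pow[of _ z ?g 0 j] by simp
 then have "germ 0 y f = germ 0 ((T ^^ j) z) ?g"
  using y Sg_one one_notin unfolding eq[symmetric]
  by (intro hfrac_eqI[of _ _ _ _ _ "\<one>\<^sub>S" 0]) (auto simp: smult_assoc1[symmetric] R.m_ac fa[symmetric])
 ultimately show "\<exists>z g. valid (- (int j * int e)) z g \<and>
    germ 0 y f = germ 0 ((T ^^ j) z) g" by blast
qed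

lemma stalk_exact_imp_acyclic:
 assumes ex: "stalk_exact j P" and e: "e > 0" and g: "g : Sg e - P"
 shows "acyclic_at j P"
 unfolding acyclic_at_def
proof (intro allI ballI impI)
 fix n y assume y: "y : Fg (int (n * e))" "T y = \<zero>"
 have [simp]: "y : carrier F" "g : carrier S" using y g by auto
 have f: "g [^]\<^sub>S n : Sg (n * e) - P" by (rule pow_notin[OF g refl])
 have vy: "valid 0 y (g [^]\<^sub>S n)" using y f unfolding valid_frac_def by auto
 then obtain z f' where z: "valid (- (int j * int e)) z f'"
   and eq: "germ 0 y (g [^]\<^sub>S n) = germ 0 ((T ^^ j) z) f'"
  using ex y unfolding stalk_exact_def by blast
 note [simp] = valid_closed[OF z]
 have vz: "valid 0 ((T ^^ j) z) f'" using valid_T_pow[OF z, of 0 j] by simp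
 obtain l h where h: "h : Sg l - P"
   and eq': "h \<odot> (f' \<odot> y) = h \<odot> (g [^]\<^sub>S n \<odot> (T ^^ j) z)"
  using hfrac_eqD[OF vy vz eq] by blast
 obtain n' where n': "f' : Sg n' - P" "z : Fg (int n' + - (int j * int e))"
  using z by (auto simp: valid_frac_def)
 have [simp]: "h : carrier S" using h by auto
 \<comment> \<open>multiply by further elements outside \<open>P\<close> to make all degrees nonnegative multiples of \<open>e\<close>\<close>
 let ?d = "h \<otimes>\<^sub>S f'"
 have d: "?d : Sg (l + n') - P" by (rule prod_notin[OF h n'(1) refl])
 let ?a = "?d [^]\<^sub>S (e - 1) \<otimes>\<^sub>S g [^]\<^sub>S j"
 have a: "?a : Sg ((e - 1) * (l + n') + j * e) - P"
  by (rule prod_notin[OF pow_notin[OF d refl] pow_notin[OF g refl] refl])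
 let ?z = "(?a \<otimes>\<^sub>S h \<otimes>\<^sub>S g [^]\<^sub>S n) \<odot> z"
 have e': "int (e - Suc 0) = int e - 1" "real e = 1 + real (e - 1)" using e by auto
 have D: "?a \<otimes>\<^sub>S ?d : Sg ((l + n' + j) * e) - P"
  by (rule prod_notin[OF a d]) (use e in "cases e; simp add: algebra_simps")
 have C: "?a \<otimes>\<^sub>S h \<otimes>\<^sub>S g [^]\<^sub>S n : Sg ((e - 1) * (l + n') + j * e + l + n * e)"
  using prod_notin[OF prod_notin[OF a h refl] f refl] by simp
 have Z: "?z : Fg (int ((l + n' + n) * e))"
  by (rule Fg_smult'[OF C n'(2)]) (use e in "cases e; simp add: algebra_simps")
 have [simp]: "?a : carrier S" by simp
 have "(?a \<otimes>\<^sub>S ?d) \<odot> y = ?a \<odot> (h \<odot> (f' \<odot> y))"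
  by (simp add: smult_assoc1 del: R.nat_pow_mult)
 also have "... = (T ^^ j) ?z"
  unfolding eq' by (simp add: smult_assoc1 T_pow_smult)
 finally show "\<exists>m k. \<exists>d\<in>Sg (m * e) - P. \<exists>z\<in>Fg (int (k * e)). k + j = m + n \<and> d \<odot> y = (T ^^ j) z"
  using D Z by (intro exI[of _ "l + n' + j"] exI[of _ "l + n' + n"] bexI[of _ "?a \<otimes>\<^sub>S ?d"] bexI[of _ ?z]) auto
qed

text \<open>
 If \<open>ker T = im T^j\<close> for an operator with \<open>T^(j+1) = 0\<close>, then \<open>ker T^i = im T^(j+1-i)\<close> for all
 \<open>i\<close>: lift \<open>T^i y \<in> ker T\<close> and correct \<open>y\<close> by an element of \<open>im T^(j-i)\<close>.
\<close>

lemma acyclic_iterate: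
 assumes ac: "acyclic_at j P" and i: "1 \<le> i" "i \<le> j"
  and y: "y : Fg (int (n * e))" "(T ^^ i) y = \<zero>"
 shows "\<exists>m k. \<exists>d\<in>Sg (m * e) - P. \<exists>z\<in>Fg (int (k * e)). k + (j + 1 - i) = m + n \<and>
   d \<odot> y = (T ^^ (j + 1 - i)) z"
 using i y
proof (induction i arbitrary: n y rule: dec_induct)
 case base
 then show ?case using ac unfolding acyclic_at_def by simp
next
 case (step i)
 have [simp]: "y : carrier F" using step by auto
 have "(T ^^ i) y : Fg (int ((n + i) * e))"
  using step.prems(2) by (rule T_pow_degree) (simp add: algebra_simps)
 moreover have "T ((T ^^ i) y) = \<zero>" using step by simp
 ultimately obtain m k d z where d: "d : Sg (m * e) - P" and z: "z : Fg (int (k * e))"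
  and k: "k + j = m + (n + i)" and eq: "d \<odot> (T ^^ i) y = (T ^^ j) z"
  using ac unfolding acyclic_at_def by blast
 have [simp]: "d : carrier S" "z : carrier F" using d z by auto
 let ?u = "d \<odot> y \<ominus> (T ^^ (j - i)) z"
 have kk: "k + (j - i) = m + n" using k step by linarith
 have kk_e: "int ((m + n) * e) = int (k * e) + int ((j - i) * e)"
  unfolding kk[symmetric] by (simp add: algebra_simps)
 have u: "?u : Fg (int ((m + n) * e))"
 proof (intro Fg_diff)
  show "d \<odot> y : Fg (int ((m + n) * e))"
   using d by (intro Fg_smult'[OF _ step.prems(2)]) (auto simp: algebra_simps)
  show "(T ^^ (j - i)) z : Fg (int ((m + n) * e))"
   using kk_e by (rule T_pow_degree[OF z])
 qed
 have "(T ^^ i) ?u = d \<odot> (T ^^ i) y \<ominus> (T ^^ i) ((T ^^ (j - i)) z)"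
  by (simp add: T_pow_diff T_pow_smult)
 also have "(T ^^ i) ((T ^^ (j - i)) z) = (T ^^ j) z"
  using step by (simp add: funpow_add[symmetric, THEN fun_cong, simplified comp_def])
 finally have "(T ^^ i) ?u = \<zero>" by (simp add: eq M.diff_zero_eq)
 with u step obtain m' k' d' z' where d': "d' : Sg (m' * e) - P" and z': "z' : Fg (int (k' * e))"
  and k': "k' + (j + 1 - i) = m' + (m + n)" and eq': "d' \<odot> ?u = (T ^^ (j + 1 - i)) z'"
  by (metis Suc_leD)
 have [simp]: "d' : carrier S" "z' : carrier F" using d' z' by auto
 have kk': "k' + 1 = m' + k" using k' kk step by linarith
 let ?w = "d' \<odot> z \<oplus> T z'"
 have w: "?w : Fg (int ((m' + k) * e))"
  using d' z z' T_degree[OF z']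
  unfolding kk'[symmetric]
  by (intro Fg_add Fg_smult'[OF _ z, of d' "m' * e"]) (use arg_cong[OF kk', of "\<lambda>x. int (x * e)"] in "auto simp: algebra_simps")
 have "(T ^^ (j - i)) ?w = d' \<odot> (T ^^ (j - i)) z \<oplus> (T ^^ (j + 1 - i)) z'"
  using step by (simp add: T_pow_add T_pow_smult funpow_swap1 Suc_diff_le)
 also have "(T ^^ (j + 1 - i)) z' = d' \<odot> (d \<odot> y) \<ominus> d' \<odot> (T ^^ (j - i)) z"
  unfolding eq'[symmetric] by (simp add: smult_diff)
 finally have "(T ^^ (j - i)) ?w = (d' \<otimes>\<^sub>S d) \<odot> y"
  by (simp add: smult_assoc1 M.minus_eq M.a_lcomm M.r_neg)
 moreover have "d' \<otimes>\<^sub>S d : Sg ((m' + m) * e) - P"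
  by (rule prod_notin[OF d' d]) (simp add: algebra_simps)
 ultimately show ?case
  using w kk by (intro exI[of _ "m' + m"] exI[of _ "m' + k"] bexI[of _ "d' \<otimes>\<^sub>S d"] bexI[of _ ?w]) auto
qed

end

section \<open>Exactness in short exact sequences\<close>

definition graded_map :: "('s, 'x) ring_scheme => ('s, 'f) module => (int => 'f set) => ('f => 'f) =>
  ('s, 'g) module => (int => 'g set) => ('g => 'g) => ('f => 'g) => bool" where
 "graded_map S F Fg T F' Fg' T' \<phi> \<longleftrightarrow> additive F F' \<phi> \<and>
   (\<forall>a\<in>carrier S. \<forall>x\<in>carrier F. \<phi> (a \<odot>\<^sub>F x) = a \<odot>\<^sub>F' \<phi> x) \<and>
   (\<forall>i. \<forall>x\<in>Fg i. \<phi> x : Fg' i) \<and> (\<forall>x\<in>carrier F. \<phi> (T x) = T' (\<phi> x))"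

locale graded_map_at = F: graded_operator_at S F Sg Fg T e P + F': graded_operator_at S F' Sg Fg' T' e P
 for S :: "('s, 'x) ring_scheme" and F :: "('s, 'f) module" and Sg Fg T e P
  and F' :: "('s, 'g) module" and Fg' T' +
 fixes \<phi>
 assumes map: "graded_map S F Fg T F' Fg' T' \<phi>"
begin

lemma closed [simp]: "x : carrier F ==> \<phi> x : carrier F'"
 and add: "x : carrier F ==> y : carrier F ==> \<phi> (x \<oplus>\<^sub>F y) = \<phi> x \<oplus>\<^sub>F' \<phi> y"
 and smult: "a : carrier S ==> x : carrier F ==> \<phi> (a \<odot>\<^sub>F x) = a \<odot>\<^sub>F' \<phi> x"
 and degree: "x : Fg i ==> \<phi> x : Fg' i"
 and T: "x : carrier F ==> \<phi> (T x) = T' (\<phi> x)"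
 and diff: "x : carrier F ==> y : carrier F ==> \<phi> (x \<ominus>\<^sub>F y) = \<phi> x \<ominus>\<^sub>F' \<phi> y"
 and zero [simp]: "\<phi> \<zero>\<^sub>F = \<zero>\<^sub>F'"
 using map additive_diff[OF F.M.ag F'.M.ag, of \<phi> x y]
  additive_zero[OF F.M.ag F'.M.ag, of \<phi>]
 by (auto simp: graded_map_def additive_def)

lemma T_pow: "x : carrier F ==> \<phi> ((T ^^ j) x) = (T' ^^ j) (\<phi> x)"
 by (induction j) (auto simp: T)

end

text \<open>
 The factorization of \<open>id - \<beta> \<alpha>\<close> through an acyclic module passes exactness on from the middle
 module of \<open>\<beta> \<alpha>\<close>.
\<close>

lemma acyclic_retract:
 assumes "graded_map_at S F Sg Fg T e P F' Fg' T' \<alpha>" "graded_map_at S F' Sg Fg' T' e P F Fg T \<beta>"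
  and "graded_map_at S F Sg Fg T e P F'' Fg'' T'' a" "graded_map_at S F'' Sg Fg'' T'' e P F Fg T b"
  and eq: "!!y. y : carrier F ==> y = \<beta> (\<alpha> y) \<oplus>\<^sub>F b (a y)"
  and ac: "graded_operator.acyclic_at F' Sg Fg' T' e j P" "graded_operator.acyclic_at F'' Sg Fg'' T'' e j P"
 shows "graded_operator.acyclic_at F Sg Fg T e j P"
proof -
 interpret \<alpha>: graded_map_at S F Sg Fg T e P F' Fg' T' \<alpha> by fact
 interpret \<beta>: graded_map_at S F' Sg Fg' T' e P F Fg T \<beta> by fact
 interpret a: graded_map_at S F Sg Fg T e P F'' Fg'' T'' a by fact
 interpret b: graded_map_at S F'' Sg Fg'' T'' e P F Fg T b by fact
 show ?thesis unfolding \<alpha>.F.acyclic_at_def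
 proof (intro allI ballI impI)
  fix n y assume y: "y : Fg (int (n * e))" "T y = \<zero>\<^sub>F"
  have [simp]: "y : carrier F" using y by auto
  have "T' (\<alpha> y) = \<zero>\<^sub>F'" "T'' (a y) = \<zero>\<^sub>F''"
   using \<alpha>.T[of y] a.T[of y] y by auto
  with y \<alpha>.degree[OF y(1)] a.degree[OF y(1)] ac
  obtain m k d z m' k' d' z' where d: "d : Sg (m * e) - P" and z: "z : Fg' (int (k * e))" and k: "k + j = m + n"
    and eq1: "d \<odot>\<^sub>F' \<alpha> y = (T' ^^ j) z"
   and d': "d' : Sg (m' * e) - P" and z': "z' : Fg'' (int (k' * e))" and k': "k' + j = m' + n"
    and eq2: "d' \<odot>\<^sub>F'' a y = (T'' ^^ j) z'"
   unfolding \<alpha>.F'.acyclic_at_def a.F'.acyclic_at_def by metis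
  have [simp]: "d : carrier S" "d' : carrier S" "z : carrier F'" "z' : carrier F''" using d d' z z' by auto
  let ?z = "d' \<odot>\<^sub>F \<beta> z \<oplus>\<^sub>F d \<odot>\<^sub>F b z'"
  have "(d \<otimes>\<^sub>S d') \<odot>\<^sub>F y = (d \<otimes>\<^sub>S d') \<odot>\<^sub>F \<beta> (\<alpha> y) \<oplus>\<^sub>F (d \<otimes>\<^sub>S d') \<odot>\<^sub>F b (a y)"
   using eq[of y] by (metis \<alpha>.F.R.m_closed \<alpha>.F.smult_r_distr \<alpha>.closed \<beta>.closed \<open>d : carrier S\<close> \<open>d' : carrier S\<close> \<open>y : carrier F\<close> a.closed b.closed)
  also have "(d \<otimes>\<^sub>S d') \<odot>\<^sub>F \<beta> (\<alpha> y) = d' \<odot>\<^sub>F \<beta> (d \<odot>\<^sub>F' \<alpha> y)"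
   by (simp add: \<beta>.smult \<alpha>.F.smult_assoc1 \<alpha>.F.smult_comm)
  also have "(d \<otimes>\<^sub>S d') \<odot>\<^sub>F b (a y) = d \<odot>\<^sub>F b (d' \<odot>\<^sub>F'' a y)"
   by (simp add: b.smult \<alpha>.F.smult_assoc1)
  also have "d' \<odot>\<^sub>F \<beta> (d \<odot>\<^sub>F' \<alpha> y) \<oplus>\<^sub>F d \<odot>\<^sub>F b (d' \<odot>\<^sub>F'' a y) = (T ^^ j) ?z"
   unfolding eq1 eq2 by (simp add: \<beta>.T_pow b.T_pow \<alpha>.F.T_pow_add \<alpha>.F.T_pow_smult)
  finally have "(d \<otimes>\<^sub>S d') \<odot>\<^sub>F y = (T ^^ j) ?z" .
  moreover have "d \<otimes>\<^sub>S d' : Sg ((m + m') * e) - P"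
   by (rule \<alpha>.F.prod_notin[OF d d']) (simp add: algebra_simps)
  moreover have "?z : Fg (int ((m' + k) * e))"
  proof (intro \<alpha>.F.Fg_add)
   show "d' \<odot>\<^sub>F \<beta> z : Fg (int ((m' + k) * e))"
    using d' by (intro \<alpha>.F.Fg_smult'[OF _ \<beta>.degree[OF z]]) (auto simp: algebra_simps)
   have "m' + k = m + k'" using k k' by linarith
   then show "d \<odot>\<^sub>F b z' : Fg (int ((m' + k) * e))"
    using d by (intro \<alpha>.F.Fg_smult'[OF _ b.degree[OF z']]) (auto simp: algebra_simps)
  qed
  ultimately show "\<exists>m k. \<exists>d\<in>Sg (m * e) - P. \<exists>z\<in>Fg (int (k * e)). k + j = m + n \<and> d \<odot>\<^sub>F y = (T ^^ j) z"
   using k by (intro exI[of _ "m + m'"] exI[of _ "m' + k"] bexI[of _ "d \<otimes>\<^sub>S d'"] bexI[of _ ?z]) auto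
 qed
qed

locale graded_exact_at = f: graded_map_at S N Sg Ng TN e P M Mg TM f + g: graded_map_at S M Sg Mg TM e P L Lg TL g
 for S :: "('s, 'x) ring_scheme" and N :: "('s, 'n) module" and Sg Ng TN e P
  and M :: "('s, 'm) module" and Mg TM f and L :: "('s, 'l) module" and Lg TL g +
 fixes j :: nat
 assumes surj: "y : Lg i ==> \<exists>x\<in>Mg i. g x = y"
  and exact: "x : Mg i ==> g x = \<zero>\<^sub>L ==> \<exists>w\<in>Ng i. f w = x"
  and inj: "w : carrier N ==> f w = \<zero>\<^sub>M ==> w = \<zero>\<^sub>N"
  and comp: "w : carrier N ==> g (f w) = \<zero>\<^sub>L"
  and nilpotent: "x : carrier M ==> (TM ^^ (j + 1)) x = \<zero>\<^sub>M"
begin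

lemma f_inj: "w : carrier N ==> w' : carrier N ==> f w = f w' ==> w = w'"
 using inj[of "w \<ominus>\<^sub>N w'"] by (simp add: f.diff f.F.M.diff_zero_eq f.F'.M.diff_zero_eq)

text \<open>
 Lift \<open>y \<in> ker T\<close> to \<open>m\<close>. Then \<open>T m\<close> comes from some \<open>w\<close> with \<open>T^j w = 0\<close>, so \<open>w \<in> im T\<close> up to scalars, and
 correcting the lift moves it into \<open>ker T = im T^j\<close>.
\<close>

lemma acyclic_quotient:
 assumes j: "j \<ge> 1" and N: "f.F.acyclic_at j P" and M: "f.F'.acyclic_at j P"
 shows "g.F'.acyclic_at j P"
 unfolding g.F'.acyclic_at_def
proof (intro allI ballI impI)
 fix n y assume y: "y : Lg (int (n * e))" "TL y = \<zero>\<^sub>L"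
 obtain m where m: "m : Mg (int (n * e))" "g m = y" using surj[OF y(1)] by blast
 have [simp]: "m : carrier M" "y : carrier L" using m y by auto
 have Tm: "TM m : Mg (int ((n + 1) * e))"
  using f.F'.T_degree[OF m(1)] by (simp add: algebra_simps)
 moreover have "g (TM m) = \<zero>\<^sub>L" using m y by (simp add: g.T)
 ultimately obtain w where w: "w : Ng (int ((n + 1) * e))" "f w = TM m" using exact by blast
 have [simp]: "w : carrier N" using w by auto
 have "f ((TN ^^ j) w) = \<zero>\<^sub>M"
  using nilpotent[of m] by (simp add: f.T_pow w(2) funpow_swap1)
 then have "(TN ^^ j) w = \<zero>\<^sub>N" by (intro inj) auto
 then obtain a k d w' where d: "d : Sg (a * e) - P" and w': "w' : Ng (int (k * e))" and k: "k + 1 = a + (n + 1)"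
   and eq: "d \<odot>\<^sub>N w = TN w'"
  using f.F.acyclic_iterate[OF N j order_refl w(1)] by auto
 have [simp]: "w' : carrier N" "d : carrier S" using w' d by auto
 let ?x = "d \<odot>\<^sub>M m \<ominus>\<^sub>M f w'"
 have x: "?x : Mg (int ((a + n) * e))"
 proof (intro f.F'.Fg_diff f.degree)
  show "d \<odot>\<^sub>M m : Mg (int ((a + n) * e))"
   using d by (intro f.F'.Fg_smult'[OF _ m(1)]) (auto simp: algebra_simps)
  have "k = a + n" using k by simp
  then show "w' : Ng (int ((a + n) * e))" using w' by simp
 qed
 have "TM ?x = d \<odot>\<^sub>M f w \<ominus>\<^sub>M f (TN w')"
  by (simp add: f.F'.T_diff f.F'.T_smult f.T w(2))
 then have "TM ?x = \<zero>\<^sub>M" unfolding eq[symmetric] by (simp add: f.smult f.F'.M.diff_zero_eq)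
 with x M obtain a' k' d' z where d': "d' : Sg (a' * e) - P" and z: "z : Mg (int (k' * e))"
   and k': "k' + j = a' + (a + n)" and eq': "d' \<odot>\<^sub>M ?x = (TM ^^ j) z"
  unfolding f.F'.acyclic_at_def by blast
 have [simp]: "z : carrier M" "d' : carrier S" using z d' by auto
 have "g ?x = d \<odot>\<^sub>L y" using m by (simp add: g.diff g.smult comp g.F'.M.minus_eq)
 then have "(d' \<otimes>\<^sub>S d) \<odot>\<^sub>L y = g (d' \<odot>\<^sub>M ?x)" using m by (auto simp: g.smult g.F'.smult_assoc1)
 then have "(d' \<otimes>\<^sub>S d) \<odot>\<^sub>L y = (TL ^^ j) (g z)" unfolding eq' by (simp add: g.T_pow)
 moreover have "d' \<otimes>\<^sub>S d : Sg ((a' + a) * e) - P"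
  by (rule f.F.prod_notin[OF d' d]) (simp add: algebra_simps)
 ultimately show "\<exists>m k. \<exists>d\<in>Sg (m * e) - P. \<exists>z\<in>Lg (int (k * e)). k + j = m + n \<and> d \<odot>\<^sub>L y = (TL ^^ j) z"
  using k' g.degree[OF z]
  by (intro exI[of _ "a' + a"] exI[of _ k'] bexI[of _ "d' \<otimes>\<^sub>S d"] bexI[of _ "g z"]) auto
qed

text \<open>
 For \<open>y \<in> ker T\<close> write \<open>f y = T^j z\<close> up to scalars. Then \<open>g z \<in> ker T^j = im T\<close>, and subtracting from \<open>z\<close> an
 element of \<open>im T\<close>, which \<open>T^j\<close> annihilates, moves it into the submodule.
\<close>

lemma acyclic_sub:
 assumes j: "j \<ge> 1" and M: "f.F'.acyclic_at j P" and L: "g.F'.acyclic_at j P"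
 shows "f.F.acyclic_at j P"
 unfolding f.F.acyclic_at_def
proof (intro allI ballI impI)
 fix n y assume y: "y : Ng (int (n * e))" "TN y = \<zero>\<^sub>N"
 have [simp]: "y : carrier N" using y by auto
 have "TM (f y) = \<zero>\<^sub>M" using f.T[of y] y by simp
 with f.degree[OF y(1)] M obtain a k d z where d: "d : Sg (a * e) - P" and z: "z : Mg (int (k * e))"
   and k: "k + j = a + n" and eq: "d \<odot>\<^sub>M f y = (TM ^^ j) z"
  unfolding f.F'.acyclic_at_def by blast
 have [simp]: "z : carrier M" "d : carrier S" using z d by auto
 have "(TL ^^ j) (g z) = g (d \<odot>\<^sub>M f y)" unfolding eq by (simp add: g.T_pow)
 then have "(TL ^^ j) (g z) = \<zero>\<^sub>L" by (simp add: g.smult comp)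
 then obtain a' k' d' l where d': "d' : Sg (a' * e) - P" and l: "l : Lg (int (k' * e))"
   and k': "k' + 1 = a' + k" and eq': "d' \<odot>\<^sub>L g z = TL l"
  using g.F'.acyclic_iterate[OF L j order_refl g.degree[OF z]] by auto
 have [simp]: "d' : carrier S" using d' by auto
 obtain m where m: "m : Mg (int (k' * e))" "g m = l" using surj[OF l] by blast
 have [simp]: "m : carrier M" "l : carrier L" using m l by auto
 let ?x = "d' \<odot>\<^sub>M z \<ominus>\<^sub>M TM m"
 have "?x : Mg (int ((a' + k) * e))"
 proof (intro f.F'.Fg_diff)
  show "d' \<odot>\<^sub>M z : Mg (int ((a' + k) * e))"
   using d' by (intro f.F'.Fg_smult'[OF _ z]) (auto simp: algebra_simps)
  show "TM m : Mg (int ((a' + k) * e))"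
   unfolding k'[symmetric] using f.F'.T_degree[OF m(1)] by (simp add: algebra_simps)
 qed
 moreover have "g ?x = \<zero>\<^sub>L" by (simp add: g.diff g.smult g.T m(2) eq' g.F'.M.diff_zero_eq)
 ultimately obtain w where w: "w : Ng (int ((a' + k) * e))" "f w = ?x" using exact by blast
 have [simp]: "w : carrier N" using w by auto
 have "f ((TN ^^ j) w) = (TM ^^ j) (d' \<odot>\<^sub>M z) \<ominus>\<^sub>M (TM ^^ j) (TM m)"
  by (simp add: f.T_pow w(2) f.F'.T_pow_diff)
 also have "(TM ^^ j) (TM m) = \<zero>\<^sub>M" using nilpotent[of m] by (simp add: funpow_swap1)
 also have "(TM ^^ j) (d' \<odot>\<^sub>M z) = f ((d' \<otimes>\<^sub>S d) \<odot>\<^sub>N y)"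
  by (simp add: f.F'.T_pow_smult f.smult f.F'.smult_assoc1 eq)
 finally have "f ((d' \<otimes>\<^sub>S d) \<odot>\<^sub>N y) = f ((TN ^^ j) w)" by (simp add: f.F'.M.minus_eq)
 then have "(d' \<otimes>\<^sub>S d) \<odot>\<^sub>N y = (TN ^^ j) w" by (intro f_inj) auto
 moreover have "d' \<otimes>\<^sub>S d : Sg ((a' + a) * e) - P"
  by (rule f.F.prod_notin[OF d' d]) (simp add: algebra_simps)
 ultimately show "\<exists>m k. \<exists>d\<in>Sg (m * e) - P. \<exists>z\<in>Ng (int (k * e)). k + j = m + n \<and> d \<odot>\<^sub>N y = (TN ^^ j) z"
  using k w(1)
  by (intro exI[of _ "a' + a"] exI[of _ "a' + k"] bexI[of _ "d' \<otimes>\<^sub>S d"] bexI[of _ w]) auto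
qed

end

section \<open>Extension of scalars\<close>

lemma smult_eq_mult_one:
 assumes "algebra kk R" "x : carrier R"
 shows "s \<odot>\<^sub>R x = (s \<odot>\<^sub>R \<one>\<^sub>R) \<otimes>\<^sub>R x"
proof -
 interpret algebra kk R by fact
 show ?thesis using assms(2) smult_assoc2[of s "\<one>\<^sub>R" x] by simp
qed

locale graded_algebra = algebra kk S
 for S :: "('k::field, 's) module" +
 fixes Sg :: "nat => 's set"
 assumes Sg_sub: "Sg n \<subseteq> carrier S"
  and Sg_one: "\<one>\<^sub>S : Sg 0"
  and Sg_mult: "a : Sg m ==> b : Sg n ==> a \<otimes>\<^sub>S b : Sg (m + n)"
  and Sg_zero: "\<zero>\<^sub>S : Sg n"
  and Sg_add: "a : Sg n ==> b : Sg n ==> a \<oplus>\<^sub>S b : Sg n"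
  and Sg_smult: "a : Sg n ==> c \<odot>\<^sub>S a : Sg n"
begin

lemma cring_S: "cring S" by (rule M_cring)

lemma vspace_S: "vspace S" by (rule vspace.intro) (rule module)

lemma Sg_closed: "a : Sg n ==> a : carrier S"
 using Sg_sub by auto

abbreviation FF where "FF M \<equiv> ext_module S M"
abbreviation FG where "FG M \<equiv> ext_degree S Sg M"
abbreviation pure where "pure M m \<equiv> tens S M \<one>\<^sub>S m"

lemma FF_simps [simp]:
 "carrier (FF M) = carrier (tensor S M)" "\<zero>\<^sub>(FF M) = \<zero>\<^sub>(tensor S M)"
 "x \<oplus>\<^sub>(FF M) y = x \<oplus>\<^sub>(tensor S M) y"
 by (simp_all add: ext_module_def ring.defs module.defs)

lemma smult_FF: "s \<odot>\<^sub>(FF M) z = tensor_lift (tensor S M) (\<lambda>s' m. tens S M (s \<otimes>\<^sub>S s') m) z"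
 by (simp add: ext_module_def ring.defs module.defs)

lemma pair: "vspace M ==> tensor_pair S M"
 by (rule tensor_pairI[OF vspace_S])

lemma abelian_group_FF:
 assumes "vspace M" shows "abelian_group (FF M)"
proof -
 interpret tensor_pair S M by (rule pair[OF assms])
 interpret T: abelian_group "tensor S M" by (rule abelian_group_tensor)
 show ?thesis
  by (rule abelian_groupI) (auto simp: T.a_ac intro: T.a_inv_closed T.l_neg)
qed

lemma additive_FF: "additive (FF M) Y h \<longleftrightarrow> additive (tensor S M) Y h"
 "additive Z (FF M) h' \<longleftrightarrow> additive Z (tensor S M) h'"
 by (auto simp: additive_def)

lemma bilin_smult:
 assumes "vspace M" "s : carrier S"
 shows "bilin S M (tensor S M) (\<lambda>s' m. tens S M (s \<otimes>\<^sub>S s') m)"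
proof -
 interpret tensor_pair S M by (rule pair[OF assms(1)])
 have "s \<otimes>\<^sub>S (c \<odot>\<^sub>S v) = c \<odot>\<^sub>S (s \<otimes>\<^sub>S v)" if "v : carrier S" for c v
  using smult_assoc2[of c v s] that assms by (simp add: m_comm)
 then show ?thesis using assms
  unfolding bilin_def
  by (auto intro!: klinI tens_closed simp: tens_add_right tens_smult_right r_distr
   tens_add_left tens_smult_left)
qed

lemma smult_FF_klin:
 assumes "vspace M" "s : carrier S"
 shows "klin (tensor S M) (tensor S M) (\<lambda>z. s \<odot>\<^sub>(FF M) z)"
proof -
 interpret tensor_pair S M by (rule pair[OF assms(1)])
 interpret tensor_bilin S M "tensor S M" "\<lambda>s' m. tens S M (s \<otimes>\<^sub>S s') m"
  by (rule tensor_bilinI) (use assms vspace_S vspace_tensor bilin_smult in auto)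
 show ?thesis using lift_klin by (simp add: smult_FF[abs_def] klin_def)
qed

lemma smult_tens:
 assumes "vspace M" "s : carrier S" "s' : carrier S" "m : carrier M"
 shows "s \<odot>\<^sub>(FF M) tens S M s' m = tens S M (s \<otimes>\<^sub>S s') m"
proof -
 interpret tensor_pair S M by (rule pair[OF assms(1)])
 interpret tensor_bilin S M "tensor S M" "\<lambda>s' m. tens S M (s \<otimes>\<^sub>S s') m"
  by (rule tensor_bilinI) (use assms vspace_S vspace_tensor bilin_smult in auto)
 show ?thesis using assms by (simp add: smult_FF lift_tens)
qed

lemma module_FF:
 assumes "vspace M" shows "module S (FF M)"
proof -
 interpret tensor_pair S M by (rule pair[OF assms])
 interpret T: abelian_group "tensor S M" by (rule abelian_group_tensor)
 note ext = tensor_ext[OF abelian_group_tensor]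
 have add: "s \<odot>\<^sub>(FF M) (x \<oplus>\<^sub>(tensor S M) y) = s \<odot>\<^sub>(FF M) x \<oplus>\<^sub>(tensor S M) s \<odot>\<^sub>(FF M) y"
  and cl: "s \<odot>\<^sub>(FF M) x : carrier (tensor S M)"
  if "s : carrier S" "x : carrier (tensor S M)" "y : carrier (tensor S M)" for s x y
  using smult_FF_klin[OF assms that(1)] that by (auto simp: klin_def)
 show ?thesis
 proof (rule moduleI)
  show "cring S" by (rule cring_S)
  show "abelian_group (FF M)" by (rule abelian_group_FF[OF assms])
 next
  fix a x assume "a : carrier S" "x : carrier (FF M)"
  then show "a \<odot>\<^sub>(FF M) x : carrier (FF M)" using cl by simp
 next
  fix a b x assume ab: "a : carrier S" "b : carrier S" and x: "x : carrier (FF M)"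
  show "(a \<oplus>\<^sub>S b) \<odot>\<^sub>(FF M) x = a \<odot>\<^sub>(FF M) x \<oplus>\<^sub>(FF M) b \<odot>\<^sub>(FF M) x"
   using x unfolding FF_simps
   by (rule ext[rotated 3])
    (use ab assms in "auto simp: additive_def add cl T.a_ac smult_tens tens_add_left l_distr")
  show "(a \<otimes>\<^sub>S b) \<odot>\<^sub>(FF M) x = a \<odot>\<^sub>(FF M) (b \<odot>\<^sub>(FF M) x)"
   using x unfolding FF_simps
   by (rule ext[rotated 3])
    (use ab assms in "auto simp: additive_def add cl smult_tens m_assoc")
 next
  fix a x y assume "a : carrier S" "x : carrier (FF M)" "y : carrier (FF M)"
  then show "a \<odot>\<^sub>(FF M) (x \<oplus>\<^sub>(FF M) y) = a \<odot>\<^sub>(FF M) x \<oplus>\<^sub>(FF M) a \<odot>\<^sub>(FF M) y"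
   using add by simp
 next
  fix x assume "x : carrier (FF M)"
  then show "\<one>\<^sub>S \<odot>\<^sub>(FF M) x = x" unfolding FF_simps
   by (rule ext[rotated 3]) (use assms in "auto simp: additive_def add cl smult_tens")
 qed
qed

lemma tens_closed_FF: "vspace M ==> s : carrier S ==> m : carrier M ==> tens S M s m : carrier (FF M)"
 using tensor_pair.tens_closed[OF pair] by simp

lemma FF_ext:
 assumes "vspace M" "abelian_group Y" "additive (FF M) Y f" "additive (FF M) Y g"
  and "!!s m. s : carrier S ==> m : carrier M ==> f (tens S M s m) = g (tens S M s m)"
  and "z : carrier (FF M)"
 shows "f z = g z"
 using tensor_pair.tensor_ext[OF pair[OF assms(1)] assms(2)] assms(3-6) by (auto simp: additive_FF)

subsection \<open>The grading\<close>

lemma FG_neg: "n < 0 ==> FG M n = {\<zero>\<^sub>(tensor S M)}"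
 by (simp add: ext_degree_def)

lemma FG_nonneg: "n \<ge> 0 ==> FG M n = tcoset S M ` {x. keys x \<subseteq> Sg (nat n) \<times> carrier M}"
 by (simp add: ext_degree_def)

lemma homog_formal: "keys x \<subseteq> Sg n \<times> carrier M ==> x : formal S M"
 using Sg_sub unfolding formal_def by blast

lemma tens_FG:
 assumes "s : Sg n" "m : carrier M" shows "tens S M s m : FG M (int n)"
 unfolding tens_def using assms by (subst FG_nonneg) auto

lemma FG_induct [consumes 2, case_names zero add]:
 assumes "vspace M" "z : FG M (int n)" and zero: "P \<zero>\<^sub>(tensor S M)"
  and add: "!!s m z. s : Sg n ==> m : carrier M ==> z : carrier (tensor S M) ==> P z ==>
   P (tens S M s m \<oplus>\<^sub>(tensor S M) z)"
 shows "P z"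
proof -
 interpret tensor_pair S M by (rule pair[OF assms(1)])
 obtain x where x: "z = tcoset S M x" "keys x \<subseteq> Sg n \<times> carrier M"
  using assms(2) by (auto simp: FG_nonneg)
 have "P (tcoset S M (\<Sum>i\<in>K. single i (f i))) \<and> (\<Sum>i\<in>K. single i (f i)) : formal S M"
  if "finite K" "K \<subseteq> Sg n \<times> carrier M" for K and f :: "_ => 'k"
  using that
 proof (induction K rule: finite_induct)
  case empty
  then show ?case using zero by (simp add: zero_tensor)
 next
  case (insert i L)
  obtain s m where i: "i = (s, m)" "s : Sg n" "m : carrier M" using insert by (cases i) auto
  have s: "s : carrier S" using i Sg_closed by auto
  let ?y = "\<Sum>i\<in>L. single i (f i)"
  have y: "?y : formal S M" "P (tcoset S M ?y)" using insert by auto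
  have "tcoset S M (single i (f i)) = tens S M s (f i \<odot>\<^sub>M m)"
   using i s by (simp add: tens_smult_right) (simp add: tens_def smult_tensor formal_single fscale_single)
  moreover have "tcoset S M (single i (f i) + ?y) =
    tcoset S M (single i (f i)) \<oplus>\<^sub>(tensor S M) tcoset S M ?y"
   using i s y by (simp add: add_tensor formal_single)
  ultimately have "P (tcoset S M (single i (f i) + ?y))"
   using i y add[of s "f i \<odot>\<^sub>M m" "tcoset S M ?y"] by (simp add: carrier_tensor)
  moreover have "single i (f i) + ?y : formal S M"
   using y i s by (auto intro: formal_add formal_single)
  ultimately show ?case using insert by simp
 qed
 moreover have "(\<Sum>i\<in>keys x. single i (lookup x i)) = x"
  by (rule poly_mapping_eqI)
   (auto simp: lookup_sum lookup_single when_def in_keys_iff sum.If_cases Int_def)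
 ultimately show ?thesis using x by (metis finite_keys)
qed

lemma FG_sub: assumes "vspace M" shows "FG M i \<subseteq> carrier (FF M)"
proof -
 interpret tensor_pair S M by (rule pair[OF assms])
 show ?thesis
 proof (cases "i < 0")
  case True
  then show ?thesis by (auto simp: FG_neg zero_tensor carrier_tensor)
 next
  case False
  then show ?thesis using homog_formal by (auto simp: FG_nonneg carrier_tensor)
 qed
qed

lemma FG_zero: assumes "vspace M" shows "\<zero>\<^sub>(FF M) : FG M i"
proof -
 interpret tensor_pair S M by (rule pair[OF assms])
 show ?thesis by (cases "i < 0") (auto simp: FG_neg FG_nonneg zero_tensor intro!: image_eqI[of _ _ 0])
qed

lemma FG_add: assumes "vspace M" "x : FG M i" "y : FG M i" shows "x \<oplus>\<^sub>(FF M) y : FG M i"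
proof -
 interpret tensor_pair S M by (rule pair[OF assms(1)])
 interpret T: abelian_group "tensor S M" by (rule abelian_group_tensor)
 show ?thesis
 proof (cases "i < 0")
  case True
  then show ?thesis using assms by (auto simp: FG_neg)
 next
  case False
  then obtain a b where "x = tcoset S M a" "y = tcoset S M b"
   "keys a \<subseteq> Sg (nat i) \<times> carrier M" "keys b \<subseteq> Sg (nat i) \<times> carrier M"
   using assms by (auto simp: FG_nonneg)
  moreover from this have "a : formal S M" "b : formal S M" using homog_formal by blast+
  ultimately have "x \<oplus>\<^sub>(FF M) y = tcoset S M (a + b)" "keys (a + b) \<subseteq> Sg (nat i) \<times> carrier M"
   using keys_add[of a b] by (auto simp: add_tensor)
  then show ?thesis using False by (simp add: FG_nonneg)
 qed
qed

lemma FG_smult: assumes "vspace M" "a : Sg n" "x : FG M i" shows "a \<odot>\<^sub>(FF M) x : FG M (int n + i)"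
proof -
 interpret module S "FF M" by (rule module_FF[OF assms(1)])
 have a: "a : carrier S" using assms Sg_closed by auto
 show ?thesis
 proof (cases "i < 0")
  case True
  then have "x = \<zero>\<^sub>(FF M)" using assms by (simp add: FG_neg)
  then show ?thesis using smult_r_null[OF a] FG_zero[OF assms(1)] by simp
 next
  case False
  then obtain k where k: "i = int k" using nonneg_int_cases by (metis not_less)
  show ?thesis using assms(1) assms(3)[unfolded k] unfolding k
  proof (induction rule: FG_induct)
   case zero
   then show ?case using smult_r_null[OF a] FG_zero[OF assms(1)] by simp
  next
   case (add s m z)
   have "a \<odot>\<^sub>(FF M) (tens S M s m \<oplus>\<^sub>(FF M) z) = tens S M (a \<otimes>\<^sub>S s) m \<oplus>\<^sub>(FF M) a \<odot>\<^sub>(FF M) z"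
    using add a Sg_closed tens_closed_FF[OF assms(1)] by (subst smult_r_distr) (auto simp: smult_tens[OF assms(1)])
   moreover have "tens S M (a \<otimes>\<^sub>S s) m : FG M (int n + int k)"
    using tens_FG[OF Sg_mult[OF assms(2) add(1)] add(2)] by simp
   ultimately show ?case using add FG_add[OF assms(1)] by simp
  qed
 qed
qed

lemma Sg_minus: "a : Sg n ==> \<ominus>\<^sub>S a : Sg n"
 using Sg_smult[of a n "-1"] Sg_closed[of a n] smult_l_minus[of 1 a] smult_one[of a] by simp

lemma FG_minus: assumes "vspace M" "x : FG M i" shows "\<ominus>\<^sub>(FF M) x : FG M i"
proof -
 interpret F: module S "FF M" by (rule module_FF[OF assms(1)])
 have x: "x : carrier (FF M)" using FG_sub[OF assms(1)] assms(2) by auto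
 have "\<ominus>\<^sub>(FF M) x = (\<ominus>\<^sub>S \<one>\<^sub>S) \<odot>\<^sub>(FF M) x"
  using F.smult_l_minus[of "\<one>\<^sub>S" x] x F.smult_one[of x] one_closed by simp
 also have "... : FG M (int 0 + i)" by (intro FG_smult assms Sg_minus Sg_one)
 finally show ?thesis by simp
qed

lemma graded_module_FF: assumes "vspace M" shows "graded_module S (FF M) Sg (FG M)"
 by (intro graded_module.intro graded_module_axioms.intro module_FF Sg_sub Sg_one Sg_mult FG_sub FG_zero
  FG_add FG_minus FG_smult assms)

subsection \<open>Linear maps after extension of scalars\<close>

definition tmap :: "('k, 'b, 'm) bmod => ('k, 'c, 'n) bmod => ('m => 'n) =>
  (('s \<times> 'm) \<Rightarrow>\<^sub>0 'k) set => (('s \<times> 'n) \<Rightarrow>\<^sub>0 'k) set" where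
 "tmap M N \<phi> = tensor_lift (tensor S N) (\<lambda>s m. tens S N s (\<phi> m))"

definition coord :: "('m => 'k) => (('s \<times> 'm) \<Rightarrow>\<^sub>0 'k) set => 's" where
 "coord l = tensor_lift S (\<lambda>s m. l m \<odot>\<^sub>S s)"

lemma tmap_bilin:
 assumes "vspace M" "vspace N" "klin M N \<phi>"
 shows "tensor_bilin S M (tensor S N) (\<lambda>s m. tens S N s (\<phi> m))"
proof -
 interpret N: tensor_pair S N by (rule pair[OF assms(2)])
 show ?thesis
 proof (intro tensor_bilinI vspace_S assms N.vspace_tensor)
  show "bilin S M (tensor S N) (\<lambda>s m. tens S N s (\<phi> m))"
   using klin_closed[OF assms(3)] klin_add[OF assms(3)] klin_smult[OF assms(3)] unfolding bilin_def klin_def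
   by (simp add: N.tens_closed N.tens_add_left N.tens_add_right N.tens_smult_left N.tens_smult_right Pi_iff)
 qed
qed

lemma tmap_klin:
 "vspace M ==> vspace N ==> klin M N \<phi> ==> klin (tensor S M) (tensor S N) (tmap M N \<phi>)"
 unfolding tmap_def by (rule tensor_bilin.lift_klin[OF tmap_bilin])

lemma tmap_tens:
 "vspace M ==> vspace N ==> klin M N \<phi> ==> s : carrier S ==> m : carrier M ==>
  tmap M N \<phi> (tens S M s m) = tens S N s (\<phi> m)"
 unfolding tmap_def by (rule tensor_bilin.lift_tens[OF tmap_bilin])

lemma tmap_additive: "vspace M ==> vspace N ==> klin M N \<phi> ==> additive (FF M) (FF N) (tmap M N \<phi>)"
 using klin_additive[OF tmap_klin] by (simp add: additive_FF)

lemma tmap_closed: "vspace M ==> vspace N ==> klin M N \<phi> ==> z : carrier (tensor S M) ==>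
  tmap M N \<phi> z : carrier (tensor S N)"
 using klin_closed[OF tmap_klin] .

lemma additive_comp:
 "additive V W f ==> additive W Y g ==> additive V Y (\<lambda>x. g (f x))"
 by (auto simp: additive_def Pi_iff)

lemma smult_additive: "vspace M ==> a : carrier S ==> additive (FF M) (FF M) (\<lambda>z. a \<odot>\<^sub>(FF M) z)"
 using klin_additive[OF smult_FF_klin] by (simp add: additive_FF)

lemma smult_closed_FF:
 "vspace M ==> s : carrier S ==> z : carrier (tensor S M) ==> s \<odot>\<^sub>(FF M) z : carrier (tensor S M)"
 using module.smult_closed[OF module_FF, of M s z] by simp

lemma scalar_smult:
 assumes M: "vspace M" and z: "z : carrier (tensor S M)"
 shows "s \<odot>\<^sub>(tensor S M) z = (s \<odot>\<^sub>S \<one>\<^sub>S) \<odot>\<^sub>(FF M) z"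
proof -
 interpret SM: tensor_pair S M by (rule pair[OF M])
 interpret TM: vspace "tensor S M" by (rule SM.vspace_tensor)
 show ?thesis
 proof (rule FF_ext[OF M abelian_group_FF[OF M], where z = z])
  show "additive (FF M) (FF M) (\<lambda>z. s \<odot>\<^sub>(tensor S M) z)"
   by (auto simp: additive_def TM.smult_r_distr)
  show "additive (FF M) (FF M) (\<lambda>z. (s \<odot>\<^sub>S \<one>\<^sub>S) \<odot>\<^sub>(FF M) z)"
   by (intro smult_additive M) (use smult_closed in auto)
  fix t m assume tm: "t : carrier S" "m : carrier M"
  have "s \<odot>\<^sub>S \<one>\<^sub>S : carrier S" using smult_closed by simp
  then show "s \<odot>\<^sub>(tensor S M) tens S M t m = (s \<odot>\<^sub>S \<one>\<^sub>S) \<odot>\<^sub>(FF M) tens S M t m"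
   using tm smult_eq_mult_one[of S t s] by (simp add: smult_tens[OF M] SM.tens_smult_left[symmetric] local.algebra_axioms)
 qed (use z in simp)
qed

lemma finsum_FF:
 assumes M: "vspace M" and f: "f : I \<rightarrow> carrier (tensor S M)"
 shows "finsum (tensor S M) f I = finsum (FF M) f I"
 by (rule additive_finsum[OF tensor_pair.abelian_group_tensor[OF pair[OF M]] abelian_group_FF[OF M] _ f, of "\<lambda>x. x"])
  (simp add: additive_def)

lemma tmap_smult:
 assumes "vspace M" "vspace N" "klin M N \<phi>" "a : carrier S" "z : carrier (tensor S M)"
 shows "tmap M N \<phi> (a \<odot>\<^sub>(FF M) z) = a \<odot>\<^sub>(FF N) tmap M N \<phi> z"
proof -
 show ?thesis
 proof (rule FF_ext[OF assms(1) abelian_group_FF[OF assms(2)], where z = z])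
  show "additive (FF M) (FF N) (\<lambda>z. tmap M N \<phi> (a \<odot>\<^sub>(FF M) z))"
   by (rule additive_comp[OF smult_additive tmap_additive]) (use assms in auto)
  show "additive (FF M) (FF N) (\<lambda>z. a \<odot>\<^sub>(FF N) tmap M N \<phi> z)"
   by (rule additive_comp[OF tmap_additive smult_additive]) (use assms in auto)
  fix s m assume "s : carrier S" "m : carrier M"
  then show "tmap M N \<phi> (a \<odot>\<^sub>(FF M) tens S M s m) = a \<odot>\<^sub>(FF N) tmap M N \<phi> (tens S M s m)"
   using assms klin_closed[OF assms(3)] by (simp add: smult_tens tmap_tens)
 qed (use assms in simp)
qed

lemma tmap_degree:
 assumes "vspace M" "vspace N" "klin M N \<phi>" "z : FG M i"
 shows "tmap M N \<phi> z : FG N i"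
proof -
 have zero: "tmap M N \<phi> \<zero>\<^sub>(tensor S M) = \<zero>\<^sub>(tensor S N)"
  using additive_zero[OF abelian_group_FF abelian_group_FF tmap_additive] assms(1-3) by fastforce
 show ?thesis
 proof (cases "i < 0")
  case True
  then show ?thesis using assms zero by (simp add: FG_neg)
 next
  case False
  then obtain k where k: "i = int k" using nonneg_int_cases by (metis not_less)
  show ?thesis using assms(1) assms(4)[unfolded k] unfolding k
  proof (induction rule: FG_induct)
   case zero
   then show ?case using \<open>tmap M N \<phi> \<zero>\<^sub>(tensor S M) = \<zero>\<^sub>(tensor S N)\<close> FG_zero[OF assms(2)] by simp
  next
   case (add s m z)
   have "tmap M N \<phi> (tens S M s m \<oplus>\<^sub>(tensor S M) z) = tens S N s (\<phi> m) \<oplus>\<^sub>(tensor S N) tmap M N \<phi> z"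
    using klin_add[OF tmap_klin[OF assms(1-3)], of "tens S M s m" z] add Sg_closed assms
     tens_closed_FF[OF assms(1), of s m] by (simp add: tmap_tens)
   then show ?case
    using FG_add[OF assms(2) tens_FG[OF add(1)], of "\<phi> m" "tmap M N \<phi> z"] add klin_closed[OF assms(3)] by simp
  qed
 qed
qed

lemma tmap_comp:
 assumes "vspace M" "vspace N" "vspace L" "klin M N \<phi>" "klin N L \<psi>" "z : carrier (tensor S M)"
  and "klin M L \<chi>" "!!m. m : carrier M ==> \<chi> m = \<psi> (\<phi> m)"
 shows "tmap N L \<psi> (tmap M N \<phi> z) = tmap M L \<chi> z"
proof (rule FF_ext[OF assms(1) abelian_group_FF[OF assms(3)], where z = z])
 show "additive (FF M) (FF L) (\<lambda>z. tmap N L \<psi> (tmap M N \<phi> z))"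
  by (rule additive_comp[OF tmap_additive tmap_additive]) (use assms in auto)
 show "additive (FF M) (FF L) (tmap M L \<chi>)" by (rule tmap_additive) (use assms in auto)
 fix s m assume "s : carrier S" "m : carrier M"
 then show "tmap N L \<psi> (tmap M N \<phi> (tens S M s m)) = tmap M L \<chi> (tens S M s m)"
  using assms klin_closed[OF assms(4)] by (simp add: tmap_tens)
qed (use assms in simp)

lemma tmap_id:
 assumes "vspace M" "z : carrier (tensor S M)" "klin M M \<phi>" "!!m. m : carrier M ==> \<phi> m = m"
 shows "tmap M M \<phi> z = z"
 by (rule FF_ext[OF assms(1) abelian_group_FF[OF assms(1)], where z = z])
  (use assms in \<open>auto simp: tmap_tens intro: tmap_additive\<close>, simp add: additive_def)

lemma coord_bilin:
 assumes "vspace M" "klin M kk l"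
 shows "tensor_bilin S M S (\<lambda>s m. l m \<odot>\<^sub>S s)"
proof (intro tensor_bilinI vspace_S assms)
 have "c \<odot>\<^sub>S (d \<odot>\<^sub>S s) = d \<odot>\<^sub>S (c \<odot>\<^sub>S s)" if "s : carrier S" for c d s
  using smult_assoc1[of c d s] smult_assoc1[of d c s] that by (simp add: mult.commute)
 moreover have "(c + d) \<odot>\<^sub>S s = c \<odot>\<^sub>S s \<oplus>\<^sub>S d \<odot>\<^sub>S s" "(c * d) \<odot>\<^sub>S s = c \<odot>\<^sub>S (d \<odot>\<^sub>S s)"
  if "s : carrier S" for c d s
  using smult_l_distr[of c d s] smult_assoc1[of c d s] that by auto
 ultimately show "bilin S M S (\<lambda>s m. l m \<odot>\<^sub>S s)"
  using assms(2) unfolding bilin_def klin_def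
  by (auto simp: smult_r_distr)
qed

lemma coord_klin: "vspace M ==> klin M kk l ==> klin (tensor S M) S (coord l)"
 unfolding coord_def by (rule tensor_bilin.lift_klin[OF coord_bilin])

lemma coord_tens: "vspace M ==> klin M kk l ==> s : carrier S ==> m : carrier M ==>
  coord l (tens S M s m) = l m \<odot>\<^sub>S s"
 unfolding coord_def by (rule tensor_bilin.lift_tens[OF coord_bilin])

lemma coord_closed: "vspace M ==> klin M kk l ==> z : carrier (tensor S M) ==> coord l z : carrier S"
 using klin_closed[OF coord_klin] .

lemma coord_additive: "vspace M ==> klin M kk l ==> additive (FF M) S (coord l)"
 using klin_additive[OF coord_klin] by (simp add: additive_FF)

lemma coord_smult:
 assumes "vspace M" "klin M kk l" "a : carrier S" "z : carrier (tensor S M)"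
 shows "coord l (a \<odot>\<^sub>(FF M) z) = a \<otimes>\<^sub>S coord l z"
proof -
 show ?thesis
 proof (rule FF_ext[OF assms(1) M.ag, where z = z])
  show "additive (FF M) S (\<lambda>z. coord l (a \<odot>\<^sub>(FF M) z))"
   by (rule additive_comp[OF smult_additive coord_additive]) (use assms in auto)
  have "additive S S (\<lambda>x. a \<otimes>\<^sub>S x)" using assms by (auto simp: additive_def r_distr)
  from additive_comp[OF coord_additive[OF assms(1,2)] this]
  show "additive (FF M) S (\<lambda>z. a \<otimes>\<^sub>S coord l z)" .
  fix s m assume sm: "s : carrier S" "m : carrier M"
  then have "l m \<odot>\<^sub>S (a \<otimes>\<^sub>S s) = a \<otimes>\<^sub>S (l m \<odot>\<^sub>S s)"
   using smult_assoc2[of "l m" s a] assms by (simp add: m_comm)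
  with sm show "coord l (a \<odot>\<^sub>(FF M) tens S M s m) = a \<otimes>\<^sub>S coord l (tens S M s m)"
   using assms by (simp add: smult_tens coord_tens)
 qed (use assms in simp)
qed

lemma coord_degree:
 assumes "vspace M" "klin M kk l" "z : FG M (int n)"
 shows "coord l z : Sg n"
 using assms(1,3)
proof (induction rule: FG_induct)
 case zero
 have "coord l \<zero>\<^sub>(tensor S M) = \<zero>\<^sub>S"
  using additive_zero[OF abelian_group_FF _ coord_additive] cring.axioms(1)[OF cring_S] ring.is_abelian_group assms
  by (metis FF_simps(2))
 then show ?case by (simp add: Sg_zero)
next
 case (add s m z)
 then show ?case
  using klin_add[OF coord_klin[OF assms(1,2)], of "tens S M s m" z] Sg_closed assms
     tens_closed_FF[OF assms(1), of s m] by (auto simp: coord_tens intro!: Sg_add Sg_smult)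
qed

lemma coord_expand:
 assumes "vspace M" "coordinates M X c" "z : carrier (tensor S M)"
 shows "z = (\<Oplus>\<^sub>(FF M)x\<in>X. coord (c x) z \<odot>\<^sub>(FF M) pure M x)"
proof -
 interpret F: module S "FF M" by (rule module_FF[OF assms(1)])
 interpret T: tensor_pair S M by (rule pair[OF assms(1)])
 have X: "finite X" "X \<subseteq> carrier M" and c: "!!x. x : X ==> klin M kk (c x)"
  and exp: "!!m. m : carrier M ==> m = (\<Oplus>\<^sub>M x\<in>X. c x m \<odot>\<^sub>M x)"
  using assms(2) unfolding coordinates_def by blast+
 have p: "pure M x : carrier (FF M)" if "x : X" for x
  using that X tens_closed_FF[OF assms(1)] by blast
 have cc: "coord (c x) z : carrier S" if "x : X" "z : carrier (tensor S M)" for x z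
  using coord_closed[OF assms(1) c] that by blast
 have s: "coord (c x) z \<odot>\<^sub>(FF M) pure M x : carrier (FF M)" if "x : X" "z : carrier (FF M)" for x z
  using p cc that by (intro F.smult_closed) auto
 show ?thesis
 proof (rule FF_ext[OF assms(1) abelian_group_FF[OF assms(1)], where z = z])
  show "additive (FF M) (FF M) (\<lambda>z. z)" by (simp add: additive_def)
  show "additive (FF M) (FF M) (\<lambda>z. \<Oplus>\<^sub>(FF M)x\<in>X. coord (c x) z \<odot>\<^sub>(FF M) pure M x)"
  proof (intro F.M.additive_finsum_maps F.M.ag)
   fix x assume x: "x : X"
   show "additive (FF M) (FF M) (\<lambda>z. coord (c x) z \<odot>\<^sub>(FF M) pure M x)"
    using klin_add[OF coord_klin[OF assms(1) c[OF x]]] s[OF x] cc[OF x] F.smult_l_distr[OF _ _ p[OF x]]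
    by (simp add: additive_def)
  qed
  fix s m assume sm: "s : carrier S" "m : carrier M"
  have "additive M (FF M) (\<lambda>m. tens S M s m)"
   using sm T.tens_closed T.tens_add_right by (auto simp: additive_def)
  from additive_finsum[OF T.W.M.ag abelian_group_FF[OF assms(1)] this, of "\<lambda>x. c x m \<odot>\<^sub>M x" X]
  have "tens S M s m = (\<Oplus>\<^sub>(FF M)x\<in>X. tens S M s (c x m \<odot>\<^sub>M x))"
   using exp[OF sm(2)] X by (simp add: Pi_iff subset_iff)
  also have "... = (\<Oplus>\<^sub>(FF M)x\<in>X. coord (c x) (tens S M s m) \<odot>\<^sub>(FF M) pure M x)"
  proof (intro F.M.finsum_cong' refl funcsetI)
   fix x assume x: "x : X"
   then have "x : carrier M" using X by auto
   then show "tens S M s (c x m \<odot>\<^sub>M x) = coord (c x) (tens S M s m) \<odot>\<^sub>(FF M) pure M x"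
    using sm c[OF x] assms(1) by (simp add: coord_tens smult_tens T.tens_smult_left T.tens_smult_right)
   show "coord (c x) (tens S M s m) \<odot>\<^sub>(FF M) pure M x : carrier (FF M)"
    using s[OF x] sm T.tens_closed by simp
  qed
  finally show "tens S M s m = (\<Oplus>\<^sub>(FF M)x\<in>X. coord (c x) (tens S M s m) \<odot>\<^sub>(FF M) pure M x)" .
 qed (use assms in simp)
qed

end

section \<open>The coordinate Hopf algebra and its dual\<close>

lemma (in tensor_bilin) lift_comp:
 assumes "vspace Y'" "klin Y Y' h" "X : carrier (tensor V W)"
  and "!!v w. v : carrier V ==> w : carrier W ==> \<gamma> v w = h (\<beta> v w)"
 shows "h (tensor_lift Y \<beta> X) = tensor_lift Y' \<gamma> X"
proof -
 interpret Y': vspace Y' by fact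
 interpret g: tensor_bilin V W Y' \<gamma>
  using assms(2,4) bilin by unfold_locales (auto simp: bilin_def klin_def Pi_iff)
 show ?thesis
 proof (rule tensor_ext[OF Y'.M.ag _ _ _ assms(3)])
  show "additive (tensor V W) Y' (\<lambda>X. h (tensor_lift Y \<beta> X))"
   using klin_additive[OF lift_klin] klin_additive[OF assms(2)] by (auto simp: additive_def Pi_iff)
  show "additive (tensor V W) Y' (tensor_lift Y' \<gamma>)" by (rule klin_additive[OF g.lift_klin])
 qed (simp add: lift_tens g.lift_tens assms(4))
qed

locale hopf_coords =
 fixes G :: "('k::field, 'h) hopf" (structure) and X :: "'h set" and c :: "'h => 'h => 'k"
 assumes group: "affine_group_scheme G"
  and coords: "coordinates G X c"
  and c_ext: "x : X ==> c x : extensional (carrier G)"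
begin

abbreviation B where "B \<equiv> group_algebra G"

lemma algebra_G: "algebra kk G"
 using group by (simp add: affine_group_scheme_def)

sublocale G: algebra kk G by (rule algebra_G)

lemma vspace_G: "vspace G" by (rule vspace.intro) (rule G.module)

sublocale GG: tensor_algebras G G
 by (intro tensor_algebras.intro tensor_pairI vspace_G algebra_G)

lemma finite_X [simp]: "finite X" and X_closed [simp]: "x : X ==> x : carrier G"
 using coords by (auto simp: coordinates_def)

lemma c_klin: "x : X ==> klin G kk (c x)"
 using coords by (simp add: coordinates_def)

lemma expand: "f : carrier G ==> (\<Oplus>x\<in>X. c x f \<odot> x) = f"
 using coords unfolding coordinates_def by metis

lemma klin_expand:
 assumes "vspace Y" "klin G Y \<phi>" "f : carrier G"
 shows "\<phi> f = (\<Oplus>\<^sub>Y x\<in>X. c x f \<odot>\<^sub>Y \<phi> x)"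
proof -
 interpret Y: vspace Y by fact
 have "\<phi> f = \<phi> (\<Oplus>x\<in>X. c x f \<odot> x)" using expand[OF assms(3)] by simp
 also have "... = (\<Oplus>\<^sub>Y x\<in>X. \<phi> (c x f \<odot> x))"
  by (rule additive_finsum[OF G.M.ag Y.M.ag klin_additive[OF assms(2)]])
   (auto intro: G.smult_closed[simplified])
 also have "... = (\<Oplus>\<^sub>Y x\<in>X. c x f \<odot>\<^sub>Y \<phi> x)"
  using klin_closed[OF assms(2)] klin_smult[OF assms(2)]
  by (intro Y.M.finsum_cong' refl) auto
 finally show ?thesis .
qed

lemma B_simps:
 "carrier B = {\<alpha> : extensional (carrier G). klin G kk \<alpha>}"
 "f : carrier G ==> (\<alpha> \<oplus>\<^sub>B \<beta>) f = \<alpha> f + \<beta> f"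
 "f : carrier G ==> (a \<odot>\<^sub>B \<alpha>) f = a * \<alpha> f"
 "f : carrier G ==> \<zero>\<^sub>B f = 0"
 "f : carrier G ==> \<one>\<^sub>B f = counit G f"
 "f : carrier G ==> (\<alpha> \<otimes>\<^sub>B \<beta>) f = tensor_lift kk (\<lambda>a b. \<alpha> a * \<beta> b) (comult G f)"
 by (auto simp: group_algebra_def klin_def)

lemma B_klin: "\<alpha> : carrier B ==> klin G kk \<alpha>"
 by (simp add: B_simps)

lemma B_eqI: "\<alpha> : extensional (carrier G) ==> \<beta> : extensional (carrier G) ==>
  (!!f. f : carrier G ==> \<alpha> f = \<beta> f) ==> \<alpha> = \<beta>"
 by (rule extensionalityI)

lemma B_ext: "\<alpha> \<oplus>\<^sub>B \<beta> : extensional (carrier G)" "a \<odot>\<^sub>B \<alpha> : extensional (carrier G)"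
  "\<zero>\<^sub>B : extensional (carrier G)" "\<one>\<^sub>B : extensional (carrier G)"
  "\<alpha> \<otimes>\<^sub>B \<beta> : extensional (carrier G)"
 by (auto simp: group_algebra_def)

lemma B_extI: "\<alpha> : carrier B ==> \<alpha> : extensional (carrier G)"
 by (simp add: B_simps)

lemma B_add: "\<alpha> : carrier B ==> \<beta> : carrier B ==> \<alpha> \<oplus>\<^sub>B \<beta> : carrier B"
 by (auto simp: B_simps B_ext klin_def algebra_simps)

lemma B_smult: "\<alpha> : carrier B ==> a \<odot>\<^sub>B \<alpha> : carrier B"
 by (auto simp: B_simps B_ext klin_def algebra_simps)

lemma B_zero: "\<zero>\<^sub>B : carrier B"
 by (auto simp: B_simps B_ext klin_def)

lemma vspace_B: "vspace B"
proof (rule vspace.intro, rule moduleI)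
 show "abelian_group B"
 proof (rule abelian_groupI)
  fix \<alpha> assume \<alpha>: "\<alpha> : carrier B"
  then show "\<exists>\<beta>\<in>carrier B. \<beta> \<oplus>\<^sub>B \<alpha> = \<zero>\<^sub>B"
   by (intro bexI[of _ "(-1) \<odot>\<^sub>B \<alpha>"] B_eqI B_ext B_smult) (auto simp: B_simps)
 next
  fix x y assume "x : carrier B" "y : carrier B"
  then show "x \<oplus>\<^sub>B y = y \<oplus>\<^sub>B x" by (intro B_eqI B_ext) (auto simp: B_simps)
 next
  fix x y z assume "x : carrier B" "y : carrier B" "z : carrier B"
  then show "x \<oplus>\<^sub>B y \<oplus>\<^sub>B z = x \<oplus>\<^sub>B (y \<oplus>\<^sub>B z)"
   by (intro B_eqI B_ext) (auto simp: B_simps)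
 next
  fix x assume "x : carrier B"
  then show "\<zero>\<^sub>B \<oplus>\<^sub>B x = x" by (intro B_eqI B_ext B_extI) (auto simp: B_simps)
 qed (auto simp: B_add B_zero)
next
 fix a \<alpha> assume "\<alpha> : carrier B"
 then show "a \<odot>\<^sub>B \<alpha> : carrier B" by (rule B_smult)
qed (auto simp: B_simps algebra_simps intro!: B_eqI B_ext intro: B_extI)

sublocale B: vspace B by (rule vspace_B)

lemma c_closed [simp]: "x : X ==> c x : carrier B"
 using c_klin c_ext by (simp add: B_simps)

lemma B_finsum:
 assumes "!!i. i : I ==> \<phi> i : carrier B" "f : carrier G"
 shows "(\<Oplus>\<^sub>B i\<in>I. \<phi> i) f = (\<Sum>i\<in>I. \<phi> i f)"
proof -
 have "additive B kk (\<lambda>\<alpha>. \<alpha> f)" using assms(2) by (auto simp: additive_def B_simps)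
 from additive_finsum[OF B.M.ag _ this, of \<phi> I] assms(1) show ?thesis by simp
qed

lemma B_expand:
 assumes "\<alpha> : carrier B" shows "(\<Oplus>\<^sub>B x\<in>X. \<alpha> x \<odot>\<^sub>B c x) = \<alpha>"
proof (rule B_eqI)
 have cl: "\<alpha> x \<odot>\<^sub>B c x : carrier B" if "x : X" for x using that by (simp add: B_smult)
 then have "(\<Oplus>\<^sub>B x\<in>X. \<alpha> x \<odot>\<^sub>B c x) : carrier B" by (intro B.M.finsum_closed) auto
 then show "(\<Oplus>\<^sub>B x\<in>X. \<alpha> x \<odot>\<^sub>B c x) : extensional (carrier G)" by (rule B_extI)
 show "\<alpha> : extensional (carrier G)" using assms by (rule B_extI)
 fix f assume f: "f : carrier G"
 show "(\<Oplus>\<^sub>B x\<in>X. \<alpha> x \<odot>\<^sub>B c x) f = \<alpha> f"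
  using klin_expand[OF vspace.intro[OF module_kk_kk] B_klin[OF assms] f] B_finsum[of X, OF cl f] f
  by (simp add: B_simps mult.commute)
qed

lemma klin_B_expand:
 assumes "vspace Y" "klin B Y \<phi>" "\<alpha> : carrier B"
 shows "\<phi> \<alpha> = (\<Oplus>\<^sub>Y x\<in>X. \<alpha> x \<odot>\<^sub>Y \<phi> (c x))"
proof -
 interpret Y: vspace Y by fact
 have "\<phi> \<alpha> = \<phi> (\<Oplus>\<^sub>B x\<in>X. \<alpha> x \<odot>\<^sub>B c x)" using B_expand[OF assms(3)] by simp
 also have "... = (\<Oplus>\<^sub>Y x\<in>X. \<phi> (\<alpha> x \<odot>\<^sub>B c x))"
  by (rule additive_finsum[OF B.M.ag Y.M.ag klin_additive[OF assms(2)]])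
   (auto intro: B_smult)
 also have "... = (\<Oplus>\<^sub>Y x\<in>X. \<alpha> x \<odot>\<^sub>Y \<phi> (c x))"
  using klin_closed[OF assms(2)] klin_smult[OF assms(2)]
  by (intro Y.M.finsum_cong' refl) auto
 finally show ?thesis .
qed

subsection \<open>The action of the dual on the coordinate algebra\<close>

lemma comult_closed [simp]: "f : carrier G ==> comult G f : carrier (tensor G G)"
 and comult_klin: "klin G (tensor G G) (comult G)"
 and comult_mult: "f : carrier G ==> g : carrier G ==>
   comult G (f \<otimes> g) = comult G f \<otimes>\<^sub>(tensor G G) comult G g"
 using group by (auto simp: affine_group_scheme_def alg_hom_def ring_hom_def klin_def)

lemma counit_klin: "klin G kk (counit G)"
 and counit_mult: "f : carrier G ==> g : carrier G ==> counit G (f \<otimes> g) = counit G f * counit G g"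
 and counit_one: "counit G \<one> = 1"
 using group by (auto simp: affine_group_scheme_def alg_hom_def ring_hom_def klin_def)

lemma vspace_kk: "vspace (kk :: ('k, 'k) module)"
 by (rule vspace.intro) simp

text \<open>\<open>hit \<alpha> f = \<Sum> \<alpha>(f\<^sub>1) f\<^sub>2\<close> is the translation of \<open>f\<close> by \<open>\<alpha>\<close>.\<close>

definition hit :: "('h => 'k) => 'h => 'h" where
 "hit \<alpha> f = tensor_lift G (\<lambda>a b. \<alpha> a \<odot> b) (comult G f)"

lemma klin_smult_vec: "v : carrier G ==> klin G kk \<alpha> ==> klin G G (\<lambda>a. \<alpha> a \<odot> v)"
 using G.smult_l_distr[simplified] G.smult_assoc1[simplified]
 by (auto simp: klin_def)

lemma klin_smult_scalar: "klin G G (\<lambda>b. s \<odot> b)"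
proof (rule klinI)
 fix d x assume x: "x : carrier G"
 show "s \<odot> (d \<odot> x) = d \<odot> (s \<odot> x)"
  using G.smult_assoc1[of s d x] G.smult_assoc1[of d s x] x by (simp add: mult.commute)
qed (use G.smult_r_distr in auto)

lemma hit_bilin: "klin G kk \<alpha> ==> tensor_bilin G G G (\<lambda>a b. \<alpha> a \<odot> b)"
 by (intro tensor_bilinI vspace_G) (auto simp: bilin_def klin_smult_vec klin_smult_scalar)

lemma klin_compose: "klin V W f ==> klin W Y g ==> klin V Y (\<lambda>x. g (f x))"
 by (auto simp: klin_def Pi_iff)

lemma hit_klin: assumes "klin G kk \<alpha>" shows "klin G G (hit \<alpha>)"
 unfolding hit_def[abs_def]
 by (rule klin_compose[OF comult_klin tensor_bilin.lift_klin[OF hit_bilin[OF assms]]])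

lemma hit_closed [simp]: "\<alpha> : carrier B ==> f : carrier G ==> hit \<alpha> f : carrier G"
 using klin_closed[OF hit_klin[OF B_klin]] .

lemma prod_bilin:
 assumes "klin G kk \<alpha>" "klin G kk \<beta>"
 shows "tensor_bilin G G kk (\<lambda>a b. \<alpha> a * \<beta> b)"
 by (intro tensor_bilinI vspace_G vspace_kk)
  (use assms in "auto simp: bilin_def klin_def algebra_simps")

lemma hit_linear_left:
 assumes "f : carrier G" shows "klin B G (\<lambda>\<alpha>. hit \<alpha> f)"
proof (rule klinI)
 fix \<alpha> assume "\<alpha> : carrier B" then show "hit \<alpha> f : carrier G" using assms by simp
next
 fix \<alpha> \<beta> assume ab: "\<alpha> : carrier B" "\<beta> : carrier B"
 interpret a: tensor_bilin G G G "\<lambda>a b. \<alpha> a \<odot> b" by (rule hit_bilin[OF B_klin[OF ab(1)]])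
 interpret b: tensor_bilin G G G "\<lambda>a b. \<beta> a \<odot> b" by (rule hit_bilin[OF B_klin[OF ab(2)]])
 interpret s: tensor_bilin G G G "\<lambda>a b. (\<alpha> \<oplus>\<^sub>B \<beta>) a \<odot> b" by (rule hit_bilin[OF B_klin[OF B_add[OF ab]]])
 have "tensor_lift G (\<lambda>a b. (\<alpha> \<oplus>\<^sub>B \<beta>) a \<odot> b) Z =
  tensor_lift G (\<lambda>a b. \<alpha> a \<odot> b) Z \<oplus> tensor_lift G (\<lambda>a b. \<beta> a \<odot> b) Z"
  if "Z : carrier (tensor G G)" for Z
  using that
 proof (rule GG.tensor_ext[OF G.M.ag, rotated 3])
  show "additive (tensor G G) G (tensor_lift G (\<lambda>a b. (\<alpha> \<oplus>\<^sub>B \<beta>) a \<odot> b))"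
   by (rule klin_additive[OF s.lift_klin])
  show "additive (tensor G G) G (\<lambda>Z. tensor_lift G (\<lambda>a b. \<alpha> a \<odot> b) Z \<oplus> tensor_lift G (\<lambda>a b. \<beta> a \<odot> b) Z)"
   using klin_closed[OF a.lift_klin] klin_closed[OF b.lift_klin]
   by (auto simp: additive_def klin_add[OF a.lift_klin] klin_add[OF b.lift_klin] G.M.a_ac)
 qed (use G.smult_l_distr[simplified] in "simp add: a.lift_tens b.lift_tens s.lift_tens B_simps")
 then show "hit (\<alpha> \<oplus>\<^sub>B \<beta>) f = hit \<alpha> f \<oplus> hit \<beta> f" using assms by (simp add: hit_def)
next
 fix s \<alpha> assume a: "\<alpha> : carrier B"
 interpret a: tensor_bilin G G G "\<lambda>a b. \<alpha> a \<odot> b" by (rule hit_bilin[OF B_klin[OF a]])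
 show "hit (s \<odot>\<^sub>B \<alpha>) f = s \<odot> hit \<alpha> f"
  unfolding hit_def using assms a G.smult_assoc1[simplified]
  by (intro a.lift_comp[symmetric, OF vspace_G klin_smult_scalar]) (auto simp: B_simps)
qed

lemma mult_apply:
 assumes "\<alpha> : carrier B" "\<beta> : carrier B" "f : carrier G"
 shows "(\<alpha> \<otimes>\<^sub>B \<beta>) f = \<beta> (hit \<alpha> f)"
proof -
 interpret a: tensor_bilin G G G "\<lambda>a b. \<alpha> a \<odot> b" by (rule hit_bilin[OF B_klin[OF assms(1)]])
 show ?thesis
  unfolding hit_def B_simps(6)[OF assms(3)] using assms klin_smult[OF B_klin[OF assms(2)]]
  by (intro a.lift_comp[symmetric, OF vspace_kk B_klin[OF assms(2)]]) auto
qed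

lemma B_mult: assumes "\<alpha> : carrier B" "\<beta> : carrier B" shows "\<alpha> \<otimes>\<^sub>B \<beta> : carrier B"
proof -
 have "klin G kk (\<lambda>f. \<beta> (hit \<alpha> f))"
  by (rule klin_compose[OF hit_klin[OF B_klin[OF assms(1)]] B_klin[OF assms(2)]])
 then have "klin G kk (\<alpha> \<otimes>\<^sub>B \<beta>)"
  unfolding klin_def using mult_apply[OF assms] by auto
 then show ?thesis by (simp add: B_simps B_ext)
qed

lemma B_one: "\<one>\<^sub>B : carrier B"
 using counit_klin by (auto simp: B_simps B_ext klin_def)

lemma hit_one: "f : carrier G ==> hit \<one>\<^sub>B f = f"
proof -
 assume f: "f : carrier G"
 interpret a: tensor_bilin G G G "\<lambda>a b. counit G a \<odot> b" by (rule hit_bilin[OF counit_klin])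
 have "hit \<one>\<^sub>B f = tensor_lift G (\<lambda>a b. counit G a \<odot> b) (comult G f)"
  unfolding hit_def using f by (intro a.lift_cong) (auto simp: B_simps)
 then show ?thesis using group f by (simp add: affine_group_scheme_def)
qed

lemma counit_hit:
 assumes "\<alpha> : carrier B" "f : carrier G" shows "counit G (hit \<alpha> f) = \<alpha> f"
proof -
 interpret a: tensor_bilin G G G "\<lambda>a b. \<alpha> a \<odot> b" by (rule hit_bilin[OF B_klin[OF assms(1)]])
 have b: "tensor_bilin G G G (\<lambda>a b. counit G b \<odot> a)"
  by (intro tensor_bilinI vspace_G) (auto simp: bilin_def klin_smult_vec[OF _ counit_klin] klin_smult_scalar)
 have "counit G (hit \<alpha> f) = tensor_lift kk (\<lambda>a b. \<alpha> a * counit G b) (comult G f)"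
  unfolding hit_def using assms klin_smult[OF counit_klin]
  by (intro a.lift_comp[OF vspace_kk counit_klin]) auto
 also have "... = \<alpha> (tensor_lift G (\<lambda>a b. counit G b \<odot> a) (comult G f))"
  using assms klin_smult[OF B_klin[OF assms(1)]]
  by (intro tensor_bilin.lift_comp[OF b vspace_kk B_klin[OF assms(1)], symmetric]) auto
 also have "... = \<alpha> f" using group assms by (simp add: affine_group_scheme_def)
 finally show ?thesis .
qed

text \<open>Coassociativity makes \<open>hit\<close> a right action of the group algebra.\<close>

lemma hit_mult:
 assumes "\<alpha> : carrier B" "\<beta> : carrier B" "f : carrier G"
 shows "hit (\<alpha> \<otimes>\<^sub>B \<beta>) f = hit \<beta> (hit \<alpha> f)"
proof -
 let ?T = "tensor G (tensor G G)"
 have vT: "vspace ?T" "vspace (tensor G G)"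
  using tensor_pair.vspace_tensor[OF tensor_pairI[OF vspace_G GG.vspace_tensor]] GG.vspace_tensor by auto
 interpret T: tensor_pair G "tensor G G" by (rule tensor_pairI[OF vspace_G vT(2)])
 note ka = B_klin[OF assms(1)] and kb = B_klin[OF assms(2)]
 interpret a: tensor_bilin G G G "\<lambda>a b. \<alpha> a \<odot> b" by (rule hit_bilin[OF ka])
 interpret b: tensor_bilin G G G "\<lambda>a b. \<beta> a \<odot> b" by (rule hit_bilin[OF kb])
 define lb where "lb = tensor_lift G (\<lambda>a b. \<beta> a \<odot> b)"
 have lb: "klin (tensor G G) G lb" unfolding lb_def by (rule b.lift_klin)
 have \<Psi>_bilin: "tensor_bilin G (tensor G G) G (\<lambda>u Y. \<alpha> u \<odot> lb Y)"
 proof (intro tensor_bilinI vspace_G vT)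
  show "bilin G (tensor G G) G (\<lambda>u Y. \<alpha> u \<odot> lb Y)"
   using klin_compose[OF lb klin_smult_scalar] klin_smult_vec[OF klin_closed[OF lb] ka]
   by (auto simp: bilin_def)
 qed
 interpret \<Psi>: tensor_bilin G "tensor G G" G "\<lambda>u Y. \<alpha> u \<odot> lb Y" by (rule \<Psi>_bilin)
 define \<Psi> where "\<Psi> = tensor_lift G (\<lambda>u Y. \<alpha> u \<odot> lb Y)"
 have \<Psi>: "klin ?T G \<Psi>" unfolding \<Psi>_def by (rule \<Psi>.lift_klin)
 have \<Psi>_tens: "\<Psi> (tens G (tensor G G) u Y) = \<alpha> u \<odot> lb Y"
  if "u : carrier G" "Y : carrier (tensor G G)" for u Y
  unfolding \<Psi>_def using that by (rule \<Psi>.lift_tens)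
 have "klin G ?T (\<lambda>d. tens G (tensor G G) c (tens G G d b))"
    "klin G ?T (\<lambda>c. tens G (tensor G G) c (tens G G d b))"
    "klin G ?T (\<lambda>b. tens G (tensor G G) c (tens G G d b))"
    "klin G ?T (\<lambda>b. tens G (tensor G G) c (comult G b))"
    "Y : carrier (tensor G G) ==> klin G ?T (\<lambda>c. tens G (tensor G G) c Y)"
  if "c : carrier G" "b : carrier G" "d : carrier G" for b c d Y
  using GG.bilin_tens T.bilin_tens that klin_compose comult_klin
  by (auto simp: bilin_def GG.tens_closed) blast+
 note kl = this
 have inner: "tensor_bilin G G ?T (\<lambda>c d. tens G (tensor G G) c (tens G G d b))" if "b : carrier G" for b
  by (intro tensor_bilinI vspace_G vT) (use kl that in "auto simp: bilin_def")
 let ?in = "\<lambda>a b. tensor_lift ?T (\<lambda>c d. tens G (tensor G G) c (tens G G d b)) (comult G a)"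
 have outer1: "tensor_bilin G G ?T ?in"
 proof (intro tensor_bilinI vspace_G vT)
  have "klin G ?T (\<lambda>a. ?in a b)" if "b : carrier G" for b
   by (rule klin_compose[OF comult_klin tensor_bilin.lift_klin[OF inner[OF that]]])
  moreover have "klin G ?T (\<lambda>b. tensor_lift ?T (\<lambda>c d. tens G (tensor G G) c (tens G G d b)) Z)"
   if "Z : carrier (tensor G G)" for Z
   using that
  proof (induction rule: GG.tensor_induct)
   case (tens v w)
   then show ?case using kl(3)[of v _ w] tensor_bilin.lift_tens[OF inner]
    by (auto simp: klin_def Pi_iff)
  next
   case (add Z Z')
   interpret vT: vspace ?T by (rule vT)
   have "tensor_lift ?T (\<lambda>c d. tens G (tensor G G) c (tens G G d b)) (Z \<oplus>\<^sub>(tensor G G) Z') =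
     tensor_lift ?T (\<lambda>c d. tens G (tensor G G) c (tens G G d b)) Z \<oplus>\<^sub>?T
     tensor_lift ?T (\<lambda>c d. tens G (tensor G G) c (tens G G d b)) Z'" if "b : carrier G" for b
    using klin_add[OF tensor_bilin.lift_klin[OF inner[OF that]]] add by simp
   with add(3,4) vT.smult_r_distr[simplified] show ?case
    unfolding klin_def by (simp add: Pi_iff vT.M.a_ac)
  qed
  ultimately show "bilin G G ?T ?in" by (auto simp: bilin_def)
 qed
 have outer2: "tensor_bilin G G ?T (\<lambda>a b. tens G (tensor G G) a (comult G b))"
  by (intro tensor_bilinI vspace_G vT) (use kl in "auto simp: bilin_def")
 have "tensor_lift ?T ?in (comult G f) = tensor_lift ?T (\<lambda>a b. tens G (tensor G G) a (comult G b)) (comult G f)"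
  using group assms(3) by (simp add: affine_group_scheme_def)
 then have "\<Psi> (tensor_lift ?T ?in (comult G f)) = \<Psi> (tensor_lift ?T (\<lambda>a b. tens G (tensor G G) a (comult G b)) (comult G f))"
  by simp
 moreover have "\<Psi> (tensor_lift ?T ?in (comult G f)) = tensor_lift G (\<lambda>a b. (\<alpha> \<otimes>\<^sub>B \<beta>) a \<odot> b) (comult G f)"
 proof (rule tensor_bilin.lift_comp[OF outer1 vspace_G \<Psi>])
  fix v w assume vw: "v : carrier G" "w : carrier G"
  have "\<Psi> (?in v w) = tensor_lift G (\<lambda>c d. (\<alpha> c * \<beta> d) \<odot> w) (comult G v)"
  proof (rule tensor_bilin.lift_comp[OF inner[OF vw(2)] vspace_G \<Psi>])
   fix a d assume "a : carrier G" "d : carrier G"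
   then show "(\<alpha> a * \<beta> d) \<odot> w = \<Psi> (tens G (tensor G G) a (tens G G d w))"
    using vw G.smult_assoc1[simplified] by (simp add: \<Psi>_tens GG.tens_closed lb_def b.lift_tens)
  qed (use vw in simp)
  also have "... = tensor_lift kk (\<lambda>c d. \<alpha> c * \<beta> d) (comult G v) \<odot> w"
  proof (rule tensor_bilin.lift_comp[OF prod_bilin[OF ka kb] vspace_G, symmetric])
   show "klin kk G (\<lambda>s. s \<odot> w)"
    using vw G.smult_l_distr[simplified] G.smult_assoc1[simplified] by (auto simp: klin_def)
  qed (use vw in auto)
  finally show "(\<alpha> \<otimes>\<^sub>B \<beta>) v \<odot> w = \<Psi> (?in v w)" using vw by (simp add: B_simps)
 qed (use assms in simp)
 moreover have "\<Psi> (tensor_lift ?T (\<lambda>a b. tens G (tensor G G) a (comult G b)) (comult G f)) =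
   tensor_lift G (\<lambda>a b. \<alpha> a \<odot> hit \<beta> b) (comult G f)"
  by (rule tensor_bilin.lift_comp[OF outer2 vspace_G \<Psi>])
   (use assms in \<open>auto simp: \<Psi>_tens lb_def hit_def\<close>)
 moreover have "hit \<beta> (hit \<alpha> f) = tensor_lift G (\<lambda>a b. \<alpha> a \<odot> hit \<beta> b) (comult G f)"
  unfolding hit_def[of \<alpha> f]
  by (rule a.lift_comp[OF vspace_G hit_klin[OF kb]])
   (use assms klin_smult[OF hit_klin[OF kb]] in auto)
 ultimately show ?thesis by (simp add: hit_def)
qed

text \<open>The Leibniz rule: \<open>\<Delta>\<alpha> = \<Sum> \<alpha>(x y) c\<^sub>x \<otimes> c\<^sub>y\<close> in the dual coalgebra structure.\<close>

lemma hit_product: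
 assumes a: "\<alpha> : carrier B" and fg: "f : carrier G" "g : carrier G"
 shows "hit \<alpha> (f \<otimes> g) = (\<Oplus>x\<in>X. \<Oplus>y\<in>X. \<alpha> (x \<otimes> y) \<odot> (hit (c x) f \<otimes> hit (c y) g))"
proof -
 let ?L = "\<lambda>\<alpha>. tensor_lift G (\<lambda>a b. \<alpha> a \<odot> b)"
 interpret a: tensor_bilin G G G "\<lambda>a b. \<alpha> a \<odot> b" by (rule hit_bilin[OF B_klin[OF a]])
 have L: "klin (tensor G G) G (?L (c x))" if "x : X" for x
  by (rule tensor_bilin.lift_klin[OF hit_bilin[OF c_klin[OF that]]])
 have L_tens: "?L (c x) (tens G G u v) = c x u \<odot> v" if "x : X" "u : carrier G" "v : carrier G" for x u v
  by (rule tensor_bilin.lift_tens[OF hit_bilin[OF c_klin[OF that(1)]] that(2,3)])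
 have Lc [simp]: "?L (c x) Z : carrier G" if "x : X" "Z : carrier (tensor G G)" for x Z
  using klin_closed[OF L] that by blast
 define R where "R Z Z' = (\<Oplus>x\<in>X. \<Oplus>y\<in>X. \<alpha> (x \<otimes> y) \<odot> (?L (c x) Z \<otimes> ?L (c y) Z'))" for Z Z'
 have closed_term [simp]: "s \<odot> (u \<otimes> v) : carrier G" if "u : carrier G" "v : carrier G" for s u v
  using that G.smult_closed by simp
 have R_additive: "additive (tensor G G) G (\<lambda>Z. R Z Z')" "additive (tensor G G) G (\<lambda>Z. R Z' Z)" if Z': "Z' : carrier (tensor G G)" for Z'
  unfolding R_def using Z' klin_add[OF L] G.smult_r_distr
  by (intro G.M.additive_finsum_maps GG.abelian_group_tensor; auto simp: additive_def G.l_distr G.r_distr)+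
 have R_add: "R (Z1 \<oplus>\<^sub>(tensor G G) Z2) Z' = R Z1 Z' \<oplus> R Z2 Z'" "R Z' (Z1 \<oplus>\<^sub>(tensor G G) Z2) = R Z' Z1 \<oplus> R Z' Z2"
  if "Z1 : carrier (tensor G G)" "Z2 : carrier (tensor G G)" "Z' : carrier (tensor G G)" for Z1 Z2 Z'
  using that R_additive by (auto simp: additive_def)
 have pure: "\<alpha> (u \<otimes> u') \<odot> (v \<otimes> v') = R (tens G G u v) (tens G G u' v')"
  if uv: "u : carrier G" "v : carrier G" "u' : carrier G" "v' : carrier G" for u v u' v'
 proof -
  have 1: "klin G kk (\<lambda>u. \<alpha> (u \<otimes> w))" and 2: "klin G kk (\<lambda>u. \<alpha> (w \<otimes> u))" if "w : carrier G" for w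
  proof -
   have "klin G G (\<lambda>u. u \<otimes> w)"
    using that by (auto simp: klin_def G.l_distr G.smult_assoc2[simplified])
   from klin_compose[OF this B_klin[OF a]] show "klin G kk (\<lambda>u. \<alpha> (u \<otimes> w))" .
   have "klin G G (\<lambda>u. w \<otimes> u)"
    using that G.smult_assoc2[simplified] by (auto simp: klin_def G.r_distr G.m_comm[of w])
   from klin_compose[OF this B_klin[OF a]] show "klin G kk (\<lambda>u. \<alpha> (w \<otimes> u))" .
  qed
  have "\<alpha> (u \<otimes> u') = (\<Sum>x\<in>X. c x u * \<alpha> (x \<otimes> u'))"
   using klin_expand[OF vspace_kk 1[OF uv(3)] uv(1)] by simp
  also have "... = (\<Sum>x\<in>X. \<Sum>y\<in>X. \<alpha> (x \<otimes> y) * (c x u * c y u'))"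
   using klin_expand[OF vspace_kk 2 uv(3)]
   by (intro sum.cong refl) (simp add: sum_distrib_left mult_ac)
  finally have *: "\<alpha> (u \<otimes> u') = (\<Sum>x\<in>X. \<Sum>y\<in>X. \<alpha> (x \<otimes> y) * (c x u * c y u'))" .
  have vv: "v \<otimes> v' : carrier G" using uv by simp
  have add: "additive (kk :: ('k, 'k) module) G (\<lambda>s. s \<odot> (v \<otimes> v'))"
   using G.smult_l_distr[OF _ _ vv] G.smult_closed[OF _ vv] by (simp add: additive_def)
  have "\<alpha> (u \<otimes> u') \<odot> (v \<otimes> v') =
    (\<Oplus>x\<in>X. (\<Sum>y\<in>X. \<alpha> (x \<otimes> y) * (c x u * c y u')) \<odot> (v \<otimes> v'))"
   unfolding * using additive_finsum[OF _ G.M.ag add, of "\<lambda>x. \<Sum>y\<in>X. \<alpha> (x \<otimes> y) * (c x u * c y u')" X]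
   by simp
  also have "... = (\<Oplus>x\<in>X. \<Oplus>y\<in>X. (\<alpha> (x \<otimes> y) * (c x u * c y u')) \<odot> (v \<otimes> v'))"
   using additive_finsum[OF _ G.M.ag add, of _ X] vv
   by (intro G.M.finsum_cong' refl) (auto intro!: G.M.finsum_closed G.smult_closed)
  also have "... = R (tens G G u v) (tens G G u' v')"
   unfolding R_def
  proof (intro G.M.finsum_cong' refl funcsetI G.M.finsum_closed)
   fix x y assume xy: "x : X" "y : X"
   have "(c x u \<odot> v) \<otimes> (c y u' \<odot> v') = c x u \<odot> (v \<otimes> (c y u' \<odot> v'))"
    using uv G.smult_assoc2 G.smult_closed by simp
   also have "v \<otimes> (c y u' \<odot> v') = c y u' \<odot> (v \<otimes> v')"
    using uv G.smult_assoc2[of "c y u'" v' v] G.smult_closed by (simp add: G.m_comm)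
   finally show "(\<alpha> (x \<otimes> y) * (c x u * c y u')) \<odot> (v \<otimes> v') =
     \<alpha> (x \<otimes> y) \<odot> (?L (c x) (tens G G u v) \<otimes> ?L (c y) (tens G G u' v'))"
    using xy uv vv G.smult_assoc1[simplified] G.smult_closed by (simp add: L_tens)
  qed (use uv in "auto simp: GG.tens_closed")
  finally show ?thesis .
 qed
 have La_add: "?L \<alpha> (Z \<oplus>\<^sub>(tensor G G) Z') = ?L \<alpha> Z \<oplus> ?L \<alpha> Z'"
  if "Z : carrier (tensor G G)" "Z' : carrier (tensor G G)" for Z Z'
  using klin_add[OF a.lift_klin] that by simp
 have "?L \<alpha> (Z \<otimes>\<^sub>(tensor G G) Z') = R Z Z'"
  if "Z : carrier (tensor G G)" "Z' : carrier (tensor G G)" for Z Z'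
  using that(1)
 proof (induction rule: GG.tensor_induct)
  case (tens u v)
  show ?case using that(2)
  proof (induction rule: GG.tensor_induct)
   case (tens u' v')
   then show ?case using \<open>u : carrier G\<close> \<open>v : carrier G\<close> pure by (simp add: GG.mult_tens a.lift_tens)
  next
   case (add Z1 Z2)
   then show ?case using tens by (simp add: GG.mult_distr GG.tens_closed GG.mult_closed La_add R_add)
  qed
 next
  case (add Z1 Z2)
  then show ?case using that(2) by (simp add: GG.mult_distr GG.tens_closed GG.mult_closed La_add R_add)
 qed
 then show ?thesis using fg unfolding R_def hit_def by (simp add: comult_mult)
qed

end

section \<open>Binomial coefficients modulo \<open>p\<close>\<close>

lemma char_prime_iff:
 assumes "CHAR('k::field) = p" "p > 0"
 shows "prime p"
 using assms prime_CHAR_semidom[where 'a = 'k] by auto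

lemma binomial_multiple_zero:
 assumes "CHAR('k::field) = p" "p > 0" "0 < k" "k < p ^ n"
 shows "(of_nat ((m * p ^ n) choose k) :: 'k) = 0"
proof -
 have p: "prime p" using assms char_prime_iff by blast
 have "p dvd ((m * p ^ n) choose k)"
 proof (rule ccontr)
  assume "\<not> p dvd ((m * p ^ n) choose k)"
  then have "coprime (p ^ n) ((m * p ^ n) choose k)" using p by (simp add: prime_imp_coprime)
  moreover have "p ^ n dvd k * ((m * p ^ n) choose k)"
   using times_binomial_minus1_eq[OF assms(3), of "m * p ^ n"] by simp
  ultimately have "p ^ n dvd k" by (simp add: coprime_dvd_mult_left_iff)
  then show False using assms dvd_imp_le by fastforce
 qed
 then show ?thesis using assms(1) by (auto simp: of_nat_eq_0_iff_char_dvd)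
qed

lemma binomial_shift_zero:
 assumes "CHAR('k::field) = p" "p > 0" "b < a" "a < p ^ n"
 shows "(of_nat ((m * p ^ n + b) choose a) :: 'k) = 0"
proof -
 have "(of_nat ((m * p ^ n + b) choose a) :: 'k) =
   (\<Sum>k\<le>a. of_nat ((m * p ^ n) choose k) * of_nat (b choose (a - k)))"
  by (simp add: vandermonde[symmetric])
 also have "... = 0"
 proof (rule sum.neutral, rule ballI)
  fix k assume "k : {..a}"
  then show "(of_nat ((m * p ^ n) choose k) * of_nat (b choose (a - k)) :: 'k) = 0"
   using binomial_multiple_zero[OF assms(1,2), of k n m] assms(3,4) by (cases "k = 0") (auto simp: binomial_eq_0)
 qed
 finally show ?thesis .
qed

lemma binomial_leading_digit:
 assumes "CHAR('k::field) = p" "p > 0" "b < p ^ n"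
 shows "(of_nat ((m * p ^ n + b) choose (p ^ n)) :: 'k) = of_nat m"
proof (induction m)
 case 0
 then show ?case using assms(3) by (simp add: binomial_eq_0)
next
 case (Suc m)
 let ?e = "p ^ n"
 have e: "?e > 0" using assms by simp
 have "(of_nat ((Suc m * ?e + b) choose ?e) :: 'k) =
   (\<Sum>k\<le>?e. of_nat (?e choose k) * of_nat ((m * ?e + b) choose (?e - k)))"
  using arg_cong[OF vandermonde[of ?e "m * ?e + b" ?e], of "of_nat :: nat => 'k"]
  by (simp add: add.assoc)
 also have "... = (\<Sum>k\<in>{0, ?e}. of_nat (?e choose k) * of_nat ((m * ?e + b) choose (?e - k)))"
  using binomial_multiple_zero[OF assms(1,2), of _ n 1] e
  by (intro sum.mono_neutral_right) (auto simp: le_less)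
 also have "... = of_nat (Suc m)" using Suc e by simp
 finally show ?case .
qed

section \<open>One-parameter subgroups\<close>

lemma alg_hom_klin: "h : alg_hom R R' ==> klin R R' h"
 by (auto simp: alg_hom_def ring_hom_def klin_def)

lemma alg_homD:
 assumes "h : alg_hom R R'"
 shows "x : carrier R ==> h x : carrier R'"
  and "x : carrier R ==> y : carrier R ==> h (x \<otimes>\<^sub>R y) = h x \<otimes>\<^sub>R' h y"
  and "x : carrier R ==> y : carrier R ==> h (x \<oplus>\<^sub>R y) = h x \<oplus>\<^sub>R' h y"
  and "h \<one>\<^sub>R = \<one>\<^sub>R'"
  and "x : carrier R ==> h (s \<odot>\<^sub>R x) = s \<odot>\<^sub>R' h x"
 using assms by (auto simp: alg_hom_def ring_hom_def)

lemma algebra_vspace: "algebra kk R ==> vspace R"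
 by (simp add: vspace_def algebra.module)

lemma add_pow_smult:
 assumes "algebra kk R" "x : carrier R"
 shows "add_pow R (n::nat) x = of_nat n \<odot>\<^sub>R x"
proof -
 interpret algebra kk R by fact
 show ?thesis
 proof (induction n)
  case 0
  then show ?case using assms(2) smult_l_null by simp
 next
  case (Suc n)
  then show ?case using assms(2) smult_l_distr[of "of_nat n" 1 x] smult_one[of x]
   by (simp add: M.add.nat_pow_Suc M.a_comm add.commute)
 qed
qed

text \<open>
 A one-parameter subgroup is used through its coefficients \<open>\<nu> f j\<close>. Products of functions become
 convolutions of coefficients and, as \<open>t\<close> is primitive, comultiplication yields binomial coefficients.
\<close>

context hopf_coords
begin

lemma one_param_iff:
 assumes R: "algebra kk R"
 shows "one_param_subgroup p r G R \<nu> \<longleftrightarrow>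
  (\<forall>f\<in>carrier G. \<nu> f : {..<p ^ r} \<rightarrow>\<^sub>E carrier R) \<and>
  (\<forall>f\<in>carrier G. \<forall>g\<in>carrier G. \<forall>j<p ^ r. \<nu> (f \<oplus> g) j = \<nu> f j \<oplus>\<^sub>R \<nu> g j) \<and>
  (\<forall>f\<in>carrier G. \<forall>s. \<forall>j<p ^ r. \<nu> (s \<odot> f) j = s \<odot>\<^sub>R \<nu> f j) \<and>
  (\<forall>f\<in>carrier G. \<forall>g\<in>carrier G. \<forall>j<p ^ r. \<nu> (f \<otimes> g) j = (\<Oplus>\<^sub>R i\<in>{..j}. \<nu> f i \<otimes>\<^sub>R \<nu> g (j - i))) \<and>
  (\<forall>j<p ^ r. \<nu> \<one> j = (if j = 0 then \<one>\<^sub>R else \<zero>\<^sub>R)) \<and>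
  (\<forall>f\<in>carrier G. \<nu> f 0 = counit G f \<odot>\<^sub>R \<one>\<^sub>R) \<and>
  (\<forall>f\<in>carrier G. \<forall>i<p ^ r. \<forall>j<p ^ r.
    (if i + j < p ^ r then of_nat ((i + j) choose i) \<odot>\<^sub>R \<nu> f (i + j) else \<zero>\<^sub>R)
    = tensor_lift R (\<lambda>a b. \<nu> a i \<otimes>\<^sub>R \<nu> b j) (comult G f))"
  (is "_ \<longleftrightarrow> ?closed \<and> ?add \<and> ?smult \<and> ?mult \<and> ?one \<and> ?counit \<and> ?comult")
proof -
 have eq_iff: "x = restrict y {..<p ^ r} \<longleftrightarrow> (\<forall>j<p ^ r. x j = y j)" if "x : extensional {..<p ^ r}" for x y :: "nat => 'z"
  using that by (auto simp: fun_eq_iff extensional_def)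
 have alg: "\<nu> : alg_hom G (trunc_poly (p ^ r) R) \<longleftrightarrow> ?closed \<and> ?add \<and> ?smult \<and> ?mult \<and> ?one"
 proof (cases ?closed)
  case True
  then have ext: "\<nu> f : extensional {..<p ^ r}" if "f : carrier G" for f
   using that by (auto simp: PiE_def)
  have s: "f : carrier G ==> s \<odot> f : carrier G" for s f using G.smult_closed by simp
  let ?q = "{..<p ^ r}"
  have "(\<forall>f\<in>carrier G. \<forall>g\<in>carrier G. \<nu> (f \<otimes> g) = restrict (\<lambda>j. \<Oplus>\<^sub>R i\<in>{..j}. \<nu> f i \<otimes>\<^sub>R \<nu> g (j - i)) ?q) \<longleftrightarrow> ?mult"
   "(\<forall>f\<in>carrier G. \<forall>g\<in>carrier G. \<nu> (f \<oplus> g) = restrict (\<lambda>j. \<nu> f j \<oplus>\<^sub>R \<nu> g j) ?q) \<longleftrightarrow> ?add"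
   "\<nu> \<one> = restrict (\<lambda>j. if j = 0 then \<one>\<^sub>R else \<zero>\<^sub>R) ?q \<longleftrightarrow> ?one"
   by (simp_all add: eq_iff ext)
  moreover have "(\<forall>s. \<forall>f\<in>carrier G. \<nu> (s \<odot> f) = restrict (\<lambda>j. s \<odot>\<^sub>R \<nu> f j) ?q) \<longleftrightarrow> ?smult"
   using s by (simp add: eq_iff ext) blast
  moreover have "\<nu> : carrier G \<rightarrow> (?q \<rightarrow>\<^sub>E carrier R)" using True by blast
  moreover have "\<nu> : alg_hom G (trunc_poly (p ^ r) R) \<longleftrightarrow>
    \<nu> : carrier G \<rightarrow> (?q \<rightarrow>\<^sub>E carrier R) \<and>
    (\<forall>f\<in>carrier G. \<forall>g\<in>carrier G. \<nu> (f \<otimes> g) = restrict (\<lambda>j. \<Oplus>\<^sub>R i\<in>{..j}. \<nu> f i \<otimes>\<^sub>R \<nu> g (j - i)) ?q) \<and>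
    (\<forall>f\<in>carrier G. \<forall>g\<in>carrier G. \<nu> (f \<oplus> g) = restrict (\<lambda>j. \<nu> f j \<oplus>\<^sub>R \<nu> g j) ?q) \<and>
    \<nu> \<one> = restrict (\<lambda>j. if j = 0 then \<one>\<^sub>R else \<zero>\<^sub>R) ?q \<and>
    (\<forall>s. \<forall>f\<in>carrier G. \<nu> (s \<odot> f) = restrict (\<lambda>j. s \<odot>\<^sub>R \<nu> f j) ?q)"
   unfolding alg_hom_def ring_hom_def trunc_poly_def mem_Collect_eq partial_object.select_convs
    monoid.select_convs ring.select_convs module.select_convs by blast
  ultimately show ?thesis using True by argo
 next
  case False
  then show ?thesis by (auto simp: alg_hom_def ring_hom_def trunc_poly_def Pi_iff)
 qed
 have *: "?comult \<longleftrightarrow> (\<forall>f\<in>carrier G. \<forall>i<p ^ r. \<forall>j<p ^ r.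
    (if i + j < p ^ r then add_pow R ((i + j) choose i) (\<nu> f (i + j)) else \<zero>\<^sub>R)
    = tensor_lift R (\<lambda>a b. \<nu> a i \<otimes>\<^sub>R \<nu> b j) (comult G f))" if ?closed
 proof -
  have "add_pow R n (\<nu> f j) = of_nat n \<odot>\<^sub>R \<nu> f j" if "f : carrier G" "j < p ^ r" for f j and n :: nat
   using \<open>?closed\<close> that by (intro add_pow_smult[OF R]) (auto simp: PiE_def Pi_iff)
  then show ?thesis by (simp cong: if_cong)
 qed
 show ?thesis
 proof (cases ?closed)
  case True
  from *[OF True] show ?thesis unfolding one_param_subgroup_def alg by argo
 next
  case False
  then show ?thesis unfolding one_param_subgroup_def alg by argo
 qed
qed

end

locale one_param = hopf_coords G X c + R: algebra kk R
 for G :: "('k::field, 'h) hopf" (structure) and X c and R :: "('k, 'a) module" +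
 fixes p r :: nat and \<nu> :: "'h => nat => 'a"
 assumes one_param: "one_param_subgroup p r G R \<nu>" and p_pos: "p > 0"
begin

lemma algebra_R: "algebra kk R" ..

lemma vspace_R: "vspace R" by (rule algebra_vspace[OF algebra_R])

lemma nu_closed [simp]: "f : carrier G ==> j < p ^ r ==> \<nu> f j : carrier R"
 and nu_ext: "f : carrier G ==> \<nu> f : extensional {..<p ^ r}"
 and nu_add: "f : carrier G ==> g : carrier G ==> j < p ^ r ==> \<nu> (f \<oplus> g) j = \<nu> f j \<oplus>\<^sub>R \<nu> g j"
 and nu_smult: "f : carrier G ==> j < p ^ r ==> \<nu> (s \<odot> f) j = s \<odot>\<^sub>R \<nu> f j"
 and nu_mult: "f : carrier G ==> g : carrier G ==> j < p ^ r ==>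
   \<nu> (f \<otimes> g) j = (\<Oplus>\<^sub>R i\<in>{..j}. \<nu> f i \<otimes>\<^sub>R \<nu> g (j - i))"
 and nu_one: "j < p ^ r ==> \<nu> \<one> j = (if j = 0 then \<one>\<^sub>R else \<zero>\<^sub>R)"
 and nu_counit: "f : carrier G ==> \<nu> f 0 = counit G f \<odot>\<^sub>R \<one>\<^sub>R"
 and nu_comult: "f : carrier G ==> i < p ^ r ==> j < p ^ r ==>
   tensor_lift R (\<lambda>a b. \<nu> a i \<otimes>\<^sub>R \<nu> b j) (comult G f) =
   (if i + j < p ^ r then of_nat ((i + j) choose i) \<odot>\<^sub>R \<nu> f (i + j) else \<zero>\<^sub>R)"
 using one_param unfolding one_param_iff[OF algebra_R] by (auto simp: PiE_def Pi_iff)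

lemma nu_klin: "j < p ^ r ==> klin G R (\<lambda>f. \<nu> f j)"
 by (auto intro!: klinI simp: nu_add nu_smult)

lemma nu_bilin:
 assumes "i < p ^ r" "j < p ^ r"
 shows "tensor_bilin G G R (\<lambda>a b. \<nu> a i \<otimes>\<^sub>R \<nu> b j)"
proof (intro tensor_bilinI vspace_G vspace_R)
 have "x \<otimes>\<^sub>R (s \<odot>\<^sub>R y) = s \<odot>\<^sub>R (x \<otimes>\<^sub>R y)" if "x : carrier R" "y : carrier R" for s x y
  using that R.smult_assoc2[of s y x] R.smult_closed by (simp add: R.m_comm)
 then show "bilin G G R (\<lambda>a b. \<nu> a i \<otimes>\<^sub>R \<nu> b j)"
  using assms R.smult_assoc2[simplified]
  by (auto simp: bilin_def nu_add nu_smult R.l_distr R.r_distr intro!: klinI)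
qed

lemma one_param_map:
 assumes R': "algebra kk R'" and h: "h : alg_hom R R'"
 shows "one_param_subgroup p r G R' (\<lambda>f. \<lambda>j\<in>{..<p ^ r}. h (\<nu> f j))"
proof -
 interpret R': algebra kk R' by fact
 note hom = alg_homD[OF h]
 have hz: "h \<zero>\<^sub>R = \<zero>\<^sub>R'"
  by (rule additive_zero[OF R.M.ag R'.M.ag klin_additive[OF alg_hom_klin[OF h]]])
 show ?thesis
  unfolding one_param_iff[OF R']
 proof (intro conjI ballI allI impI)
  fix f g j assume fg: "f : carrier G" "g : carrier G" and j: "j < p ^ r"
  have "h (\<Oplus>\<^sub>R i\<in>{..j}. \<nu> f i \<otimes>\<^sub>R \<nu> g (j - i)) = (\<Oplus>\<^sub>R' i\<in>{..j}. h (\<nu> f i \<otimes>\<^sub>R \<nu> g (j - i)))"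
   using fg j by (intro additive_finsum[OF R.M.ag R'.M.ag
    klin_additive[OF alg_hom_klin[OF h]]]) auto
  also have "... = (\<Oplus>\<^sub>R' i\<in>{..j}. (\<lambda>j\<in>{..<p ^ r}. h (\<nu> f j)) i \<otimes>\<^sub>R' (\<lambda>j\<in>{..<p ^ r}. h (\<nu> g j)) (j - i))"
   using fg j hom by (intro R'.M.finsum_cong' refl) auto
  finally show "(\<lambda>j\<in>{..<p ^ r}. h (\<nu> (f \<otimes> g) j)) j =
    (\<Oplus>\<^sub>R' i\<in>{..j}. (\<lambda>j\<in>{..<p ^ r}. h (\<nu> f j)) i \<otimes>\<^sub>R' (\<lambda>j\<in>{..<p ^ r}. h (\<nu> g j)) (j - i))"
   using fg j by (simp add: nu_mult)
 next
  fix f i j assume f: "f : carrier G" and ij: "i < p ^ r" "j < p ^ r"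
  interpret n: tensor_bilin G G R "\<lambda>a b. \<nu> a i \<otimes>\<^sub>R \<nu> b j" by (rule nu_bilin[OF ij])
  have "tensor_lift R' (\<lambda>a b. (\<lambda>j\<in>{..<p ^ r}. h (\<nu> a j)) i \<otimes>\<^sub>R' (\<lambda>j\<in>{..<p ^ r}. h (\<nu> b j)) j) (comult G f)
    = h (tensor_lift R (\<lambda>a b. \<nu> a i \<otimes>\<^sub>R \<nu> b j) (comult G f))"
   using f ij hom by (intro n.lift_comp[symmetric, OF algebra_vspace[OF R'] alg_hom_klin[OF h]]) auto
  then show "(if i + j < p ^ r then of_nat (i + j choose i) \<odot>\<^sub>R' (\<lambda>j\<in>{..<p ^ r}. h (\<nu> f j)) (i + j)
    else \<zero>\<^sub>R') = tensor_lift R' (\<lambda>a b. (\<lambda>j\<in>{..<p ^ r}. h (\<nu> a j)) i \<otimes>\<^sub>R' (\<lambda>j\<in>{..<p ^ r}. h (\<nu> b j)) j) (comult G f)"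
   using f ij hom hz by (simp add: nu_comult)
 next
  fix f assume f: "f : carrier G"
  then show "(\<lambda>j\<in>{..<p ^ r}. h (\<nu> f j)) 0 = counit G f \<odot>\<^sub>R' \<one>\<^sub>R'"
   using hom p_pos by (simp add: nu_counit)
 qed (use hom hz in "auto simp: nu_add nu_smult nu_one")
qed

lemma one_param_rescale:
 assumes b: "b : carrier R"
 shows "one_param_subgroup p r G R (rescale (p ^ r) R b \<nu>)"
proof -
 define \<mu> where "\<mu> = rescale (p ^ r) R b \<nu>"
 have \<mu>: "\<mu> f j = b [^]\<^sub>R j \<otimes>\<^sub>R \<nu> f j" if "j < p ^ r" for f j
  using that by (simp add: \<mu>_def rescale_def)
 have "one_param_subgroup p r G R \<mu>"
  unfolding one_param_iff[OF algebra_R]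
 proof (intro conjI ballI allI impI)
  fix f assume f: "f : carrier G"
  then show "\<mu> f : {..<p ^ r} \<rightarrow>\<^sub>E carrier R" using b by (auto simp: \<mu>_def rescale_def)
  show "\<mu> f 0 = counit G f \<odot>\<^sub>R \<one>\<^sub>R" using f p_pos R.smult_closed by (simp add: \<mu> nu_counit)
 next
  fix f g j assume fg: "f : carrier G" "g : carrier G" and j: "j < p ^ r"
  show "\<mu> (f \<oplus> g) j = \<mu> f j \<oplus>\<^sub>R \<mu> g j" using fg j b by (simp add: \<mu> nu_add R.r_distr)
  have "\<mu> (f \<otimes> g) j = (\<Oplus>\<^sub>R i\<in>{..j}. b [^]\<^sub>R j \<otimes>\<^sub>R (\<nu> f i \<otimes>\<^sub>R \<nu> g (j - i)))"
   using fg j b by (simp add: \<mu> nu_mult R.finsum_rdistr Pi_iff)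
  also have "... = (\<Oplus>\<^sub>R i\<in>{..j}. \<mu> f i \<otimes>\<^sub>R \<mu> g (j - i))"
  proof (intro R.M.finsum_cong' refl)
   show "(\<lambda>i. \<mu> f i \<otimes>\<^sub>R \<mu> g (j - i)) : {..j} \<rightarrow> carrier R" using fg j b by (auto simp: \<mu>)
   fix i assume i: "i : {..j}"
   have "b [^]\<^sub>R j = b [^]\<^sub>R i \<otimes>\<^sub>R b [^]\<^sub>R (j - i)" using b i by (simp add: R.nat_pow_mult)
   then show "b [^]\<^sub>R j \<otimes>\<^sub>R (\<nu> f i \<otimes>\<^sub>R \<nu> g (j - i)) = \<mu> f i \<otimes>\<^sub>R \<mu> g (j - i)"
    using fg i j b by (simp add: \<mu> R.m_ac del: R.nat_pow_mult)
  qed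
  finally show "\<mu> (f \<otimes> g) j = (\<Oplus>\<^sub>R i\<in>{..j}. \<mu> f i \<otimes>\<^sub>R \<mu> g (j - i))" .
 next
  fix f s j assume f: "f : carrier G" and j: "j < p ^ r"
  show "\<mu> (s \<odot> f) j = s \<odot>\<^sub>R \<mu> f j"
   using f j b R.smult_assoc2[of s "\<nu> f j" "b [^]\<^sub>R j"] R.smult_closed by (simp add: \<mu> nu_smult R.m_comm)
 next
  fix j assume "j < p ^ r"
  then show "\<mu> \<one> j = (if j = 0 then \<one>\<^sub>R else \<zero>\<^sub>R)" using b by (simp add: \<mu> nu_one)
 next
  fix f i j assume f: "f : carrier G" and ij: "i < p ^ r" "j < p ^ r"
  interpret n: tensor_bilin G G R "\<lambda>a b. \<nu> a i \<otimes>\<^sub>R \<nu> b j" by (rule nu_bilin[OF ij])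
  let ?b = "b [^]\<^sub>R (i + j)"
  have comm: "s \<odot>\<^sub>R (?b \<otimes>\<^sub>R x) = ?b \<otimes>\<^sub>R (s \<odot>\<^sub>R x)" if "x : carrier R" for s x
   using that b R.smult_assoc2[of s x ?b] R.smult_closed by (simp add: R.m_comm)
  have "klin R R (\<lambda>x. ?b \<otimes>\<^sub>R x)" using b comm by (auto intro!: klinI simp: R.r_distr)
  from n.lift_comp[OF vspace_R this, of "comult G f" "\<lambda>u v. \<mu> u i \<otimes>\<^sub>R \<mu> v j"]
  have "?b \<otimes>\<^sub>R tensor_lift R (\<lambda>a b. \<nu> a i \<otimes>\<^sub>R \<nu> b j) (comult G f) =
    tensor_lift R (\<lambda>u v. \<mu> u i \<otimes>\<^sub>R \<mu> v j) (comult G f)"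
   using f ij b by (simp add: \<mu> R.m_ac R.nat_pow_mult[symmetric])
  then show "(if i + j < p ^ r then of_nat (i + j choose i) \<odot>\<^sub>R \<mu> f (i + j) else \<zero>\<^sub>R) =
    tensor_lift R (\<lambda>a b. \<mu> a i \<otimes>\<^sub>R \<mu> b j) (comult G f)"
   using f ij b comm by (auto simp: nu_comult \<mu> split: if_splits)
 qed
 then show ?thesis by (simp add: \<mu>_def)
qed

end

section \<open>The graded algebra of functions on one-parameter subgroups\<close>

text \<open>
 Each factor \<open>a + b\<close> raises one of the exponents \<open>i\<close>, \<open>j\<close>; once they add up to \<open>n + m\<close>, one of the
 powers is zero. The case \<open>i = j = 0\<close> shows that the nilradical is closed under sums.
\<close>

lemma (in cring) sum_nilpotent:
 assumes a: "a : carrier R" "a [^] (n::nat) = \<zero>" and b: "b : carrier R" "b [^] (m::nat) = \<zero>"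
  and "i + j + k \<ge> n + m"
 shows "a [^] i \<otimes> b [^] j \<otimes> (a \<oplus> b) [^] k = \<zero>"
 using assms(5)
proof (induction k arbitrary: i j)
 case 0
 then consider "i \<ge> n" | "j \<ge> m" by linarith
 then show ?case
 proof cases
  case 1
  then have "a [^] i = a [^] n \<otimes> a [^] (i - n)" using a(1) by (simp add: nat_pow_mult)
  then show ?thesis using a b by simp
 next
  case 2
  then have "b [^] j = b [^] m \<otimes> b [^] (j - m)" using b(1) by (simp add: nat_pow_mult)
  then show ?thesis using a b by simp
 qed
next
 case (Suc k)
 have "a [^] i \<otimes> b [^] j \<otimes> (a \<oplus> b) [^] Suc k =
   a [^] Suc i \<otimes> b [^] j \<otimes> (a \<oplus> b) [^] k \<oplus> a [^] i \<otimes> b [^] Suc j \<otimes> (a \<oplus> b) [^] k"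
  using a(1) b(1) by (simp add: r_distr l_distr m_ac)
 then show ?case using Suc.IH[of "Suc i" j] Suc.IH[of i "Suc j"] Suc.prems by simp
qed

lemma (in cring) nilradical_ideal: "ideal (nilradical R) R"
proof (rule idealI)
 show "ring R" by (rule ring_axioms)
 show "subgroup (nilradical R) (add_monoid R)"
 proof (rule add.subgroupI)
  show "nilradical R \<subseteq> carrier R" by (auto simp: nilradical_def)
  have "\<zero> [^] (1::nat) = \<zero>" by simp
  then show "nilradical R \<noteq> {}" unfolding nilradical_def by blast
 next
  fix a assume "a : nilradical R"
  then obtain n :: nat where a: "a : carrier R" "a [^] n = \<zero>" by (auto simp: nilradical_def)
  have "(\<ominus> a) [^] n = (\<ominus> \<one>) [^] n \<otimes> a [^] n"
   using a nat_pow_distrib[of "\<ominus> \<one>" a n] by (simp add: l_minus)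
  then show "\<ominus>\<^sub>R a : nilradical R" using a by (auto simp: nilradical_def)
 next
  fix a b assume "a : nilradical R" "b : nilradical R"
  then obtain n m :: nat where a: "a : carrier R" "a [^] n = \<zero>" and b: "b : carrier R" "b [^] m = \<zero>"
   by (auto simp: nilradical_def)
  have "(a \<oplus> b) [^] (n + m) = \<zero>" using sum_nilpotent[OF a b, of 0 0 "n + m"] a b by simp
  then show "a \<oplus> b : nilradical R" using a b by (auto simp: nilradical_def)
 qed
next
 fix a x assume "a : nilradical R" and x: "x : carrier R"
 then obtain n :: nat where a: "a : carrier R" "a [^] n = \<zero>" by (auto simp: nilradical_def)
 then show "x \<otimes> a : nilradical R" "a \<otimes> x : nilradical R"
  using x by (auto simp: nilradical_def nat_pow_distrib intro!: exI[of _ n])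
qed

locale reduced = R: algebra kk A for A :: "('k::field, 'a) module"
begin

abbreviation nil where "nil \<equiv> nilradical A"
abbreviation S where "S \<equiv> reduced_alg A"
definition pr :: "'a => 'a set" where "pr a = nil +>\<^sub>A a"

sublocale nil: ideal nil A by (rule R.nilradical_ideal)

lemma pr_eq_iff: "a : carrier A ==> b : carrier A ==> pr a = pr b \<longleftrightarrow> a \<ominus>\<^sub>A b : nil"
 unfolding pr_def by (rule R.quotient_eq_iff_same_a_r_cos[OF nil.ideal_axioms, symmetric])

lemma smult_nil: "x : nil ==> s \<odot>\<^sub>A x : nil"
 using smult_eq_mult_one[OF R.algebra_axioms, of x s] nil.I_l_closed[of x "s \<odot>\<^sub>A \<one>\<^sub>A"] R.smult_closed
  nil.a_Hcarr[of x] by simp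

lemma S_simps:
 "carrier S = pr ` carrier A" "\<one>\<^sub>S = pr \<one>\<^sub>A" "\<zero>\<^sub>S = pr \<zero>\<^sub>A"
 "a : carrier A ==> b : carrier A ==> pr a \<oplus>\<^sub>S pr b = pr (a \<oplus>\<^sub>A b)"
 "a : carrier A ==> b : carrier A ==> pr a \<otimes>\<^sub>S pr b = pr (a \<otimes>\<^sub>A b)"
 "a : carrier A ==> s \<odot>\<^sub>S pr a = pr (s \<odot>\<^sub>A a)"
proof -
 have fields: "carrier S = carrier (A Quot nil)" "\<one>\<^sub>S = \<one>\<^sub>(A Quot nil)" "\<zero>\<^sub>S = \<zero>\<^sub>(A Quot nil)"
  "x \<oplus>\<^sub>S y = x \<oplus>\<^sub>(A Quot nil) y" "x \<otimes>\<^sub>S y = x \<otimes>\<^sub>(A Quot nil) y"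
  "s \<odot>\<^sub>S x = (\<Union>y\<in>x. nil +>\<^sub>A (s \<odot>\<^sub>A y))" for x y s
  by (simp_all add: reduced_alg_def ring.defs module.defs)
 have hom: "pr : ring_hom A (A Quot nil)" using nil.rcos_ring_hom by (simp add: pr_def[abs_def])
 show "carrier S = pr ` carrier A"
  by (auto simp: fields FactRing_def A_RCOSETS_def' pr_def)
 show "\<one>\<^sub>S = pr \<one>\<^sub>A" using ring_hom_one[OF hom] by (simp add: fields)
 show "\<zero>\<^sub>S = pr \<zero>\<^sub>A" using ring_hom_zero[OF hom] nil.quotient_is_ring R.ring_axioms by (simp add: fields)
 show "pr a \<oplus>\<^sub>S pr b = pr (a \<oplus>\<^sub>A b)" "pr a \<otimes>\<^sub>S pr b = pr (a \<otimes>\<^sub>A b)"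
  if "a : carrier A" "b : carrier A" using ring_hom_add[OF hom that] ring_hom_mult[OF hom that] by (simp_all add: fields)
 show "s \<odot>\<^sub>S pr a = pr (s \<odot>\<^sub>A a)" if a: "a : carrier A"
 proof -
  have "nil +>\<^sub>A (s \<odot>\<^sub>A y) = pr (s \<odot>\<^sub>A a)" if "y : pr a" for y
  proof -
   have y: "y : carrier A" using that a R.a_r_coset_subset_G[OF nil.a_subset, of a] unfolding pr_def by auto
   have "pr y = pr a" using that a nil.a_repr_independence'[of y a] unfolding pr_def by simp
   then have "y \<ominus>\<^sub>A a : nil" using a y by (simp add: pr_eq_iff)
   then have "s \<odot>\<^sub>A (y \<ominus>\<^sub>A a) : nil" by (rule smult_nil)
   moreover have "s \<odot>\<^sub>A (y \<ominus>\<^sub>A a) = s \<odot>\<^sub>A y \<ominus>\<^sub>A s \<odot>\<^sub>A a"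
    using a y R.smult_closed by (simp add: R.minus_eq R.smult_r_distr R.smult_r_minus)
   ultimately show ?thesis using a y R.smult_closed pr_eq_iff[of "s \<odot>\<^sub>A y" "s \<odot>\<^sub>A a"] by (simp add: pr_def)
  qed
  moreover have "a : pr a" using a nil.a_rcos_self by (simp add: pr_def)
  ultimately show ?thesis unfolding fields by blast
 qed
qed

lemma cring_S: "cring S"
proof -
 have "cring (A Quot nil)" by (rule nil.quotient_is_cring[OF R.cring_axioms])
 then interpret Q: cring "A Quot nil" .
 have f: "carrier S = carrier (A Quot nil)" "\<one>\<^sub>S = \<one>\<^sub>(A Quot nil)" "\<zero>\<^sub>S = \<zero>\<^sub>(A Quot nil)"
  "x \<oplus>\<^sub>S y = x \<oplus>\<^sub>(A Quot nil) y" "x \<otimes>\<^sub>S y = x \<otimes>\<^sub>(A Quot nil) y" for x y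
  by (simp_all add: reduced_alg_def ring.defs module.defs)
 show ?thesis
 proof (rule cringI)
  show "abelian_group S"
  proof (rule abelian_groupI)
   fix x assume "x : carrier S"
   then show "\<exists>y\<in>carrier S. y \<oplus>\<^sub>S x = \<zero>\<^sub>S"
    by (intro bexI[of _ "\<ominus>\<^sub>(A Quot nil) x"]) (auto simp: f Q.l_neg)
  qed (simp_all add: f Q.a_ac)
  show "comm_monoid S" by (rule comm_monoidI) (simp_all add: f Q.m_ac)
 qed (simp add: f Q.l_distr)
qed

lemma algebra_S: "algebra kk S"
proof (rule algebraI)
 show "cring S" by (rule cring_S)
qed (auto simp: S_simps R.smult_closed R.smult_l_distr[simplified] R.smult_r_distr R.smult_assoc1[simplified]
  R.smult_assoc2 R.smult_one[simplified])

lemma pr_hom: "pr : alg_hom A S"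
 by (auto simp: alg_hom_def ring_hom_def S_simps)

end

lemma subalgebra_algebra:
 assumes "algebra kk A" and K: "K \<subseteq> carrier A" "\<one>\<^sub>A : K"
  "!!a b. a : K ==> b : K ==> a \<oplus>\<^sub>A b : K" "!!a b. a : K ==> b : K ==> a \<otimes>\<^sub>A b : K"
  "!!s a. a : K ==> s \<odot>\<^sub>A a : K"
 shows "algebra kk (A\<lparr>carrier := K\<rparr>)"
proof -
 interpret algebra kk A by fact
 have sub [simp]: "a : K ==> a : carrier A" for a using K(1) by auto
 have zero: "\<zero>\<^sub>A : K" using K(5)[OF K(2), of 0] smult_l_null[of "\<one>\<^sub>A"] by simp
 have neg: "\<ominus>\<^sub>A a : K" if "a : K" for a
  using K(5)[OF that, of "-1"] smult_l_minus[of 1 a] smult_one[of a] that by simp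
 show ?thesis
 proof (rule algebraI)
  show "cring (A\<lparr>carrier := K\<rparr>)"
  proof (rule cringI)
   show "abelian_group (A\<lparr>carrier := K\<rparr>)"
   proof (rule abelian_groupI)
    fix x assume "x : carrier (A\<lparr>carrier := K\<rparr>)"
    then show "\<exists>y\<in>carrier (A\<lparr>carrier := K\<rparr>). y \<oplus>\<^sub>(A\<lparr>carrier := K\<rparr>) x = \<zero>\<^sub>(A\<lparr>carrier := K\<rparr>)"
     using neg by (intro bexI[of _ "\<ominus>\<^sub>A x"]) (auto simp: l_neg)
   qed (use K zero in "simp_all add: a_ac")
   show "comm_monoid (A\<lparr>carrier := K\<rparr>)"
    by (rule comm_monoidI) (use K in "simp_all add: m_ac")
  qed (simp add: l_distr)
 qed (use K in "auto simp: smult_l_distr[simplified] smult_r_distr smult_assoc1[simplified] smult_assoc2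
   smult_one[simplified]")
qed

locale representing = one_param G X c A p r U
 for G :: "('k::field, 'h) hopf" (structure) and X c and A :: "('k, 'a) module" and p r U +
 assumes univ: "algebra kk Q ==> one_param_subgroup p r G Q \<nu> ==>
   \<exists>!\<psi>. \<psi> : extensional (carrier A) \<and> classifies (p ^ r) G A U Q \<nu> \<psi>"
  and char: "CHAR('k) = p" and r_pos: "r \<ge> 1"
begin

lemma prime_p: "prime p"
 using char_prime_iff[OF char p_pos] .

sublocale reduced A ..

lemma id_hom: "(\<lambda>x\<in>carrier A. x) : alg_hom A A"
 by (auto simp: alg_hom_def ring_hom_def R.smult_closed)

text \<open>
 The coefficients of the universal subgroup generate \<open>A\<close>: it factors through any subalgebra
 containing them, and the resulting endomorphism of \<open>A\<close> is the identity by uniqueness.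
\<close>

lemma subalgebra_all:
 assumes K: "K \<subseteq> carrier A" "\<one>\<^sub>A : K"
  "!!a b. a : K ==> b : K ==> a \<oplus>\<^sub>A b : K" "!!a b. a : K ==> b : K ==> a \<otimes>\<^sub>A b : K"
  "!!s a. a : K ==> s \<odot>\<^sub>A a : K"
  and U: "!!f j. f : carrier G ==> j < p ^ r ==> U f j : K"
 shows "carrier A \<subseteq> K"
proof -
 let ?K = "A\<lparr>carrier := K\<rparr>"
 have alg: "algebra kk ?K" by (rule subalgebra_algebra[OF algebra_R K])
 interpret K: algebra kk ?K by (rule alg)
 have zero: "\<zero>\<^sub>A : K" using K.M.zero_closed by simp
 have incl: "klin ?K A (\<lambda>x. x)" using K(1) by (auto simp: klin_def)
 have "one_param_subgroup p r G ?K U"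
  unfolding one_param_iff[OF alg]
 proof (intro conjI ballI allI impI)
  fix f assume "f : carrier G"
  then show "U f : {..<p ^ r} \<rightarrow>\<^sub>E carrier ?K" using U nu_ext by (auto simp: PiE_def)
 next
  fix f g j assume fg: "f : carrier G" "g : carrier G" and j: "j < p ^ r"
  have "(\<Oplus>\<^sub>?K i\<in>{..j}. U f i \<otimes>\<^sub>?K U g (j - i)) = (\<Oplus>\<^sub>A i\<in>{..j}. U f i \<otimes>\<^sub>?K U g (j - i))"
   by (rule additive_finsum[OF K.M.ag R.M.ag klin_additive[OF incl]])
    (use fg j U K in auto)
  then show "U (f \<otimes> g) j = (\<Oplus>\<^sub>?K i\<in>{..j}. U f i \<otimes>\<^sub>?K U g (j - i))"
   using fg j by (simp add: nu_mult)
 next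
  fix f i j assume f: "f : carrier G" and ij: "i < p ^ r" "j < p ^ r"
  interpret n: tensor_bilin G G A "\<lambda>a b. U a i \<otimes>\<^sub>A U b j" by (rule nu_bilin[OF ij])
  have "tensor_bilin G G ?K (\<lambda>a b. U a i \<otimes>\<^sub>A U b j)"
   using n.bilin U K(4) ij
   by (intro tensor_bilinI vspace_G algebra_vspace[OF alg]) (auto simp: bilin_def klin_def)
  from tensor_bilin.lift_comp[OF this vspace_R incl, of "comult G f" "\<lambda>a b. U a i \<otimes>\<^sub>A U b j"]
  have "tensor_lift ?K (\<lambda>a b. U a i \<otimes>\<^sub>A U b j) (comult G f) = tensor_lift A (\<lambda>a b. U a i \<otimes>\<^sub>A U b j) (comult G f)"
   using f by simp
  then show "(if i + j < p ^ r then of_nat (i + j choose i) \<odot>\<^sub>?K U f (i + j) else \<zero>\<^sub>?K) =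
    tensor_lift ?K (\<lambda>a b. U a i \<otimes>\<^sub>?K U b j) (comult G f)"
   using f ij by (simp add: nu_comult)
 qed (auto simp: nu_add nu_smult nu_one nu_counit)
 from univ[OF alg this] obtain \<psi> where \<psi>: "\<psi> : extensional (carrier A)" "classifies (p ^ r) G A U ?K U \<psi>" by blast
 then have \<psi>_K: "\<psi> a : K" if "a : carrier A" for a
  using that by (auto simp: classifies_def alg_hom_def ring_hom_def)
 have "classifies (p ^ r) G A U A U \<psi>"
  using \<psi>(2) K(1) by (auto simp: classifies_def alg_hom_def ring_hom_def)
 moreover have "classifies (p ^ r) G A U A U (\<lambda>x\<in>carrier A. x)"
  using id_hom by (auto simp: classifies_def)
 ultimately have "\<psi> = (\<lambda>x\<in>carrier A. x)" using univ[OF algebra_R one_param] \<psi>(1) by (metis restrict_extensional)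
 then show ?thesis using \<psi>_K by auto
qed

abbreviation VD where "VD \<equiv> V_degree p r G A U"

lemma VD_I:
 assumes "a : carrier A"
  and "!!Q \<nu> b \<psi> \<psi>'. algebra kk Q ==> one_param_subgroup p r G Q \<nu> ==> b : carrier Q ==>
   classifies (p ^ r) G A U Q \<nu> \<psi> ==> classifies (p ^ r) G A U Q (rescale (p ^ r) Q b \<nu>) \<psi>' ==>
   \<psi> : alg_hom A Q ==> \<psi>' : alg_hom A Q ==> \<psi>' a = b [^]\<^sub>Q n \<otimes>\<^sub>Q \<psi> a"
 shows "a : VD n"
 using assms unfolding V_degree_def by (auto simp: classifies_def)

lemma VD_D:
 assumes "a : VD n" "algebra kk Q" "one_param_subgroup p r G Q \<nu>" "b : carrier Q"
  "classifies (p ^ r) G A U Q \<nu> \<psi>" "classifies (p ^ r) G A U Q (rescale (p ^ r) Q b \<nu>) \<psi>'"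
 shows "\<psi>' a = b [^]\<^sub>Q n \<otimes>\<^sub>Q \<psi> a"
 using assms unfolding V_degree_def by blast

lemma VD_closed: "a : VD n ==> a : carrier A"
 by (simp add: V_degree_def)

lemma VD_one: "\<one>\<^sub>A : VD 0"
proof (rule VD_I)
 fix Q \<nu> b \<psi> \<psi>'
 assume "algebra kk Q" and h: "\<psi> : alg_hom A Q" "\<psi>' : alg_hom A Q"
 then interpret Q: algebra kk Q by simp
 show "\<psi>' \<one>\<^sub>A = b [^]\<^sub>Q (0::nat) \<otimes>\<^sub>Q \<psi> \<one>\<^sub>A" using alg_homD(4)[OF h(1)] alg_homD(4)[OF h(2)] by simp
qed simp

lemma VD_zero: "\<zero>\<^sub>A : VD n"
proof (rule VD_I)
 fix Q \<nu> b \<psi> \<psi>'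
 assume "algebra kk Q" and b: "b : carrier Q" and h: "\<psi> : alg_hom A Q" "\<psi>' : alg_hom A Q"
 then interpret Q: algebra kk Q by simp
 have "\<phi> \<zero>\<^sub>A = \<zero>\<^sub>Q" if "\<phi> : alg_hom A Q" for \<phi>
  by (rule additive_zero[OF R.M.ag Q.M.ag klin_additive[OF alg_hom_klin[OF that]]])
 from this[OF h(1)] this[OF h(2)] show "\<psi>' \<zero>\<^sub>A = b [^]\<^sub>Q n \<otimes>\<^sub>Q \<psi> \<zero>\<^sub>A" using b by simp
qed simp

lemma VD_add:
 assumes x: "x : VD n" "y : VD n" shows "x \<oplus>\<^sub>A y : VD n"
proof (rule VD_I)
 fix Q \<nu> b \<psi> \<psi>'
 assume *: "algebra kk Q" "one_param_subgroup p r G Q \<nu>" "b : carrier Q"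
   "classifies (p ^ r) G A U Q \<nu> \<psi>" "classifies (p ^ r) G A U Q (rescale (p ^ r) Q b \<nu>) \<psi>'"
  and h: "\<psi> : alg_hom A Q" "\<psi>' : alg_hom A Q"
 interpret Q: algebra kk Q by fact
 show "\<psi>' (x \<oplus>\<^sub>A y) = b [^]\<^sub>Q n \<otimes>\<^sub>Q \<psi> (x \<oplus>\<^sub>A y)"
  using VD_D[OF x(1) *] VD_D[OF x(2) *] alg_homD[OF h(1)] alg_homD[OF h(2)] x[THEN VD_closed] *(3)
  by (simp add: Q.r_distr)
qed (use x[THEN VD_closed] in simp)

lemma VD_smult:
 assumes x: "x : VD n" shows "s \<odot>\<^sub>A x : VD n"
proof (rule VD_I)
 fix Q \<nu> b \<psi> \<psi>'
 assume *: "algebra kk Q" "one_param_subgroup p r G Q \<nu>" "b : carrier Q"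
   "classifies (p ^ r) G A U Q \<nu> \<psi>" "classifies (p ^ r) G A U Q (rescale (p ^ r) Q b \<nu>) \<psi>'"
  and h: "\<psi> : alg_hom A Q" "\<psi>' : alg_hom A Q"
 interpret Q: algebra kk Q by fact
 have x': "x : carrier A" "\<psi> x : carrier Q" using x VD_closed alg_homD(1)[OF h(1)] by auto
 have "\<psi>' (s \<odot>\<^sub>A x) = s \<odot>\<^sub>Q (b [^]\<^sub>Q n \<otimes>\<^sub>Q \<psi> x)"
  using VD_D[OF x *] alg_homD(5)[OF h(2)] x' by simp
 also have "... = b [^]\<^sub>Q n \<otimes>\<^sub>Q (s \<odot>\<^sub>Q \<psi> x)"
  using x' *(3) Q.smult_assoc2[of s "\<psi> x" "b [^]\<^sub>Q n"] Q.smult_closed by (simp add: Q.m_comm)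
 finally show "\<psi>' (s \<odot>\<^sub>A x) = b [^]\<^sub>Q n \<otimes>\<^sub>Q \<psi> (s \<odot>\<^sub>A x)" using alg_homD(5)[OF h(1)] x' by simp
qed (use x[THEN VD_closed] R.smult_closed in simp)

lemma VD_mult:
 assumes x: "x : VD n" and y: "y : VD m" shows "x \<otimes>\<^sub>A y : VD (n + m)"
proof (rule VD_I)
 fix Q \<nu> b \<psi> \<psi>'
 assume *: "algebra kk Q" "one_param_subgroup p r G Q \<nu>" "b : carrier Q"
   "classifies (p ^ r) G A U Q \<nu> \<psi>" "classifies (p ^ r) G A U Q (rescale (p ^ r) Q b \<nu>) \<psi>'"
  and h: "\<psi> : alg_hom A Q" "\<psi>' : alg_hom A Q"
 interpret Q: algebra kk Q by fact
 have xy: "x : carrier A" "y : carrier A" using x y VD_closed by auto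
 show "\<psi>' (x \<otimes>\<^sub>A y) = b [^]\<^sub>Q (n + m) \<otimes>\<^sub>Q \<psi> (x \<otimes>\<^sub>A y)"
  using VD_D[OF x *] VD_D[OF y *] alg_homD[OF h(1)] alg_homD[OF h(2)] xy *(3)
  by (simp add: Q.nat_pow_mult[symmetric] Q.m_ac)
qed (use x y VD_closed in auto)

lemma VD_U: assumes "f : carrier G" "j < p ^ r" shows "U f j : VD j"
 by (rule VD_I) (use assms in "auto simp: classifies_def rescale_def")

text \<open>
 An ideal containing all \<open>U f j\<close> with \<open>j > 0\<close> contains all functions of positive degree: modulo
 it, every function agrees with its pullback along the rescaling by \<open>0\<close>.
\<close>

lemma VD_positive_in_ideal:
 assumes I: "ideal I A" and U: "!!f j. f : carrier G ==> 0 < j ==> j < p ^ r ==> U f j : I" and n: "n > 0"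
 shows "VD n \<subseteq> I"
proof
 fix a assume a: "a : VD n"
 interpret I: ideal I A by fact
 have resc: "one_param_subgroup p r G A (rescale (p ^ r) A \<zero>\<^sub>A U)" by (rule one_param_rescale) simp
 obtain \<phi> where \<phi>: "classifies (p ^ r) G A U A (rescale (p ^ r) A \<zero>\<^sub>A U) \<phi>"
  using univ[OF algebra_R resc] by blast
 then have hom: "\<phi> : alg_hom A A" by (simp add: classifies_def)
 note h = alg_homD[OF hom]
 let ?K = "{a \<in> carrier A. a \<ominus>\<^sub>A \<phi> a : I}"
 have "carrier A \<subseteq> ?K"
 proof (rule subalgebra_all)
  show "\<one>\<^sub>A : ?K" using h(4) by (simp add: R.minus_eq R.r_neg)
 next
  fix a b assume ab: "a : ?K" "b : ?K"
  have "(a \<oplus>\<^sub>A b) \<ominus>\<^sub>A \<phi> (a \<oplus>\<^sub>A b) = (a \<ominus>\<^sub>A \<phi> a) \<oplus>\<^sub>A (b \<ominus>\<^sub>A \<phi> b)"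
   using ab h by (simp add: R.minus_eq R.minus_add R.a_ac)
  then show "a \<oplus>\<^sub>A b : ?K" using ab by simp
  have "a \<otimes>\<^sub>A b \<ominus>\<^sub>A \<phi> (a \<otimes>\<^sub>A b) = a \<otimes>\<^sub>A (b \<ominus>\<^sub>A \<phi> b) \<oplus>\<^sub>A (a \<ominus>\<^sub>A \<phi> a) \<otimes>\<^sub>A \<phi> b"
   using ab h(1)[of a] h(1)[of b] h(2)[of a b]
   by (simp add: R.minus_eq R.l_distr R.r_distr R.l_minus R.r_minus R.a_assoc R.r_neg1)
  then show "a \<otimes>\<^sub>A b : ?K" using ab h by (simp add: I.I_l_closed I.I_r_closed)
 next
  fix s a assume a: "a : ?K"
  have "s \<odot>\<^sub>A a \<ominus>\<^sub>A \<phi> (s \<odot>\<^sub>A a) = s \<odot>\<^sub>A (a \<ominus>\<^sub>A \<phi> a)"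
   using a h R.smult_closed by (simp add: R.minus_eq R.smult_r_distr R.smult_r_minus)
  also have "... = (s \<odot>\<^sub>A \<one>\<^sub>A) \<otimes>\<^sub>A (a \<ominus>\<^sub>A \<phi> a)"
   using a h by (intro smult_eq_mult_one[OF algebra_R]) simp
  finally show "s \<odot>\<^sub>A a : ?K" using a R.smult_closed by (simp add: I.I_l_closed)
 next
  fix f j assume f: "f : carrier G" and j: "j < p ^ r"
  have eq: "\<phi> (U f j) = \<zero>\<^sub>A [^]\<^sub>A j \<otimes>\<^sub>A U f j"
   using \<phi> f j by (simp add: classifies_def rescale_def)
  show "U f j : ?K"
  proof (cases "j = 0")
   case True
   then show ?thesis using f j eq by (simp add: R.minus_eq R.r_neg)
  next
   case False
   then have "\<zero>\<^sub>A [^]\<^sub>A j = \<zero>\<^sub>A" by (simp add: R.nat_pow_zero)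
   then show ?thesis using f j eq U[of f j] False by (simp add: R.minus_eq)
  qed
 qed auto
 then have "a \<ominus>\<^sub>A \<phi> a : I" using a VD_closed by blast
 moreover have "\<phi> a = \<zero>\<^sub>A [^]\<^sub>A n \<otimes>\<^sub>A (\<lambda>x\<in>carrier A. x) a"
 proof (rule VD_D[OF a algebra_R one_param _ _ \<phi>])
  show "classifies (p ^ r) G A U A U (\<lambda>x\<in>carrier A. x)" using id_hom by (auto simp: classifies_def)
 qed simp
 then have "\<phi> a = \<zero>\<^sub>A" using n a VD_closed by (simp add: R.nat_pow_zero)
 ultimately show "a : I" using a VD_closed by (simp add: R.minus_eq)
qed

subsection \<open>The reduced algebra\<close>

abbreviation Sg where "Sg \<equiv> reduced_degree p r G A U"

lemma Sg_eq: "Sg n = pr ` VD n"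
 by (simp add: reduced_degree_def pr_def)

lemma graded_algebra_S: "graded_algebra S Sg"
proof (intro graded_algebra.intro graded_algebra_axioms.intro algebra_S)
 note cl = VD_closed
 fix n m
 show "Sg n \<subseteq> carrier S" using cl by (auto simp: Sg_eq S_simps)
 show "\<one>\<^sub>S : Sg 0" using VD_one by (auto simp: Sg_eq S_simps)
 show "\<zero>\<^sub>S : Sg n" using VD_zero by (auto simp: Sg_eq S_simps)
 fix a b
 show "a \<otimes>\<^sub>S b : Sg (m + n)" if "a : Sg m" "b : Sg n"
  using that VD_mult by (auto simp: Sg_eq S_simps cl)
 show "a \<oplus>\<^sub>S b : Sg n" if "a : Sg n" "b : Sg n"
  using that VD_add by (auto simp: Sg_eq S_simps cl)
 show "s \<odot>\<^sub>S a : Sg n" if "a : Sg n" for s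
  using that VD_smult by (auto simp: Sg_eq S_simps cl)
qed

sublocale GA: graded_algebra S Sg by (rule graded_algebra_S)

definition u :: "'h => nat => 'a set" where "u f = (\<lambda>j\<in>{..<p ^ r}. pr (U f j))"

lemma u_eq: "j < p ^ r ==> u f j = pr (U f j)"
 by (simp add: u_def)

sublocale u: one_param G X c S p r u
proof (intro one_param.intro one_param_axioms.intro hopf_coords_axioms algebra_S p_pos)
 show "one_param_subgroup p r G S u"
  using one_param_map[OF algebra_S pr_hom] by (simp add: u_def[abs_def])
qed

lemma u_degree: "f : carrier G ==> j < p ^ r ==> u f j : Sg j"
 using VD_U by (auto simp: u_eq Sg_eq)

lemma positive_degree_in_prime:
 assumes P: "primeideal P S" and u: "!!f j. f : carrier G ==> 0 < j ==> j < p ^ r ==> u f j : P" and n: "n > 0"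
 shows "Sg n \<subseteq> P"
proof -
 interpret P: primeideal P S by fact
 let ?I = "{a \<in> carrier A. pr a : P}"
 have "ideal ?I A"
 proof (rule idealI)
  show "ring A" by (rule R.ring_axioms)
  show "subgroup ?I (add_monoid A)"
  proof (rule R.add.subgroupI)
   have "pr \<zero>\<^sub>A : P" using P.zero_closed by (simp add: S_simps)
   then show "?I \<noteq> {}" by blast
  next
   fix a assume a: "a : ?I"
   have "\<ominus>\<^sub>S (pr a) : P" using a P.a_inv_closed by simp
   moreover have "pr (\<ominus>\<^sub>A a) = \<ominus>\<^sub>S (pr a)"
    using a additive_minus[OF R.M.ag _ klin_additive[OF alg_hom_klin[OF pr_hom]]]
     cring.axioms(1)[OF cring_S] ring.is_abelian_group by blast
   ultimately show "\<ominus>\<^sub>A a : ?I" using a by simp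
  next
   fix a b assume "a : ?I" "b : ?I"
   then show "a \<oplus>\<^sub>A b : ?I" using P.a_closed[of "pr a" "pr b"] by (simp add: S_simps)
  qed auto
 next
  fix a x assume a: "a : ?I" and x: "x : carrier A"
  have "pr x : carrier S" using x by (simp add: S_simps)
  then show "x \<otimes>\<^sub>A a : ?I" "a \<otimes>\<^sub>A x : ?I"
   using a x P.I_l_closed[of "pr a" "pr x"] P.I_r_closed[of "pr a" "pr x"] by (auto simp: S_simps)
 qed
 then have "VD n \<subseteq> ?I" using n u by (intro VD_positive_in_ideal) (auto simp: u_eq)
 then show ?thesis by (auto simp: Sg_eq)
qed

text \<open>
 If all \<open>u g (p^l)\<close> with \<open>l < i\<close> vanish modulo \<open>P\<close>, then so do all \<open>u g j\<close> with \<open>j\<close> not a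
 multiple of \<open>p^i\<close>: such a \<open>j\<close> is a power of \<open>p\<close>, or \<open>j = a + b\<close> with \<open>a, b < j\<close> and
 \<open>j choose a\<close> prime to \<open>p\<close>.
\<close>

lemma nonmultiples_in_prime:
 assumes P: "primeideal P S" and small: "!!g l. g : carrier G ==> l < i ==> u g (p ^ l) : P" and i: "i \<le> r"
  and g: "g : carrier G" and j: "j < p ^ r" "\<not> p ^ i dvd j"
 shows "u g j : P"
 using g j
proof (induction j arbitrary: g rule: less_induct)
 case (less j)
 interpret P: primeideal P S by fact
 have j0: "j > 0" using less.prems(3) by (cases j) auto
 obtain l m where lm: "j = p ^ l * m" "\<not> p dvd m"
  using prime_power_canonical[OF prime_p j0] by (metis mult.commute)
 have m0: "m > 0" using j0 lm by (cases m) auto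
 have li: "l < i" using less.prems(3) lm by (metis dvd_triv_left dvd_trans le_imp_power_dvd not_less)
 show ?case
 proof (cases "m = 1")
  case True
  then show ?thesis using small[OF less.prems(1) li] lm by simp
 next
  case False
  let ?a = "p ^ l"
  define bb where "bb = p ^ l * (m - 1)"
  have ab: "?a + bb = j" using lm m0 unfolding bb_def by (cases m) auto
  have pos: "?a > 0" "bb > 0" using p_pos False m0 by (auto simp: bb_def)
  have small': "?a < j" "bb < j" using ab pos by linarith+
  have q: "?a < p ^ r" "bb < p ^ r" using small' less.prems(2) by linarith+
  have na: "\<not> p ^ i dvd ?a" using li p_pos prime_gt_1_nat[OF prime_p]
   by (meson dvd_imp_le linorder_not_less power_strict_increasing zero_less_power)
  have Ia: "u f ?a : P" if "f : carrier G" for f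
   using less.IH[OF small'(1) that q(1) na] .
  have "(\<lambda>a b. u a ?a \<otimes>\<^sub>S u b bb) v w : P" if "v : carrier G" "w : carrier G" for v w
   using Ia[OF that(1)] that q by (simp add: P.I_r_closed)
  note vals = this
  interpret t: tensor_bilin G G S "\<lambda>a b. u a ?a \<otimes>\<^sub>S u b bb" by (rule u.nu_bilin[OF q])
  have "tensor_lift S (\<lambda>a b. u a ?a \<otimes>\<^sub>S u b bb) Z : P" if "Z : carrier (tensor G G)" for Z
   using that
  proof (induction rule: GG.tensor_induct)
   case (tens v w)
   then show ?case using vals by (simp add: t.lift_tens)
  next
   case (add Y Z)
   then show ?case using klin_add[OF t.lift_klin] by simp
  qed
  from this[of "comult G g"] have "of_nat (j choose ?a) \<odot>\<^sub>S u g j : P"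
   using u.nu_comult[OF less.prems(1) q] less.prems(1,2) ab by simp
  moreover have "(of_nat (j choose ?a) :: 'k) = of_nat m"
   using binomial_leading_digit[OF char p_pos, of 0 l m] p_pos lm(1) by (simp add: mult.commute)
  moreover have m_nz: "(of_nat m :: 'k) \<noteq> 0" using lm(2) char by (simp add: of_nat_eq_0_iff_char_dvd)
  ultimately have *: "of_nat m \<odot>\<^sub>S u g j : P" by simp
  have cl: "u g j : carrier S" using less.prems by simp
  have "(1 / of_nat m) \<odot>\<^sub>S (of_nat m \<odot>\<^sub>S u g j) = u g j"
   using GA.smult_assoc1[of "1 / of_nat m" "of_nat m" "u g j"] cl m_nz GA.smult_one[of "u g j"] by simp
  moreover have "(1 / of_nat m) \<odot>\<^sub>S x : P" if "x : P" for x
   using smult_eq_mult_one[OF algebra_S, of x "1 / of_nat m"] that P.a_Hcarr[OF that]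
    P.I_l_closed[OF that, of "(1 / of_nat m) \<odot>\<^sub>S \<one>\<^sub>S"] GA.smult_closed by simp
  ultimately show ?thesis using * by metis
 qed
qed

text \<open>
 Otherwise all coefficients of positive degree lie in \<open>P\<close>, by \<open>nonmultiples_in_prime\<close> at the top level
 \<open>r\<close>, and then so does the irrelevant ideal.
\<close>

lemma exists_minimal_level:
 assumes P: "P : Proj S Sg"
 obtains i f where "i < r" "f : carrier G" "u f (p ^ i) \<notin> P"
  "!!g l. g : carrier G ==> l < i ==> u g (p ^ l) : P"
proof -
 have prime: "primeideal P S" using P by (rule Proj_prime)
 define Bad where "Bad i \<longleftrightarrow> i < r \<and> (\<exists>f\<in>carrier G. u f (p ^ i) \<notin> P)" for i
 have "\<exists>i. Bad i"
 proof (rule ccontr)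
  assume "\<not> (\<exists>i. Bad i)"
  then have small: "u g (p ^ l) : P" if "g : carrier G" "l < r" for g l
   using that by (auto simp: Bad_def)
  have "u f j : P" if "f : carrier G" "0 < j" "j < p ^ r" for f j
   using nonmultiples_in_prime[OF prime small order_refl that(1,3)] that dvd_imp_le by fastforce
  then have "Sg n \<subseteq> P" if "n > 0" for n using positive_degree_in_prime[OF prime] that by blast
  then show False using P by (auto simp: Proj_def)
 qed
 then obtain i where i: "Bad i" "!!l. l < i ==> \<not> Bad l" using exists_least_iff[of Bad] by blast
 then obtain f where f: "f : carrier G" "u f (p ^ i) \<notin> P" by (auto simp: Bad_def)
 have "u g (p ^ l) : P" if "g : carrier G" "l < i" for g l
  using i(2)[OF that(2)] i(1) that by (auto simp: Bad_def)
 with i(1) f show thesis by (intro that[of i f]) (auto simp: Bad_def)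
qed

text \<open>
 A power of \<open>u f (p ^ i)\<close> as in \<open>exists_minimal_level\<close> will do, since its degree \<open>p ^ i\<close> divides \<open>p ^ (r - 1)\<close>.
\<close>

lemma exists_degree_outside:
 assumes P: "P : Proj S Sg"
 shows "\<exists>g. g : Sg (p ^ (r - 1)) - P"
proof -
 interpret P: primeideal P S using P by (rule Proj_prime)
 obtain i f where i: "i < r" "f : carrier G" "u f (p ^ i) \<notin> P" using exists_minimal_level[OF P] .
 have q: "p ^ i < p ^ r" using i prime_gt_1_nat[OF prime_p] by simp
 have deg: "x [^]\<^sub>S (n::nat) : Sg (n * m)" if "x : Sg m" for x n m
 proof (induction n)
  case 0
  then show ?case using GA.Sg_one by simp
 next
  case (Suc n)
  then show ?case using GA.Sg_mult[OF Suc that] by (simp add: add.commute)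
 qed
 have "u f (p ^ i) [^]\<^sub>S (p ^ (r - 1 - i)) : Sg (p ^ (r - 1 - i) * p ^ i)"
  by (rule deg[OF u_degree[OF i(2) q]])
 also have "p ^ (r - 1 - i) * p ^ i = p ^ (r - 1)" using i by (simp add: power_add[symmetric])
 finally show ?thesis using P.notin_pow[of "u f (p ^ i)"] i q by auto
qed

end

section \<open>The operator \<open>\<Theta>\<close>\<close>

lemma (in module) finsum_smult_rdistr:
 assumes "f : I \<rightarrow> carrier R" "x : carrier M"
 shows "(\<Oplus>\<^sub>R i\<in>I. f i) \<odot>\<^sub>M x = (\<Oplus>\<^sub>M i\<in>I. f i \<odot>\<^sub>M x)"
proof (rule additive_finsum[OF R.ag M.ag _ assms(1)])
 show "additive R M (\<lambda>a. a \<odot>\<^sub>M x)" using assms(2) by (auto simp: additive_def smult_l_distr)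
qed

context representing
begin

abbreviation "FF \<equiv> GA.FF"
abbreviation "FG \<equiv> GA.FG"
abbreviation "tmap \<equiv> GA.tmap"

abbreviation e where "e \<equiv> p ^ (r - 1)"

lemma e_less: "e < p ^ r"
 using r_pos prime_gt_1_nat[OF prime_p] by (intro power_strict_increasing) auto

lemma e_p: "p * e = p ^ r"
 using r_pos by (cases r) auto

lemma e_pos: "e > 0"
 using p_pos by simp

text \<open>
 \<open>\<Theta>\<close> is characterized by its values at functions; expanding a function in the coordinates of \<open>k[G]\<close>
 turns this into a formula.
\<close>

lemma Theta_eq: "Theta p r G A U = (\<Oplus>\<^sub>(tensor A B)x\<in>X. tens A B (U x e) (c x))"
proof -
 interpret AB: tensor_pair A B by (rule tensor_pairI[OF vspace_R vspace_B])
 interpret T: abelian_group "tensor A B" by (rule AB.abelian_group_tensor)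
 let ?Z = "\<Oplus>\<^sub>(tensor A B)x\<in>X. tens A B (U x e) (c x)"
 have cl: "tens A B (U x e) (c x) : carrier (tensor A B)" if "x : X" for x
  using that e_less by (intro AB.tens_closed) auto
 have bil: "tensor_bilin A B A (\<lambda>a \<alpha>. \<alpha> f \<odot>\<^sub>A a)" if f: "f : carrier G" for f
 proof (intro tensor_bilinI vspace_R vspace_B)
  have "s \<odot>\<^sub>A (t \<odot>\<^sub>A a) = t \<odot>\<^sub>A (s \<odot>\<^sub>A a)" if "a : carrier A" for s t a
   using R.smult_assoc1[of s t a] R.smult_assoc1[of t s a] that by (simp add: mult.commute)
  then show "bilin A B A (\<lambda>a \<alpha>. \<alpha> f \<odot>\<^sub>A a)"
   using f R.smult_closed R.smult_l_distr[simplified] R.smult_assoc1[simplified] unfolding bilin_def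
   by (auto intro!: klinI simp: R.smult_r_distr B_simps(2,3))
 qed
 show ?thesis
  unfolding Theta_def
 proof (rule the_equality)
  have "tensor_lift A (\<lambda>a \<alpha>. \<alpha> f \<odot>\<^sub>A a) ?Z = U f e" if f: "f : carrier G" for f
  proof -
   interpret b: tensor_bilin A B A "\<lambda>a \<alpha>. \<alpha> f \<odot>\<^sub>A a" by (rule bil[OF f])
   have "tensor_lift A (\<lambda>a \<alpha>. \<alpha> f \<odot>\<^sub>A a) ?Z = (\<Oplus>\<^sub>A x\<in>X. tensor_lift A (\<lambda>a \<alpha>. \<alpha> f \<odot>\<^sub>A a) (tens A B (U x e) (c x)))"
    using cl by (intro additive_finsum[OF T.ag R.M.ag klin_additive[OF b.lift_klin]]) auto
   also have "... = (\<Oplus>\<^sub>A x\<in>X. c x f \<odot>\<^sub>A U x e)"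
    using e_less R.smult_closed by (intro R.M.finsum_cong' refl) (auto simp: b.lift_tens)
   also have "... = U f e" using klin_expand[OF vspace_R nu_klin[OF e_less] f] by simp
   finally show ?thesis .
  qed
  then show "?Z : carrier (tensor A B) \<and>
   (\<forall>f\<in>carrier G. tensor_lift A (\<lambda>a \<alpha>. \<alpha> f \<odot>\<^sub>A a) ?Z = dual_u p r (U f))"
   using cl by (auto simp: dual_u_def intro!: T.finsum_closed)
 next
  fix Z assume Z: "Z : carrier (tensor A B) \<and>
   (\<forall>f\<in>carrier G. tensor_lift A (\<lambda>a \<alpha>. \<alpha> f \<odot>\<^sub>A a) Z = dual_u p r (U f))"
  have lk: "klin (tensor A B) A (tensor_lift A (\<lambda>a \<alpha>. \<alpha> x \<odot>\<^sub>A a))" if "x : X" for x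
   using tensor_bilin.lift_klin[OF bil] that by simp
  have "Z = (\<Oplus>\<^sub>(tensor A B)x\<in>X. tens A B (tensor_lift A (\<lambda>a \<alpha>. \<alpha> x \<odot>\<^sub>A a) Z) (c x))"
  proof (rule AB.tensor_ext[OF T.ag, where X = Z])
   show "additive (tensor A B) (tensor A B) (\<lambda>Z. Z)" by (simp add: additive_def)
   show "additive (tensor A B) (tensor A B) (\<lambda>Z. \<Oplus>\<^sub>(tensor A B)x\<in>X. tens A B (tensor_lift A (\<lambda>a \<alpha>. \<alpha> x \<odot>\<^sub>A a) Z) (c x))"
   proof (rule T.additive_finsum_maps[OF T.ag])
    fix x assume x: "x : X"
    have "klin A (tensor A B) (\<lambda>a. tens A B a (c x))" using AB.bilin_tens x by (simp add: bilin_def)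
    from klin_additive[OF klin_compose[OF lk[OF x] this]]
    show "additive (tensor A B) (tensor A B) (\<lambda>Z. tens A B (tensor_lift A (\<lambda>a \<alpha>. \<alpha> x \<odot>\<^sub>A a) Z) (c x))" .
   qed
   fix a \<alpha> assume a: "a : carrier A" "\<alpha> : carrier B"
   have "klin B (tensor A B) (tens A B a)" using AB.bilin_tens a by (simp add: bilin_def)
   from klin_B_expand[OF AB.vspace_tensor this a(2)]
   have "tens A B a \<alpha> = (\<Oplus>\<^sub>(tensor A B)x\<in>X. \<alpha> x \<odot>\<^sub>(tensor A B) tens A B a (c x))" .
   also have "... = (\<Oplus>\<^sub>(tensor A B)x\<in>X. tens A B (tensor_lift A (\<lambda>a \<alpha>. \<alpha> x \<odot>\<^sub>A a) (tens A B a \<alpha>)) (c x))"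
    using a R.smult_closed
    by (intro T.finsum_cong' refl) (auto simp: tensor_bilin.lift_tens[OF bil] AB.tens_smult_left intro!: AB.tens_closed)
   finally show "tens A B a \<alpha> = (\<Oplus>\<^sub>(tensor A B)x\<in>X. tens A B (tensor_lift A (\<lambda>a \<alpha>. \<alpha> x \<odot>\<^sub>A a) (tens A B a \<alpha>)) (c x))" .
  qed (use Z in simp)
  also have "... = ?Z"
   using Z cl by (intro T.finsum_cong' refl) (auto simp: dual_u_def)
  finally show "Z = ?Z" .
 qed
qed

subsection \<open>Operators \<open>\<Sum> u\<^sub>x \<otimes> \<phi>(c\<^sub>x)\<close>\<close>

definition lin_family :: "('k, 'b, 'm) bmod => ('k, 'd, 'n) bmod => (('h => 'k) => 'm => 'n) => bool" where
 "lin_family M N \<phi> \<longleftrightarrow> (\<forall>\<alpha>\<in>carrier B. klin M N (\<phi> \<alpha>)) \<and> (\<forall>m\<in>carrier M. klin B N (\<lambda>\<alpha>. \<phi> \<alpha> m))"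

text \<open>
 The universal subgroup sends the element of the group algebra dual to \<open>t^j\<close> to \<open>\<Sum> u x j \<otimes> c x\<close>, and
 \<open>\<phi>\<close> lets its second components act. The action of \<open>\<Theta>\<close> is the case \<open>j = e\<close>; multiplication by
 coefficients of functions is another one.
\<close>

definition op :: "nat => ('k, 'b, 'm) bmod => ('k, 'd, 'n) bmod => (('h => 'k) => 'm => 'n) =>
  (('a set \<times> 'm) \<Rightarrow>\<^sub>0 'k) set => (('a set \<times> 'n) \<Rightarrow>\<^sub>0 'k) set" where
 "op j M N \<phi> z = (\<Oplus>\<^sub>(FF N)x\<in>X. u x j \<odot>\<^sub>(FF N) tmap M N (\<phi> (c x)) z)"

lemma lin_family_klin: "lin_family M N \<phi> ==> \<alpha> : carrier B ==> klin M N (\<phi> \<alpha>)"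
 by (simp add: lin_family_def)

lemma lin_family_klin': "lin_family M N \<phi> ==> m : carrier M ==> klin B N (\<lambda>\<alpha>. \<phi> \<alpha> m)"
 by (simp add: lin_family_def)

context
 fixes M :: "('k, 'b, 'm) bmod" and N :: "('k, 'd, 'n) bmod" and \<phi>
 assumes M: "vspace M" and N: "vspace N" and fam: "lin_family M N \<phi>"
begin

interpretation N: module S "FF N" by (rule GA.module_FF[OF N])

lemma op_summand:
 assumes "x : X" "j < p ^ r"
 shows "additive (FF M) (FF N) (\<lambda>z. u x j \<odot>\<^sub>(FF N) tmap M N (\<phi> (c x)) z)"
 using assms by (intro GA.additive_comp[OF GA.tmap_additive GA.smult_additive] M N lin_family_klin[OF fam]) auto

lemma op_additive: "j < p ^ r ==> additive (FF M) (FF N) (op j M N \<phi>)"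
 unfolding op_def[abs_def]
 by (rule N.M.additive_finsum_maps[OF GA.abelian_group_FF[OF M]]) (rule op_summand)

lemma op_closed: "j < p ^ r ==> z : carrier (tensor S M) ==> op j M N \<phi> z : carrier (tensor S N)"
 using op_additive[of j] by (auto simp: additive_def)

lemma op_summand_closed: "x : X ==> j < p ^ r ==> z : carrier (tensor S M) ==>
  u x j \<odot>\<^sub>(FF N) tmap M N (\<phi> (c x)) z : carrier (FF N)"
 using op_summand[of x j] by (auto simp: additive_def)

lemma op_smult:
 assumes "j < p ^ r" "a : carrier S" "z : carrier (tensor S M)"
 shows "op j M N \<phi> (a \<odot>\<^sub>(FF M) z) = a \<odot>\<^sub>(FF N) op j M N \<phi> z"
proof -
 have "a \<odot>\<^sub>(FF N) op j M N \<phi> z = (\<Oplus>\<^sub>(FF N)x\<in>X. a \<odot>\<^sub>(FF N) (u x j \<odot>\<^sub>(FF N) tmap M N (\<phi> (c x)) z))"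
  unfolding op_def using assms op_summand_closed by (intro N.finsum_smult_ldistr) auto
 also have "... = op j M N \<phi> (a \<odot>\<^sub>(FF M) z)"
  unfolding op_def
 proof (intro N.M.finsum_cong' refl funcsetI)
  fix x assume x: "x : X"
  have t: "tmap M N (\<phi> (c x)) z : carrier (FF N)"
   using GA.tmap_closed[OF M N lin_family_klin[OF fam]] x assms by simp
  show "a \<odot>\<^sub>(FF N) (u x j \<odot>\<^sub>(FF N) tmap M N (\<phi> (c x)) z) =
    u x j \<odot>\<^sub>(FF N) tmap M N (\<phi> (c x)) (a \<odot>\<^sub>(FF M) z)"
   using x assms t GA.tmap_smult[OF M N lin_family_klin[OF fam]]
   by (simp add: N.smult_assoc1[symmetric] GA.m_comm)
  show "u x j \<odot>\<^sub>(FF N) tmap M N (\<phi> (c x)) (a \<odot>\<^sub>(FF M) z) : carrier (FF N)"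
   using x assms module.smult_closed[OF GA.module_FF[OF M]] by (intro op_summand_closed) auto
 qed
 finally show ?thesis by simp
qed

lemma FG_finsum: "(!!x. x : I ==> f x : FG N i) ==> (\<Oplus>\<^sub>(FF N)x\<in>I. f x) : FG N i"
proof (induction I rule: infinite_finite_induct)
 case (insert x F)
 then have "f : insert x F \<rightarrow> carrier (FF N)" using GA.FG_sub[OF N] by blast
 then have "(\<Oplus>\<^sub>(FF N)x\<in>insert x F. f x) = f x \<oplus>\<^sub>(FF N) (\<Oplus>\<^sub>(FF N)x\<in>F. f x)"
  using insert by (intro N.M.finsum_insert) auto
 moreover have "(\<Oplus>\<^sub>(FF N)x\<in>F. f x) : FG N i" "f x : FG N i" using insert by auto
 ultimately show ?case using GA.FG_add[OF N] by metis
qed (use GA.FG_zero[OF N] N.M.finsum_infinite in auto)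

lemma op_degree:
 assumes "j < p ^ r" "z : FG M i"
 shows "op j M N \<phi> z : FG N (int j + i)"
 unfolding op_def using assms
 by (intro FG_finsum GA.FG_smult[OF N] u_degree GA.tmap_degree M N lin_family_klin[OF fam]) auto

lemma op_tens:
 assumes "j < p ^ r" "s : carrier S" "m : carrier M"
 shows "op j M N \<phi> (tens S M s m) = (\<Oplus>\<^sub>(FF N)x\<in>X. tens S N (u x j \<otimes>\<^sub>S s) (\<phi> (c x) m))"
 unfolding op_def
proof (intro N.M.finsum_cong' refl funcsetI)
 fix x assume x: "x : X"
 note k = lin_family_klin[OF fam c_closed[OF x]]
 show "u x j \<odot>\<^sub>(FF N) tmap M N (\<phi> (c x)) (tens S M s m) = tens S N (u x j \<otimes>\<^sub>S s) (\<phi> (c x) m)"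
  using assms x klin_closed[OF k] by (simp add: GA.tmap_tens[OF M N k] GA.smult_tens[OF N])
 show "tens S N (u x j \<otimes>\<^sub>S s) (\<phi> (c x) m) : carrier (FF N)"
  using assms x klin_closed[OF k] by (intro GA.tens_closed_FF[OF N]) auto
qed

end

text \<open>This is the part of the module structure that makes \<open>\<Theta>\<close> act as an operator \<open>op\<close>.\<close>

definition kG_action :: "('k, 'h => 'k, 'm) bmod => bool" where
 "kG_action M \<longleftrightarrow> vspace M \<and> lin_family M M (act M) \<and>
   (\<forall>\<alpha>\<in>carrier B. \<forall>\<beta>\<in>carrier B. \<forall>m\<in>carrier M. act M (\<alpha> \<otimes>\<^sub>B \<beta>) m = act M \<alpha> (act M \<beta> m))"

lemma fd_module_kG_action: "fd_module B M ==> kG_action M"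
 unfolding fd_module_def kG_action_def vspace_def lin_family_def by (auto intro!: klinI)

lemma kG_action_family: "kG_action M ==> lin_family M M (act M)"
 and kG_action_vspace: "kG_action M ==> vspace M"
 by (auto simp: kG_action_def)

abbreviation Th where "Th M \<equiv> Theta_act p r G A U M"

lemma Th_eq_op:
 assumes M: "kG_action M" and z: "z : carrier (tensor S M)"
 shows "Th M z = op e M M (act M) z"
proof -
 note vM = kG_action_vspace[OF M] and fM = kG_action_family[OF M]
 interpret AB: tensor_pair A B by (rule tensor_pairI[OF vspace_R vspace_B])
 interpret TAB: abelian_group "tensor A B" by (rule AB.abelian_group_tensor)
 interpret SM: tensor_pair S M by (rule GA.pair[OF vM])
 interpret M: module S "FF M" by (rule GA.module_FF[OF vM])
 let ?\<beta> = "\<lambda>s m. tensor_lift (tensor S M) (\<lambda>a \<alpha>. tens S M ((nil +>\<^sub>A a) \<otimes>\<^sub>S s) (act M \<alpha> m)) (Theta p r G A U)"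
 let ?\<gamma> = "\<lambda>s m. op e M M (act M) (tens S M s m)"
 have op_klin: "klin (tensor S M) (tensor S M) (op e M M (act M))"
 proof (rule klinI)
  fix a z assume z: "z : carrier (tensor S M)"
  show "op e M M (act M) (a \<odot>\<^sub>(tensor S M) z) = a \<odot>\<^sub>(tensor S M) op e M M (act M) z"
   unfolding GA.scalar_smult[OF vM z] GA.scalar_smult[OF vM op_closed[OF vM vM fM e_less z]]
   using z GA.smult_closed by (intro op_smult[OF vM vM fM e_less]) auto
 qed (use op_additive[OF vM vM fM e_less] in "auto simp: additive_def")
 have bil: "tensor_bilin S M (tensor S M) ?\<gamma>"
 proof (intro tensor_bilinI GA.vspace_S vM SM.vspace_tensor)
  show "bilin S M (tensor S M) ?\<gamma>"
   unfolding bilin_def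
  proof (intro conjI ballI)
   fix s assume "s : carrier S"
   then have "klin M (tensor S M) (tens S M s)" using SM.bilin_tens by (simp add: bilin_def)
   from klin_compose[OF this op_klin] show "klin M (tensor S M) (?\<gamma> s)" .
  next
   fix m assume "m : carrier M"
   then have "klin S (tensor S M) (\<lambda>s. tens S M s m)" using SM.bilin_tens by (simp add: bilin_def)
   from klin_compose[OF this op_klin] show "klin S (tensor S M) (\<lambda>s. ?\<gamma> s m)" .
  qed
 qed
 have "?\<beta> s m = ?\<gamma> s m" if sm: "s : carrier S" "m : carrier M" for s m
 proof -
  have prc: "pr a : carrier S" if "a : carrier A" for a using that by (simp add: S_simps)
  have b2: "tensor_bilin A B (tensor S M) (\<lambda>a \<alpha>. tens S M ((nil +>\<^sub>A a) \<otimes>\<^sub>S s) (act M \<alpha> m))"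
  proof (intro tensor_bilinI vspace_R vspace_B SM.vspace_tensor)
   have 1: "klin A S (\<lambda>a. pr a \<otimes>\<^sub>S s)"
    using sm by (auto intro!: klinI simp: prc S_simps(4,6)[symmetric] GA.l_distr GA.smult_assoc2[simplified])
   have 2: "klin B M (\<lambda>\<alpha>. act M \<alpha> m)" by (rule lin_family_klin'[OF fM sm(2)])
   have 3: "klin A (tensor S M) (\<lambda>a. tens S M (pr a \<otimes>\<^sub>S s) m')" if "m' : carrier M" for m'
    using klin_compose[OF 1] SM.bilin_tens that by (auto simp: bilin_def)
   have 4: "klin B (tensor S M) (\<lambda>\<alpha>. tens S M s' (act M \<alpha> m))" if "s' : carrier S" for s'
    using klin_compose[OF 2] SM.bilin_tens that by (auto simp: bilin_def)
   show "bilin A B (tensor S M) (\<lambda>a \<alpha>. tens S M ((nil +>\<^sub>A a) \<otimes>\<^sub>S s) (act M \<alpha> m))"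
    using 3[OF klin_closed[OF 2]] 4[OF klin_closed[OF 1]] unfolding pr_def[symmetric] by (auto simp: bilin_def)
  qed
  have cl: "tens A B (U x e) (c x) : carrier (tensor A B)" if "x : X" for x
   using that e_less by (intro AB.tens_closed) auto
  have "?\<beta> s m = (\<Oplus>\<^sub>(tensor S M)x\<in>X. tensor_lift (tensor S M) (\<lambda>a \<alpha>. tens S M ((nil +>\<^sub>A a) \<otimes>\<^sub>S s) (act M \<alpha> m)) (tens A B (U x e) (c x)))"
   unfolding Theta_eq using cl
   by (intro additive_finsum[OF TAB.ag SM.abelian_group_tensor klin_additive[OF tensor_bilin.lift_klin[OF b2]]]) auto
  also have "... = (\<Oplus>\<^sub>(tensor S M)x\<in>X. tens S M (u x e \<otimes>\<^sub>S s) (act M (c x) m))"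
  proof (intro abelian_monoid.finsum_cong'[OF abelian_group.axioms(1)[OF SM.abelian_group_tensor]] refl funcsetI)
   fix x assume x: "x : X"
   show "tensor_lift (tensor S M) (\<lambda>a \<alpha>. tens S M ((nil +>\<^sub>A a) \<otimes>\<^sub>S s) (act M \<alpha> m)) (tens A B (U x e) (c x)) =
    tens S M (u x e \<otimes>\<^sub>S s) (act M (c x) m)"
    using x e_less tensor_bilin.lift_tens[OF b2, of "U x e" "c x"] by (simp add: u_eq pr_def)
   show "tens S M (u x e \<otimes>\<^sub>S s) (act M (c x) m) : carrier (tensor S M)"
    using x e_less sm klin_closed[OF lin_family_klin[OF fM]] by (intro SM.tens_closed) auto
  qed
  also have "... = (\<Oplus>\<^sub>(FF M)x\<in>X. tens S M (u x e \<otimes>\<^sub>S s) (act M (c x) m))"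
   using e_less sm klin_closed[OF lin_family_klin[OF fM]] by (intro GA.finsum_FF vM) (auto simp: SM.tens_closed)
  also have "... = ?\<gamma> s m" by (rule op_tens[OF vM vM fM e_less sm, symmetric])
  finally show ?thesis .
 qed
 then have "tensor_lift (tensor S M) ?\<beta> z = tensor_lift (tensor S M) ?\<gamma> z"
  using z by (intro tensor_bilin.lift_cong[OF bil]) auto
 also have "... = op e M M (act M) z"
 proof (rule SM.tensor_ext[OF SM.abelian_group_tensor klin_additive[OF tensor_bilin.lift_klin[OF bil]] klin_additive[OF op_klin] _ z])
 qed (rule tensor_bilin.lift_tens[OF bil])
 finally show ?thesis by (simp add: Theta_act_def Let_def)
qed

end

section \<open>Lifting exactness from the residue field\<close>

lemma (in abelian_group) additive_add_pow:
 assumes "abelian_group H" "additive G H h" "x : carrier G"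
 shows "h (add_pow G (n::nat) x) = add_pow H n (h x)"
proof -
 interpret H: abelian_group H by fact
 show ?thesis
 proof (induction n)
  case 0
  then show ?case using additive_zero[OF ag assms(1,2)] by simp
 next
  case (Suc n)
  have "add_pow G n x : carrier G" using assms(3) by simp
  with Suc assms(2,3) show ?case
   by (simp add: additive_def)
 qed
qed

lemma (in abelian_group) diff_diff_cancel:
 assumes "x : carrier G" "y : carrier G" "z : carrier G"
 shows "(x \<ominus> y) \<ominus> (z \<ominus> y) = x \<ominus> z"
proof -
 have "(x \<ominus> y) \<ominus> (z \<ominus> y) = x \<oplus> (\<ominus> z \<oplus> (\<ominus> y \<oplus> y))"
  using assms by (simp add: minus_eq minus_add a_assoc a_lcomm[of "\<ominus> y" "\<ominus> z" y] del: l_neg)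
 then show ?thesis using assms by (simp add: minus_eq l_neg)
qed

text \<open>
 Iterating \<open>x \<mapsto> L x + x R\<close> gives binomial sums; modulo a prime \<open>p\<close> only the outer terms survive.
 For \<open>R = - L\<close> this is the iterated commutator.
\<close>

primrec iter_bimult :: "('f, 'x) ring_scheme => ('f => 'f) => ('f => 'f) => ('f => 'f) => nat => 'f => 'f" where
 "iter_bimult F L R x 0 z = x z"
| "iter_bimult F L R x (Suc n) z = L (iter_bimult F L R x n z) \<oplus>\<^sub>F iter_bimult F L R x n (R z)"

lemma funpow_additive: "additive F F L ==> additive F F (L ^^ n)"
 by (induction n) (auto simp: additive_def Pi_iff)

lemma iter_bimult_additive:
 assumes F: "abelian_group F" and ad: "additive F F L" "additive F F R" "additive F F x"
 shows "additive F F (iter_bimult F L R x n)"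
proof (induction n)
 case 0
 then show ?case using ad(3) by (simp add: additive_def)
next
 case (Suc n)
 interpret abelian_group F by fact
 show ?case using Suc ad(1,2) unfolding additive_def
  by (auto simp: Pi_iff a_ac)
qed

lemma iter_bimult_binomial:
 assumes F: "abelian_group F" and ad: "additive F F L" "additive F F R" "additive F F x" and z: "z : carrier F"
 shows "iter_bimult F L R x n z = (\<Oplus>\<^sub>F b\<in>{..n}. add_pow F (n choose b) ((L ^^ (n - b)) (x ((R ^^ b) z))))"
 using z
proof (induction n arbitrary: z)
 case 0
 interpret abelian_group F by fact
 show ?case using ad(3) 0 by (simp add: additive_def Pi_iff)
next
 case (Suc n)
 interpret abelian_group F by fact
 have cl: "(L ^^ a) (x ((R ^^ b) y)) : carrier F" if "y : carrier F" for a b y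
  using that funpow_additive[OF ad(1), of a] funpow_additive[OF ad(2), of b] ad(3) by (auto simp: additive_def)
 have Rz: "R z : carrier F" using ad(2) Suc.prems by (auto simp: additive_def)
 define t where "t a b = (L ^^ a) (x ((R ^^ b) z))" for a b
 have t: "t a b : carrier F" for a b unfolding t_def by (rule cl[OF Suc.prems])
 have "L (iter_bimult F L R x n z) = (\<Oplus>\<^sub>F b\<in>{..n}. L (add_pow F (n choose b) (t (n - b) b)))"
  unfolding Suc.IH[OF Suc.prems] t_def
  using cl Suc.prems by (intro additive_finsum[OF F F ad(1)]) auto
 also have "... = (\<Oplus>\<^sub>F b\<in>{..n}. add_pow F (n choose b) (t (Suc n - b) b))"
  using t additive_add_pow[OF F ad(1)]
  by (intro finsum_cong' refl) (auto simp: t_def Suc_diff_le)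
 also have "... = (\<Oplus>\<^sub>F b\<in>{..Suc n}. add_pow F (n choose b) (t (Suc n - b) b))"
  using t by (subst finsum_Suc) (auto simp: binomial_eq_0)
 also have "... = (\<Oplus>\<^sub>F b\<in>{..n}. add_pow F (n choose Suc b) (t (n - b) (Suc b))) \<oplus>\<^sub>F t (Suc n) 0"
  using t by (subst finsum_Suc2) auto
 finally have 1: "L (iter_bimult F L R x n z) =
   (\<Oplus>\<^sub>F b\<in>{..n}. add_pow F (n choose Suc b) (t (n - b) (Suc b))) \<oplus>\<^sub>F t (Suc n) 0" .
 have 2: "iter_bimult F L R x n (R z) = (\<Oplus>\<^sub>F b\<in>{..n}. add_pow F (n choose b) (t (n - b) (Suc b)))"
  unfolding Suc.IH[OF Rz] t_def by (simp add: funpow_swap1)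
 have "(\<Oplus>\<^sub>F b\<in>{..Suc n}. add_pow F (Suc n choose b) (t (Suc n - b) b)) =
   (\<Oplus>\<^sub>F b\<in>{..n}. add_pow F (Suc n choose Suc b) (t (n - b) (Suc b))) \<oplus>\<^sub>F t (Suc n) 0"
  using t by (subst finsum_Suc2) auto
 also have "(\<Oplus>\<^sub>F b\<in>{..n}. add_pow F (Suc n choose Suc b) (t (n - b) (Suc b))) =
   (\<Oplus>\<^sub>F b\<in>{..n}. add_pow F (n choose b) (t (n - b) (Suc b)) \<oplus>\<^sub>F add_pow F (n choose Suc b) (t (n - b) (Suc b)))"
  using t by (intro finsum_cong' refl) (auto simp: add.nat_pow_mult[symmetric])
 also have "... = (\<Oplus>\<^sub>F b\<in>{..n}. add_pow F (n choose b) (t (n - b) (Suc b))) \<oplus>\<^sub>F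
   (\<Oplus>\<^sub>F b\<in>{..n}. add_pow F (n choose Suc b) (t (n - b) (Suc b)))"
  using t by (intro finsum_addf) auto
 finally show ?case
  using t unfolding iter_bimult.simps 1 2
  by (simp add: t_def[symmetric] a_ac Pi_iff)
qed

lemma iter_bimult_prime:
 assumes F: "abelian_group F" and ad: "additive F F L" "additive F F R" "additive F F x" and z: "z : carrier F"
  and p: "prime p" "!!y. y : carrier F ==> add_pow F p y = \<zero>\<^sub>F"
 shows "iter_bimult F L R x p z = (L ^^ p) (x z) \<oplus>\<^sub>F x ((R ^^ p) z)"
proof -
 interpret abelian_group F by fact
 let ?t = "\<lambda>b. (L ^^ (p - b)) (x ((R ^^ b) z))"
 have t: "?t b : carrier F" for b
  using z funpow_additive[OF ad(1), of "p - b"] funpow_additive[OF ad(2), of b] ad(3) by (auto simp: additive_def)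
 have t0: "?t 0 = (L ^^ p) (x z)" and tp: "?t p = x ((R ^^ p) z)" by simp_all
 have "iter_bimult F L R x p z = (\<Oplus>\<^sub>F b\<in>{..p}. if b = 0 \<or> b = p then ?t b else \<zero>\<^sub>F)"
  unfolding iter_bimult_binomial[OF F ad z]
 proof (intro finsum_cong' refl)
  show "(\<lambda>b. if b = 0 \<or> b = p then ?t b else \<zero>\<^sub>F) : {..p} \<rightarrow> carrier F" using t by auto
  fix b assume b: "b : {..p}"
  show "add_pow F (p choose b) (?t b) = (if b = 0 \<or> b = p then ?t b else \<zero>\<^sub>F)"
  proof (cases "b = 0 \<or> b = p")
   case True
   then show ?thesis using t[of 0] t[of p] by auto
  next
   case False
   then have "p dvd p choose b" using p(1) b by (intro dvd_choose_prime) auto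
   then obtain k where k: "p choose b = p * k" by (elim dvdE)
   show ?thesis unfolding k add.nat_pow_pow[OF t, symmetric] using False by (simp add: p(2)[OF t])
  qed
 qed
 also have "... = (\<Oplus>\<^sub>F b\<in>{0, p}. ?t b)"
  using t by (intro add.finprod_mono_neutral_cong_right) auto
 also have "... = ?t 0 \<oplus>\<^sub>F ?t p"
  using t t[of 0] t[of p] prime_gt_0_nat[OF p(1)] by (subst finsum_insert) auto
 finally show ?thesis unfolding t0 tp .
qed

locale residual = graded_operator_at S F Sg Fg T e P
 for S :: "('s, 'x) ring_scheme" and F :: "('s, 'f) module" (structure) and Sg Fg T e P +
 fixes I :: "'i set" and y :: "'i => 'f" and k :: "'i => 'f => 's"
 assumes Sg_add: "a : Sg n ==> b : Sg n ==> a \<oplus>\<^sub>S b : Sg n"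
  and Sg_minus: "a : Sg n ==> \<ominus>\<^sub>S a : Sg n"
  and finite_I: "finite I"
  and y_degree: "i : I ==> y i : Fg 0"
  and k_additive: "i : I ==> additive F S (k i)"
  and k_smult: "i : I ==> a : carrier S ==> z : carrier F ==> k i (a \<odot> z) = a \<otimes>\<^sub>S k i z"
  and k_degree: "i : I ==> z : Fg (int n) ==> k i z : Sg n"
  and expand: "z : carrier F ==> (\<Oplus>i\<in>I. k i z \<odot> y i) = z"
begin

sublocale prim: primeideal P S by (rule prime)

lemma y_closed [simp]: "i : I ==> y i : carrier F" by (rule Fg_closed[OF y_degree])

lemma k_closed [simp]: "i : I ==> z : carrier F ==> k i z : carrier S"
 using k_additive by (auto simp: additive_def)

text \<open>
 As the \<open>y i\<close> generate \<open>F\<close> with linear coordinates \<open>k i\<close>, this is the submodule \<open>P F\<close>; congruence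
 modulo it stands for equality over the residue field.
\<close>

definition PF where "PF = {z \<in> carrier F. \<forall>i\<in>I. k i z : P}"

lemma PF_closed: "z : PF ==> z : carrier F" by (simp add: PF_def)

lemma PF_zero: "\<zero> : PF"
 using additive_zero[OF M.ag R.ag k_additive] prim.zero_closed by (auto simp: PF_def)

lemma PF_add: "z : PF ==> w : PF ==> z \<oplus> w : PF"
 using k_additive prim.a_closed by (auto simp: PF_def additive_def)

lemma PF_smult: "a : carrier S ==> z : PF ==> a \<odot> z : PF"
 by (auto simp: PF_def k_smult prim.I_l_closed)

lemma PF_minus: "z : PF ==> \<ominus> z : PF"
 using PF_smult[of "\<ominus>\<^sub>S \<one>\<^sub>S" z] PF_closed[of z] by (simp add: smult_l_minus)

lemma PF_diff: "z : PF ==> w : PF ==> z \<ominus> w : PF"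
 by (simp add: M.minus_eq PF_add PF_minus)

text \<open>
 Nakayama's lemma by elimination: if the generators \<open>y i\<close> lie in \<open>W\<close> up to the scalar \<open>c\<close> and
 combinations with coefficients in \<open>P\<close>, then up to a scalar outside \<open>P\<close> they lie in \<open>W\<close>. Keeping
 all coefficients homogeneous of the same degree makes the final scalar homogeneous.
\<close>

lemma elimination:
 assumes W: "!!n. \<zero> : W n" "!!n v w. v : W n ==> w : W n ==> v \<oplus> w : W n"
  "!!n m a w. a : Sg m ==> w : W n ==> a \<odot> w : W (m + n)" "!!n. W n \<subseteq> carrier F"
  and J: "finite J" "J \<subseteq> I" and c: "c : Sg a - P"
  and rel: "!!i. i : J ==> \<exists>w\<in>W a. \<exists>q. (\<forall>j\<in>J. q j : Sg a \<inter> P) \<and> c \<odot> y i = w \<oplus> (\<Oplus>j\<in>J. q j \<odot> y j)"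
 shows "\<exists>m. \<exists>d\<in>Sg m - P. \<forall>i\<in>J. d \<odot> y i : W m"
proof -
 define Z where "Z n J = {w \<oplus> (\<Oplus>j\<in>J. q j \<odot> y j) | w q. w : W n \<and> (\<forall>j\<in>J. q j : Sg n \<inter> P)}" for n J
 have Wc: "w : carrier F" if "w : W n" for w n using W(4) that by blast
 have qc: "(\<lambda>j. q j \<odot> y j) : J \<rightarrow> carrier F" if "\<forall>j\<in>J. q j : Sg n \<inter> P" "J \<subseteq> I" for q n J using that by auto
 note lc = M.finsum_closed[OF qc]
 have Z_closed: "z : carrier F" if "z : Z n J" "J \<subseteq> I" for z n J using that Wc by (auto simp: Z_def intro!: M.a_closed lc[of _ _ n])
 have Z_add: "z \<oplus> z' : Z n J" if z: "z : Z n J" "z' : Z n J" and J: "J \<subseteq> I" for z z' n J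
 proof -
  obtain w q w' q' where w: "w : W n" "w' : W n" and q: "\<forall>j\<in>J. q j : Sg n \<inter> P" "\<forall>j\<in>J. q' j : Sg n \<inter> P"
   and eq: "z = w \<oplus> (\<Oplus>j\<in>J. q j \<odot> y j)" "z' = w' \<oplus> (\<Oplus>j\<in>J. q' j \<odot> y j)" using z by (auto simp: Z_def)
  have "(\<Oplus>j\<in>J. (q j \<oplus>\<^sub>S q' j) \<odot> y j) = (\<Oplus>j\<in>J. q j \<odot> y j \<oplus> q' j \<odot> y j)"
   using q J by (intro M.finsum_cong' refl) (auto simp: smult_l_distr subset_iff)
  also have "... = (\<Oplus>j\<in>J. q j \<odot> y j) \<oplus> (\<Oplus>j\<in>J. q' j \<odot> y j)" by (rule M.finsum_addf[OF qc[OF q(1) J] qc[OF q(2) J]])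
  finally have "z \<oplus> z' = (w \<oplus> w') \<oplus> (\<Oplus>j\<in>J. (q j \<oplus>\<^sub>S q' j) \<odot> y j)"
   using w Wc lc[OF q(1) J] lc[OF q(2) J] by (simp add: eq M.a_ac)
  moreover have "\<forall>j\<in>J. q j \<oplus>\<^sub>S q' j : Sg n \<inter> P" using q by (auto intro: Sg_add)
  ultimately show ?thesis using W(2)[OF w] by (auto simp: Z_def)
 qed
 have push: "s \<odot> z : V" if z: "z : Z n J" and J: "finite J" "J \<subseteq> I" and s: "s : carrier S"
   and V: "!!w q. w : W n ==> \<forall>j\<in>J. q j : Sg n \<inter> P ==> s \<odot> w \<oplus> (\<Oplus>j\<in>J. (s \<otimes>\<^sub>S q j) \<odot> y j) : V" for z n J s V
 proof -
  obtain w q where w: "w : W n" and q: "\<forall>j\<in>J. q j : Sg n \<inter> P" and eq: "z = w \<oplus> (\<Oplus>j\<in>J. q j \<odot> y j)"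
   using z by (auto simp: Z_def)
  have "s \<odot> (\<Oplus>j\<in>J. q j \<odot> y j) = (\<Oplus>j\<in>J. (s \<otimes>\<^sub>S q j) \<odot> y j)"
   using q J s by (subst finsum_smult_ldistr) (auto simp: smult_assoc1 subset_iff intro!: M.finsum_cong')
  then show ?thesis using V[OF w q] s Wc[OF w] lc[OF q J(2)] by (simp add: eq smult_r_distr)
 qed
 have Z_smult: "s \<odot> z : Z (m + n) J" if "z : Z n J" "finite J" "J \<subseteq> I" "s : Sg m" for z m n J s
 proof (rule push[OF that(1-3)])
  fix w q assume w: "w : W n" and q: "\<forall>j\<in>J. q j : Sg n \<inter> P"
  have "\<forall>j\<in>J. s \<otimes>\<^sub>S q j : Sg (m + n) \<inter> P" using q that(4) by (auto intro!: Sg_mult prim.I_l_closed)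
  then show "s \<odot> w \<oplus> (\<Oplus>j\<in>J. (s \<otimes>\<^sub>S q j) \<odot> y j) : Z (m + n) J" using W(3)[OF that(4) w] by (auto simp: Z_def)
 qed (use that in simp)
 have split: "\<exists>q\<in>Sg n \<inter> P. \<exists>z'\<in>Z n J. z = q \<odot> y l \<oplus> z'"
  if z: "z : Z n (insert l J)" and J: "finite J" "l \<notin> J" "insert l J \<subseteq> I" for z n l J
 proof -
  obtain w q where w: "w : W n" and q: "\<forall>j\<in>insert l J. q j : Sg n \<inter> P"
   and eq: "z = w \<oplus> (\<Oplus>j\<in>insert l J. q j \<odot> y j)" using z by (auto simp: Z_def)
  have "(\<Oplus>j\<in>insert l J. q j \<odot> y j) = q l \<odot> y l \<oplus> (\<Oplus>j\<in>J. q j \<odot> y j)" using q J by (intro M.finsum_insert) auto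
  then have "z = q l \<odot> y l \<oplus> (w \<oplus> (\<Oplus>j\<in>J. q j \<odot> y j))"
   using q J Wc[OF w] lc[of J q n] by (simp add: eq M.a_lcomm)
  then show ?thesis using q w by (auto simp: Z_def)
 qed
 have "\<forall>i\<in>J. c \<odot> y i : Z a J" using rel unfolding Z_def by blast
 with J c show ?thesis
 proof (induction J arbitrary: c a rule: finite_induct)
  case empty
  then show ?case by blast
 next
  case (insert n J)
  have J: "J \<subseteq> I" "n : I" using insert.prems by auto
  have c [simp]: "c : carrier S" "c : Sg a" "c \<notin> P" using insert.prems by auto
  have step: "\<exists>q\<in>Sg a \<inter> P. \<exists>z'\<in>Z a J. c \<odot> y i = q \<odot> y n \<oplus> z'" if "i : insert n J" for i
   using split[OF _ insert.hyps insert.prems(1)] insert.prems(3) that by blast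
  obtain q z where q: "q : Sg a" "q : P" and z: "z : Z a J" and eq: "c \<odot> y n = q \<odot> y n \<oplus> z" using step by blast
  have [simp]: "q : carrier S" "z : carrier F" "y n : carrier F" using q Z_closed[OF z] J by auto
  let ?u = "c \<ominus>\<^sub>S q"
  have u: "?u : Sg a" using q by (simp add: R.minus_eq Sg_add Sg_minus)
  have u_P: "?u \<notin> P"
  proof
   assume "?u : P"
   then have "?u \<oplus>\<^sub>S q : P" using q by simp
   then show False by (simp add: R.minus_eq R.a_assoc R.l_neg)
  qed
  have "?u \<odot> y n = c \<odot> y n \<ominus> q \<odot> y n" by (simp add: R.minus_eq M.minus_eq smult_l_distr smult_l_minus)
  also have "... = z" unfolding eq by (simp add: M.minus_eq M.a_ac M.r_neg M.r_neg1 M.r_neg2)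
  finally have u_eq: "?u \<odot> y n = z" .
  have "\<exists>m. \<exists>d\<in>Sg m - P. \<forall>i\<in>J. d \<odot> y i : W m"
  proof (rule insert.IH[of "?u \<otimes>\<^sub>S c" "a + a"])
   show "?u \<otimes>\<^sub>S c : Sg (a + a) - P" using u u_P by (intro prod_notin) auto
   show "\<forall>i\<in>J. (?u \<otimes>\<^sub>S c) \<odot> y i : Z (a + a) J"
   proof
    fix i assume i: "i : J"
    obtain q' z' where q': "q' : Sg a" and z': "z' : Z a J" and eq': "c \<odot> y i = q' \<odot> y n \<oplus> z'" using step[of i] i by blast
    have [simp]: "q' : carrier S" "z' : carrier F" "y i : carrier F" using q' Z_closed[OF z'] J i by auto
    have "(?u \<otimes>\<^sub>S c) \<odot> y i = q' \<odot> z \<oplus> ?u \<odot> z'"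
     using smult_comm[of ?u q' "y n"] by (simp add: smult_assoc1 eq' smult_r_distr u_eq)
    then show "(?u \<otimes>\<^sub>S c) \<odot> y i : Z (a + a) J"
     using Z_add[OF Z_smult[OF z insert.hyps(1) J(1) q'] Z_smult[OF z' insert.hyps(1) J(1) u] J(1)] by simp
   qed
  qed (fact J(1))
  then obtain m d where d: "d : Sg m - P" "!!i. i : J ==> d \<odot> y i : W m" by blast
  have [simp]: "d : carrier S" using d by auto
  have dz: "d \<odot> z : W (a + m)"
  proof (rule push[OF z insert.hyps(1) J(1)])
   fix w q assume w: "w : W a" and q: "\<forall>j\<in>J. q j : Sg a \<inter> P"
   have "(\<Oplus>j\<in>K. (d \<otimes>\<^sub>S q j) \<odot> y j) : W (a + m)" if "finite K" "K \<subseteq> J" for K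
    using that
   proof (induction K rule: finite_induct)
    case (insert j K)
    have "(d \<otimes>\<^sub>S q j) \<odot> y j = q j \<odot> (d \<odot> y j)" using insert.prems q J by (auto simp: smult_assoc1 smult_comm[of d])
    then have "(d \<otimes>\<^sub>S q j) \<odot> y j : W (a + m)" using W(3)[OF _ d(2)] insert.prems q by auto
    moreover have "(\<lambda>j. (d \<otimes>\<^sub>S q j) \<odot> y j) : insert j K \<rightarrow> carrier F"
     using insert.prems q J by (auto simp: subset_iff)
    ultimately show ?case using insert W(2) by (subst M.finsum_insert) auto
   qed (simp add: W(1))
   from this[OF insert.hyps(1) subset_refl] show "d \<odot> w \<oplus> (\<Oplus>j\<in>J. (d \<otimes>\<^sub>S q j) \<odot> y j) : W (a + m)"
    using W(2) W(3)[of d m w a] w d(1) by (simp add: add.commute)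
  qed simp
  have "(?u \<otimes>\<^sub>S d) \<odot> y i : W (a + m)" if "i : insert n J" for i
  proof (cases "i = n")
   case True
   then show ?thesis using dz by (simp add: smult_assoc1 smult_comm[of ?u d] u_eq)
  next
   case False
   then show ?thesis using that d(2)[of i] J W(3)[OF u, of "d \<odot> y i" m] by (auto simp: smult_assoc1)
  qed
  moreover have "?u \<otimes>\<^sub>S d : Sg (a + m) - P" using u u_P d(1) by (intro prod_notin[of _ a _ m]) auto
  ultimately show ?case by blast
 qed
qed

definition endo :: "nat => ('f => 'f) => bool" where
 "endo a N \<longleftrightarrow> additive F F N \<and> (\<forall>s\<in>carrier S. \<forall>z\<in>carrier F. N (s \<odot> z) = s \<odot> N z) \<and>
   (\<forall>n. \<forall>z\<in>Fg (int n). N z : Fg (int (n + a)))"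

lemma endo_closed [simp]: "endo a N ==> z : carrier F ==> N z : carrier F"
 and endo_add: "endo a N ==> z : carrier F ==> w : carrier F ==> N (z \<oplus> w) = N z \<oplus> N w"
 and endo_smult: "endo a N ==> s : carrier S ==> z : carrier F ==> N (s \<odot> z) = s \<odot> N z"
 and endo_degree: "endo a N ==> z : Fg (int n) ==> N z : Fg (int (n + a))"
 and endo_additive: "endo a N ==> additive F F N"
 by (auto simp: endo_def additive_def)

lemma endo_zero: "endo a N ==> N \<zero> = \<zero>"
 using additive_zero[OF M.ag M.ag endo_additive] .

lemma endo_diff: "endo a N ==> z : carrier F ==> w : carrier F ==> N (z \<ominus> w) = N z \<ominus> N w"
 using additive_diff[OF M.ag M.ag endo_additive] .

lemma endo_comp: "endo a N ==> endo b N' ==> endo (a + b) (\<lambda>z. N (N' z))"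
 unfolding endo_def by (auto simp: additive_def Pi_iff) (metis add.assoc add.commute of_nat_add)

lemma endo_scale: "s : Sg b ==> endo a N ==> endo (a + b) (\<lambda>z. s \<odot> N z)"
 unfolding endo_def by (auto simp: additive_def Pi_iff smult_r_distr smult_comm intro!: Fg_smult')

lemma endo_plus: "endo a N ==> endo a N' ==> endo a (\<lambda>z. N z \<oplus> N' z)"
 unfolding endo_def by (auto simp: additive_def Pi_iff smult_r_distr M.a_ac intro!: Fg_add)

lemma endo_minus: "endo a N ==> endo a (\<lambda>z. \<ominus> N z)"
 unfolding endo_def by (auto simp: additive_def Pi_iff smult_r_minus M.minus_add intro!: Fg_minus)

lemma endo_id: "endo 0 (\<lambda>z. z)"
 by (auto simp: endo_def additive_def)

lemma endo_T: "endo e T"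
 using T_degree by (auto simp: endo_def T_additive T_smult algebra_simps)

lemma endo_expand:
 assumes "endo a N" "z : carrier F"
 shows "N z = (\<Oplus>i\<in>I. k i z \<odot> N (y i))"
proof -
 have "N z = N (\<Oplus>i\<in>I. k i z \<odot> y i)" using expand[OF assms(2)] by simp
 also have "... = (\<Oplus>i\<in>I. N (k i z \<odot> y i))"
  using assms by (intro additive_finsum[OF M.ag M.ag endo_additive[OF assms(1)]]) auto
 also have "... = (\<Oplus>i\<in>I. k i z \<odot> N (y i))"
  using assms by (intro M.finsum_cong' refl) (auto simp: endo_smult)
 finally show ?thesis .
qed

lemma Fg_finsum: "(!!i. i : K ==> f i : Fg l) ==> (\<Oplus>i\<in>K. f i) : Fg l"
proof (induction K rule: infinite_finite_induct)
 case (insert j K)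
 have "f : insert j K \<rightarrow> carrier F" using insert.prems Fg_sub by blast
 then have "(\<Oplus>i\<in>insert j K. f i) = f j \<oplus> (\<Oplus>i\<in>K. f i)"
  using insert by (intro M.finsum_insert) auto
 then show ?case using insert Fg_add by simp
qed (use Fg_zero M.finsum_infinite in auto)

text \<open>
 Nakayama's lemma for the image of \<open>N\<close>: up to scalars each generator has a preimage, and extending
 linearly by the coordinates gives an endomorphism.
\<close>

lemma right_inverse:
 assumes N: "endo a N" and N': "endo b N'" and c: "c : Sg (a + b) - P"
  and approx: "!!z. z : carrier F ==> c \<odot> z \<ominus> N (N' z) : PF"
 shows "\<exists>m d N''. d : Sg (a + m) - P \<and> endo m N'' \<and> (\<forall>z\<in>carrier F. N (N'' z) = d \<odot> z)"
proof -
 have [simp]: "c : carrier S" using c by auto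
 let ?W = "\<lambda>n. N ` Fg (int n - int a)"
 have "\<exists>m. \<exists>d\<in>Sg m - P. \<forall>i\<in>I. d \<odot> y i : ?W m"
 proof (rule elimination[OF _ _ _ _ finite_I subset_refl c])
  show "\<zero> : ?W n" for n using Fg_zero endo_zero[OF N] by (auto intro!: image_eqI[of _ _ "\<zero>"])
  show "v \<oplus> w : ?W n" if "v : ?W n" "w : ?W n" for n v w
   using that by (auto simp: endo_add[OF N, symmetric] intro!: imageI Fg_add)
  show "s \<odot> w : ?W (m + n)" if "s : Sg m" "w : ?W n" for n m s w
   using that by (auto simp: endo_smult[OF N, symmetric] intro!: imageI Fg_smult')
  show "?W n \<subseteq> carrier F" for n using N by auto
 next
  fix i assume i: "i : I"
  define q where "q j = k j (c \<odot> y i \<ominus> N (N' (y i)))" for j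
  have z: "c \<odot> y i \<ominus> N (N' (y i)) : PF" using i by (intro approx) auto
  have N'y: "N' (y i) : Fg (int b)" using endo_degree[OF N', of "y i" 0] y_degree[OF i] by simp
  then have NN: "N (N' (y i)) : Fg (int (a + b))" using endo_degree[OF N N'y] by (simp add: add.commute)
  have cy: "c \<odot> y i : Fg (int (a + b))" using Fg_smult'[OF _ y_degree[OF i], of c "a + b" "int (a + b)"] c by simp
  have "\<forall>j\<in>I. q j : Sg (a + b) \<inter> P"
   using z k_degree[OF _ Fg_diff[OF cy NN]] by (auto simp: q_def PF_def)
  moreover have "c \<odot> y i = N (N' (y i)) \<oplus> (\<Oplus>j\<in>I. q j \<odot> y j)"
   using expand[OF PF_closed[OF z]] Fg_closed[OF NN] Fg_closed[OF cy] unfolding q_def[symmetric]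
   by (simp add: M.minus_eq M.a_lcomm[of "N (N' (y i))" "c \<odot> y i"] M.r_neg)
  moreover have "N (N' (y i)) : ?W (a + b)" using N'y by simp
  ultimately show "\<exists>w\<in>?W (a + b). \<exists>q. (\<forall>j\<in>I. q j : Sg (a + b) \<inter> P) \<and>
    c \<odot> y i = w \<oplus> (\<Oplus>j\<in>I. q j \<odot> y j)" by blast
 qed
 then obtain m d where d: "d : Sg m - P" and dW: "\<forall>i\<in>I. \<exists>v. v : Fg (int m - int a) \<and> d \<odot> y i = N v" by blast
 then obtain v where v: "!!i. i : I ==> v i : Fg (int m - int a)" "!!i. i : I ==> d \<odot> y i = N (v i)"
  using bchoice[of I "\<lambda>i v. v : Fg (int m - int a) \<and> d \<odot> y i = N v"] by blast
 have [simp]: "d : carrier S" "i : I ==> v i : carrier F" for i using d Fg_closed[OF v(1)] by auto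
 \<comment> \<open>the factor \<open>c\<close> only makes the degree nonnegative\<close>
 let ?N = "\<lambda>z. \<Oplus>i\<in>I. k i z \<odot> (c \<odot> v i)"
 have cv: "c \<odot> v i : Fg (int (b + m))" if "i : I" for i
  using c by (intro Fg_smult'[OF _ v(1)[OF that]]) auto
 have "endo (b + m) ?N"
  unfolding endo_def
 proof (intro conjI ballI allI)
  show "additive F F ?N"
  proof (rule M.additive_finsum_maps[OF M.ag])
   fix i assume "i : I"
   then show "additive F F (\<lambda>z. k i z \<odot> (c \<odot> v i))"
    using k_additive[of i] by (auto simp: additive_def smult_l_distr)
  qed
 next
  fix s z assume "s : carrier S" "z : carrier F"
  then show "?N (s \<odot> z) = s \<odot> ?N z"
   using finite_I by (subst finsum_smult_ldistr) (auto simp: k_smult smult_assoc1 intro!: M.finsum_cong')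
 next
  fix n z assume z: "z : Fg (int n)"
  show "?N z : Fg (int (n + (b + m)))"
  proof (rule Fg_finsum)
   fix i assume i: "i : I"
   show "k i z \<odot> (c \<odot> v i) : Fg (int (n + (b + m)))"
    by (rule Fg_smult'[OF k_degree[OF i z] cv[OF i]]) simp
  qed
 qed
 moreover have "N (?N z) = (c \<otimes>\<^sub>S d) \<odot> z" if z: "z : carrier F" for z
 proof -
  have "N (?N z) = (\<Oplus>i\<in>I. N (k i z \<odot> (c \<odot> v i)))"
   using z by (intro additive_finsum[OF M.ag M.ag endo_additive[OF N]]) auto
  also have "... = (\<Oplus>i\<in>I. (c \<otimes>\<^sub>S d) \<odot> (k i z \<odot> y i))"
  proof (intro M.finsum_cong' refl)
   fix i assume i: "i : I"
   have "N (k i z \<odot> (c \<odot> v i)) = k i z \<odot> (c \<odot> (d \<odot> y i))"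
    using z i v(2)[OF i] by (simp add: endo_smult[OF N])
   then show "N (k i z \<odot> (c \<odot> v i)) = (c \<otimes>\<^sub>S d) \<odot> (k i z \<odot> y i)"
    using z i by (simp add: smult_assoc1[symmetric] R.m_ac)
  qed (use z in auto)
  also have "... = (c \<otimes>\<^sub>S d) \<odot> (\<Oplus>i\<in>I. k i z \<odot> y i)"
   using z finite_I by (intro finsum_smult_ldistr[symmetric]) auto
  finally show ?thesis using expand[OF z] by simp
 qed
 moreover have "c \<otimes>\<^sub>S d : Sg (a + (b + m)) - P" by (rule prod_notin[OF c d]) simp
 ultimately show ?thesis by blast
qed

text \<open>
 An endomorphism invertible modulo \<open>P\<close> is invertible up to a scalar outside \<open>P\<close>. Its right inverse
 is again invertible modulo \<open>P\<close>, which gives injectivity.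
\<close>

lemma invertible_mod_prime:
 assumes N: "endo a N" and N': "endo b N'" and c: "c : Sg (a + b) - P"
  and approx: "!!z. z : carrier F ==> c \<odot> z \<ominus> N (N' z) : PF"
   "!!z. z : carrier F ==> c \<odot> z \<ominus> N' (N z) : PF"
 obtains m d N'' l d' where "d : Sg (a + m) - P" "endo m N''" "!!z. z : carrier F ==> N (N'' z) = d \<odot> z"
  "d' : Sg l - P" "!!z. z : carrier F ==> N z = \<zero> ==> d' \<odot> z = \<zero>"
proof -
 obtain m d N2 where d: "d : Sg (a + m) - P" and N2: "endo m N2" and NN2: "!!z. z : carrier F ==> N (N2 z) = d \<odot> z"
  using right_inverse[OF N N' c approx(1)] by blast
 have [simp]: "c : carrier S" "d : carrier S" using c d by auto
 have cN: "endo (a + (a + b)) (\<lambda>z. c \<odot> N z)" using c N by (intro endo_scale) auto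
 have dc: "d \<otimes>\<^sub>S c : Sg (m + (a + (a + b))) - P" by (rule prod_notin[OF d c]) simp
 have "\<exists>m' d' N''. d' : Sg (m + m') - P \<and> endo m' N'' \<and> (\<forall>z\<in>carrier F. N2 (N'' z) = d' \<odot> z)"
 proof (rule right_inverse[OF N2 cN dc])
  fix z assume z [simp]: "z : carrier F"
  note [simp] = N N' N2 endo_closed[OF N] endo_closed[OF N'] endo_closed[OF N2]
  let ?w = "N2 (N z)"
  have 1: "c \<odot> ?w \<ominus> N' (N ?w) : PF" by (rule approx(2)) simp
  have 2: "N' (N ?w) = d \<odot> N' (N z)" by (simp add: NN2 endo_smult[OF N'])
  have 3: "d \<odot> (c \<odot> z \<ominus> N' (N z)) : PF" by (intro PF_smult approx(2)) auto
  have "(d \<otimes>\<^sub>S c) \<odot> z \<ominus> N2 (c \<odot> N z) =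
    d \<odot> (c \<odot> z \<ominus> N' (N z)) \<ominus> (c \<odot> ?w \<ominus> N' (N ?w))"
   unfolding 2 by (simp add: smult_diff smult_assoc1 endo_smult[OF N2] M.diff_diff_cancel)
  then show "(d \<otimes>\<^sub>S c) \<odot> z \<ominus> N2 (c \<odot> N z) : PF" using PF_diff[OF 3 1] by simp
 qed
 then obtain m' d4 N4 where d4: "d4 : Sg (m + m') - P" and N4: "endo m' N4"
  and NN4: "!!z. z : carrier F ==> N2 (N4 z) = d4 \<odot> z" by blast
 have [simp]: "d4 : carrier S" using d4 by auto
 have inj: "(d \<otimes>\<^sub>S d4) \<odot> z = \<zero>" if z: "z : carrier F" and Nz: "N z = \<zero>" for z
 proof -
  have N4z: "N4 z : carrier F" using N4 z by simp
  have "d \<odot> N4 z = N (N2 (N4 z))" using NN2[OF N4z] by simp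
  also have "... = \<zero>" using z Nz by (simp add: NN4 endo_smult[OF N])
  finally have "N2 (d \<odot> N4 z) = \<zero>" using endo_zero[OF N2] by simp
  then show ?thesis using z N4z by (simp add: endo_smult[OF N2] NN4 smult_assoc1)
 qed
 show thesis
  using that[OF d N2 NN2 prod_notin[OF d d4 refl] inj] by blast
qed

end

lemma funpow_commute:
 assumes "!!z. z : C ==> f (g z) = g (f z)" "f : C \<rightarrow> C" "z : C"
 shows "(f ^^ n) (g z) = g ((f ^^ n) z)"
 using assms(3)
proof (induction n)
 case (Suc n)
 have "(f ^^ n) z : C" using Suc.prems assms(2) by (induction n) auto
 then show ?case using Suc assms(1) by simp
qed simp

text \<open>
 The Frobenius is additive on commuting operators: for those, the powers of a sum are the iterates
 of \<open>iter_bimult\<close> with the identity in the middle.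
\<close>

lemma (in abelian_group) frobenius_two:
 assumes p: "prime p" "!!y. y : carrier G ==> add_pow G p y = \<zero>"
  and ad: "additive G G f" "additive G G g" and comm: "!!z. z : carrier G ==> f (g z) = g (f z)"
  and z: "z : carrier G"
 shows "((\<lambda>z. f z \<oplus> g z) ^^ p) z = (f ^^ p) z \<oplus> (g ^^ p) z"
proof -
 note ag = ag
 have fc: "f : carrier G \<rightarrow> carrier G" and gc: "g : carrier G \<rightarrow> carrier G" using ad by (auto simp: additive_def)
 have id: "additive G G (\<lambda>z. z)" by (simp add: additive_def)
 have fg: "((f ^^ a) ((g ^^ b) z)) : carrier G" if "z : carrier G" for a b z
  using that funpow_additive[OF ad(1), of a] funpow_additive[OF ad(2), of b] by (auto simp: additive_def)
 have pow: "((\<lambda>z. f z \<oplus> g z) ^^ n) z = iter_bimult G f g (\<lambda>z. z) n z" if "z : carrier G" for n z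
  using that
 proof (induction n arbitrary: z)
  case (Suc n)
  have ib: "iter_bimult G f g (\<lambda>z. z) n z : carrier G" "iter_bimult G f g (\<lambda>z. z) n (g z) = g (iter_bimult G f g (\<lambda>z. z) n z)"
  proof -
   show "iter_bimult G f g (\<lambda>z. z) n z : carrier G"
    using iter_bimult_additive[OF ag ad id, of n] Suc.prems by (auto simp: additive_def)
   show "iter_bimult G f g (\<lambda>z. z) n (g z) = g (iter_bimult G f g (\<lambda>z. z) n z)"
    using Suc.prems
   proof (induction n arbitrary: z)
    case (Suc n)
    have "iter_bimult G f g (\<lambda>z. z) n z : carrier G" "iter_bimult G f g (\<lambda>z. z) n (g z) : carrier G" "g z : carrier G"
     using iter_bimult_additive[OF ag ad id, of n] Suc.prems gc by (auto simp: additive_def)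
    then show ?case using Suc comm ad fc gc by (simp add: additive_def Pi_iff)
   qed simp
  qed
  then show ?case using Suc by simp
 qed simp
 show ?thesis unfolding pow[OF z] by (rule iter_bimult_prime[OF ag ad id z p])
qed

lemma (in abelian_group) frobenius_sum:
 assumes p: "prime p" "!!y. y : carrier G ==> add_pow G p y = \<zero>" and X: "finite X"
  and ad: "!!x. x : X ==> additive G G (f x)"
  and comm: "!!x y z. x : X ==> y : X ==> z : carrier G ==> f x (f y z) = f y (f x z)"
  and z: "z : carrier G"
 shows "((\<lambda>z. \<Oplus>x\<in>X. f x z) ^^ (p ^ n)) z = (\<Oplus>x\<in>X. (f x ^^ (p ^ n)) z)"
proof -
 have cl: "f x : carrier G \<rightarrow> carrier G" if "x : X" for x using ad[OF that] by (auto simp: additive_def)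
 have step: "((\<lambda>z. \<Oplus>x\<in>X. f x z) ^^ p) z = (\<Oplus>x\<in>X. (f x ^^ p) z)"
  if X: "finite X" and ad: "!!x. x : X ==> additive G G (f x)"
   and comm: "!!x y z. x : X ==> y : X ==> z : carrier G ==> f x (f y z) = f y (f x z)"
   and z: "z : carrier G" for f :: "'c => 'a => 'a" and X z
  using X ad comm z
 proof (induction X arbitrary: z rule: finite_induct)
  case empty
  have "((\<lambda>z. \<zero>) ^^ Suc m) z = \<zero>" for m by (induction m) auto
  then show ?case using prime_gt_0_nat[OF p(1)] by (cases p) auto
 next
  case (insert x X)
  have cl: "f y : carrier G \<rightarrow> carrier G" if "y : insert x X" for y using insert.prems(1)[OF that] by (auto simp: additive_def)
  let ?s = "\<lambda>z. \<Oplus>y\<in>X. f y z"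
  have s: "additive G G ?s" using insert.prems(1) by (intro additive_finsum_maps ag) auto
  have split: "(\<Oplus>y\<in>insert x X. g y) = g x \<oplus> (\<Oplus>y\<in>X. g y)" if "g : insert x X \<rightarrow> carrier G" for g
   using that insert(1,2) by (intro finsum_insert) auto
  have powcl: "(f y ^^ m) w : carrier G" if "y : insert x X" "w : carrier G" for y m w
   using funpow_additive[OF insert.prems(1)[OF that(1)], of m] that(2) by (auto simp: additive_def)
  have eqpow: "((\<lambda>z. \<Oplus>y\<in>insert x X. f y z) ^^ m) z = ((\<lambda>z. f x z \<oplus> ?s z) ^^ m) z" for m
  proof (induction m)
   case (Suc m)
   have "((\<lambda>z. f x z \<oplus> ?s z) ^^ m) z : carrier G"
    using insert.prems(3) cl s by (induction m) (auto simp: additive_def Pi_iff)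
   then show ?case using Suc cl by (simp add: split Pi_iff)
  qed simp
  have "f x (?s w) = ?s (f x w)" if w: "w : carrier G" for w
  proof -
   have "f x (?s w) = (\<Oplus>y\<in>X. f x (f y w))"
    using cl w by (intro additive_finsum[OF ag ag insert.prems(1)]) auto
   also have "... = ?s (f x w)" using cl w insert.prems(2) by (intro finsum_cong') (auto simp: Pi_iff)
   finally show ?thesis .
  qed
  then have "((\<lambda>z. f x z \<oplus> ?s z) ^^ p) z = (f x ^^ p) z \<oplus> (?s ^^ p) z"
   using insert.prems by (intro frobenius_two p s) auto
  also have "(?s ^^ p) z = (\<Oplus>y\<in>X. (f y ^^ p) z)" using insert.prems by (intro insert.IH) auto
  finally show ?case unfolding eqpow using powcl insert.prems(3) by (subst split) auto
 qed
 show ?thesis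
  using z
 proof (induction n arbitrary: z)
  case 0
  then show ?case using cl by (simp add: Pi_iff cong: finsum_cong)
 next
  case (Suc n)
  let ?s = "\<lambda>z. \<Oplus>x\<in>X. f x z"
  have addpow: "additive G G (f x ^^ m)" if "x : X" for x m using ad[OF that] by (rule funpow_additive)
  have cpow: "f x ^^ m : carrier G \<rightarrow> carrier G" if "x : X" for x m using addpow[OF that] by (auto simp: additive_def)
  have iter: "((?s ^^ (p ^ n)) ^^ m) z = ((\<lambda>z. \<Oplus>x\<in>X. (f x ^^ (p ^ n)) z) ^^ m) z" for m
  proof (induction m)
   case (Suc m)
   have "((\<lambda>z. \<Oplus>x\<in>X. (f x ^^ (p ^ n)) z) ^^ m) z : carrier G"
    using \<open>z : carrier G\<close> cpow by (induction m) (auto simp: Pi_iff)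
   then show ?case using Suc \<open>!!z. z : carrier G ==> (?s ^^ (p ^ n)) z = _ z\<close> by simp
  qed simp
  have "(?s ^^ (p ^ Suc n)) z = ((?s ^^ (p ^ n)) ^^ p) z" by (simp add: funpow_mult mult.commute)
  also have "... = (\<Oplus>x\<in>X. ((f x ^^ (p ^ n)) ^^ p) z)"
   unfolding iter
  proof (rule step[OF X addpow _ Suc.prems])
   fix x y z assume xy: "x : X" "y : X" and z: "z : carrier G"
   have "(f x ^^ a) (f y w) = f y ((f x ^^ a) w)" if "w : carrier G" for a w
    using comm xy cl that by (intro funpow_commute[of "carrier G"]) auto
   then have "(f y ^^ b) ((f x ^^ a) z) = (f x ^^ a) ((f y ^^ b) z)" for a b
    using xy cpow z by (intro funpow_commute[of "carrier G"]) (auto dest: cl)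
   then show "(f x ^^ (p ^ n)) ((f y ^^ (p ^ n)) z) = (f y ^^ (p ^ n)) ((f x ^^ (p ^ n)) z)" by simp
  qed
  finally show ?case by (simp add: funpow_mult mult.commute)
 qed
qed

context residual
begin

lemma endo_PF: "endo a N ==> z : PF ==> N z : PF"
proof -
 assume N: "endo a N" and z: "z : PF"
 have zc: "z : carrier F" using z by (rule PF_closed)
 have "k i z \<odot> N (y i) : PF" if i: "i : I" for i
  using z i N zc by (auto simp: PF_def k_smult prim.I_r_closed)
 then have "(\<Oplus>i\<in>J. k i z \<odot> N (y i)) : PF" if "J \<subseteq> I" for J
  using that
 proof (induction J rule: infinite_finite_induct)
  case (insert i J)
  then have "(\<lambda>i. k i z \<odot> N (y i)) : insert i J \<rightarrow> carrier F" using PF_closed by blast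
  then show ?case using insert PF_add by (subst M.finsum_insert) auto
 qed (use PF_zero M.finsum_infinite in auto)
 then show ?thesis using endo_expand[OF N zc] by simp
qed

lemma PF_add_pow: "z : PF ==> add_pow F (n::nat) z : PF"
 using PF_add PF_zero by (induction n) auto

lemma endo_pow: "endo a N ==> endo (n * a) (N ^^ n)"
proof (induction n)
 case (Suc n)
 then show ?case using endo_comp[of a N "n * a" "N ^^ n"] by (simp add: o_def)
qed (use endo_id in "simp add: id_def")

text \<open>
 The core of the acyclicity of projective modules. Modulo \<open>P\<close> the operators \<open>x m\<close> are, up to
 factorials, the iterated commutators of \<open>x 0\<close> with \<open>T\<close>. As \<open>T^p = 0\<close> in characteristic \<open>p\<close>, the
 \<open>p\<close>-th commutator vanishes, so the one before, \<open>N\<close>, commutes with \<open>T\<close>. It is invertible up to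
 scalars outside \<open>P\<close>, since modulo \<open>P\<close> it is a nonzero multiple of \<open>x (p - 1)\<close>, which has a power that is such a
 scalar. On \<open>ker T\<close> it is up to sign \<open>T^(p - 1) x 0\<close>, so \<open>ker T\<close> lies in \<open>im T^(p - 1)\<close> up to such scalars.
\<close>

lemma acyclic_of_commutators:
 assumes e: "e > 0" and p: "prime p" "!!y. y : carrier F ==> add_pow F p y = \<zero>"
  and unit: "!!s. s : carrier S ==> add_pow S (fact (p - 1) :: nat) s : P ==> s : P"
  and nilp: "!!y. y : carrier F ==> (T ^^ p) y = \<zero>"
  and x: "!!m. m < p ==> endo (a + m * e) (x m)"
  and comm: "!!m z. Suc m < p ==> z : carrier F ==>
   x m (T z) \<ominus> (T (x m z) \<oplus> add_pow F (Suc m) (x (Suc m) z)) : PF"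
  and c: "c : Sg (a + (p - 1) * e) - P" and q: "q > 0"
  and power: "!!z. z : carrier F ==> (x (p - 1) ^^ q) z = (c [^]\<^sub>S q) \<odot> z"
 shows "acyclic_at (p - 1) P"
proof -
 have p0: "p > 0" using p(1) by (rule prime_gt_0_nat)
 let ?L = "\<lambda>z. \<ominus> T z"
 define h where "h n = iter_bimult F ?L T (x 0) n" for n
 have h0: "h 0 z = x 0 z" and hS: "h (Suc n) z = \<ominus> T (h n z) \<oplus> h n (T z)" for n z
  by (simp_all add: h_def)
 have x0: "endo a (x 0)" using x[of 0] p0 by simp
 have h_endo: "endo (a + n * e) (h n)" for n
 proof (induction n)
  case 0
  then show ?case using x0 by (simp add: h_def)
 next
  case (Suc n)
  have "endo (a + n * e + e) (\<lambda>z. \<ominus> T (h n z) \<oplus> h n (T z))"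
   using endo_comp[OF endo_T Suc] endo_comp[OF Suc endo_T] by (intro endo_plus endo_minus) (simp_all add: add.commute)
  then show ?case by (simp add: h_def algebra_simps)
 qed
 note [simp] = endo_closed[OF h_endo]
 have xc [simp]: "m < p ==> z : carrier F ==> x m z : carrier F" for m z using endo_closed[OF x] .
 have approx: "h m z \<ominus> add_pow F (fact m :: nat) (x m z) : PF" if "m < p" "z : carrier F" for m z
  using that
 proof (induction m arbitrary: z)
  case 0
  then show ?case by (simp add: h0 PF_zero M.r_neg M.minus_eq)
 next
  case (Suc m)
  define f where "f = (fact m :: nat)"
  have m: "m < p" and zc [simp]: "z : carrier F" using Suc.prems by auto
  note [simp] = xc[OF m] xc[OF Suc.prems(1)]
  let ?A = "h m (T z)" and ?B = "h m z" and ?C = "add_pow F f (x m (T z))" and ?D = "add_pow F f (x m z)"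
   and ?E = "add_pow F (fact (Suc m)::nat) (x (Suc m) z)"
  have 1: "?A \<ominus> ?C : PF" unfolding f_def using Suc m by simp
  have 2: "T (?B \<ominus> ?D) : PF" unfolding f_def using Suc.IH[OF m zc] by (rule endo_PF[OF endo_T])
  have 3: "add_pow F f (x m (T z) \<ominus> (T (x m z) \<oplus> add_pow F (Suc m) (x (Suc m) z))) : PF"
   using comm Suc.prems by (intro PF_add_pow) auto
  have e3: "add_pow F f (x m (T z) \<ominus> (T (x m z) \<oplus> add_pow F (Suc m) (x (Suc m) z))) = ?C \<ominus> (T ?D \<oplus> ?E)"
  proof -
   have ad: "additive F F (\<lambda>z. add_pow F f z)" by (auto simp: additive_def M.add.nat_pow_distrib)
   have "?E = add_pow F f (add_pow F (Suc m) (x (Suc m) z))"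
    unfolding f_def by (subst M.add.nat_pow_pow) (auto simp: mult.commute simp del: fact_Suc simp: fact_Suc)
   moreover have "T ?D = add_pow F f (T (x m z))"
    by (rule M.additive_add_pow[OF M.ag T_additive]) simp
   ultimately show ?thesis
    by (simp add: additive_diff[OF M.ag M.ag ad] M.add.nat_pow_distrib del: M.add.nat_pow_Suc)
  qed
  have "h (Suc m) z \<ominus> ?E = (?A \<ominus> ?C) \<ominus> T (?B \<ominus> ?D) \<oplus> (?C \<ominus> (T ?D \<oplus> ?E))"
  proof -
   have "A' \<ominus> C' \<ominus> (B' \<ominus> D') \<oplus> (C' \<ominus> (D' \<oplus> E')) = \<ominus> B' \<oplus> A' \<ominus> E'"
    if "A' : carrier F" "B' : carrier F" "C' : carrier F" "D' : carrier F" "E' : carrier F" for A' B' C' D' E'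
    using that by (simp add: M.minus_eq M.minus_add M.a_assoc M.r_neg1 M.r_neg2 M.a_lcomm[of D' C']
      M.a_lcomm[of "\<ominus> B'" C'] M.a_lcomm[of A' "\<ominus> B'"])
   from this[of ?A "T ?B" ?C "T ?D" ?E] show ?thesis by (simp add: hS T_diff del: fact_Suc)
  qed
  then show ?case using PF_add[OF PF_diff[OF 1 2] 3[unfolded e3]] by simp
 qed
 have T_sign: "\<exists>v\<in>{z, \<ominus> z}. (?L ^^ n) z = (T ^^ n) v" if "z : carrier F" for n z
 proof (induction n)
  case (Suc n)
  then obtain v where v: "v : {z, \<ominus> z}" "(?L ^^ n) z = (T ^^ n) v" by blast
  then have vc: "v : carrier F" using that by auto
  have "(?L ^^ Suc n) z = (T ^^ Suc n) (\<ominus> v)"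
   using v(2) vc additive_minus[OF M.ag M.ag T_pow_additive[of "Suc n"], of v] by simp
  then show ?case using v(1) that by auto
 qed simp
 define N where "N = h (p - 1)"
 define A where "A = a + (p - 1) * e"
 have N: "endo A N" unfolding N_def A_def by (rule h_endo)
 note [simp] = endo_closed[OF N]
 have NT: "N (T z) = T (N z)" if z: "z : carrier F" for z
 proof -
  have "h p z = \<zero>"
  proof -
   have L: "additive F F ?L" using endo_additive[OF endo_minus[OF endo_T]] .
   have "(?L ^^ p) (x 0 z) = \<zero>" using T_sign[of "x 0 z" p] nilp z x0 by auto
   moreover have "h p z = (?L ^^ p) (x 0 z) \<oplus> x 0 ((T ^^ p) z)"
    unfolding h_def by (rule iter_bimult_prime[OF M.ag L T_additive endo_additive[OF x0] z p])
   ultimately show ?thesis using nilp[OF z] endo_zero[OF x0] by simp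
  qed
  then have "\<ominus> T (N z) \<oplus> N (T z) = \<zero>" using hS[of "p - 1" z] p0 by (simp add: N_def)
  then show ?thesis using z M.minus_equality[of "N (T z)" "\<ominus> T (N z)"] by (simp add: M.a_comm)
 qed
 have Nker: "\<exists>v\<in>{x 0 z, \<ominus> x 0 z}. h n z = (T ^^ n) v" if z: "z : carrier F" "T z = \<zero>" for z n
 proof (induction n)
  case (Suc n)
  then obtain v where v: "v : {x 0 z, \<ominus> x 0 z}" "h n z = (T ^^ n) v" by blast
  then have vc: "v : carrier F" using z x0 by auto
  have "h (Suc n) z = (T ^^ Suc n) (\<ominus> v)"
   using v(2) vc z endo_zero[OF h_endo] additive_minus[OF M.ag M.ag T_pow_additive[of "Suc n"], of v]
   by (simp add: hS)
  then show ?case using v(1) z x0 by auto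
 qed (simp add: h0)
 define w where "w = x (p - 1)"
 have w: "endo A w" unfolding w_def A_def using p0 by (intro x) simp
 note [simp] = endo_closed[OF w]
 define f where "f = (fact (p - 1) :: nat)"
 define n0 where "n0 = q - 1"
 define c' where "c' = add_pow S f (c [^]\<^sub>S q)"
 have cc [simp]: "c : carrier S" using c by auto
 have Aq: "A + n0 * A = q * A" using q by (cases q) (auto simp: n0_def)
 have Sg_pow: "c [^]\<^sub>S n : Sg (n * A)" for n :: nat
 proof (induction n)
  case (Suc n)
  then show ?case using Sg_mult[of "c [^]\<^sub>S n" "n * A" c A] c[folded A_def] by (simp add: add.commute)
 qed (simp add: Sg_one)
 have Sg_zero: "\<zero>\<^sub>S : Sg n" if "s : Sg n" for s n
  using Sg_add[OF that Sg_minus[OF that]] that by (simp add: R.r_neg)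
 have "add_pow S n (c [^]\<^sub>S q) : Sg (q * A)" for n :: nat
  by (induction n) (use Sg_pow[of q] Sg_zero Sg_add in auto)
 then have c': "c' : Sg (A + n0 * A) - P"
  unfolding Aq c'_def using unit[of "c [^]\<^sub>S q"] notin_pow[of c q] c by (auto simp: f_def)
 let ?N' = "w ^^ n0"
 have wq: "w (?N' z) = (w ^^ q) z" "?N' (w z) = (w ^^ q) z" for z
  using q funpow_swap1[of w n0 z] by (cases q; simp add: n0_def)+
 have c'_eq: "c' \<odot> z = add_pow F f ((w ^^ q) z)" if z: "z : carrier F" for z
 proof -
  have "add_pow S n (c [^]\<^sub>S q) \<odot> z = add_pow F n ((c [^]\<^sub>S q) \<odot> z)" for n :: nat
   using z by (induction n) (auto simp: smult_l_distr)
  then show ?thesis using power[OF z] by (simp add: c'_def w_def)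
 qed
 have N': "endo (n0 * A) ?N'" by (rule endo_pow[OF w])
 have flip: "\<ominus> (u \<ominus> v) = v \<ominus> u" if "u : carrier F" "v : carrier F" for u v
  using that by (simp add: M.minus_eq M.minus_add M.a_comm)
 have ap: "N z \<ominus> add_pow F f (w z) : PF" if "z : carrier F" for z
  unfolding N_def f_def w_def using that p0 by (intro approx) auto
 have ap1: "c' \<odot> z \<ominus> N (?N' z) : PF" if z: "z : carrier F" for z
 proof -
  have n': "?N' z : carrier F" using endo_closed[OF N' z] .
  have wz: "(w ^^ q) z : carrier F" using endo_closed[OF endo_pow[OF w] z] .
  show ?thesis using PF_minus[OF ap[OF n']] n' wz by (simp add: flip c'_eq[OF z] wq)
 qed
 have ap2: "c' \<odot> z \<ominus> ?N' (N z) : PF" if z: "z : carrier F" for z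
 proof -
  have "?N' (add_pow F f (w z)) = add_pow F f (?N' (w z))"
   using z by (intro M.additive_add_pow[OF M.ag endo_additive[OF N']]) auto
  then have "c' \<odot> z = ?N' (add_pow F f (w z))" by (simp only: c'_eq[OF z] wq)
  then have "c' \<odot> z \<ominus> ?N' (N z) = \<ominus> (?N' (N z \<ominus> add_pow F f (w z)))"
   using z endo_closed[OF N'] by (simp add: endo_diff[OF N'] flip)
  then show ?thesis using PF_minus[OF endo_PF[OF N' ap[OF z]]] by simp
 qed
 show ?thesis
 proof (rule invertible_mod_prime[OF N N' c' ap1 ap2])
 fix m d N'' l d' assume d: "d : Sg (A + m) - P" and N'': "endo m N''"
  and NN: "!!z. z : carrier F ==> N (N'' z) = d \<odot> z"
  and d': "d' : Sg l - P" and inj: "!!z. z : carrier F ==> N z = \<zero> ==> d' \<odot> z = \<zero>"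
 have [simp]: "d : carrier S" "d' : carrier S" using d d' by auto
 show ?thesis
  unfolding acyclic_at_def
 proof (intro allI ballI impI)
  fix n u assume u: "u : Fg (int (n * e))" and Tu: "T u = \<zero>"
  have uc [simp]: "u : carrier F" using u by simp
  define v where "v = N'' u"
  have v: "v : Fg (int (n * e + m))" unfolding v_def using N'' u by (rule endo_degree)
  have vc [simp]: "v : carrier F" using v by simp
  \<comment> \<open>up to scalars \<open>v\<close> is the preimage of \<open>u\<close> under \<open>N\<close> and lies in \<open>ker T\<close>\<close>
  have "N (T v) = \<zero>" using NT[OF vc] NN[OF uc] Tu by (simp add: v_def T_smult)
  then have Tv: "T (d' \<odot> v) = \<zero>" using inj[of "T v"] by (simp add: T_smult)
  obtain t where t: "t : {x 0 (d' \<odot> v), \<ominus> x 0 (d' \<odot> v)}"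
   and ht: "h (p - 1) (d' \<odot> v) = (T ^^ (p - 1)) t" using Nker[OF _ Tv] by auto
  define M where "M = A + m + l"
  have dd: "d' \<otimes>\<^sub>S d : Sg M - P" unfolding M_def by (rule prod_notin[OF d' d]) simp
  have dd_pow: "(d' \<otimes>\<^sub>S d) [^]\<^sub>S j : Sg (j * M)" for j :: nat
  proof (induction j)
   case (Suc j)
   then show ?case using Sg_mult[of "(d' \<otimes>\<^sub>S d) [^]\<^sub>S j" "j * M" "d' \<otimes>\<^sub>S d" M] dd by (simp add: algebra_simps)
  qed (simp add: Sg_one)
  have Nt: "(T ^^ (p - 1)) t = (d' \<otimes>\<^sub>S d) \<odot> u"
   using ht[folded N_def] NN[OF uc] by (simp add: v_def[symmetric] endo_smult[OF N] smult_assoc1)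
  have "d' \<odot> v : Fg (int (n * e + m + l))" using d' by (intro Fg_smult'[OF _ v]) auto
  from endo_degree[OF x0 this] have t_deg: "t : Fg (int (n * e + m + l + a))" using t Fg_minus by auto
  have tc [simp]: "t : carrier F" using t_deg by simp
  \<comment> \<open>this factor makes all degrees multiples of \<open>e\<close>\<close>
  let ?s = "(d' \<otimes>\<^sub>S d) [^]\<^sub>S (e - 1)"
  have es: "?s \<otimes>\<^sub>S (d' \<otimes>\<^sub>S d) = (d' \<otimes>\<^sub>S d) [^]\<^sub>S e"
   using e by (cases e) auto
  have AM: "(p - 1) * e \<le> M" unfolding M_def A_def by simp
  have "(p - 1) * 1 \<le> (p - 1) * e" using e by (intro mult_le_mono2) simp
  then have le: "p - 1 \<le> M" using AM by linarith
  show "\<exists>m k. \<exists>d\<in>Sg (m * e) - P. \<exists>z\<in>Fg (int (k * e)). k + (p - 1) = m + n \<and> d \<odot> u = (T ^^ (p - 1)) z"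
  proof (intro exI bexI conjI)
   show "(n + M - (p - 1)) + (p - 1) = M + n" using le by simp
   show "((d' \<otimes>\<^sub>S d) [^]\<^sub>S e) \<odot> u = (T ^^ (p - 1)) (?s \<odot> t)"
    unfolding es[symmetric] using Nt[symmetric] by (simp add: T_pow_smult smult_assoc1[of _ "d' \<otimes>\<^sub>S d"])
   show "(d' \<otimes>\<^sub>S d) [^]\<^sub>S e : Sg (M * e) - P"
    using dd_pow[of e] notin_pow[of "d' \<otimes>\<^sub>S d" e] dd by (simp add: mult.commute)
   have "(n + M - (p - 1)) * e = n * e + (M * e - (p - 1) * e)"
    unfolding Nat.add_diff_assoc[OF le, symmetric] by (simp only: add_mult_distrib diff_mult_distrib)
   moreover have "M * e = (e - 1) * M + M" using e by (cases e) auto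
   ultimately have "(n + M - (p - 1)) * e = (e - 1) * M + (n * e + m + l + a)"
    by (simp add: M_def A_def)
   then show "?s \<odot> t : Fg (int ((n + M - (p - 1)) * e))"
    by (intro Fg_smult'[OF dd_pow t_deg]) simp
  qed
 qed
 qed
qed

end

section \<open>Hopf modules\<close>

lemma (in module) finsum_smult_inner:
 assumes fin: "finite A" "finite X" "finite Y"
  and s: "!!a x y. a : A ==> x : X ==> y : Y ==> s a x y : carrier R"
  and b: "!!x y. x : X ==> y : Y ==> b x y : carrier M"
 shows "(\<Oplus>\<^sub>M a\<in>A. \<Oplus>\<^sub>M x\<in>X. \<Oplus>\<^sub>M y\<in>Y. s a x y \<odot>\<^sub>M b x y) =
   (\<Oplus>\<^sub>M x\<in>X. \<Oplus>\<^sub>M y\<in>Y. (\<Oplus>\<^sub>R a\<in>A. s a x y) \<odot>\<^sub>M b x y)"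
proof -
 have "(\<Oplus>\<^sub>M a\<in>A. \<Oplus>\<^sub>M x\<in>X. \<Oplus>\<^sub>M y\<in>Y. s a x y \<odot>\<^sub>M b x y) =
   (\<Oplus>\<^sub>M x\<in>X. \<Oplus>\<^sub>M a\<in>A. \<Oplus>\<^sub>M y\<in>Y. s a x y \<odot>\<^sub>M b x y)"
  using fin s b by (intro M.finsum_swap M.finsum_closed) auto
 also have "... = (\<Oplus>\<^sub>M x\<in>X. \<Oplus>\<^sub>M y\<in>Y. \<Oplus>\<^sub>M a\<in>A. s a x y \<odot>\<^sub>M b x y)"
  using fin s b by (intro M.finsum_cong' refl M.finsum_swap funcsetI M.finsum_closed) auto
 also have "... = (\<Oplus>\<^sub>M x\<in>X. \<Oplus>\<^sub>M y\<in>Y. (\<Oplus>\<^sub>R a\<in>A. s a x y) \<odot>\<^sub>M b x y)"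
  using fin s b by (intro M.finsum_cong' refl finsum_smult_rdistr[symmetric] funcsetI M.finsum_closed smult_closed R.finsum_closed) auto
 finally show ?thesis .
qed

lemma (in module) finsum_smult_outer:
 assumes fin: "finite A" "finite X" "finite Y"
  and s: "!!a x y. a : A ==> x : X ==> y : Y ==> s a x y : carrier R"
  and b: "!!a. a : A ==> b a : carrier M"
 shows "(\<Oplus>\<^sub>M x\<in>X. \<Oplus>\<^sub>M y\<in>Y. \<Oplus>\<^sub>M a\<in>A. s a x y \<odot>\<^sub>M b a) =
   (\<Oplus>\<^sub>M a\<in>A. (\<Oplus>\<^sub>R x\<in>X. \<Oplus>\<^sub>R y\<in>Y. s a x y) \<odot>\<^sub>M b a)"
proof -
 have "(\<Oplus>\<^sub>M x\<in>X. \<Oplus>\<^sub>M y\<in>Y. \<Oplus>\<^sub>M a\<in>A. s a x y \<odot>\<^sub>M b a) =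
   (\<Oplus>\<^sub>M x\<in>X. \<Oplus>\<^sub>M a\<in>A. \<Oplus>\<^sub>M y\<in>Y. s a x y \<odot>\<^sub>M b a)"
  using fin s b by (intro M.finsum_cong' refl M.finsum_swap funcsetI M.finsum_closed) auto
 also have "... = (\<Oplus>\<^sub>M a\<in>A. \<Oplus>\<^sub>M x\<in>X. \<Oplus>\<^sub>M y\<in>Y. s a x y \<odot>\<^sub>M b a)"
  using fin s b by (intro M.finsum_swap M.finsum_closed) auto
 also have "... = (\<Oplus>\<^sub>M a\<in>A. \<Oplus>\<^sub>M x\<in>X. (\<Oplus>\<^sub>R y\<in>Y. s a x y) \<odot>\<^sub>M b a)"
  using fin s b by (intro M.finsum_cong' refl finsum_smult_rdistr[symmetric] funcsetI M.finsum_closed smult_closed R.finsum_closed) auto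
 also have "... = (\<Oplus>\<^sub>M a\<in>A. (\<Oplus>\<^sub>R x\<in>X. \<Oplus>\<^sub>R y\<in>Y. s a x y) \<odot>\<^sub>M b a)"
  using fin s b by (intro M.finsum_cong' refl finsum_smult_rdistr[symmetric] funcsetI M.finsum_closed smult_closed R.finsum_closed) auto
 finally show ?thesis .
qed

lemma (in hopf_coords) comult_expand:
 assumes \<beta>: "tensor_bilin G G Y \<beta>" and f: "f : carrier G"
 shows "tensor_lift Y \<beta> (comult G f) = (\<Oplus>\<^sub>Y x\<in>X. \<Oplus>\<^sub>Y y\<in>X. (c x \<otimes>\<^sub>B c y) f \<odot>\<^sub>Y \<beta> x y)"
proof -
 interpret tensor_bilin G G Y \<beta> by (rule \<beta>)
 let ?r = "\<lambda>Z. \<Oplus>\<^sub>Y x\<in>X. \<Oplus>\<^sub>Y y\<in>X. tensor_lift kk (\<lambda>a b. c x a * c y b) Z \<odot>\<^sub>Y \<beta> x y"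
 have bx: "x : X ==> v : carrier G ==> klin G Y (\<lambda>w. \<beta> v w)" "y : carrier G ==> klin G Y (\<lambda>v. \<beta> v y)" for x v y
  using bilin by (auto simp: bilin_def)
 have lk: "klin (tensor G G) kk (tensor_lift kk (\<lambda>a b. c x a * c y b))" if "x : X" "y : X" for x y
  using tensor_bilin.lift_klin[OF prod_bilin[OF c_klin c_klin]] that by blast
 have "tensor_lift Y \<beta> (comult G f) = ?r (comult G f)"
 proof (rule GG.tensor_ext[OF Y.M.ag klin_additive[OF lift_klin] _ _ comult_closed[OF f]])
  show "additive (tensor G G) Y ?r"
  proof (intro Y.M.additive_finsum_maps GG.abelian_group_tensor)
   fix x y assume xy: "x : X" "y : X"
   then show "additive (tensor G G) Y (\<lambda>Z. tensor_lift kk (\<lambda>a b. c x a * c y b) Z \<odot>\<^sub>Y \<beta> x y)"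
    using klin_add[OF lk[OF xy]] by (auto simp: additive_def Y.smult_l_distr[simplified])
  qed
  fix v w assume vw: "v : carrier G" "w : carrier G"
  have "?r (tens G G v w) = (\<Oplus>\<^sub>Y x\<in>X. c x v \<odot>\<^sub>Y \<beta> x w)"
  proof (intro Y.M.finsum_cong' refl funcsetI)
   fix x assume x: "x : X"
   have "(\<Oplus>\<^sub>Y y\<in>X. tensor_lift kk (\<lambda>a b. c x a * c y b) (tens G G v w) \<odot>\<^sub>Y \<beta> x y) =
     (\<Oplus>\<^sub>Y y\<in>X. c x v \<odot>\<^sub>Y (c y w \<odot>\<^sub>Y \<beta> x y))"
    using x vw by (intro Y.M.finsum_cong' refl)
     (auto simp: tensor_bilin.lift_tens[OF prod_bilin[OF c_klin c_klin]] Y.smult_assoc1[simplified])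
   also have "... = c x v \<odot>\<^sub>Y \<beta> x w"
    using x vw klin_expand[OF Y.vspace_axioms bx(1)[OF x] vw(2), of x]
    by (subst Y.finsum_smult_ldistr[symmetric]) auto
   finally show "(\<Oplus>\<^sub>Y y\<in>X. tensor_lift kk (\<lambda>a b. c x a * c y b) (tens G G v w) \<odot>\<^sub>Y \<beta> x y) = c x v \<odot>\<^sub>Y \<beta> x w" .
  qed (use vw in auto)
  also have "... = \<beta> v w" using klin_expand[OF Y.vspace_axioms bx(2)[OF vw(2)] vw(1)] by simp
  finally show "tensor_lift Y \<beta> (tens G G v w) = ?r (tens G G v w)" using lift_tens[OF vw] by simp
 qed
 then show ?thesis using f by (simp add: group_algebra_def)
qed

context representing
begin

abbreviation scal :: "'k => 'a set" where "scal s \<equiv> s \<odot>\<^sub>S \<one>\<^sub>S"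

lemma scal_closed [simp]: "scal s : carrier S" using GA.smult_closed by simp

text \<open>
 The coefficients \<open>u x i\<close> are comultiplicative: this is the relation between divided powers in the
 group algebra of the additive group, transported to operators.
\<close>

lemma comult_sum:
 assumes N: "vspace N" and t: "klin B (tensor S N) t" and ij: "i < p ^ r" "j < p ^ r"
 shows "(\<Oplus>\<^sub>(FF N)x\<in>X. \<Oplus>\<^sub>(FF N)y\<in>X. (u x i \<otimes>\<^sub>S u y j) \<odot>\<^sub>(FF N) t (c x \<otimes>\<^sub>B c y)) =
  (if i + j < p ^ r then scal (of_nat ((i + j) choose i)) \<odot>\<^sub>(FF N)
    (\<Oplus>\<^sub>(FF N)x\<in>X. u x (i + j) \<odot>\<^sub>(FF N) t (c x)) else \<zero>\<^sub>(FF N))"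
proof -
 interpret N: module S "FF N" by (rule GA.module_FF[OF N])
 note [simp] = GA.smult_closed_FF[OF N]
 interpret SN: tensor_pair S N by (rule GA.pair[OF N])
 interpret TN: vspace "tensor S N" by (rule SN.vspace_tensor)
 have tc: "\<alpha> : carrier B ==> t \<alpha> : carrier (FF N)" for \<alpha> using klin_closed[OF t] by simp
 have t_exp: "t \<alpha> = (\<Oplus>\<^sub>(FF N)w\<in>X. scal (\<alpha> w) \<odot>\<^sub>(FF N) t (c w))" if "\<alpha> : carrier B" for \<alpha>
 proof -
  have "t \<alpha> = (\<Oplus>\<^sub>(tensor S N)w\<in>X. \<alpha> w \<odot>\<^sub>(tensor S N) t (c w))"
   by (rule klin_B_expand[OF SN.vspace_tensor t that])
  also have "... = (\<Oplus>\<^sub>(FF N)w\<in>X. \<alpha> w \<odot>\<^sub>(tensor S N) t (c w))"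
   using tc TN.smult_closed by (intro GA.finsum_FF N) auto
  also have "... = (\<Oplus>\<^sub>(FF N)w\<in>X. scal (\<alpha> w) \<odot>\<^sub>(FF N) t (c w))"
   using tc by (intro N.M.finsum_cong' refl) (auto simp: GA.scalar_smult[OF N])
  finally show ?thesis .
 qed
 have "(\<Oplus>\<^sub>(FF N)x\<in>X. \<Oplus>\<^sub>(FF N)y\<in>X. (u x i \<otimes>\<^sub>S u y j) \<odot>\<^sub>(FF N) t (c x \<otimes>\<^sub>B c y)) =
  (\<Oplus>\<^sub>(FF N)x\<in>X. \<Oplus>\<^sub>(FF N)y\<in>X. \<Oplus>\<^sub>(FF N)w\<in>X. ((c x \<otimes>\<^sub>B c y) w \<odot>\<^sub>S (u x i \<otimes>\<^sub>S u y j)) \<odot>\<^sub>(FF N) t (c w))"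
 proof (intro N.M.finsum_cong' refl funcsetI N.M.finsum_closed)
  fix x y assume xy: "x : X" "y : X"
  have "(u x i \<otimes>\<^sub>S u y j) \<odot>\<^sub>(FF N) t (c x \<otimes>\<^sub>B c y) =
    (\<Oplus>\<^sub>(FF N)w\<in>X. (u x i \<otimes>\<^sub>S u y j) \<odot>\<^sub>(FF N) (scal ((c x \<otimes>\<^sub>B c y) w) \<odot>\<^sub>(FF N) t (c w)))"
   unfolding t_exp[OF B_mult[OF c_closed[OF xy(1)] c_closed[OF xy(2)]]]
   using xy ij tc by (intro N.finsum_smult_ldistr) auto
  also have "... = (\<Oplus>\<^sub>(FF N)w\<in>X. ((c x \<otimes>\<^sub>B c y) w \<odot>\<^sub>S (u x i \<otimes>\<^sub>S u y j)) \<odot>\<^sub>(FF N) t (c w))"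
   using xy ij tc by (intro N.M.finsum_cong' refl)
    (auto simp: N.smult_assoc1[symmetric] smult_eq_mult_one[OF algebra_S, of "u x i \<otimes>\<^sub>S u y j"] GA.m_comm)
  finally show "(u x i \<otimes>\<^sub>S u y j) \<odot>\<^sub>(FF N) t (c x \<otimes>\<^sub>B c y) =
   (\<Oplus>\<^sub>(FF N)w\<in>X. ((c x \<otimes>\<^sub>B c y) w \<odot>\<^sub>S (u x i \<otimes>\<^sub>S u y j)) \<odot>\<^sub>(FF N) t (c w))" .
 qed (use ij tc GA.smult_closed in auto)
 also have "... = (\<Oplus>\<^sub>(FF N)w\<in>X. (\<Oplus>\<^sub>S x\<in>X. \<Oplus>\<^sub>S y\<in>X. (c x \<otimes>\<^sub>B c y) w \<odot>\<^sub>S (u x i \<otimes>\<^sub>S u y j)) \<odot>\<^sub>(FF N) t (c w))"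
  using ij tc GA.smult_closed by (intro N.finsum_smult_outer) auto
 also have "... = (\<Oplus>\<^sub>(FF N)w\<in>X. (if i + j < p ^ r then of_nat ((i + j) choose i) \<odot>\<^sub>S u w (i + j) else \<zero>\<^sub>S) \<odot>\<^sub>(FF N) t (c w))"
  using ij tc GA.smult_closed by (intro N.M.finsum_cong' refl)
   (auto simp: comult_expand[OF u.nu_bilin[OF ij], symmetric] u.nu_comult)
 also have "... = (if i + j < p ^ r then scal (of_nat ((i + j) choose i)) \<odot>\<^sub>(FF N)
    (\<Oplus>\<^sub>(FF N)x\<in>X. u x (i + j) \<odot>\<^sub>(FF N) t (c x)) else \<zero>\<^sub>(FF N))"
 proof (cases "i + j < p ^ r")
  case True
  have "(\<Oplus>\<^sub>(FF N)w\<in>X. (of_nat ((i + j) choose i) \<odot>\<^sub>S u w (i + j)) \<odot>\<^sub>(FF N) t (c w)) =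
    (\<Oplus>\<^sub>(FF N)w\<in>X. scal (of_nat ((i + j) choose i)) \<odot>\<^sub>(FF N) (u w (i + j) \<odot>\<^sub>(FF N) t (c w)))"
   using True tc by (intro N.M.finsum_cong' refl)
    (auto simp: N.smult_assoc1[symmetric] smult_eq_mult_one[OF algebra_S, of "u w (i + j)" for w])
  also have "... = scal (of_nat ((i + j) choose i)) \<odot>\<^sub>(FF N) (\<Oplus>\<^sub>(FF N)x\<in>X. u x (i + j) \<odot>\<^sub>(FF N) t (c x))"
   using True tc by (intro N.finsum_smult_ldistr[symmetric]) auto
  finally show ?thesis using True by simp
 next
  case False
  have "(\<Oplus>\<^sub>(FF N)w\<in>X. \<zero>\<^sub>S \<odot>\<^sub>(FF N) t (c w)) = (\<Oplus>\<^sub>(FF N)w\<in>X. \<zero>\<^sub>(FF N))"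
   using tc by (intro N.M.finsum_cong' refl) (auto simp: N.smult_l_null)
  then show ?thesis using False N.M.finsum_zero[of X] by simp
 qed
 finally show ?thesis .
qed

lemma family_apply_klin:
 assumes M: "vspace M" and N: "vspace N" and fam: "lin_family M N \<chi>" and z: "z : carrier (tensor S M)"
 shows "klin B (tensor S N) (\<lambda>\<alpha>. tmap M N (\<chi> \<alpha>) z)"
proof -
 interpret SM: tensor_pair S M by (rule GA.pair[OF M])
 interpret SN: tensor_pair S N by (rule GA.pair[OF N])
 interpret TN: vspace "tensor S N" by (rule SN.vspace_tensor)
 note k = lin_family_klin[OF fam] and k' = lin_family_klin'[OF fam]
 note ad = klin_additive[OF GA.tmap_klin[OF M N k]]
 show ?thesis
 proof (rule klinI)
  fix \<alpha> assume a: "\<alpha> : carrier B"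
  then show "tmap M N (\<chi> \<alpha>) z : carrier (tensor S N)" using z by (intro GA.tmap_closed M N k)
  fix s
  show "tmap M N (\<chi> (s \<odot>\<^sub>B \<alpha>)) z = s \<odot>\<^sub>(tensor S N) tmap M N (\<chi> \<alpha>) z"
  proof (rule SM.tensor_ext[OF SN.abelian_group_tensor ad[OF B_smult[OF a]] _ _ z])
   show "additive (tensor S M) (tensor S N) (\<lambda>z. s \<odot>\<^sub>(tensor S N) tmap M N (\<chi> \<alpha>) z)"
    using ad[OF a] by (auto simp: additive_def TN.smult_r_distr Pi_iff)
   fix t m assume tm: "t : carrier S" "m : carrier M"
   then show "tmap M N (\<chi> (s \<odot>\<^sub>B \<alpha>)) (tens S M t m) = s \<odot>\<^sub>(tensor S N) tmap M N (\<chi> \<alpha>) (tens S M t m)"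
    using a klin_closed[OF k[OF a]] by (simp add: GA.tmap_tens[OF M N k] B_smult klin_smult[OF k'] SN.tens_smult_right)
  qed
 next
  fix \<alpha> \<beta> assume a: "\<alpha> : carrier B" "\<beta> : carrier B"
  show "tmap M N (\<chi> (\<alpha> \<oplus>\<^sub>B \<beta>)) z = tmap M N (\<chi> \<alpha>) z \<oplus>\<^sub>(tensor S N) tmap M N (\<chi> \<beta>) z"
  proof (rule SM.tensor_ext[OF SN.abelian_group_tensor ad[OF B_add[OF a]] _ _ z])
   show "additive (tensor S M) (tensor S N) (\<lambda>z. tmap M N (\<chi> \<alpha>) z \<oplus>\<^sub>(tensor S N) tmap M N (\<chi> \<beta>) z)"
    using ad[OF a(1)] ad[OF a(2)] by (auto simp: additive_def Pi_iff TN.M.a_ac)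
   fix t m assume tm: "t : carrier S" "m : carrier M"
   then show "tmap M N (\<chi> (\<alpha> \<oplus>\<^sub>B \<beta>)) (tens S M t m) =
     tmap M N (\<chi> \<alpha>) (tens S M t m) \<oplus>\<^sub>(tensor S N) tmap M N (\<chi> \<beta>) (tens S M t m)"
    using a klin_closed[OF k[OF a(1)]] klin_closed[OF k[OF a(2)]]
    by (simp add: GA.tmap_tens[OF M N k] B_add klin_add[OF k'] SN.tens_add_right)
  qed
 qed
qed

lemma op_op:
 assumes M: "vspace M" and N: "vspace N" and L: "vspace L" and \<psi>: "lin_family M N \<psi>" and \<phi>: "lin_family N L \<phi>"
  and ij: "i < p ^ r" "j < p ^ r" and z: "z : carrier (tensor S M)"
 shows "op i N L \<phi> (op j M N \<psi> z) = (\<Oplus>\<^sub>(FF L)x\<in>X. \<Oplus>\<^sub>(FF L)y\<in>X.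
   (u x i \<otimes>\<^sub>S u y j) \<odot>\<^sub>(FF L) tmap N L (\<phi> (c x)) (tmap M N (\<psi> (c y)) z))"
proof -
 interpret L: module S "FF L" by (rule GA.module_FF[OF L])
 note [simp] = GA.smult_closed_FF[OF L]
 interpret N: module S "FF N" by (rule GA.module_FF[OF N])
 note [simp] = GA.smult_closed_FF[OF N]
 note kp = lin_family_klin[OF \<psi>] and kf = lin_family_klin[OF \<phi>]
 have tc: "y : X ==> tmap M N (\<psi> (c y)) z : carrier (tensor S N)" for y using z by (intro GA.tmap_closed M N kp) auto
 have tc': "x : X ==> w : carrier (tensor S N) ==> tmap N L (\<phi> (c x)) w : carrier (tensor S L)" for x w
  by (intro GA.tmap_closed N L kf) auto
 show ?thesis
  unfolding op_def[of i]
 proof (intro L.M.finsum_cong' refl funcsetI L.M.finsum_closed)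
  fix x assume x: "x : X"
  have "tmap N L (\<phi> (c x)) (op j M N \<psi> z) =
    (\<Oplus>\<^sub>(FF L)y\<in>X. tmap N L (\<phi> (c x)) (u y j \<odot>\<^sub>(FF N) tmap M N (\<psi> (c y)) z))"
   unfolding op_def using x op_summand_closed[OF M N \<psi> _ ij(2) z]
   by (intro additive_finsum[OF N.M.ag L.M.ag] GA.tmap_additive N L kf) auto
  also have "... = (\<Oplus>\<^sub>(FF L)y\<in>X. u y j \<odot>\<^sub>(FF L) tmap N L (\<phi> (c x)) (tmap M N (\<psi> (c y)) z))"
   using x ij tc tc' L.smult_closed by (intro L.M.finsum_cong' refl GA.tmap_smult N L kf) auto
  finally have "u x i \<odot>\<^sub>(FF L) tmap N L (\<phi> (c x)) (op j M N \<psi> z) =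
   (\<Oplus>\<^sub>(FF L)y\<in>X. u x i \<odot>\<^sub>(FF L) (u y j \<odot>\<^sub>(FF L) tmap N L (\<phi> (c x)) (tmap M N (\<psi> (c y)) z)))"
   using x ij tc tc' L.smult_closed by (simp only:) (intro L.finsum_smult_ldistr; simp)
  also have "... = (\<Oplus>\<^sub>(FF L)y\<in>X. (u x i \<otimes>\<^sub>S u y j) \<odot>\<^sub>(FF L) tmap N L (\<phi> (c x)) (tmap M N (\<psi> (c y)) z))"
   using x ij tc tc' L.smult_closed by (intro L.M.finsum_cong' refl) (auto simp: L.smult_assoc1)
  finally show "u x i \<odot>\<^sub>(FF L) tmap N L (\<phi> (c x)) (op j M N \<psi> z) =
   (\<Oplus>\<^sub>(FF L)y\<in>X. (u x i \<otimes>\<^sub>S u y j) \<odot>\<^sub>(FF L) tmap N L (\<phi> (c x)) (tmap M N (\<psi> (c y)) z))" .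
 qed (use ij tc tc' L.smult_closed in auto)
qed

lemma act_op_act:
 assumes M: "kG_action M" and ij: "i < p ^ r" "j < p ^ r" and z: "z : carrier (tensor S M)"
 shows "op i M M (act M) (op j M M (act M) z) =
  (if i + j < p ^ r then scal (of_nat ((i + j) choose i)) \<odot>\<^sub>(FF M) op (i + j) M M (act M) z else \<zero>\<^sub>(FF M))"
proof -
 note vM = kG_action_vspace[OF M] and fM = kG_action_family[OF M]
 interpret M: module S "FF M" by (rule GA.module_FF[OF vM])
 note [simp] = GA.smult_closed_FF[OF vM]
 note k = lin_family_klin[OF fM]
 have "op i M M (act M) (op j M M (act M) z) = (\<Oplus>\<^sub>(FF M)x\<in>X. \<Oplus>\<^sub>(FF M)y\<in>X.
   (u x i \<otimes>\<^sub>S u y j) \<odot>\<^sub>(FF M) tmap M M (act M (c x \<otimes>\<^sub>B c y)) z)"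
  unfolding op_op[OF vM vM vM fM fM ij z]
 proof (intro M.M.finsum_cong' refl funcsetI M.M.finsum_closed)
  fix x y assume xy: "x : X" "y : X"
  then show "(u x i \<otimes>\<^sub>S u y j) \<odot>\<^sub>(FF M) tmap M M (act M (c x)) (tmap M M (act M (c y)) z) =
    (u x i \<otimes>\<^sub>S u y j) \<odot>\<^sub>(FF M) tmap M M (act M (c x \<otimes>\<^sub>B c y)) z"
   using M z by (subst GA.tmap_comp[OF vM vM vM k k z k[of "c x \<otimes>\<^sub>B c y"]]) (auto simp: kG_action_def B_mult)
  show "(u x i \<otimes>\<^sub>S u y j) \<odot>\<^sub>(FF M) tmap M M (act M (c x \<otimes>\<^sub>B c y)) z : carrier (FF M)"
   using xy ij z GA.tmap_closed[OF vM vM k] B_mult by (intro M.smult_closed) auto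
 qed (use ij z GA.tmap_closed[OF vM vM k] B_mult M.smult_closed in auto)
 then show ?thesis using comult_sum[OF vM family_apply_klin[OF vM vM fM z] ij] by (simp add: op_def cong: if_cong)
qed

end

context representing
begin

lemma graded_operator_Th:
 assumes M: "kG_action M"
 shows "graded_operator S (FF M) Sg (FG M) (Th M) e"
proof -
 note v = kG_action_vspace[OF M] and f = kG_action_family[OF M]
 note eq = Th_eq_op[OF M] and cl = op_closed[OF v v f e_less]
 interpret F: graded_module S "FF M" Sg "FG M" by (rule GA.graded_module_FF[OF v])
 show ?thesis
 proof unfold_locales
  show "additive (FF M) (FF M) (Th M)"
   using op_additive[OF v v f e_less] F.M.a_closed by (auto simp: additive_def eq Pi_iff)
  show "Th M (a \<odot>\<^sub>(FF M) x) = a \<odot>\<^sub>(FF M) Th M x" if "a : carrier S" "x : carrier (FF M)" for a x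
   using op_smult[OF v v f e_less, of a x] that GA.smult_closed_FF[OF v] by (simp add: eq)
  show "Th M x : FG M (i + int e)" if "x : FG M i" for x i
   using op_degree[OF v v f e_less that] GA.FG_sub[OF v] that by (auto simp: eq add.commute subset_iff)
 qed
qed

abbreviation acyc :: "('k, 'h => 'k, 'm) bmod => 'a set set => bool" where
 "acyc M P \<equiv> graded_operator.acyclic_at (FF M) Sg (FG M) (Th M) e (p - 1) P"

end

text \<open>
 A \<open>G\<close>-module with a compatible action \<open>m\<close> of the functions on \<open>G\<close>; by \<open>m_act\<close>, \<open>act\<close> and \<open>m\<close>
 commute up to the comultiplication, like the translations and multiplication operators on
 functions with values in a vector space.
\<close>

locale hopf_module = representing G X c A p r U
 for G :: "('k::field, 'h) hopf" (structure) and X c and A :: "('k, 'a) module" and p r U +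
 fixes E :: "('k, 'h => 'k, 'm) bmod" and m :: "'h => 'm => 'm" and Y k
 assumes action: "kG_action E" and act_one: "w : carrier E ==> act E \<one>\<^sub>B w = w"
  and m_klin: "f : carrier G ==> klin E E (m f)"
  and m_klin_left: "w : carrier E ==> klin G E (\<lambda>f. m f w)"
  and m_mult: "f : carrier G ==> g : carrier G ==> w : carrier E ==> m (f \<otimes> g) w = m f (m g w)"
  and m_one: "w : carrier E ==> m \<one> w = w"
  and m_act: "f : carrier G ==> \<alpha> : carrier B ==> w : carrier E ==>
   m f (act E \<alpha> w) = (\<Oplus>\<^sub>E x\<in>X. \<Oplus>\<^sub>E y\<in>X. \<alpha> (x \<otimes> y) \<odot>\<^sub>E act E (c y) (m (hit (c x) f) w))"
  and Frobenius: "f : carrier G ==> f [^] (p ^ r) = (counit G f ^ (p ^ r)) \<odot> \<one>"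
  and coords_E: "coordinates E Y k"
begin

lemma vE: "vspace E" by (rule kG_action_vspace[OF action])
lemma famE: "lin_family E E (act E)" by (rule kG_action_family[OF action])

sublocale E: vspace E by (rule vE)
sublocale F: graded_operator S "FF E" Sg "FG E" "Th E" e
 by (rule graded_operator_Th[OF action])
sublocale SE: tensor_pair S E by (rule GA.pair[OF vE])
sublocale TE: vspace "tensor S E" by (rule SE.vspace_tensor)

lemmas sm = GA.smult_closed_FF[OF vE]

lemma mfam: "f : carrier G ==> lin_family E E (\<lambda>\<alpha>. m (hit \<alpha> f))"
 unfolding lin_family_def
 using klin_compose[OF hit_linear_left m_klin_left] m_klin by (auto simp: klin_def)

abbreviation tm where "tm f \<equiv> tmap E E (m f)"
abbreviation T where "T j \<equiv> op j E E (act E)"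
definition \<mu> where "\<mu> f j = op j E E (\<lambda>\<alpha>. m (hit \<alpha> f))"

lemma tm_closed: "f : carrier G ==> z : carrier (tensor S E) ==> tm f z : carrier (tensor S E)"
 using GA.tmap_closed[OF vE vE m_klin] .

lemma ta_closed: "\<alpha> : carrier B ==> z : carrier (tensor S E) ==> tmap E E (act E \<alpha>) z : carrier (tensor S E)"
 using GA.tmap_closed[OF vE vE lin_family_klin[OF famE]] .

lemma T_closed: "j < p ^ r ==> z : carrier (tensor S E) ==> T j z : carrier (tensor S E)"
 using op_closed[OF vE vE famE] .

lemma mu_closed: "f : carrier G ==> j < p ^ r ==> z : carrier (tensor S E) ==> \<mu> f j z : carrier (tensor S E)"
 unfolding \<mu>_def using op_closed[OF vE vE mfam] .

lemma tm_act:
 assumes f: "f : carrier G" and \<alpha>: "\<alpha> : carrier B" and z: "z : carrier (tensor S E)"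
 shows "tm f (tmap E E (act E \<alpha>) z) = (\<Oplus>\<^sub>(FF E)x\<in>X. \<Oplus>\<^sub>(FF E)y\<in>X.
   scal (\<alpha> (x \<otimes> y)) \<odot>\<^sub>(FF E) tmap E E (act E (c y)) (tm (hit (c x) f) z))"
proof (rule GA.FF_ext[OF vE F.M.ag, where z = z])
 note ka = lin_family_klin[OF famE]
 show "additive (FF E) (FF E) (\<lambda>z. tm f (tmap E E (act E \<alpha>) z))"
  using f \<alpha> by (intro GA.additive_comp[OF GA.tmap_additive GA.tmap_additive] vE m_klin ka)
 show "additive (FF E) (FF E) (\<lambda>z. \<Oplus>\<^sub>(FF E)x\<in>X. \<Oplus>\<^sub>(FF E)y\<in>X.
   scal (\<alpha> (x \<otimes> y)) \<odot>\<^sub>(FF E) tmap E E (act E (c y)) (tm (hit (c x) f) z))"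
 proof (intro F.M.additive_finsum_maps F.M.ag)
  fix x y assume "x : X" "y : X"
  then show "additive (FF E) (FF E) (\<lambda>z. scal (\<alpha> (x \<otimes> y)) \<odot>\<^sub>(FF E) tmap E E (act E (c y)) (tm (hit (c x) f) z))"
   using f by (intro GA.additive_comp[OF GA.additive_comp[OF GA.tmap_additive GA.tmap_additive] GA.smult_additive] vE m_klin ka) auto
 qed
 fix s w assume sw: "s : carrier S" "w : carrier E"
 define b where "b x y = act E (c y) (m (hit (c x) f) w)" for x y
 have b: "b x y : carrier E" if "x : X" "y : X" for x y
  unfolding b_def using that f sw by (intro klin_closed[OF ka] klin_closed[OF m_klin]) auto
 have tk: "klin E (tensor S E) (tens S E s)" using SE.bilin_tens sw by (auto simp: bilin_def)
 have ad: "additive E (FF E) (tens S E s)" using klin_additive[OF tk] by (simp add: additive_def)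
 have aw: "act E \<alpha> w : carrier E" using klin_closed[OF ka[OF \<alpha>] sw(2)] .
 have "tm f (tmap E E (act E \<alpha>) (tens S E s w)) = tens S E s (m f (act E \<alpha> w))"
  using sw f aw by (simp add: GA.tmap_tens[OF vE vE ka[OF \<alpha>]] GA.tmap_tens[OF vE vE m_klin])
 also have "... = tens S E s (\<Oplus>\<^sub>E x\<in>X. \<Oplus>\<^sub>E y\<in>X. \<alpha> (x \<otimes> y) \<odot>\<^sub>E b x y)"
  by (simp add: m_act[OF f \<alpha> sw(2)] b_def)
 also have "... = (\<Oplus>\<^sub>(FF E)x\<in>X. tens S E s (\<Oplus>\<^sub>E y\<in>X. \<alpha> (x \<otimes> y) \<odot>\<^sub>E b x y))"
  using b by (intro additive_finsum[OF E.M.ag F.M.ag ad] funcsetI E.M.finsum_closed E.smult_closed) auto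
 also have "... = (\<Oplus>\<^sub>(FF E)x\<in>X. \<Oplus>\<^sub>(FF E)y\<in>X.
   scal (\<alpha> (x \<otimes> y)) \<odot>\<^sub>(FF E) tmap E E (act E (c y)) (tm (hit (c x) f) (tens S E s w)))"
 proof (intro F.M.finsum_cong' refl funcsetI F.M.finsum_closed)
  fix x assume x: "x : X"
  have "tens S E s (\<Oplus>\<^sub>E y\<in>X. \<alpha> (x \<otimes> y) \<odot>\<^sub>E b x y) = (\<Oplus>\<^sub>(FF E)y\<in>X. tens S E s (\<alpha> (x \<otimes> y) \<odot>\<^sub>E b x y))"
   using x b by (intro additive_finsum[OF E.M.ag F.M.ag ad] funcsetI E.smult_closed) auto
  also have "... = (\<Oplus>\<^sub>(FF E)y\<in>X. scal (\<alpha> (x \<otimes> y)) \<odot>\<^sub>(FF E) tmap E E (act E (c y)) (tm (hit (c x) f) (tens S E s w)))"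
  proof (intro F.M.finsum_cong' refl funcsetI)
   fix y assume y: "y : X"
   have "m (hit (c x) f) w : carrier E" using x f sw by (intro klin_closed[OF m_klin]) auto
   then have "tmap E E (act E (c y)) (tm (hit (c x) f) (tens S E s w)) = tens S E s (b x y)"
    using x y f sw by (simp add: GA.tmap_tens[OF vE vE ka] GA.tmap_tens[OF vE vE m_klin] b_def)
   moreover have "tens S E s (\<alpha> (x \<otimes> y) \<odot>\<^sub>E b x y) = \<alpha> (x \<otimes> y) \<odot>\<^sub>(tensor S E) tens S E s (b x y)"
    using klin_smult[OF tk] b[OF x y] by simp
   ultimately show "tens S E s (\<alpha> (x \<otimes> y) \<odot>\<^sub>E b x y) =
     scal (\<alpha> (x \<otimes> y)) \<odot>\<^sub>(FF E) tmap E E (act E (c y)) (tm (hit (c x) f) (tens S E s w))"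
    using SE.tens_closed[OF sw(1) b[OF x y]] by (simp add: GA.scalar_smult[OF vE])
  qed (use x f sw SE.tens_closed in "auto intro!: sm ta_closed tm_closed")
  finally show "tens S E s (\<Oplus>\<^sub>E y\<in>X. \<alpha> (x \<otimes> y) \<odot>\<^sub>E b x y) =
   (\<Oplus>\<^sub>(FF E)y\<in>X. scal (\<alpha> (x \<otimes> y)) \<odot>\<^sub>(FF E) tmap E E (act E (c y)) (tm (hit (c x) f) (tens S E s w)))" .
 qed (use f sw SE.tens_closed in "auto intro!: sm ta_closed tm_closed")
 finally show "tm f (tmap E E (act E \<alpha>) (tens S E s w)) = (\<Oplus>\<^sub>(FF E)x\<in>X. \<Oplus>\<^sub>(FF E)y\<in>X.
   scal (\<alpha> (x \<otimes> y)) \<odot>\<^sub>(FF E) tmap E E (act E (c y)) (tm (hit (c x) f) (tens S E s w)))" .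
qed (use z in simp)

text \<open>
 Leibniz rule: \<open>T n\<close> acts like a divided power of a derivation, with \<open>\<mu> f a\<close> the multiplication
 by the \<open>a\<close>-th divided derivative of \<open>f\<close>.
\<close>

lemma tm_T:
 assumes f: "f : carrier G" and n: "n < p ^ r" and z: "z : carrier (tensor S E)"
 shows "tm f (T n z) = (\<Oplus>\<^sub>(FF E)a\<in>{..n}. T (n - a) (\<mu> f a z))"
proof -
 define b where "b x y = tmap E E (act E (c y)) (tm (hit (c x) f) z)" for x y
 have b: "b x y : carrier (tensor S E)" if "x : X" "y : X" for x y
  unfolding b_def using that f z by (intro ta_closed tm_closed) auto
 have tw: "tmap E E (act E (c w)) z : carrier (tensor S E)" if "w : X" for w using that z by (intro ta_closed) auto
 have "tm f (T n z) = (\<Oplus>\<^sub>(FF E)w\<in>X. tm f (u w n \<odot>\<^sub>(FF E) tmap E E (act E (c w)) z))"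
  unfolding op_def using n f tw
  by (intro additive_finsum[OF F.M.ag F.M.ag] GA.tmap_additive vE m_klin) (auto intro!: sm)
 also have "... = (\<Oplus>\<^sub>(FF E)w\<in>X. \<Oplus>\<^sub>(FF E)x\<in>X. \<Oplus>\<^sub>(FF E)y\<in>X. (c w (x \<otimes> y) \<odot>\<^sub>S u w n) \<odot>\<^sub>(FF E) b x y)"
 proof (intro F.M.finsum_cong' refl funcsetI F.M.finsum_closed)
  fix w assume w: "w : X"
  have "tm f (u w n \<odot>\<^sub>(FF E) tmap E E (act E (c w)) z) = u w n \<odot>\<^sub>(FF E) (\<Oplus>\<^sub>(FF E)x\<in>X. \<Oplus>\<^sub>(FF E)y\<in>X.
    scal (c w (x \<otimes> y)) \<odot>\<^sub>(FF E) b x y)"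
   unfolding b_def using w f n z tw by (simp add: GA.tmap_smult[OF vE vE m_klin] tm_act)
  also have "... = (\<Oplus>\<^sub>(FF E)x\<in>X. u w n \<odot>\<^sub>(FF E) (\<Oplus>\<^sub>(FF E)y\<in>X. scal (c w (x \<otimes> y)) \<odot>\<^sub>(FF E) b x y))"
   using w n b by (intro F.finsum_smult_ldistr funcsetI F.M.finsum_closed) (auto intro!: sm)
  also have "... = (\<Oplus>\<^sub>(FF E)x\<in>X. \<Oplus>\<^sub>(FF E)y\<in>X. u w n \<odot>\<^sub>(FF E) (scal (c w (x \<otimes> y)) \<odot>\<^sub>(FF E) b x y))"
   using w n b by (intro F.M.finsum_cong' refl F.finsum_smult_ldistr funcsetI F.M.finsum_closed) (auto intro!: sm)
  also have "... = (\<Oplus>\<^sub>(FF E)x\<in>X. \<Oplus>\<^sub>(FF E)y\<in>X. (c w (x \<otimes> y) \<odot>\<^sub>S u w n) \<odot>\<^sub>(FF E) b x y)"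
  proof (intro F.M.finsum_cong' refl funcsetI F.M.finsum_closed)
   fix x y assume xy: "x : X" "y : X"
   show "u w n \<odot>\<^sub>(FF E) (scal (c w (x \<otimes> y)) \<odot>\<^sub>(FF E) b x y) = (c w (x \<otimes> y) \<odot>\<^sub>S u w n) \<odot>\<^sub>(FF E) b x y"
    using w n b[OF xy] F.smult_assoc1[of "u w n" "scal (c w (x \<otimes> y))" "b x y"]
    by (simp add: smult_eq_mult_one[OF algebra_S, of "u w n"] GA.m_comm)
  qed (use w n b GA.smult_closed in "auto intro!: sm")
  finally show "tm f (u w n \<odot>\<^sub>(FF E) tmap E E (act E (c w)) z) =
    (\<Oplus>\<^sub>(FF E)x\<in>X. \<Oplus>\<^sub>(FF E)y\<in>X. (c w (x \<otimes> y) \<odot>\<^sub>S u w n) \<odot>\<^sub>(FF E) b x y)" .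
 qed (use n b GA.smult_closed in "auto intro!: sm")
 also have "... = (\<Oplus>\<^sub>(FF E)x\<in>X. \<Oplus>\<^sub>(FF E)y\<in>X. (\<Oplus>\<^sub>S w\<in>X. c w (x \<otimes> y) \<odot>\<^sub>S u w n) \<odot>\<^sub>(FF E) b x y)"
  using n b GA.smult_closed by (intro F.finsum_smult_inner) auto
 also have "... = (\<Oplus>\<^sub>(FF E)x\<in>X. \<Oplus>\<^sub>(FF E)y\<in>X. (\<Oplus>\<^sub>S a\<in>{..n}. u x a \<otimes>\<^sub>S u y (n - a)) \<odot>\<^sub>(FF E) b x y)"
 proof (intro F.M.finsum_cong' refl funcsetI F.M.finsum_closed)
  fix x y assume xy: "x : X" "y : X"
  have "(\<Oplus>\<^sub>S w\<in>X. c w (x \<otimes> y) \<odot>\<^sub>S u w n) = u (x \<otimes> y) n"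
   using xy n by (intro klin_expand[OF u.vspace_R u.nu_klin, symmetric]) auto
  then show "(\<Oplus>\<^sub>S w\<in>X. c w (x \<otimes> y) \<odot>\<^sub>S u w n) \<odot>\<^sub>(FF E) b x y =
    (\<Oplus>\<^sub>S a\<in>{..n}. u x a \<otimes>\<^sub>S u y (n - a)) \<odot>\<^sub>(FF E) b x y"
   using xy n by (simp add: u.nu_mult)
 qed (use n b in "auto intro!: sm GA.finsum_closed")
 also have "... = (\<Oplus>\<^sub>(FF E)a\<in>{..n}. \<Oplus>\<^sub>(FF E)x\<in>X. \<Oplus>\<^sub>(FF E)y\<in>X. (u x a \<otimes>\<^sub>S u y (n - a)) \<odot>\<^sub>(FF E) b x y)"
  using n b by (intro F.finsum_smult_inner[symmetric]) auto
 also have "... = (\<Oplus>\<^sub>(FF E)a\<in>{..n}. T (n - a) (\<mu> f a z))"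
 proof (intro F.M.finsum_cong' refl funcsetI)
  fix a assume a: "a : {..n}"
  have "T (n - a) (\<mu> f a z) = (\<Oplus>\<^sub>(FF E)y\<in>X. \<Oplus>\<^sub>(FF E)x\<in>X. (u y (n - a) \<otimes>\<^sub>S u x a) \<odot>\<^sub>(FF E) b x y)"
   unfolding \<mu>_def b_def using a n by (intro op_op[OF vE vE vE mfam famE _ _ z] f) auto
  also have "... = (\<Oplus>\<^sub>(FF E)x\<in>X. \<Oplus>\<^sub>(FF E)y\<in>X. (u y (n - a) \<otimes>\<^sub>S u x a) \<odot>\<^sub>(FF E) b x y)"
   using a n b by (intro F.M.finsum_swap) (auto intro!: sm)
  also have "... = (\<Oplus>\<^sub>(FF E)x\<in>X. \<Oplus>\<^sub>(FF E)y\<in>X. (u x a \<otimes>\<^sub>S u y (n - a)) \<odot>\<^sub>(FF E) b x y)"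
   using a n b by (intro F.M.finsum_cong' refl funcsetI F.M.finsum_closed) (auto intro!: sm simp: GA.m_comm)
  finally show "(\<Oplus>\<^sub>(FF E)x\<in>X. \<Oplus>\<^sub>(FF E)y\<in>X. (u x a \<otimes>\<^sub>S u y (n - a)) \<odot>\<^sub>(FF E) b x y) = T (n - a) (\<mu> f a z)" by simp
  show "T (n - a) (\<mu> f a z) : carrier (FF E)" using T_closed[OF _ mu_closed[OF f _ z]] n a by simp
 qed
 finally show ?thesis .
qed

text \<open>
 Leibniz rule for a divided derivative: by \<open>comult_sum\<close> the \<open>a\<close>-th derivative of the \<open>j\<close>-th one is the
 \<open>(j + a)\<close>-th one, up to a binomial coefficient.
\<close>

lemma mu_T:
 assumes f: "f : carrier G" and j: "j < p ^ r" and n: "n < p ^ r" and z: "z : carrier (tensor S E)"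
 shows "\<mu> f j (T n z) = (\<Oplus>\<^sub>(FF E)a\<in>{..n}. T (n - a)
   (if j + a < p ^ r then scal (of_nat ((j + a) choose j)) \<odot>\<^sub>(FF E) \<mu> f (j + a) z else \<zero>\<^sub>(FF E)))"
proof -
 have hf: "x : X ==> hit (c x) f : carrier G" for x using f by simp
 have mc: "\<mu> (hit (c x) f) a z : carrier (tensor S E)" if "x : X" "a \<le> n" for x a
  using mu_closed[OF hf[OF that(1)] _ z, of a] that n by simp
 note Tad = op_additive[OF vE vE famE] and Tsm = op_smult[OF vE vE famE]
 have "\<mu> f j (T n z) = (\<Oplus>\<^sub>(FF E)x\<in>X. \<Oplus>\<^sub>(FF E)a\<in>{..n}. T (n - a) (u x j \<odot>\<^sub>(FF E) \<mu> (hit (c x) f) a z))"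
  unfolding \<mu>_def[of f] op_def[of j]
 proof (intro F.M.finsum_cong' refl funcsetI F.M.finsum_closed)
  fix x assume x: "x : X"
  have "u x j \<odot>\<^sub>(FF E) tm (hit (c x) f) (T n z) =
    (\<Oplus>\<^sub>(FF E)a\<in>{..n}. u x j \<odot>\<^sub>(FF E) T (n - a) (\<mu> (hit (c x) f) a z))"
   unfolding tm_T[OF hf[OF x] n z] using x j n T_closed[OF _ mc[OF x]] by (intro F.finsum_smult_ldistr) auto
  also have "... = (\<Oplus>\<^sub>(FF E)a\<in>{..n}. T (n - a) (u x j \<odot>\<^sub>(FF E) \<mu> (hit (c x) f) a z))"
   using x j n mc[OF x] T_closed by (intro F.M.finsum_cong' refl) (auto simp: Tsm intro!: sm)
  finally show "u x j \<odot>\<^sub>(FF E) tm (hit (c x) f) (T n z) =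
    (\<Oplus>\<^sub>(FF E)a\<in>{..n}. T (n - a) (u x j \<odot>\<^sub>(FF E) \<mu> (hit (c x) f) a z))" .
 qed (use j n mc in "auto intro!: sm T_closed less_imp_diff_less")
 also have "... = (\<Oplus>\<^sub>(FF E)a\<in>{..n}. \<Oplus>\<^sub>(FF E)x\<in>X. T (n - a) (u x j \<odot>\<^sub>(FF E) \<mu> (hit (c x) f) a z))"
  using j n mc by (intro F.M.finsum_swap) (auto intro!: sm T_closed less_imp_diff_less)
 also have "... = (\<Oplus>\<^sub>(FF E)a\<in>{..n}. T (n - a)
   (if j + a < p ^ r then scal (of_nat ((j + a) choose j)) \<odot>\<^sub>(FF E) \<mu> f (j + a) z else \<zero>\<^sub>(FF E)))"
 proof (intro F.M.finsum_cong' refl funcsetI)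
  fix a assume a: "a : {..n}"
  have ap: "a < p ^ r" "n - a < p ^ r" using a n by auto
  have "(\<Oplus>\<^sub>(FF E)x\<in>X. T (n - a) (u x j \<odot>\<^sub>(FF E) \<mu> (hit (c x) f) a z)) =
    T (n - a) (\<Oplus>\<^sub>(FF E)x\<in>X. u x j \<odot>\<^sub>(FF E) \<mu> (hit (c x) f) a z)"
   using a j mc by (intro additive_finsum[OF F.M.ag F.M.ag Tad[OF ap(2)], symmetric]) (auto intro!: sm)
  also have "(\<Oplus>\<^sub>(FF E)x\<in>X. u x j \<odot>\<^sub>(FF E) \<mu> (hit (c x) f) a z) =
    (\<Oplus>\<^sub>(FF E)x\<in>X. \<Oplus>\<^sub>(FF E)y\<in>X. (u x j \<otimes>\<^sub>S u y a) \<odot>\<^sub>(FF E) tm (hit (c x \<otimes>\<^sub>B c y) f) z)"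
  proof (intro F.M.finsum_cong' refl funcsetI F.M.finsum_closed)
   fix x assume x: "x : X"
   have t: "tm (hit (c y) (hit (c x) f)) z : carrier (tensor S E)" if "y : X" for y
    using that x f z by (intro tm_closed) auto
   have "u x j \<odot>\<^sub>(FF E) \<mu> (hit (c x) f) a z =
     (\<Oplus>\<^sub>(FF E)y\<in>X. u x j \<odot>\<^sub>(FF E) (u y a \<odot>\<^sub>(FF E) tm (hit (c y) (hit (c x) f)) z))"
    unfolding \<mu>_def op_def using x j ap t by (intro F.finsum_smult_ldistr) (auto intro!: sm)
   also have "... = (\<Oplus>\<^sub>(FF E)y\<in>X. (u x j \<otimes>\<^sub>S u y a) \<odot>\<^sub>(FF E) tm (hit (c x \<otimes>\<^sub>B c y) f) z)"
    using x j ap t f by (intro F.M.finsum_cong' refl) (auto simp: F.smult_assoc1 hit_mult intro!: sm)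
   finally show "u x j \<odot>\<^sub>(FF E) \<mu> (hit (c x) f) a z =
     (\<Oplus>\<^sub>(FF E)y\<in>X. (u x j \<otimes>\<^sub>S u y a) \<odot>\<^sub>(FF E) tm (hit (c x \<otimes>\<^sub>B c y) f) z)" .
  qed (use j ap f z B_mult in "auto intro!: sm tm_closed")
  also have "... = (if j + a < p ^ r then scal (of_nat ((j + a) choose j)) \<odot>\<^sub>(FF E) \<mu> f (j + a) z else \<zero>\<^sub>(FF E))"
   unfolding \<mu>_def op_def by (rule comult_sum[OF vE family_apply_klin[OF vE vE mfam[OF f] z] j ap(1)])
  finally show "(\<Oplus>\<^sub>(FF E)x\<in>X. T (n - a) (u x j \<odot>\<^sub>(FF E) \<mu> (hit (c x) f) a z)) = T (n - a)
    (if j + a < p ^ r then scal (of_nat ((j + a) choose j)) \<odot>\<^sub>(FF E) \<mu> f (j + a) z else \<zero>\<^sub>(FF E))" .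
  show "T (n - a) (if j + a < p ^ r then scal (of_nat ((j + a) choose j)) \<odot>\<^sub>(FF E) \<mu> f (j + a) z else \<zero>\<^sub>(FF E))
    : carrier (FF E)"
   using ap f z mu_closed F.M.zero_closed by (auto intro!: T_closed sm)
 qed
 finally show ?thesis .
qed

end

lemma (in ideal) finsum_mem: "(!!i. i : J ==> f i : I) ==> (\<Oplus>\<^sub>R i\<in>J. f i) : I"
proof (induction J rule: infinite_finite_induct)
 case (insert j J)
 then have "f : insert j J \<rightarrow> carrier R" using a_Hcarr by blast
 then have "(\<Oplus>\<^sub>R i\<in>insert j J. f i) = f j \<oplus>\<^sub>R (\<Oplus>\<^sub>R i\<in>J. f i)" using insert(1,2) by (intro finsum_insert) auto
 then show ?case using insert by simp
qed (auto simp: finsum_infinite zero_closed)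

lemma (in residual) PF_finsum: "(!!i. i : J ==> f i : PF) ==> (\<Oplus>i\<in>J. f i) : PF"
proof (induction J rule: infinite_finite_induct)
 case (insert j J)
 then have "f : insert j J \<rightarrow> carrier F" using PF_closed by blast
 then have "(\<Oplus>i\<in>insert j J. f i) = f j \<oplus> (\<Oplus>i\<in>J. f i)" using insert(1,2) by (intro M.finsum_insert) auto
 then show ?case using insert PF_add by simp
qed (auto simp: M.finsum_infinite PF_zero)

lemma (in residual) prime_smult_PF: "s : P ==> z : carrier F ==> s \<odot> z : PF"
 using prim.a_Hcarr[of s] by (auto simp: PF_def k_smult prim.I_r_closed)

context representing
begin

text \<open>
 Modulo a prime the series \<open>\<Sum> u h a t^a\<close> has coefficients in a domain, so leading coefficients multiply.
 The bound on the degree keeps the product below the truncation.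
\<close>

lemma leading_power:
 assumes P: "primeideal P S" and h: "h : carrier G" and d: "!!a. a < d ==> u h a : P" "u h d \<notin> P"
  and n: "n * d < p ^ r"
 shows "(\<forall>l<n * d. u (h [^] n) l : P) \<and> u (h [^] n) (n * d) \<notin> P"
 using n
proof (induction n)
 case 0
 then show ?case using u.nu_one[of 0] primeideal.one_notin[OF P] by simp
next
 case (Suc n)
 interpret P: primeideal P S by fact
 let ?g = "h [^] n"
 have IH: "!!l. l < n * d ==> u ?g l : P" "u ?g (n * d) \<notin> P" and nd: "n * d < p ^ r" using Suc by auto
 have g: "?g : carrier G" using h by simp
 have in_P: "u ?g a \<otimes>\<^sub>S u h (l - a) : P" if a: "a \<le> l" "l < p ^ r" and "a < n * d \<or> l - a < d" for a l
 proof (cases "a < n * d")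
  case True
  then show ?thesis using IH(1) a h by (intro P.I_r_closed) auto
 next
  case False
  then show ?thesis using that d(1) g by (intro P.I_l_closed) auto
 qed
 have eq: "u (h [^] Suc n) l = (\<Oplus>\<^sub>S a\<in>{..l}. u ?g a \<otimes>\<^sub>S u h (l - a))" if "l < p ^ r" for l
  using u.nu_mult[OF g h that] by simp
 show ?case
 proof (intro conjI allI impI)
  fix l assume "l < Suc n * d"
  then show "u (h [^] Suc n) l : P" using Suc.prems by (subst eq) (auto intro!: P.finsum_mem in_P)
 next
  let ?l = "Suc n * d" and ?a = "n * d"
  let ?s = "\<Oplus>\<^sub>S a\<in>{..?l} - {?a}. u ?g a \<otimes>\<^sub>S u h (?l - a)"
  have cl: "u ?g a \<otimes>\<^sub>S u h (?l - a) : carrier S" if "a \<le> ?l" for a using that g h Suc.prems by auto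
  have s: "?s : P" using Suc.prems by (intro P.finsum_mem in_P) auto
  have "{..?l} = insert ?a ({..?l} - {?a})" by auto
  then have "u (h [^] Suc n) ?l = (\<Oplus>\<^sub>S a\<in>insert ?a ({..?l} - {?a}). u ?g a \<otimes>\<^sub>S u h (?l - a))"
   using eq[OF Suc.prems] by argo
  also have "... = u ?g ?a \<otimes>\<^sub>S u h (?l - ?a) \<oplus>\<^sub>S ?s"
   using cl cl[of ?a] by (intro GA.finsum_insert) auto
  finally have e: "u (h [^] Suc n) ?l = u ?g ?a \<otimes>\<^sub>S u h d \<oplus>\<^sub>S ?s" by simp
  have d_less: "d < p ^ r" using Suc.prems by (metis le_add1 le_less_trans mult_Suc)
  have "u ?g ?a \<otimes>\<^sub>S u h d \<notin> P"
   using primeideal.notin_mult[OF P, of "u ?g ?a" "u h d"] IH(2) d(2) g h nd d_less by auto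
  moreover have "u ?g ?a \<otimes>\<^sub>S u h d : carrier S" using g h nd d_less by auto
  ultimately show "u (h [^] Suc n) ?l \<notin> P"
   unfolding e using s P.a_closed[OF _ P.a_inv_closed[OF s], of "u ?g ?a \<otimes>\<^sub>S u h d \<oplus>\<^sub>S ?s"] P.a_Hcarr[OF s]
   by (auto simp: GA.a_assoc GA.r_neg)
 qed
qed

lemma scal_mult: "s \<odot>\<^sub>S x = scal s \<otimes>\<^sub>S x" if "x : carrier S"
 by (rule smult_eq_mult_one[OF algebra_S that])

lemma scal_scal: "scal (s * t) = scal s \<otimes>\<^sub>S scal t"
 using GA.smult_assoc1[of s t "\<one>\<^sub>S"] scal_mult[of "scal t" s] by simp

lemma scal_pow: "scal s [^]\<^sub>S (n::nat) = scal (s ^ n)"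
 using GA.smult_one[of "\<one>\<^sub>S"] by (induction n) (auto simp: scal_scal GA.m_comm)

lemma scal_one: "scal 1 = \<one>\<^sub>S" using GA.smult_one[of "\<one>\<^sub>S"] by simp

lemma scal_zero: "scal 0 = \<zero>\<^sub>S" using GA.smult_l_null[of "\<one>\<^sub>S"] by simp

lemma scal_prime:
 assumes P: "primeideal P S" and s: "s \<noteq> 0" and x: "x : carrier S" "s \<odot>\<^sub>S x : P"
 shows "x : P"
proof -
 interpret P: primeideal P S by fact
 have "scal (1 / s) \<otimes>\<^sub>S (s \<odot>\<^sub>S x) : P" using x by (intro P.I_l_closed) auto
 moreover have "scal (1 / s) \<otimes>\<^sub>S (s \<odot>\<^sub>S x) = x"
  using x s scal_scal[of "1 / s" s] by (simp add: scal_mult[OF x(1)] GA.m_assoc[symmetric] scal_one)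
 ultimately show ?thesis by simp
qed

lemma add_pow_FF:
 assumes M: "vspace M" and z: "z : carrier (tensor S M)"
 shows "add_pow (FF M) (n::nat) z = scal (of_nat n) \<odot>\<^sub>(FF M) z"
proof -
 interpret M: module S "FF M" by (rule GA.module_FF[OF M])
 note cl = GA.smult_closed_FF[OF M]
 show ?thesis
 proof (induction n)
  case 0
  then show ?case using z M.smult_l_null[of z] by (simp add: scal_zero)
 next
  case (Suc n)
  have "scal (of_nat (Suc n)) = scal (of_nat n) \<oplus>\<^sub>S \<one>\<^sub>S"
   using GA.smult_l_distr[of "of_nat n" 1 "\<one>\<^sub>S"] by (simp add: scal_one add.commute)
  then show ?case using Suc z M.smult_l_distr[of "scal (of_nat n)" "\<one>\<^sub>S" z] M.smult_one[of z] by simp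
 qed
qed

context
 fixes M :: "('k, 'h => 'k, 'm) bmod"
 assumes M: "kG_action M" and act_one: "!!w. w : carrier M ==> act M \<one>\<^sub>B w = w"
begin

interpretation F: graded_operator S "FF M" Sg "FG M" "Th M" e
 by (rule graded_operator_Th[OF M])

lemma op_zero:
 assumes z: "z : carrier (tensor S M)"
 shows "op 0 M M (act M) z = z"
proof -
 note vM = kG_action_vspace[OF M] and famM = kG_action_family[OF M]
 interpret SM: tensor_pair S M by (rule GA.pair[OF vM])
 interpret TM: vspace "tensor S M" by (rule SM.vspace_tensor)
 have tc: "\<alpha> : carrier B ==> tmap M M (act M \<alpha>) z : carrier (tensor S M)" for \<alpha>
  using GA.tmap_closed[OF vM vM lin_family_klin[OF famM] z] .
 let ?t = "\<lambda>\<alpha>. tmap M M (act M \<alpha>) z"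
 have one: "x : X ==> \<one>\<^sub>B x = counit G x" for x by (simp add: group_algebra_def)
 have p0: "0 < p ^ r" using p_pos by simp
 have u0: "u x 0 = scal (counit G x)" if "x : X" for x using u.nu_counit that by simp
 have "z = ?t \<one>\<^sub>B"
  using GA.tmap_id[OF vM z lin_family_klin[OF famM B_one]] act_one by simp
 also have "?t \<one>\<^sub>B = (\<Oplus>\<^sub>(tensor S M)x\<in>X. \<one>\<^sub>B x \<odot>\<^sub>(tensor S M) ?t (c x))"
  by (rule klin_B_expand[OF SM.vspace_tensor family_apply_klin[OF vM vM famM z] B_one])
 also have "... = (\<Oplus>\<^sub>(FF M)x\<in>X. \<one>\<^sub>B x \<odot>\<^sub>(tensor S M) ?t (c x))"
  using z tc TM.smult_closed
  by (intro GA.finsum_FF vM) auto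
 also have "... = op 0 M M (act M) z"
  unfolding op_def using z tc
  by (intro F.M.finsum_cong' refl) (auto simp: one GA.scalar_smult[OF vM] u0 intro!: GA.smult_closed_FF[OF vM])
 finally show ?thesis by simp
qed

lemma Th_nilpotent:
 assumes z: "z : carrier (tensor S M)"
 shows "(Th M ^^ p) z = \<zero>\<^sub>(FF M)"
proof -
 have "\<exists>s\<in>carrier S. (Th M ^^ n) z = s \<odot>\<^sub>(FF M) op (n * e) M M (act M) z" if "n < p" for n
  using that
 proof (induction n)
  case 0
  then show ?case using op_zero[OF z] F.smult_one[of z] z by (intro bexI[of _ "\<one>\<^sub>S"]) auto
 next
  case (Suc n)
  then obtain s where s: "s : carrier S" "(Th M ^^ n) z = s \<odot>\<^sub>(FF M) op (n * e) M M (act M) z" by auto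
  have l: "e + n * e < p ^ r" using mult_strict_right_mono[OF Suc.prems e_pos] e_p by simp
  have n: "n * e < p ^ r" using l by simp
  have w: "op (n * e) M M (act M) z : carrier (tensor S M)" by (rule op_closed[OF kG_action_vspace[OF M] kG_action_vspace[OF M] kG_action_family[OF M] n z])
  have "(Th M ^^ Suc n) z = s \<odot>\<^sub>(FF M) op e M M (act M) (op (n * e) M M (act M) z)"
   using s w F.T_smult[of s "op (n * e) M M (act M) z"] by (simp add: Th_eq_op[OF M])
  also have "... = (s \<otimes>\<^sub>S scal (of_nat ((e + n * e) choose e))) \<odot>\<^sub>(FF M) op (e + n * e) M M (act M) z"
   unfolding act_op_act[OF M e_less n z] using l s op_closed[OF kG_action_vspace[OF M] kG_action_vspace[OF M] kG_action_family[OF M] l z] by (simp add: F.smult_assoc1)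
  finally show ?case using s by auto
 qed
 from this[of "p - 1"] p_pos obtain s where s: "s : carrier S" "(Th M ^^ (p - 1)) z = s \<odot>\<^sub>(FF M) op ((p - 1) * e) M M (act M) z" by auto
 have pe: "e + (p - 1) * e = p ^ r" using e_p p_pos by (cases p) auto
 then have n: "(p - 1) * e < p ^ r" using e_pos by linarith
 have w: "op ((p - 1) * e) M M (act M) z : carrier (tensor S M)" by (rule op_closed[OF kG_action_vspace[OF M] kG_action_vspace[OF M] kG_action_family[OF M] n z])
 have "(Th M ^^ p) z = Th M ((Th M ^^ (p - 1)) z)" using p_pos by (cases p) auto
 also have "... = s \<odot>\<^sub>(FF M) op e M M (act M) (op ((p - 1) * e) M M (act M) z)"
  using s w F.T_smult[of s "op ((p - 1) * e) M M (act M) z"] by (simp only: Th_eq_op[OF M w] GA.FF_simps)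
 also have "... = \<zero>\<^sub>(FF M)"
  unfolding act_op_act[OF M e_less n z] using pe s F.smult_r_null[of s] by simp
 finally show ?thesis .
qed

end

end

context hopf_module
begin

lemma T_0: "z : carrier (tensor S E) ==> T 0 z = z"
 using op_zero[OF action act_one] .

lemma Th_T: "z : carrier (tensor S E) ==> Th E z = T e z"
 by (rule Th_eq_op[OF action])

lemma tm_tm: "f : carrier G ==> g : carrier G ==> z : carrier (tensor S E) ==> tm f (tm g z) = tm (f \<otimes> g) z"
 by (intro GA.tmap_comp vE m_klin) (auto simp: m_mult)

lemma tm_scalar:
 assumes z: "z : carrier (tensor S E)"
 shows "tm (s \<odot> \<one>) z = scal s \<odot>\<^sub>(FF E) z"
proof -
 have s1: "s \<odot> \<one> : carrier G" using G.smult_closed by simp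
 have ms: "m (s \<odot> \<one>) w = s \<odot>\<^sub>E w" if "w : carrier E" for w
  using klin_smult[OF m_klin_left[OF that], of "\<one>" s] m_one[OF that] by simp
 show ?thesis
 proof (rule GA.FF_ext[OF vE F.M.ag, where z = z])
  show "additive (FF E) (FF E) (tm (s \<odot> \<one>))" by (rule GA.tmap_additive[OF vE vE m_klin[OF s1]])
  show "additive (FF E) (FF E) (\<lambda>z. scal s \<odot>\<^sub>(FF E) z)" by (rule GA.smult_additive[OF vE]) simp
  fix t w assume "t : carrier S" "w : carrier E"
  then show "tm (s \<odot> \<one>) (tens S E t w) = scal s \<odot>\<^sub>(FF E) tens S E t w"
   by (simp add: GA.tmap_tens[OF vE vE m_klin[OF s1]] ms SE.tens_smult_right GA.scalar_smult[OF vE, symmetric] SE.tens_closed)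
 qed (use z in simp)
qed

text \<open>
 The operators \<open>\<mu> f j\<close> are elements of the commutative algebra \<open>S \<otimes> k[G]\<close>. As the Frobenius of
 order \<open>p ^ r\<close> on \<open>k[G]\<close> has values in the scalars, their powers are scalars.
\<close>

lemma mu_power:
 assumes f: "f : carrier G" and j: "j < p ^ r" and z: "z : carrier (tensor S E)"
 shows "(\<mu> f j ^^ (p ^ r)) z = (u f j [^]\<^sub>S (p ^ r)) \<odot>\<^sub>(FF E) z"
proof -
 let ?F = "FF E"
 define h where "h x = hit (c x) f" for x
 have h: "x : X ==> h x : carrier G" for x using f by (simp add: h_def)
 have ux: "x : X ==> u x j : carrier S" for x using j by simp
 define L where "L x z = u x j \<odot>\<^sub>?F tm (h x) z" for x z
 define R where "R x z = (scal (c x f) \<otimes>\<^sub>S u x j) \<odot>\<^sub>?F z" for x z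
 have char0: "add_pow ?F p w = \<zero>\<^sub>?F" if "w : carrier ?F" for w
  using that char F.smult_l_null[of w] of_nat_CHAR[where 'a = 'k] by (simp add: add_pow_FF[OF vE] scal_zero)
 have Lad: "additive ?F ?F (L x)" if "x : X" for x
  unfolding L_def[abs_def] using that h ux by (intro GA.additive_comp[OF GA.tmap_additive GA.smult_additive] vE m_klin)
 have Rad: "additive ?F ?F (R x)" if "x : X" for x
  unfolding R_def[abs_def] using that ux by (intro GA.smult_additive vE) auto
 have LL: "L x (L y w) = (u x j \<otimes>\<^sub>S u y j) \<odot>\<^sub>?F tm (h x \<otimes> h y) w" if "x : X" "y : X" "w : carrier (tensor S E)" for x y w
  unfolding L_def using that h ux tm_closed[OF h] tm_closed[of "h x \<otimes> h y" w]
  by (simp add: GA.tmap_smult[OF vE vE m_klin] tm_tm F.smult_assoc1)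
 have Lpow: "(L x ^^ n) w = (u x j [^]\<^sub>S n) \<odot>\<^sub>?F tm (h x [^] n) w" if "x : X" "w : carrier (tensor S E)" for x n w
 proof (induction n)
  case 0
  have "tm \<one> w = w" using tm_scalar[OF that(2), of 1] G.smult_one[of "\<one>"] F.smult_one[of w] that(2) by (simp add: scal_one)
  then show ?case using that F.smult_one[of w] by simp
 next
  case (Suc n)
  have "(L x ^^ Suc n) w = L x ((u x j [^]\<^sub>S n) \<odot>\<^sub>?F tm (h x [^] n) w)" using Suc by simp
  also have "... = u x j \<odot>\<^sub>?F tm (h x) ((u x j [^]\<^sub>S n) \<odot>\<^sub>?F tm (h x [^] n) w)"
   by (simp add: L_def)
  also have "... = (u x j [^]\<^sub>S Suc n) \<odot>\<^sub>?F tm (h x [^] Suc n) w"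
   using that h ux tm_closed
   by (simp add: GA.tmap_smult[OF vE vE m_klin] tm_tm F.smult_assoc1[symmetric] GA.m_comm G.m_comm)
  finally show ?case .
 qed
 have Rpow: "(R x ^^ n) w = ((scal (c x f) \<otimes>\<^sub>S u x j) [^]\<^sub>S n) \<odot>\<^sub>?F w" if "x : X" "w : carrier (tensor S E)" for x n w
  using that ux F.smult_one[of w] by (induction n) (auto simp: R_def F.smult_assoc1[symmetric] GA.m_comm)
 have "(\<mu> f j ^^ (p ^ r)) z = ((\<lambda>z. \<Oplus>\<^sub>?F x\<in>X. L x z) ^^ (p ^ r)) z"
  by (simp add: \<mu>_def op_def[abs_def] L_def h_def)
 also have "... = (\<Oplus>\<^sub>?F x\<in>X. (L x ^^ (p ^ r)) z)"
 proof (rule F.M.frobenius_sum[OF prime_p char0 finite_X Lad])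
  show "L x (L y w) = L y (L x w)" if "x : X" "y : X" "w : carrier ?F" for x y w
   using that by (simp add: LL GA.m_comm[OF ux ux] G.m_comm[OF h h])
 qed (use z in simp_all)
 also have "... = (\<Oplus>\<^sub>?F x\<in>X. (R x ^^ (p ^ r)) z)"
 proof (intro F.M.finsum_cong' refl funcsetI)
  fix x assume x: "x : X"
  show "(R x ^^ (p ^ r)) z : carrier ?F" using x z ux unfolding Rpow[OF x z] by (auto intro!: sm)
  have "h x [^] (p ^ r) = (c x f ^ (p ^ r)) \<odot> \<one>"
   using Frobenius[OF h[OF x]] x f by (simp add: h_def counit_hit)
  then show "(L x ^^ (p ^ r)) z = (R x ^^ (p ^ r)) z"
   unfolding Lpow[OF x z] Rpow[OF x z] using x z ux
   by (simp add: tm_scalar F.smult_assoc1[symmetric] GA.nat_pow_distrib scal_pow GA.m_comm)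
 qed
 also have "... = ((\<lambda>z. \<Oplus>\<^sub>?F x\<in>X. R x z) ^^ (p ^ r)) z"
  using z ux by (intro F.M.frobenius_sum[symmetric] prime_p char0 Rad)
   (auto simp: R_def F.smult_assoc1[symmetric] GA.m_comm)
 also have "... = (u f j [^]\<^sub>S (p ^ r)) \<odot>\<^sub>?F z"
 proof -
  have ufj: "u f j = (\<Oplus>\<^sub>S x\<in>X. scal (c x f) \<otimes>\<^sub>S u x j)"
   using klin_expand[OF u.vspace_R u.nu_klin[OF j] f] ux by (simp add: scal_mult[OF ux] cong: GA.finsum_cong)
  have "(\<Oplus>\<^sub>?F x\<in>X. R x w) = u f j \<odot>\<^sub>?F w" if "w : carrier (tensor S E)" for w
   unfolding ufj R_def using that ux by (intro F.finsum_smult_rdistr[symmetric]) auto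
  then have "((\<lambda>z. \<Oplus>\<^sub>?F x\<in>X. R x z) ^^ n) z = (u f j [^]\<^sub>S n) \<odot>\<^sub>?F z" for n
   using z f j F.smult_one[of z] sm[OF _ z]
   by (induction n) (simp_all add: F.smult_assoc1[symmetric] GA.m_comm)
  then show ?thesis .
 qed
 finally show ?thesis .
qed

end

context hopf_module
begin

lemma mu_endo:
 assumes f: "f : carrier G" and j: "j < p ^ r"
 shows "additive (FF E) (FF E) (\<mu> f j)"
  and "s : carrier S ==> z : carrier (tensor S E) ==> \<mu> f j (s \<odot>\<^sub>(FF E) z) = s \<odot>\<^sub>(FF E) \<mu> f j z"
  and "z : FG E (int n) ==> \<mu> f j z : FG E (int (n + j))"
 using op_additive[OF vE vE mfam[OF f] j] op_smult[OF vE vE mfam[OF f] j] op_degree[OF vE vE mfam[OF f] j, of z "int n"]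
 by (auto simp: \<mu>_def[abs_def] add.commute)

text \<open>
 At the prime \<open>P\<close>, take the least \<open>i\<close> such that some \<open>u f (p ^ i)\<close> is not in \<open>P\<close>; then only the
 coefficients \<open>u g j\<close> with \<open>p ^ i\<close> dividing \<open>j\<close> matter. The operators for the core argument are the
 \<open>\<mu> z j\<close>, with \<open>z\<close> the power of \<open>f - f(1)\<close> whose leading coefficient has degree \<open>p ^ r - p ^ i\<close>. In
 the Leibniz rule for them all middle terms vanish: either their coefficients are in \<open>P\<close> or the
 binomials are divisible by \<open>p\<close>.
\<close>

theorem acyclic:
 assumes P: "P : Proj S Sg"
 shows "acyc E P"
proof -
 have prime: "primeideal P S" using P by (rule Proj_prime)
 interpret FP: graded_operator_at S "FF E" Sg "FG E" "Th E" e P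
  by (intro graded_operator_at.intro graded_module_at.intro graded_module_at_axioms.intro
    F.graded_operator_axioms F.graded_module_axioms prime)
 have kk: "y : Y ==> klin E kk (k y)" and Y: "finite Y" "Y \<subseteq> carrier E" for y
  using coords_E by (auto simp: coordinates_def)
 interpret residual S "FF E" Sg "FG E" "Th E" e P Y "GA.pure E" "\<lambda>y. GA.coord (k y)"
 proof unfold_locales
  show "GA.pure E y : FG E 0" if "y : Y" for y
   using GA.tens_FG[OF GA.Sg_one, of y E] that Y by auto
  show "(\<Oplus>\<^sub>(FF E)y\<in>Y. GA.coord (k y) z \<odot>\<^sub>(FF E) GA.pure E y) = z" if "z : carrier (FF E)" for z
   using GA.coord_expand[OF vE coords_E, of z] that by simp
  show "GA.coord (k y) (a \<odot>\<^sub>(FF E) z) = a \<otimes>\<^sub>S GA.coord (k y) z" if "y : Y" "a : carrier S" "z : carrier (FF E)" for y a z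
   using GA.coord_smult[OF vE kk[OF that(1)]] that by simp
  show "finite Y" by (rule Y)
 qed (fact GA.Sg_add GA.Sg_minus GA.coord_additive[OF vE kk] GA.coord_degree[OF vE kk])+
 obtain i f where i: "i < r" and f: "f : carrier G" "u f (p ^ i) \<notin> P"
  and small: "!!g l. g : carrier G ==> l < i ==> u g (p ^ l) : P"
  using exists_minimal_level[OF P] by blast
 define d where "d = p ^ i"
 have d0: "d > 0" using p_pos by (simp add: d_def)
 have de: "d dvd e" using i by (simp add: d_def le_imp_power_dvd)
 then have d_le: "d \<le> e" using e_pos by (simp add: dvd_imp_le)
 have nonmult: "u g j : P" if "g : carrier G" "j < p ^ r" "\<not> d dvd j" for g j
  using nonmultiples_in_prime[OF prime small _ that(1,2)] i that(3) by (auto simp: d_def)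
 have d_less: "d < p ^ r" using d_le e_less by simp
 \<comment> \<open>replacing \<open>f\<close> by \<open>f - f(1)\<close> makes the coefficient of degree \<open>0\<close> vanish\<close>
 define h where "h = f \<oplus> ((- counit G f) \<odot> \<one>)"
 have one_s: "s \<odot> \<one> : carrier G" for s using G.smult_closed by simp
 have h: "h : carrier G" unfolding h_def using f(1) one_s by simp
 have uh: "u h j = u f j \<oplus>\<^sub>S ((- counit G f) \<odot>\<^sub>S (if j = 0 then \<one>\<^sub>S else \<zero>\<^sub>S))" if "j < p ^ r" for j
  unfolding h_def using that f(1) one_s by (simp add: u.nu_add u.nu_smult u.nu_one del: if_split)
 have s0: "s \<odot>\<^sub>S \<zero>\<^sub>S = \<zero>\<^sub>S" for s using GA.smult_r_null[of s] by simp
 have "u h 0 = \<zero>\<^sub>S"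
  using uh[of 0] p_pos f(1) GA.smult_l_distr[of "counit G f" "- counit G f" "\<one>\<^sub>S"] by (simp add: u.nu_counit scal_zero)
 then have low: "u h a : P" if "a < d" for a
  using that nonmult[OF h, of a] d_less prim.zero_closed nat_dvd_not_less[of a d] by (cases "a = 0") auto
 have "u h d = u f d" using uh[OF d_less] d0 f(1) d_less by (simp add: s0)
 then have lead: "u h d \<notin> P" using f(2) by (simp add: d_def)
 define n where "n = p ^ (r - i) - 1"
 have "p ^ r = p ^ (r - i) * d" using i by (simp add: d_def power_add[symmetric])
 then have nd: "n * d = p ^ r - d" by (simp add: n_def diff_mult_distrib)
 have nd_less: "n * d < p ^ r" using nd d0 d_less by simp
 define z where "z = h [^] n"
 have z: "z : carrier G" using h by (simp add: z_def)
 have top: "u z (p ^ r - d) \<notin> P" using leading_power[OF prime h low lead nd_less] by (simp add: z_def nd)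
 \<comment> \<open>steps of size \<open>e\<close>, the degree of \<open>\<Theta>\<close>, that end at the leading degree \<open>p ^ r - d\<close> of \<open>z\<close>\<close>
 define j where "j m = (e - d) + m * e" for m
 have j_less: "j m < p ^ r" if "m < p" for m
 proof -
  have "Suc m * e \<le> p * e" using that by (intro mult_le_mono1) simp
  then show ?thesis using d0 e_pos d_le e_p by (simp add: j_def)
 qed
 have j_Suc: "j (Suc m) = j m + e" for m by (simp add: j_def)
 have pe: "e + (p - 1) * e = p ^ r" using e_p p_pos by (cases p) auto
 have j_top: "j (p - 1) = p ^ r - d" using pe d_le by (simp add: j_def)
 show ?thesis
 proof (rule acyclic_of_commutators[where a = "e - d" and x = "\<lambda>m. \<mu> z (j m)" and c = "u z (p ^ r - d)" and q = "p ^ r"])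
  show "e > 0" by (rule e_pos)
  show "prime p" by (rule prime_p)
  show "add_pow (FF E) p y = \<zero>\<^sub>(FF E)" if "y : carrier (FF E)" for y
   using that char F.smult_l_null[of y] of_nat_CHAR[where 'a = 'k] by (simp add: add_pow_FF[OF vE] scal_zero)
  show "s : P" if s: "s : carrier S" "add_pow S (fact (p - 1) :: nat) s : P" for s
  proof (rule scal_prime[OF prime _ s(1)])
   show "(of_nat (fact (p - 1)) :: 'k) \<noteq> 0"
    using prime_dvd_fact_iff[OF prime_p, of "p - 1"] p_pos char
    by (simp add: of_nat_eq_0_iff_char_dvd del: of_nat_fact)
   show "of_nat (fact (p - 1)) \<odot>\<^sub>S s : P" using s(2) add_pow_smult[OF algebra_S s(1)] by (simp del: of_nat_fact)
  qed
  show "(Th E ^^ p) y = \<zero>\<^sub>(FF E)" if "y : carrier (FF E)" for y using Th_nilpotent[OF action act_one] that by simp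
  show "endo (e - d + m * e) (\<mu> z (j m))" if "m < p" for m
   using mu_endo[OF z j_less[OF that]] by (simp add: endo_def j_def)
  show "u z (p ^ r - d) : Sg (e - d + (p - 1) * e) - P"
  proof -
   have "e - d + (p - 1) * e = p ^ r - d" using pe d_le by simp
   then show ?thesis using top u_degree[OF z, of "p ^ r - d"] d0 d_less by simp
  qed
  show "p ^ r > 0" using p_pos by simp
  show "(\<mu> z (j (p - 1)) ^^ (p ^ r)) w = (u z (p ^ r - d) [^]\<^sub>S (p ^ r)) \<odot>\<^sub>(FF E) w" if "w : carrier (FF E)" for w
   unfolding j_top using mu_power[OF z _, of "p ^ r - d" w] that d0 d_less by simp
 next
  fix m w assume m: "Suc m < p" and w: "w : carrier (FF E)"
  let ?J = "j m"
  have J: "?J < p ^ r" "?J + e < p ^ r" using j_less[of m] j_less[OF m] m by (auto simp: j_Suc)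
  define g where "g a = T (e - a) (if ?J + a < p ^ r then scal (of_nat ((?J + a) choose ?J)) \<odot>\<^sub>(FF E) \<mu> z (?J + a) w
    else \<zero>\<^sub>(FF E))" for a
  have wc: "w : carrier (tensor S E)" using w by simp
  have sym: "(a + b) choose a = (a + b) choose b" for a b :: nat using binomial_symmetric[of a "a + b"] by simp
  have arg: "(if ?J + a < p ^ r then scal (of_nat ((?J + a) choose ?J)) \<odot>\<^sub>(FF E) \<mu> z (?J + a) w
    else \<zero>\<^sub>(FF E)) : carrier (tensor S E)" for a
   using mu_closed[OF z _ wc] F.M.zero_closed by (auto intro!: sm)
  have g: "g a : carrier (FF E)" for a
   unfolding g_def using T_closed[OF _ arg, of "e - a"] e_less by simp
  have g0: "g 0 = Th E (\<mu> z ?J w)"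
   using J(1) mu_closed[OF z J(1) wc] F.smult_one[of "\<mu> z ?J w"] by (simp add: g_def scal_one Th_T)
  have ge: "g e = add_pow (FF E) (Suc m) (\<mu> z (j (Suc m)) w)"
  proof -
   have eq: "?J + e = Suc m * e + (e - d)" by (simp add: j_def)
   have "(of_nat ((?J + e) choose ?J) :: 'k) = of_nat (Suc m)"
    unfolding sym[of ?J e] unfolding eq using d0 e_pos by (intro binomial_leading_digit[OF char p_pos]) simp
   then show ?thesis
    using J mu_closed[OF z J(2) wc] sm
    by (simp add: g_def T_0 add_pow_FF[OF vE] j_Suc del: F.M.add.nat_pow_Suc)
  qed
  have mid: "g a : PF" if a: "0 < a" "a < e" for a
  proof (cases "d dvd a")
   case True
   then have "d \<le> a" using a by (simp add: dvd_imp_le)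
   then have eq: "?J + a = Suc m * e + (a - d)" using d_le by (simp add: j_def)
   have "(of_nat ((?J + a) choose ?J) :: 'k) = 0"
    unfolding sym[of ?J a] unfolding eq using a d0 \<open>d \<le> a\<close> by (intro binomial_shift_zero[OF char p_pos]) auto
   then have "(if ?J + a < p ^ r then scal (of_nat ((?J + a) choose ?J)) \<odot>\<^sub>(FF E) \<mu> z (?J + a) w
     else \<zero>\<^sub>(FF E)) = \<zero>\<^sub>(FF E)"
    using mu_closed[OF z _ wc] F.smult_l_null[of "\<mu> z (?J + a) w"] by (simp add: scal_zero)
   then have "g a = T (e - a) \<zero>\<^sub>(FF E)" unfolding g_def by argo
   also have "... = \<zero>\<^sub>(FF E)"
    using additive_zero[OF F.M.ag F.M.ag op_additive[OF vE vE famE, of "e - a"]] e_less by simp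
   finally show ?thesis using PF_zero by simp
  next
   case False
   then have "\<not> d dvd e - a" using de a by (metis dvd_diff_nat diff_diff_cancel less_imp_le)
   then have "u x (e - a) : P" if "x : X" for x using nonmult[of x "e - a"] that e_less by simp
   then show ?thesis
    unfolding g_def op_def[of "e - a"] using ta_closed[OF _ arg] by (intro PF_finsum prime_smult_PF) auto
  qed
  let ?s = "\<Oplus>\<^sub>(FF E)a\<in>{0<..<e}. g a"
  have s: "?s : PF" using mid by (intro PF_finsum) auto
  have sc: "?s : carrier (FF E)" by (rule PF_closed[OF s])
  have "{..e} = insert 0 (insert e {0<..<e})" using e_pos by auto
  then have "\<mu> z ?J (Th E w) = (\<Oplus>\<^sub>(FF E)a\<in>insert 0 (insert e {0<..<e}). g a)"
   unfolding Th_T[OF wc] mu_T[OF z J(1) e_less wc] g_def by argo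
  also have "... = g 0 \<oplus>\<^sub>(FF E) (\<Oplus>\<^sub>(FF E)a\<in>insert e {0<..<e}. g a)"
   using g e_pos by (intro F.M.finsum_insert) auto
  also have "(\<Oplus>\<^sub>(FF E)a\<in>insert e {0<..<e}. g a) = g e \<oplus>\<^sub>(FF E) ?s"
   using g by (intro F.M.finsum_insert) auto
  finally have "\<mu> z ?J (Th E w) \<ominus>\<^sub>(FF E) (g 0 \<oplus>\<^sub>(FF E) g e) = ?s"
  proof -
   assume eq: "\<mu> z ?J (Th E w) = g 0 \<oplus>\<^sub>(FF E) (g e \<oplus>\<^sub>(FF E) ?s)"
   have "g 0 \<oplus>\<^sub>(FF E) (g e \<oplus>\<^sub>(FF E) ?s) = ?s \<oplus>\<^sub>(FF E) (g 0 \<oplus>\<^sub>(FF E) g e)"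
    using g sc by (metis F.M.a_assoc F.M.a_comm F.M.a_closed)
   then show ?thesis unfolding eq using g sc
    by (simp only: F.M.minus_eq F.M.a_assoc F.M.a_closed F.M.a_inv_closed F.M.r_neg F.M.r_zero)
  qed
  then show "\<mu> z ?J (Th E w) \<ominus>\<^sub>(FF E) (Th E (\<mu> z ?J w) \<oplus>\<^sub>(FF E) add_pow (FF E) (Suc m) (\<mu> z (j (Suc m)) w)) : PF"
   unfolding g0 ge using s by simp
 qed
qed

end

section \<open>Exactness and module homomorphisms\<close>

lemma (in vspace) fin_dim_family:
 assumes I: "finite I" "!!i. i : I ==> b i : carrier V"
  and span: "!!v. v : carrier V ==> \<exists>a. v = (\<Oplus>i\<in>I. a i \<odot> b i)"
 shows "fin_dim V"
proof -
 let ?X = "b ` I"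
 have X: "finite ?X" "?X \<subseteq> carrier V" using I by auto
 have sc: "s \<odot> v : carrier V" if "v : carrier V" for s v using that smult_closed by simp
 have "\<exists>c. (\<Oplus>i\<in>J. a i \<odot> b i) = (\<Oplus>x\<in>?X. c x \<odot> x)" if "finite J" "J \<subseteq> I" for J a
  using that
 proof (induction J rule: finite_induct)
  case empty
  have "(\<Oplus>x\<in>?X. 0 \<odot> x) = (\<Oplus>x\<in>?X. \<zero>)"
   using X by (intro M.finsum_cong' refl) (auto simp: smult_l_null[simplified])
  then show ?case by (intro exI[of _ "\<lambda>_. 0"]) simp
 next
  case (insert j J)
  then obtain c where c: "(\<Oplus>i\<in>J. a i \<odot> b i) = (\<Oplus>x\<in>?X. c x \<odot> x)" by auto
  let ?d = "\<lambda>x. if x = b j then a j else 0"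
  have bj: "b j : ?X" "b j : carrier V" using insert.prems X by auto
  have "(\<Oplus>x\<in>?X. ?d x \<odot> x) = (\<Oplus>x\<in>?X. if b j = x then a j \<odot> x else \<zero>)"
   using X sc by (intro M.finsum_cong' refl) (auto simp: smult_l_null[simplified] subset_iff)
  also have "... = a j \<odot> b j"
   using X sc bj by (intro M.finsum_singleton) auto
  finally have d: "(\<Oplus>x\<in>?X. ?d x \<odot> x) = a j \<odot> b j" .
  have "(\<Oplus>i\<in>insert j J. a i \<odot> b i) = a j \<odot> b j \<oplus> (\<Oplus>i\<in>J. a i \<odot> b i)"
   using insert I sc by (intro M.finsum_insert) auto
  also have "... = (\<Oplus>x\<in>?X. (?d x + c x) \<odot> x)"
   unfolding c d[symmetric] by (rule finsum_smult_add[OF X, symmetric])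
  finally show ?case by (rule exI[of _ "\<lambda>x. ?d x + c x"])
 qed
 from this[OF I(1) subset_refl] have "\<exists>c. v = (\<Oplus>x\<in>?X. c x \<odot> x)" if "v : carrier V" for v
  using span[OF that] by metis
 with X show ?thesis unfolding fin_dim_def by blast
qed

lemma fin_dim_image:
 assumes V: "vspace V" "fin_dim V" and W: "vspace W" and h: "klin V W h" "h ` carrier V = carrier W"
 shows "fin_dim W"
proof -
 interpret V: vspace V by fact
 interpret W: vspace W by fact
 obtain X where X: "finite X" "X \<subseteq> carrier V" "\<forall>v\<in>carrier V. \<exists>c. v = (\<Oplus>\<^sub>V x\<in>X. c x \<odot>\<^sub>V x)"
  using V(2) by (auto simp: fin_dim_def)
 show ?thesis
 proof (rule W.fin_dim_family[of X h])
  show "h i : carrier W" if "i : X" for i using klin_closed[OF h(1)] that X by auto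
  fix w assume "w : carrier W"
  then obtain v where v: "v : carrier V" "w = h v" using h(2) by auto
  then obtain a where a: "v = (\<Oplus>\<^sub>V x\<in>X. a x \<odot>\<^sub>V x)" using X by blast
  have sc: "s \<odot>\<^sub>V x : carrier V" if "x : X" for s x using that X V.smult_closed by auto
  have "w = (\<Oplus>\<^sub>W x\<in>X. h (a x \<odot>\<^sub>V x))"
   unfolding v(2) a using sc
   by (intro additive_finsum[OF V.M.ag W.M.ag klin_additive[OF h(1)]]) auto
  also have "... = (\<Oplus>\<^sub>W x\<in>X. a x \<odot>\<^sub>W h x)"
   using X klin_smult[OF h(1)] klin_closed[OF h(1)] W.smult_closed by (intro W.M.finsum_cong' refl) auto
  finally show "\<exists>a. w = (\<Oplus>\<^sub>W i\<in>X. a i \<odot>\<^sub>W h i)" by blast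
 qed (rule X(1))
qed

lemma linear_section:
 assumes M: "vspace M" and L: "vspace L" "fin_dim L" and g: "klin M L g" "g ` carrier M = carrier L"
 obtains s where "klin L M s" "!!l. l : carrier L ==> g (s l) = l"
proof -
 interpret M: vspace M by fact
 interpret L: vspace L by fact
 obtain X c where c: "coordinates L X c" using L.fin_dim_coordinates[OF L(2)] by blast
 then have X: "finite X" "X \<subseteq> carrier L" and ck: "x : X ==> klin L kk (c x)"
  and exp: "l : carrier L ==> (\<Oplus>\<^sub>L x\<in>X. c x l \<odot>\<^sub>L x) = l" for x l
  by (auto simp: coordinates_def)
 have "\<forall>x\<in>X. \<exists>m. m : carrier M \<and> g m = x" using X g(2) by (metis imageE subsetD)
 then obtain q where q: "x : X ==> q x : carrier M" "x : X ==> g (q x) = x" for x by metis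
 let ?s = "\<lambda>l. \<Oplus>\<^sub>M x\<in>X. c x l \<odot>\<^sub>M q x"
 have cl: "c x l \<odot>\<^sub>M q x : carrier M" if "x : X" for x l using q that M.smult_closed by auto
 have "klin L M ?s"
 proof (rule klinI)
  show "?s l : carrier M" for l using cl by (intro M.M.finsum_closed) auto
  show "?s (x \<oplus>\<^sub>L y) = ?s x \<oplus>\<^sub>M ?s y" if "x : carrier L" "y : carrier L" for x y
  proof -
   have "?s (x \<oplus>\<^sub>L y) = (\<Oplus>\<^sub>M i\<in>X. c i x \<odot>\<^sub>M q i \<oplus>\<^sub>M c i y \<odot>\<^sub>M q i)"
    using that cl q by (intro M.M.finsum_cong' refl) (auto simp: klin_add[OF ck] M.smult_l_distr[simplified])
   also have "... = ?s x \<oplus>\<^sub>M ?s y" using cl by (intro M.M.finsum_addf) auto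
   finally show ?thesis .
  qed
  show "?s (a \<odot>\<^sub>L x) = a \<odot>\<^sub>M ?s x" if "x : carrier L" for a x
   using that cl q X by (subst M.finsum_smult_ldistr)
    (auto simp: klin_smult[OF ck] M.smult_assoc1[simplified] M.smult_closed intro!: M.M.finsum_cong')
 qed
 moreover have "g (?s l) = l" if l: "l : carrier L" for l
 proof -
  have "g (?s l) = (\<Oplus>\<^sub>L x\<in>X. g (c x l \<odot>\<^sub>M q x))"
   using cl by (intro additive_finsum[OF M.M.ag L.M.ag klin_additive[OF g(1)]]) auto
  also have "... = (\<Oplus>\<^sub>L x\<in>X. c x l \<odot>\<^sub>L x)"
   using q X L.smult_closed by (intro L.M.finsum_cong' refl) (auto simp: klin_smult[OF g(1)] subset_iff)
  finally show ?thesis using exp[OF l] by simp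
 qed
 ultimately show thesis by (rule that)
qed

context representing
begin

definition equivariant :: "('k, 'h => 'k, 'm) bmod => ('k, 'h => 'k, 'n) bmod => ('m => 'n) => bool" where
 "equivariant M N \<phi> \<longleftrightarrow> klin M N \<phi> \<and> (\<forall>\<alpha>\<in>carrier B. \<forall>x\<in>carrier M. \<phi> (act M \<alpha> x) = act N \<alpha> (\<phi> x))"

lemma equivariant_klin: "equivariant M N \<phi> ==> klin M N \<phi>"
 by (simp add: equivariant_def)

lemma mod_hom_equivariant: "f : mod_hom B M N ==> equivariant M N f"
 by (auto simp: mod_hom_def equivariant_def klin_def)

lemma equivariant_mod_hom: "equivariant M N f ==> f : mod_hom B M N"
 by (auto simp: mod_hom_def equivariant_def klin_def)

lemma graded_map_tmap:
 assumes M: "kG_action M" and N: "kG_action N" and \<phi>: "equivariant M N \<phi>"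
 shows "graded_map S (FF M) (FG M) (Th M) (FF N) (FG N) (Th N) (tmap M N \<phi>)"
proof -
 note vM = kG_action_vspace[OF M] and vN = kG_action_vspace[OF N] and k = equivariant_klin[OF \<phi>]
 note aM = lin_family_klin[OF kG_action_family[OF M]] and aN = lin_family_klin[OF kG_action_family[OF N]]
 interpret M: module S "FF M" by (rule GA.module_FF[OF vM])
 interpret N: module S "FF N" by (rule GA.module_FF[OF vN])
 have "tmap M N \<phi> (Th M z) = Th N (tmap M N \<phi> z)" if z: "z : carrier (FF M)" for z
 proof -
  have zc: "z : carrier (tensor S M)" using z by simp
  note cl = GA.tmap_closed[OF vM vM aM zc]
  have "tmap M N \<phi> (Th M z) = (\<Oplus>\<^sub>(FF N)x\<in>X. tmap M N \<phi> (u x e \<odot>\<^sub>(FF M) tmap M M (act M (c x)) z))"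
   unfolding Th_eq_op[OF M zc] op_def using e_less cl GA.smult_closed_FF[OF vM]
   by (intro additive_finsum[OF M.M.ag N.M.ag GA.tmap_additive[OF vM vN k]]) auto
  also have "... = (\<Oplus>\<^sub>(FF N)x\<in>X. u x e \<odot>\<^sub>(FF N) tmap N N (act N (c x)) (tmap M N \<phi> z))"
  proof (intro N.M.finsum_cong' refl funcsetI)
   fix x assume x: "x : X"
   have ka: "klin M N (\<lambda>w. \<phi> (act M (c x) w))" using klin_compose[OF aM k] x by simp
   have "tmap M N \<phi> (tmap M M (act M (c x)) z) = tmap M N (\<lambda>w. \<phi> (act M (c x) w)) z"
    using x by (intro GA.tmap_comp[OF vM vM vN aM k zc ka]) auto
   also have "... = tmap N N (act N (c x)) (tmap M N \<phi> z)"
    using x \<phi> by (intro GA.tmap_comp[OF vM vN vN k aN zc ka, symmetric]) (auto simp: equivariant_def)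
   finally show "tmap M N \<phi> (u x e \<odot>\<^sub>(FF M) tmap M M (act M (c x)) z) =
     u x e \<odot>\<^sub>(FF N) tmap N N (act N (c x)) (tmap M N \<phi> z)"
    using x e_less cl by (simp add: GA.tmap_smult[OF vM vN k])
   show "u x e \<odot>\<^sub>(FF N) tmap N N (act N (c x)) (tmap M N \<phi> z) : carrier (FF N)"
    using x e_less GA.tmap_closed[OF vN vN aN GA.tmap_closed[OF vM vN k zc]] GA.smult_closed_FF[OF vN] by simp
  qed
  also have "... = Th N (tmap M N \<phi> z)"
   unfolding Th_eq_op[OF N GA.tmap_closed[OF vM vN k zc]] op_def ..
  finally show ?thesis .
 qed
 then show ?thesis
  unfolding graded_map_def
  using GA.tmap_additive[OF vM vN k] GA.tmap_smult[OF vM vN k] GA.tmap_degree[OF vM vN k] by simp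
qed

lemma operator_at:
 assumes M: "kG_action M" and P: "P : Proj S Sg"
 shows "graded_operator_at S (FF M) Sg (FG M) (Th M) e P"
 using graded_operator_Th[OF M] Proj_prime[OF P]
 by (intro graded_operator_at.intro graded_module_at.intro graded_module_at_axioms.intro graded_operator.axioms(1)[OF graded_operator_Th[OF M]])

lemma map_at:
 assumes "kG_action M" "kG_action N" "equivariant M N \<phi>" "P : Proj S Sg"
 shows "graded_map_at S (FF M) Sg (FG M) (Th M) e P (FF N) (FG N) (Th N) (tmap M N \<phi>)"
 by (intro graded_map_at.intro graded_map_at_axioms.intro operator_at graded_map_tmap assms)

lemma H1_zero_iff:
 assumes M: "kG_action M"
 shows "H1_zero p r G A U M \<longleftrightarrow> (\<forall>P\<in>Proj S Sg. acyc M P)"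
proof -
 interpret F: graded_operator S "FF M" Sg "FG M" "Th M" e by (rule graded_operator_Th[OF M])
 have "F.stalk_exact (p - 1) P \<longleftrightarrow> acyc M P" if P: "P : Proj S Sg" for P
  using graded_operator_at.acyclic_imp_stalk_exact[OF operator_at[OF M P] _ e_pos]
   graded_operator_at.stalk_exact_imp_acyclic[OF operator_at[OF M P] _ e_pos] exists_degree_outside[OF P] by blast
 then show ?thesis
  unfolding H1_zero_def Let_def F.quotient_sheaf_zero_iff by blast
qed

lemma tmap_zero:
 assumes M: "vspace M" and N: "vspace N" and z: "z : carrier (tensor S M)" and \<phi>: "klin M N \<phi>" "!!x. x : carrier M ==> \<phi> x = \<zero>\<^sub>N"
 shows "tmap M N \<phi> z = \<zero>\<^sub>(FF N)"
proof (rule GA.FF_ext[OF M GA.abelian_group_FF[OF N] GA.tmap_additive[OF M N \<phi>(1)], where z = z])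
 interpret N: vspace N by fact
 interpret SN: tensor_pair S N by (rule GA.pair[OF N])
 interpret TN: module S "FF N" by (rule GA.module_FF[OF N])
 show "additive (FF M) (FF N) (\<lambda>z. \<zero>\<^sub>(FF N))" using TN.M.l_zero[OF TN.M.zero_closed] TN.M.zero_closed by (auto simp: additive_def)
 fix s m assume sm: "s : carrier S" "m : carrier M"
 have "klin N (tensor S N) (tens S N s)" using SN.bilin_tens sm by (auto simp: bilin_def)
 from additive_zero[OF N.M.ag SN.abelian_group_tensor klin_additive[OF this]]
 show "tmap M N \<phi> (tens S M s m) = \<zero>\<^sub>(FF N)" using sm \<phi>(2) by (simp add: GA.tmap_tens[OF M N \<phi>(1)])
qed (use z in simp)

lemma tmap_sum:
 assumes M: "vspace M" and N: "vspace N" and z: "z : carrier (tensor S M)"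
  and \<phi>: "klin M N \<phi>" "klin M N \<psi>" "klin M N \<chi>" "!!x. x : carrier M ==> \<phi> x = \<psi> x \<oplus>\<^sub>N \<chi> x"
 shows "tmap M N \<phi> z = tmap M N \<psi> z \<oplus>\<^sub>(FF N) tmap M N \<chi> z"
proof (rule GA.FF_ext[OF M GA.abelian_group_FF[OF N] GA.tmap_additive[OF M N \<phi>(1)], where z = z])
 interpret SN: tensor_pair S N by (rule GA.pair[OF N])
 interpret TN: module S "FF N" by (rule GA.module_FF[OF N])
 show "additive (FF M) (FF N) (\<lambda>z. tmap M N \<psi> z \<oplus>\<^sub>(FF N) tmap M N \<chi> z)"
  using GA.tmap_additive[OF M N \<phi>(2)] GA.tmap_additive[OF M N \<phi>(3)] TN.M.a_ac TN.M.a_closed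
  by (simp add: additive_def Pi_iff)
 fix s m assume sm: "s : carrier S" "m : carrier M"
 then show "tmap M N \<phi> (tens S M s m) = tmap M N \<psi> (tens S M s m) \<oplus>\<^sub>(FF N) tmap M N \<chi> (tens S M s m)"
  using klin_closed[OF \<phi>(2)] klin_closed[OF \<phi>(3)] \<phi>(4)
  by (simp add: GA.tmap_tens[OF M N \<phi>(1)] GA.tmap_tens[OF M N \<phi>(2)] GA.tmap_tens[OF M N \<phi>(3)] SN.tens_add_right)
qed (use z in simp)

lemma acyc_retract:
 assumes M: "kG_action M" and N: "kG_action N" and Q: "kG_action Q"
  and maps: "equivariant M N i" "equivariant N M q" "equivariant M Q a" "equivariant Q M b"
  and eq: "!!x. x : carrier M ==> x = q (i x) \<oplus>\<^sub>M b (a x)"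
  and P: "P : Proj S Sg" and ac: "acyc N P" "acyc Q P"
 shows "acyc M P"
proof (rule acyclic_retract[OF map_at[OF M N maps(1) P] map_at[OF N M maps(2) P] map_at[OF M Q maps(3) P] map_at[OF Q M maps(4) P] _ ac])
 fix z assume "z : carrier (FF M)"
 then have z: "z : carrier (tensor S M)" by simp
 note vM = kG_action_vspace[OF M] and vN = kG_action_vspace[OF N] and vQ = kG_action_vspace[OF Q]
 note k = maps[THEN equivariant_klin]
 have id: "klin M M (\<lambda>x. x)" by (simp add: klin_def)
 have k1: "klin M M (\<lambda>x. q (i x))" and k2: "klin M M (\<lambda>x. b (a x))" using klin_compose k by blast+
 have "z = tmap M M (\<lambda>x. x) z" using GA.tmap_id[OF vM z id] by simp
 also have "... = tmap M M (\<lambda>x. q (i x)) z \<oplus>\<^sub>(FF M) tmap M M (\<lambda>x. b (a x)) z"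
  by (rule tmap_sum[OF vM vM z id k1 k2 eq])
 also have "tmap M M (\<lambda>x. q (i x)) z = tmap N M q (tmap M N i z)"
  by (rule GA.tmap_comp[OF vM vN vM k(1,2) z k1, symmetric]) simp
 also have "tmap M M (\<lambda>x. b (a x)) z = tmap Q M b (tmap M Q a z)"
  by (rule GA.tmap_comp[OF vM vQ vM k(3,4) z k2, symmetric]) simp
 finally show "z = tmap N M q (tmap M N i z) \<oplus>\<^sub>(FF M) tmap Q M b (tmap M Q a z)" .
qed

text \<open>
 A short exact sequence of modules is split over the field, so it stays exact, in every degree,
 after extension of scalars to \<open>S\<close>.
\<close>

lemma exact_at:
 assumes ex: "short_exact B N f M g L" and P: "P : Proj S Sg"
 shows "graded_exact_at S (FF N) Sg (FG N) (Th N) e P (FF M) (FG M) (Th M) (tmap N M f)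
   (FF L) (FG L) (Th L) (tmap M L g) (p - 1)"
proof -
 have fd: "fd_module B N" "fd_module B M" "fd_module B L" and f: "equivariant N M f" and g: "equivariant M L g"
  and inj: "inj_on f (carrier N)" and im: "f ` carrier N = {x \<in> carrier M. g x = \<zero>\<^sub>L}" and sur: "g ` carrier M = carrier L"
  using ex mod_hom_equivariant by (auto simp: short_exact_def)
 note ac = fd[THEN fd_module_kG_action]
 note v = ac[THEN kG_action_vspace] and kf = equivariant_klin[OF f] and kg = equivariant_klin[OF g]
 interpret M: vspace M by (rule v)
 interpret N: vspace N by (rule v)
 interpret L: vspace L by (rule v)
 interpret TM: module S "FF M" by (rule GA.module_FF[OF v(2)])
 interpret TN: module S "FF N" by (rule GA.module_FF[OF v(1)])
 obtain s where s: "klin L M s" "!!l. l : carrier L ==> g (s l) = l"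
  using linear_section[OF v(2,3) _ kg sur] fd(3) by (auto simp: fd_module_def)
 have gf: "g (f x) = \<zero>\<^sub>L" if "x : carrier N" for x using im that by blast
 define t where "t x = inv_into (carrier N) f (x \<ominus>\<^sub>M s (g x))" for x
 have sg: "klin M M (\<lambda>x. s (g x))" by (rule klin_compose[OF kg s(1)])
 have t: "t x : carrier N" "f (t x) = x \<ominus>\<^sub>M s (g x)" if x: "x : carrier M" for x
 proof -
  have gx: "g x : carrier L" "s (g x) : carrier M" using klin_closed[OF kg x] klin_closed[OF sg x] by auto
  have "g (x \<ominus>\<^sub>M s (g x)) = g x \<ominus>\<^sub>L g (s (g x))"
   using x gx by (intro additive_diff[OF M.M.ag L.M.ag klin_additive[OF kg]])
  then have "x \<ominus>\<^sub>M s (g x) : f ` carrier N" unfolding im using x gx s(2) by (simp add: L.M.minus_eq L.M.r_neg)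
  then show "t x : carrier N" "f (t x) = x \<ominus>\<^sub>M s (g x)" unfolding t_def by (auto intro: inv_into_into f_inv_into_f)
 qed
 have tI: "t x = w" if "x : carrier M" "w : carrier N" "f w = x \<ominus>\<^sub>M s (g x)" for x w
  using inj_onD[OF inj _ t(1)[OF that(1)] that(2)] t(2)[OF that(1)] that(3) by simp
 note sgc = klin_closed[OF sg]
 have kt: "klin M N t"
 proof (rule klinI)
  show "t x : carrier N" if "x : carrier M" for x using t that by simp
  show "t (x \<oplus>\<^sub>M y) = t x \<oplus>\<^sub>N t y" if "x : carrier M" "y : carrier M" for x y
   using that t sgc by (intro tI) (auto simp: klin_add[OF kf] klin_add[OF sg] M.M.minus_eq M.M.minus_add M.M.a_ac)
  show "t (a \<odot>\<^sub>M x) = a \<odot>\<^sub>N t x" if "x : carrier M" for a x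
   using that t sgc M.smult_closed N.smult_closed M.smult_r_distr M.smult_r_minus
   by (intro tI) (auto simp: klin_smult[OF kf] klin_smult[OF sg] M.M.minus_eq)
 qed
 have s0: "s \<zero>\<^sub>L = \<zero>\<^sub>M" using additive_zero[OF L.M.ag M.M.ag klin_additive[OF s(1)]] .
 have tf: "t (f w) = w" if "w : carrier N" for w
  using that klin_closed[OF kf that] by (intro tI) (auto simp: gf s0 M.M.minus_eq)
 show ?thesis
 proof (intro graded_exact_at.intro graded_exact_at_axioms.intro map_at ac f g P)
  fix y i assume y: "y : FG L i"
  have yc: "y : carrier (tensor S L)" using GA.FG_sub[OF v(3)] y by auto
  have id: "klin L L (\<lambda>l. g (s l))" by (rule klin_compose[OF s(1) kg])
  have "tmap M L g (tmap L M s y) = tmap L L (\<lambda>l. g (s l)) y"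
   by (rule GA.tmap_comp[OF v(3,2,3) s(1) kg yc id]) simp
  also have "... = y" using s(2) by (intro GA.tmap_id[OF v(3) yc id]) auto
  finally show "\<exists>x\<in>FG M i. tmap M L g x = y" using GA.tmap_degree[OF v(3,2) s(1) y] by blast
 next
  fix x i assume x: "x : FG M i" and gx: "tmap M L g x = \<zero>\<^sub>(FF L)"
  have xc: "x : carrier (tensor S M)" using GA.FG_sub[OF v(2)] x by auto
  have id: "klin M M (\<lambda>x. x)" by (simp add: klin_def)
  have ft: "klin M M (\<lambda>x. f (t x))" by (rule klin_compose[OF kt kf])
  have split: "x = f (t x) \<oplus>\<^sub>M s (g x)" if "x : carrier M" for x
   using that t sgc by (simp add: M.M.minus_eq M.M.a_assoc M.M.l_neg)
  have "x = tmap M M (\<lambda>x. x) x" using GA.tmap_id[OF v(2) xc id] by simp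
  also have "... = tmap M M (\<lambda>x. f (t x)) x \<oplus>\<^sub>(FF M) tmap M M (\<lambda>x. s (g x)) x"
   by (rule tmap_sum[OF v(2,2) xc id ft sg split])
  also have "tmap M M (\<lambda>x. s (g x)) x = tmap L M s (tmap M L g x)"
   by (rule GA.tmap_comp[OF v(2,3,2) kg s(1) xc sg, symmetric]) simp
  also have "... = \<zero>\<^sub>(FF M)"
   unfolding gx by (rule additive_zero[OF GA.abelian_group_FF[OF v(3)] TM.M.ag GA.tmap_additive[OF v(3,2) s(1)]])
  also have "tmap M M (\<lambda>x. f (t x)) x = tmap N M f (tmap M N t x)"
   by (rule GA.tmap_comp[OF v(2,1,2) kt kf xc ft, symmetric]) simp
  finally have "x = tmap N M f (tmap M N t x)"
   using GA.tmap_closed[OF v(1,2) kf GA.tmap_closed[OF v(2,1) kt xc]] TM.M.r_zero by simp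
  then show "\<exists>w\<in>FG N i. tmap N M f w = x" using GA.tmap_degree[OF v(2,1) kt x] by metis
 next
  fix w assume w: "w : carrier (FF N)" and fw: "tmap N M f w = \<zero>\<^sub>(FF M)"
  have wc: "w : carrier (tensor S N)" using w by simp
  have id: "klin N N (\<lambda>w. t (f w))" by (rule klin_compose[OF kf kt])
  have "w = tmap N N (\<lambda>w. t (f w)) w" using GA.tmap_id[OF v(1) wc id] tf by simp
  also have "... = tmap M N t (tmap N M f w)"
   by (rule GA.tmap_comp[OF v(1,2,1) kf kt wc id, symmetric]) simp
  also have "... = \<zero>\<^sub>(FF N)"
   unfolding fw by (rule additive_zero[OF TM.M.ag TN.M.ag GA.tmap_additive[OF v(2,1) kt]])
  finally show "w = \<zero>\<^sub>(FF N)" .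
 next
  fix w assume w: "w : carrier (FF N)"
  then have wc: "w : carrier (tensor S N)" by simp
  have gfk: "klin N L (\<lambda>w. g (f w))" by (rule klin_compose[OF kf kg])
  have "tmap M L g (tmap N M f w) = tmap N L (\<lambda>w. g (f w)) w"
   by (rule GA.tmap_comp[OF v(1,2,3) kf kg wc gfk]) simp
  also have "... = \<zero>\<^sub>(FF L)" by (rule tmap_zero[OF v(1,3) wc gfk gf])
  finally show "tmap M L g (tmap N M f w) = \<zero>\<^sub>(FF L)" .
 next
  fix x assume "x : carrier (FF M)"
  then show "(Th M ^^ (p - 1 + 1)) x = \<zero>\<^sub>(FF M)"
   using Th_nilpotent[OF ac(2), of x] fd(2) p_pos by (simp add: fd_module_def)
 qed
qed

lemma p_minus_one: "p - 1 \<ge> 1"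
 using prime_gt_1_nat[OF prime_p] by simp

lemma acyc_quotient: "short_exact B N f M g L ==> P : Proj S Sg ==> acyc N P ==> acyc M P ==> acyc L P"
 by (rule graded_exact_at.acyclic_quotient[OF exact_at p_minus_one])

lemma acyc_sub: "short_exact B N f M g L ==> P : Proj S Sg ==> acyc M P ==> acyc L P ==> acyc N P"
 by (rule graded_exact_at.acyclic_sub[OF exact_at p_minus_one])

end

section \<open>Projective modules\<close>

lemma (in abelian_monoid) finsum_pairs:
 assumes "finite I" "finite J" "!!i j. i : I ==> j : J ==> f i j : carrier G"
 shows "(\<Oplus>z\<in>I \<times> J. f (fst z) (snd z)) = (\<Oplus>i\<in>I. \<Oplus>j\<in>J. f i j)"
 using assms(1,3)
proof (induction I rule: finite_induct)
 case (insert i I)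
 have "insert i I \<times> J = Pair i ` J \<union> I \<times> J" by auto
 then have "(\<Oplus>z\<in>insert i I \<times> J. f (fst z) (snd z)) = (\<Oplus>z\<in>Pair i ` J. f (fst z) (snd z)) \<oplus> (\<Oplus>z\<in>I \<times> J. f (fst z) (snd z))"
  using insert assms(2) by (simp only:) (intro finsum_Un_disjoint; auto)
 also have "(\<Oplus>z\<in>Pair i ` J. f (fst z) (snd z)) = (\<Oplus>j\<in>J. f i j)"
  using insert by (subst finsum_reindex) (auto simp: inj_on_def)
 finally show ?case using insert assms(2) by (subst finsum_insert) auto
qed simp

text \<open>The coinduced module of linear maps from \<open>k[G]\<close> to \<open>M\<close>; its coefficients are translated.\<close>

definition coind :: "('k::field, 'h) hopf => ('k, 'h => 'k, 'm) bmod => ('k, 'h => 'k, 'h => 'm) bmod" where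
 "coind G M = \<lparr>carrier = {\<phi> : extensional (carrier G). klin G M \<phi>}, monoid.mult = undefined, one = undefined,
   ring.zero = (\<lambda>f\<in>carrier G. \<zero>\<^sub>M), add = (\<lambda>\<phi> \<psi>. \<lambda>f\<in>carrier G. \<phi> f \<oplus>\<^sub>M \<psi> f),
   module.smult = (\<lambda>s \<phi>. \<lambda>f\<in>carrier G. s \<odot>\<^sub>M \<phi> f),
   act = (\<lambda>\<alpha> \<phi>. \<lambda>f\<in>carrier G. \<phi> (hopf_coords.hit G \<alpha> f))\<rparr>"

context hopf_coords
begin

context
 fixes M :: "('k, 'h => 'k, 'm) bmod"
 assumes fd: "fd_module B M"
begin

abbreviation E where "E \<equiv> coind G M"

interpretation M: vspace M using fd by (auto simp: fd_module_def vspace_def)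

lemma M_smult: "w : carrier M ==> s \<odot>\<^sub>M w : carrier M" using M.smult_closed by simp

lemma coind_simps:
 "carrier E = {\<phi> : extensional (carrier G). klin G M \<phi>}"
 "f : carrier G ==> (\<phi> \<oplus>\<^sub>E \<psi>) f = \<phi> f \<oplus>\<^sub>M \<psi> f"
 "f : carrier G ==> (s \<odot>\<^sub>E \<phi>) f = s \<odot>\<^sub>M \<phi> f"
 "f : carrier G ==> \<zero>\<^sub>E f = \<zero>\<^sub>M"
 "f : carrier G ==> act E \<alpha> \<phi> f = \<phi> (hit \<alpha> f)"
 by (simp_all add: coind_def)

lemma coind_ext: "\<phi> \<oplus>\<^sub>E \<psi> : extensional (carrier G)" "s \<odot>\<^sub>E \<phi> : extensional (carrier G)"
  "\<zero>\<^sub>E : extensional (carrier G)" "act E \<alpha> \<phi> : extensional (carrier G)"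
 by (auto simp: coind_def)

lemma coind_D: "\<phi> : carrier E ==> klin G M \<phi>" "\<phi> : carrier E ==> \<phi> : extensional (carrier G)"
 "\<phi> : carrier E ==> f : carrier G ==> \<phi> f : carrier M"
 using klin_closed by (auto simp: coind_simps)

lemma coind_eqI: "\<phi> : extensional (carrier G) ==> \<psi> : extensional (carrier G) ==>
  (!!f. f : carrier G ==> \<phi> f = \<psi> f) ==> \<phi> = \<psi>"
 by (rule extensionalityI)

lemma G_smult: "f : carrier G ==> s \<odot> f : carrier G" using G.smult_closed by simp

lemma coind_add: "\<phi> : carrier E ==> \<psi> : carrier E ==> \<phi> \<oplus>\<^sub>E \<psi> : carrier E"
 using M.smult_r_distr M.M.a_ac G_smult by (auto simp: coind_simps coind_ext klin_def Pi_iff)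

lemma coind_smult: "\<phi> : carrier E ==> s \<odot>\<^sub>E \<phi> : carrier E"
 using M.smult_r_distr M_smult M.smult_assoc1[symmetric] G_smult
 by (auto simp: coind_simps coind_ext klin_def Pi_iff mult.commute)

lemma coind_zero: "\<zero>\<^sub>E : carrier E"
 using G_smult M.smult_r_null by (auto simp: coind_simps coind_ext klin_def)

lemma coind_act: "\<alpha> : carrier B ==> \<phi> : carrier E ==> act E \<alpha> \<phi> : carrier E"
 using klin_compose[OF hit_klin[OF B_klin], of \<alpha> M \<phi>] G_smult
 by (auto simp: coind_simps coind_ext klin_def Pi_iff)

lemma vspace_coind: "vspace E"
proof (rule vspace.intro, rule moduleI)
 show "abelian_group E"
 proof (rule abelian_groupI)
  fix \<phi> assume a: "\<phi> : carrier E"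
  have "(-1) \<odot>\<^sub>M w \<oplus>\<^sub>M w = \<zero>\<^sub>M" if "w : carrier M" for w
   using M.smult_l_distr[of "-1" 1 w] M.smult_one[of w] M.smult_l_null[of w] that by simp
  then show "\<exists>\<psi>\<in>carrier E. \<psi> \<oplus>\<^sub>E \<phi> = \<zero>\<^sub>E"
   using a coind_D by (intro bexI[of _ "(-1) \<odot>\<^sub>E \<phi>"] coind_eqI coind_ext coind_smult) (auto simp: coind_simps(2-))
 next
  fix x y assume "x : carrier E" "y : carrier E"
  then show "x \<oplus>\<^sub>E y = y \<oplus>\<^sub>E x" using coind_D M.M.a_comm by (intro coind_eqI coind_ext) (auto simp: coind_simps(2-))
 next
  fix x y z assume "x : carrier E" "y : carrier E" "z : carrier E"
  then show "x \<oplus>\<^sub>E y \<oplus>\<^sub>E z = x \<oplus>\<^sub>E (y \<oplus>\<^sub>E z)"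
   using coind_D M.M.a_assoc by (intro coind_eqI coind_ext) (auto simp: coind_simps(2-))
 next
  fix x assume "x : carrier E"
  then show "\<zero>\<^sub>E \<oplus>\<^sub>E x = x" using coind_D by (intro coind_eqI coind_ext) (auto simp: coind_simps(2-))
 qed (auto simp: coind_add coind_zero)
next
 fix a \<phi> assume "\<phi> : carrier E"
 then show "a \<odot>\<^sub>E \<phi> : carrier E" by (rule coind_smult)
next
 fix a b \<phi> assume "\<phi> : carrier E"
 then show "(a \<oplus>\<^sub>kk b) \<odot>\<^sub>E \<phi> = a \<odot>\<^sub>E \<phi> \<oplus>\<^sub>E b \<odot>\<^sub>E \<phi>" "(a \<otimes>\<^sub>kk b) \<odot>\<^sub>E \<phi> = a \<odot>\<^sub>E (b \<odot>\<^sub>E \<phi>)"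
  "\<one>\<^sub>kk \<odot>\<^sub>E \<phi> = \<phi>"
  using coind_D M.smult_l_distr M.smult_assoc1 M.smult_one
  by (auto intro!: coind_eqI coind_ext simp: coind_simps(2-))
next
 fix a \<phi> \<psi> assume "\<phi> : carrier E" "\<psi> : carrier E"
 then show "a \<odot>\<^sub>E (\<phi> \<oplus>\<^sub>E \<psi>) = a \<odot>\<^sub>E \<phi> \<oplus>\<^sub>E a \<odot>\<^sub>E \<psi>"
  using coind_D M.smult_r_distr by (auto intro!: coind_eqI coind_ext simp: coind_simps(2-))
qed simp

interpretation E: vspace E by (rule vspace_coind)

lemma coind_finsum:
 assumes "!!i. i : I ==> \<psi> i : carrier E" "f : carrier G"
 shows "(\<Oplus>\<^sub>E i\<in>I. \<psi> i) f = (\<Oplus>\<^sub>M i\<in>I. \<psi> i f)"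
 using assms coind_D
 by (intro additive_finsum[OF E.M.ag M.M.ag, where h = "\<lambda>\<phi>. \<phi> f"])
  (auto simp: additive_def coind_simps(2-))

lemma fd_coind: "fd_module B E"
proof -
 have "fin_dim E"
 proof -
  obtain Y k where k: "coordinates M Y k" using M.fin_dim_coordinates fd by (auto simp: fd_module_def)
  then have Y: "finite Y" "Y \<subseteq> carrier M" and expM: "w : carrier M ==> (\<Oplus>\<^sub>M y\<in>Y. k y w \<odot>\<^sub>M y) = w" for w
   by (auto simp: coordinates_def)
  define b where "b z = (\<lambda>f\<in>carrier G. c (fst z) f \<odot>\<^sub>M snd z)" for z
  have b: "b z : carrier E" if "z : X \<times> Y" for z
   using that Y klin_add[OF c_klin] klin_smult[OF c_klin] M_smult M.smult_l_distr M.smult_assoc1 G_smult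
   by (auto simp: b_def coind_simps(1) klin_def subset_iff)
  show ?thesis
  proof (rule E.fin_dim_family[of "X \<times> Y" b])
   show "finite (X \<times> Y)" using Y by simp
   show "\<exists>a. \<phi> = (\<Oplus>\<^sub>E z\<in>X \<times> Y. a z \<odot>\<^sub>E b z)" if phi: "\<phi> : carrier E" for \<phi>
   proof (intro exI coind_eqI)
    let ?a = "\<lambda>z. k (snd z) (\<phi> (fst z))"
    have s: "(\<Oplus>\<^sub>E z\<in>X \<times> Y. ?a z \<odot>\<^sub>E b z) : carrier E" using b coind_smult by (intro E.M.finsum_closed) auto
    show "(\<Oplus>\<^sub>E z\<in>X \<times> Y. ?a z \<odot>\<^sub>E b z) : extensional (carrier G)" by (rule coind_D(2)[OF s])
    show "\<phi> : extensional (carrier G)" using phi by (rule coind_D)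
    fix f assume f: "f : carrier G"
    have cl: "x : X ==> \<phi> x : carrier M" for x using coind_D(3)[OF phi] by simp
    have "(\<Oplus>\<^sub>E z\<in>X \<times> Y. ?a z \<odot>\<^sub>E b z) f = (\<Oplus>\<^sub>M z\<in>X \<times> Y. (?a z \<odot>\<^sub>E b z) f)"
     using b coind_smult f by (intro coind_finsum) auto
    also have "... = (\<Oplus>\<^sub>M z\<in>X \<times> Y. c (fst z) f \<odot>\<^sub>M (k (snd z) (\<phi> (fst z)) \<odot>\<^sub>M snd z))"
     using f Y M_smult
     by (intro M.M.finsum_cong' refl) (auto simp: coind_simps(3) b_def M.smult_assoc1[simplified, symmetric] subset_iff mult.commute)
    also have "... = (\<Oplus>\<^sub>M x\<in>X. \<Oplus>\<^sub>M y\<in>Y. c x f \<odot>\<^sub>M (k y (\<phi> x) \<odot>\<^sub>M y))"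
     using Y M_smult by (intro M.M.finsum_pairs) auto
    also have "... = (\<Oplus>\<^sub>M x\<in>X. c x f \<odot>\<^sub>M \<phi> x)"
    proof (intro M.M.finsum_cong' refl)
     fix x assume x: "x : X"
     have "c x f \<odot>\<^sub>M (\<Oplus>\<^sub>M y\<in>Y. k y (\<phi> x) \<odot>\<^sub>M y) = (\<Oplus>\<^sub>M y\<in>Y. c x f \<odot>\<^sub>M (k y (\<phi> x) \<odot>\<^sub>M y))"
      using Y M_smult by (intro M.finsum_smult_ldistr) auto
     then show "(\<Oplus>\<^sub>M y\<in>Y. c x f \<odot>\<^sub>M (k y (\<phi> x) \<odot>\<^sub>M y)) = c x f \<odot>\<^sub>M \<phi> x"
      using expM[OF cl[OF x]] by simp
    qed (use cl M_smult in auto)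
    also have "... = \<phi> f" using klin_expand[OF M.vspace_axioms coind_D(1)[OF phi] f] by simp
    finally show "\<phi> f = (\<Oplus>\<^sub>E z\<in>X \<times> Y. ?a z \<odot>\<^sub>E b z) f" by simp
   qed
  qed (use b in auto)
 qed
 moreover have "act E \<alpha> (\<phi> \<oplus>\<^sub>E \<psi>) = act E \<alpha> \<phi> \<oplus>\<^sub>E act E \<alpha> \<psi>" if "\<alpha> : carrier B" for \<alpha> \<phi> \<psi>
  using that by (intro coind_eqI coind_ext) (auto simp: coind_simps(2-))
 moreover have "act E (\<alpha> \<oplus>\<^sub>B \<beta>) \<phi> = act E \<alpha> \<phi> \<oplus>\<^sub>E act E \<beta> \<phi>" if "\<alpha> : carrier B" "\<beta> : carrier B" "\<phi> : carrier E" for \<alpha> \<beta> \<phi>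
  using that klin_add[OF hit_linear_left] klin_add[OF coind_D(1)] by (intro coind_eqI coind_ext) (auto simp: coind_simps(2-))
 moreover have "act E \<alpha> (s \<odot>\<^sub>E \<phi>) = s \<odot>\<^sub>E act E \<alpha> \<phi>" "act E (s \<odot>\<^sub>B \<alpha>) \<phi> = s \<odot>\<^sub>E act E \<alpha> \<phi>"
  if "\<alpha> : carrier B" "\<phi> : carrier E" for \<alpha> s \<phi>
  using that klin_smult[OF hit_linear_left] klin_smult[OF coind_D(1)] by (auto intro!: coind_eqI coind_ext simp: coind_simps(2-))
 moreover have "act E (\<alpha> \<otimes>\<^sub>B \<beta>) \<phi> = act E \<alpha> (act E \<beta> \<phi>)" if "\<alpha> : carrier B" "\<beta> : carrier B" for \<alpha> \<beta> \<phi>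
  using that by (intro coind_eqI coind_ext) (auto simp: coind_simps(2-) hit_mult)
 moreover have "act E \<one>\<^sub>B \<phi> = \<phi>" if "\<phi> : carrier E" for \<phi>
  using that coind_D by (intro coind_eqI coind_ext) (auto simp: coind_simps(2-) hit_one)
 ultimately show ?thesis unfolding fd_module_def using E.module_kk coind_act by (intro conjI ballI allI) simp_all
qed

text \<open>Every module is a quotient of its coinduced module, by evaluation against the dual basis.\<close>

definition coind_map :: "('h => 'm) => 'm" where
 "coind_map \<phi> = (\<Oplus>\<^sub>M x\<in>X. act M (c x) (\<phi> x))"

lemma act_klin: "\<alpha> : carrier B ==> klin M M (act M \<alpha>)" "w : carrier M ==> klin B M (\<lambda>\<alpha>. act M \<alpha> w)"
 using fd by (auto simp: fd_module_def intro!: klinI)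

lemma act_closed: "\<alpha> : carrier B ==> w : carrier M ==> act M \<alpha> w : carrier M"
 using klin_closed[OF act_klin(1)] .

lemma coind_map_klin: "klin E M coind_map"
proof (rule klinI)
 fix \<phi> assume phi: "\<phi> : carrier E"
 have cl: "\<psi> : carrier E ==> x : X ==> act M (c x) (\<psi> x) : carrier M" for \<psi> x
  using coind_D(3) by (intro act_closed) auto
 show "coind_map \<phi> : carrier M" unfolding coind_map_def using cl[OF phi] by (intro M.M.finsum_closed) auto
 show "coind_map (s \<odot>\<^sub>E \<phi>) = s \<odot>\<^sub>M coind_map \<phi>" for s
  unfolding coind_map_def using cl[OF phi] coind_D(3)[OF phi] M_smult
  by (subst M.finsum_smult_ldistr) (auto simp: coind_simps(3) klin_smult[OF act_klin(1)] intro!: M.M.finsum_cong')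
 fix \<psi> assume psi: "\<psi> : carrier E"
 have "coind_map (\<phi> \<oplus>\<^sub>E \<psi>) = (\<Oplus>\<^sub>M x\<in>X. act M (c x) (\<phi> x) \<oplus>\<^sub>M act M (c x) (\<psi> x))"
  unfolding coind_map_def using cl[OF phi] cl[OF psi] coind_D(3)[OF phi] coind_D(3)[OF psi]
  by (intro M.M.finsum_cong' refl) (auto simp: coind_simps(2) klin_add[OF act_klin(1)])
 then show "coind_map (\<phi> \<oplus>\<^sub>E \<psi>) = coind_map \<phi> \<oplus>\<^sub>M coind_map \<psi>"
  unfolding coind_map_def using cl[OF phi] cl[OF psi] by (simp add: M.M.finsum_addf Pi_iff)
qed

lemma coind_map_act:
 assumes a: "\<alpha> : carrier B" and phi: "\<phi> : carrier E"
 shows "coind_map (act E \<alpha> \<phi>) = act M \<alpha> (coind_map \<phi>)"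
proof -
 have py: "\<phi> y : carrier M" if "y : X" for y using coind_D(3)[OF phi] that by simp
 have cl: "act M (c x) (\<phi> y) : carrier M" if "x : X" "y : X" for x y using that py by (intro act_closed) auto
 have "coind_map (act E \<alpha> \<phi>) = (\<Oplus>\<^sub>M x\<in>X. \<Oplus>\<^sub>M y\<in>X. (\<alpha> \<otimes>\<^sub>B c y) x \<odot>\<^sub>M act M (c x) (\<phi> y))"
  unfolding coind_map_def
 proof (intro M.M.finsum_cong' refl funcsetI M.M.finsum_closed)
  fix x assume x: "x : X"
  have hx: "hit \<alpha> x : carrier G" using a x by simp
  have "act E \<alpha> \<phi> x = (\<Oplus>\<^sub>M y\<in>X. (\<alpha> \<otimes>\<^sub>B c y) x \<odot>\<^sub>M \<phi> y)"
   using x klin_expand[OF M.vspace_axioms coind_D(1)[OF phi] hx] a py M_smult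
   by (auto simp: coind_simps(5) mult_apply intro!: M.M.finsum_cong')
  then have "act M (c x) (act E \<alpha> \<phi> x) = (\<Oplus>\<^sub>M y\<in>X. act M (c x) ((\<alpha> \<otimes>\<^sub>B c y) x \<odot>\<^sub>M \<phi> y))"
   using x py M_smult
   by (simp only:) (intro additive_finsum[OF M.M.ag M.M.ag klin_additive[OF act_klin(1)]]; auto)
  also have "... = (\<Oplus>\<^sub>M y\<in>X. (\<alpha> \<otimes>\<^sub>B c y) x \<odot>\<^sub>M act M (c x) (\<phi> y))"
   using x py cl M_smult by (intro M.M.finsum_cong' refl) (auto simp: klin_smult[OF act_klin(1)])
  finally show "act M (c x) (act E \<alpha> \<phi> x) = (\<Oplus>\<^sub>M y\<in>X. (\<alpha> \<otimes>\<^sub>B c y) x \<odot>\<^sub>M act M (c x) (\<phi> y))" .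
 qed (use cl M_smult in auto)
 also have "... = (\<Oplus>\<^sub>M y\<in>X. \<Oplus>\<^sub>M x\<in>X. (\<alpha> \<otimes>\<^sub>B c y) x \<odot>\<^sub>M act M (c x) (\<phi> y))"
  using cl M_smult by (intro M.M.finsum_swap) auto
 also have "... = (\<Oplus>\<^sub>M y\<in>X. act M \<alpha> (act M (c y) (\<phi> y)))"
 proof (intro M.M.finsum_cong' refl funcsetI)
  fix y assume y: "y : X"
  have "act M (\<alpha> \<otimes>\<^sub>B c y) (\<phi> y) = (\<Oplus>\<^sub>M x\<in>X. (\<alpha> \<otimes>\<^sub>B c y) x \<odot>\<^sub>M act M (c x) (\<phi> y))"
   using y a by (intro klin_B_expand[OF M.vspace_axioms act_klin(2)[OF py[OF y]]] B_mult) auto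
  moreover have "act M (\<alpha> \<otimes>\<^sub>B c y) (\<phi> y) = act M \<alpha> (act M (c y) (\<phi> y))"
   using fd y a py[OF y] by (simp add: fd_module_def)
  ultimately show "(\<Oplus>\<^sub>M x\<in>X. (\<alpha> \<otimes>\<^sub>B c y) x \<odot>\<^sub>M act M (c x) (\<phi> y)) = act M \<alpha> (act M (c y) (\<phi> y))" by simp
  show "act M \<alpha> (act M (c y) (\<phi> y)) : carrier M" using act_closed[OF a cl[OF y y]] .
 qed
 also have "... = act M \<alpha> (coind_map \<phi>)"
  unfolding coind_map_def using cl
  by (intro additive_finsum[OF M.M.ag M.M.ag klin_additive[OF act_klin(1)[OF a]], symmetric]) auto
 finally show ?thesis .
qed

lemma coind_map_surj: "coind_map ` carrier E = carrier M"
proof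
 show "coind_map ` carrier E \<subseteq> carrier M" using klin_closed[OF coind_map_klin] by auto
 show "carrier M \<subseteq> coind_map ` carrier E"
 proof
  fix w assume w: "w : carrier M"
  let ?\<phi> = "\<lambda>f\<in>carrier G. counit G f \<odot>\<^sub>M w"
  have phi: "?\<phi> : carrier E"
   using w klin_add[OF counit_klin] klin_smult[OF counit_klin] M_smult M.smult_l_distr M.smult_assoc1 G_smult
   by (auto simp: coind_simps(1) klin_def)
  have "coind_map ?\<phi> = (\<Oplus>\<^sub>M x\<in>X. \<one>\<^sub>B x \<odot>\<^sub>M act M (c x) w)"
   unfolding coind_map_def using w M_smult act_closed
   by (intro M.M.finsum_cong' refl) (auto simp: B_simps(5) klin_smult[OF act_klin(1)])
  also have "... = act M \<one>\<^sub>B w"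
   by (rule klin_B_expand[OF M.vspace_axioms act_klin(2)[OF w] B_one, symmetric])
  also have "... = w" using fd w by (simp add: fd_module_def)
  finally show "w : coind_map ` carrier E" using phi by force
 qed
qed

end

end

text \<open>
 The coinduced module consists of functions, whereas projectivity only speaks about modules with
 elements of one given type. So it is copied there, along an injection of coordinate vectors.
\<close>

lemma alg_closed_infinite: "infinite (UNIV :: 'k::alg_closed_field set)"
proof
 assume fin: "finite (UNIV :: 'k set)"
 let ?q = "\<Prod>a\<in>UNIV. [:- a, 1:] :: 'k poly"
 have deg: "degree ?q = card (UNIV :: 'k set)" by (subst degree_prod_sum_eq) auto
 also have "... > 0" using fin by (simp add: card_gt_0_iff)
 finally have "degree (?q + 1) > 0" by (simp add: degree_add_eq_left)
 then obtain x where "poly (?q + 1) x = 0" using alg_closed_imp_poly_has_root by blast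
 moreover have "poly ?q x = 0" using fin by (simp add: poly_prod prod_zero_iff)
 ultimately show False by simp
qed

lemma vectors_embed:
 assumes inf: "infinite (UNIV :: 'k set)" and Y: "finite Y"
 shows "\<exists>h :: ('y => 'k) => 'k. inj_on h (extensional Y)"
 using Y
proof (induction Y rule: finite_induct)
 case (insert y Y)
 then obtain h :: "('y => 'k) => 'k" where h: "inj_on h (extensional Y)" by blast
 obtain q :: "'k \<times> 'k => 'k" where "bij_betw q (UNIV \<times> UNIV) UNIV"
  using card_of_Times_same_infinite[OF inf] unfolding card_of_ordIso[symmetric] by blast
 then have q: "inj q" by (simp add: bij_betw_def)
 have "inj_on (\<lambda>f. q (f y, h (restrict f Y))) (extensional (insert y Y))"
 proof (rule inj_onI)
  fix f g assume fg: "f : extensional (insert y Y)" "g : extensional (insert y Y)"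
   and "q (f y, h (restrict f Y)) = q (g y, h (restrict g Y))"
  then have y: "f y = g y" and "h (restrict f Y) = h (restrict g Y)" using q by (auto dest: injD)
  then have "restrict f Y = restrict g Y" using inj_onD[OF h] by blast
  then have "f x = g x" if "x : Y" for x using that by (metis restrict_apply')
  then show "f = g" using y fg by (intro extensionalityI[OF fg]) auto
 qed
 then show ?case by blast
qed (auto simp: inj_on_def)

lemma module_embed:
 assumes inf: "infinite (UNIV :: 'k::field set)" and \<iota>: "inj (\<iota> :: 'k => 'm)"
  and V: "vspace (V :: ('k, 'v, 'x) module_scheme)" "fin_dim V"
 shows "\<exists>j :: 'v => 'm. inj_on j (carrier V)"
proof -
 interpret V: vspace V by fact
 obtain Y k where k: "coordinates V Y k" using V.fin_dim_coordinates[OF V(2)] by blast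
 obtain h :: "('v => 'k) => 'k" where h: "inj_on h (extensional Y)"
  using vectors_embed[OF inf, of Y] k unfolding coordinates_def by blast
 have "inj_on (\<lambda>v. \<iota> (h (\<lambda>y\<in>Y. k y v))) (carrier V)"
 proof (rule inj_onI)
  fix v w assume vw: "v : carrier V" "w : carrier V" and "\<iota> (h (\<lambda>y\<in>Y. k y v)) = \<iota> (h (\<lambda>y\<in>Y. k y w))"
  then have eq: "(\<lambda>y\<in>Y. k y v) = (\<lambda>y\<in>Y. k y w)" using \<iota> h by (auto dest!: injD inj_onD)
  have "k y v = k y w" if "y : Y" for y using fun_cong[OF eq, of y] that by simp
  then have "(\<Oplus>\<^sub>V y\<in>Y. k y v \<odot>\<^sub>V y) = (\<Oplus>\<^sub>V y\<in>Y. k y w \<odot>\<^sub>V y)"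
   using k V.smult_closed by (intro V.M.finsum_cong' refl) (auto simp: coordinates_def)
  then show "v = w" using k vw unfolding coordinates_def by metis
 qed
 then show ?thesis by blast
qed

definition transport :: "('e => 'm) => ('k, 'b, 'e) bmod => ('k, 'b, 'm) bmod" where
 "transport j E = (let i = inv_into (carrier E) j in
   \<lparr>carrier = j ` carrier E, monoid.mult = undefined, one = undefined, ring.zero = j \<zero>\<^sub>E,
   add = (\<lambda>a b. j (i a \<oplus>\<^sub>E i b)), module.smult = (\<lambda>s a. j (s \<odot>\<^sub>E i a)), act = (\<lambda>\<alpha> a. j (act E \<alpha> (i a)))\<rparr>)"

context
 fixes B :: "('k::field, 'b) module" and E :: "('k, 'b, 'e) bmod" and j :: "'e => 'm"
 assumes E: "fd_module B E" and j: "inj_on j (carrier E)"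
begin

interpretation E: vspace E using E by (auto simp: fd_module_def vspace_def)

lemma transport_simps:
 "carrier (transport j E) = j ` carrier E" "\<zero>\<^sub>(transport j E) = j \<zero>\<^sub>E"
 "x : carrier E ==> y : carrier E ==> j x \<oplus>\<^sub>(transport j E) j y = j (x \<oplus>\<^sub>E y)"
 "x : carrier E ==> s \<odot>\<^sub>(transport j E) j x = j (s \<odot>\<^sub>E x)"
 "x : carrier E ==> act (transport j E) \<alpha> (j x) = j (act E \<alpha> x)"
 by (simp_all add: transport_def Let_def inv_into_f_f[OF j])

lemma vspace_transport: "vspace (transport j E)"
proof (rule vspace.intro, rule moduleI)
 have sc: "s \<odot>\<^sub>E x : carrier E" if "x : carrier E" for s x using that E.smult_closed by simp
 show "abelian_group (transport j E)"
 proof (rule abelian_groupI)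
  fix a assume "a : carrier (transport j E)"
  then obtain x where x: "x : carrier E" "a = j x" by (auto simp: transport_simps)
  then show "\<exists>b\<in>carrier (transport j E). b \<oplus>\<^sub>(transport j E) a = \<zero>\<^sub>(transport j E)"
   by (intro bexI[of _ "j (\<ominus>\<^sub>E x)"]) (auto simp: transport_simps E.M.l_neg)
 qed (auto simp: transport_simps E.M.a_ac)
 show "a \<odot>\<^sub>(transport j E) x : carrier (transport j E)" if "x : carrier (transport j E)" for a x
  using that sc by (auto simp: transport_simps)
qed (use E.smult_l_distr E.smult_r_distr E.smult_assoc1 E.smult_one E.smult_closed in "auto simp: transport_simps")

lemma transport_klin: "klin E (transport j E) j"
 by (rule klinI) (auto simp: transport_simps)

lemma fd_transport: "fd_module B (transport j E)"
proof -
 have "fin_dim (transport j E)"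
  using E fin_dim_image[OF E.vspace_axioms _ vspace_transport transport_klin] by (simp add: transport_simps fd_module_def)
 then show ?thesis
  using E vspace.module_kk[OF vspace_transport] E.smult_closed by (auto simp: fd_module_def transport_simps)
qed

end

context representing
begin

text \<open>
 The coinduced module is a Hopf module over \<open>k[G]\<close>, so it is acyclic. Projective modules are
 retracts of coinduced ones.
\<close>

lemma acyc_coind:
 fixes M :: "('k, 'h => 'k, 'm) bmod"
 assumes Frobenius: "!!f. f : carrier G ==> f [^] (p ^ r) = (counit G f ^ (p ^ r)) \<odot> \<one>"
  and M: "fd_module B M" and P: "P : Proj S Sg"
 shows "acyc (coind G M) P"
proof -
 let ?E = "coind G M"
 define m where "m f \<phi> = (\<lambda>g\<in>carrier G. \<phi> (f \<otimes> g))" for f and \<phi> :: "'h => 'm"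
 note cs = coind_simps[OF M] and ce = coind_ext[OF M] and cD = coind_D[OF M] and eqI = coind_eqI[OF M]
 note fdE = fd_coind[OF M]
 interpret M: vspace M using M by (auto simp: fd_module_def vspace_def)
 interpret E: vspace ?E by (rule vspace_coind[OF M])
 have Gs: "f : carrier G ==> s \<odot> f : carrier G" for f s using G.smult_closed by simp
 have Gm: "f \<otimes> (s \<odot> g) = s \<odot> (f \<otimes> g)" "(s \<odot> f) \<otimes> g = s \<odot> (f \<otimes> g)"
  if "f : carrier G" "g : carrier G" for f g s
  using that G.smult_assoc2[of s g f] G.smult_assoc2[of s f g] Gs by (auto simp: G.m_comm)
 have mE: "m f \<phi> : carrier ?E" if "f : carrier G" "\<phi> : carrier ?E" for f \<phi>
  unfolding cs(1) m_def using that cD(3)[OF that(2)] klin_add[OF cD(1)[OF that(2)]] klin_smult[OF cD(1)[OF that(2)]] Gs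
  by (auto simp: klin_def G.r_distr Gm)
 have me: "m f \<phi> : extensional (carrier G)" for f \<phi> by (simp add: m_def)
 obtain Y k where Yk: "coordinates ?E Y k" using E.fin_dim_coordinates fdE by (auto simp: fd_module_def)
 interpret H: hopf_module G X c A p r U ?E m Y k
 proof unfold_locales
  show "kG_action ?E" by (rule fd_module_kG_action[OF fdE])
  show "act ?E \<one>\<^sub>B w = w" if "w : carrier ?E" for w using fdE that by (simp add: fd_module_def)
  show "klin ?E ?E (m f)" if f: "f : carrier G" for f
   using f mE by (intro klinI eqI ce me) (auto simp: m_def cs(2,3))
  show "klin G ?E (\<lambda>f. m f w)" if w: "w : carrier ?E" for w
   using w mE Gs klin_add[OF cD(1)[OF w]] klin_smult[OF cD(1)[OF w]]
   by (intro klinI eqI ce me) (auto simp: m_def cs(2,3) G.l_distr Gm)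
  show "m (f \<otimes> g) w = m f (m g w)" if "f : carrier G" "g : carrier G" "w : carrier ?E" for f g w
   using that by (intro eqI me) (auto simp: m_def G.m_ac)
  show "m \<one> w = w" if "w : carrier ?E" for w
   using cD(2)[OF that] by (intro eqI me) (auto simp: m_def)
  show "f [^] (p ^ r) = (counit G f ^ (p ^ r)) \<odot> \<one>" if "f : carrier G" for f by (rule Frobenius[OF that])
  show "coordinates ?E Y k" by (rule Yk)
 next
  fix f \<alpha> w assume f: "f : carrier G" and a: "\<alpha> : carrier B" and w: "w : carrier ?E"
  let ?b = "\<lambda>x y. \<alpha> (x \<otimes> y) \<odot>\<^sub>?E act ?E (c y) (m (hit (c x) f) w)"
  have b: "?b x y : carrier ?E" if "x : X" "y : X" for x y
   using that f w by (intro coind_smult[OF M] coind_act[OF M] mE) auto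
  have bsum: "(\<Oplus>\<^sub>?E y\<in>X. ?b x y) : carrier ?E" if "x : X" for x using b that by (intro E.M.finsum_closed) auto
  have s: "(\<Oplus>\<^sub>?E x\<in>X. \<Oplus>\<^sub>?E y\<in>X. ?b x y) : carrier ?E" using bsum by (intro E.M.finsum_closed) auto
  show "m f (act ?E \<alpha> w) = (\<Oplus>\<^sub>?E x\<in>X. \<Oplus>\<^sub>?E y\<in>X. ?b x y)"
  proof (rule eqI[OF me cD(2)[OF s]])
   fix g assume g: "g : carrier G"
   have t: "hit (c x) f \<otimes> hit (c y) g : carrier G" if "x : X" "y : X" for x y using that f g by simp
   have wt: "w (hit (c x) f \<otimes> hit (c y) g) : carrier M" if "x : X" "y : X" for x y using cD(3)[OF w t[OF that]] .
   note wad = additive_finsum[OF G.M.ag M.M.ag klin_additive[OF cD(1)[OF w]]]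
   have "m f (act ?E \<alpha> w) g = w (hit \<alpha> (f \<otimes> g))" using f g by (simp add: m_def cs(5))
   also have "... = (\<Oplus>\<^sub>M x\<in>X. w (\<Oplus>y\<in>X. \<alpha> (x \<otimes> y) \<odot> (hit (c x) f \<otimes> hit (c y) g)))"
    unfolding hit_product[OF a f g] using t Gs by (intro wad funcsetI G.M.finsum_closed) auto
   also have "... = (\<Oplus>\<^sub>M x\<in>X. \<Oplus>\<^sub>M y\<in>X. \<alpha> (x \<otimes> y) \<odot>\<^sub>M w (hit (c x) f \<otimes> hit (c y) g))"
   proof (intro M.M.finsum_cong' refl funcsetI M.M.finsum_closed)
    fix x assume x: "x : X"
    have "w (\<Oplus>y\<in>X. \<alpha> (x \<otimes> y) \<odot> (hit (c x) f \<otimes> hit (c y) g)) =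
      (\<Oplus>\<^sub>M y\<in>X. w (\<alpha> (x \<otimes> y) \<odot> (hit (c x) f \<otimes> hit (c y) g)))"
     using x t Gs by (intro wad) auto
    also have "... = (\<Oplus>\<^sub>M y\<in>X. \<alpha> (x \<otimes> y) \<odot>\<^sub>M w (hit (c x) f \<otimes> hit (c y) g))"
     using x t wt M.smult_closed by (intro M.M.finsum_cong' refl klin_smult[OF cD(1)[OF w]]) auto
    finally show "w (\<Oplus>y\<in>X. \<alpha> (x \<otimes> y) \<odot> (hit (c x) f \<otimes> hit (c y) g)) =
      (\<Oplus>\<^sub>M y\<in>X. \<alpha> (x \<otimes> y) \<odot>\<^sub>M w (hit (c x) f \<otimes> hit (c y) g))" .
   qed (use wt M.smult_closed in auto)
   also have "... = (\<Oplus>\<^sub>M x\<in>X. \<Oplus>\<^sub>M y\<in>X. ?b x y g)"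
    using wt f g M.smult_closed by (intro M.M.finsum_cong' refl funcsetI M.M.finsum_closed) (auto simp: cs(3,5) m_def)
   also have "... = (\<Oplus>\<^sub>M x\<in>X. (\<Oplus>\<^sub>?E y\<in>X. ?b x y) g)"
    using b bsum g cD(3) by (intro M.M.finsum_cong' refl coind_finsum[OF M, symmetric]) auto
   also have "... = (\<Oplus>\<^sub>?E x\<in>X. \<Oplus>\<^sub>?E y\<in>X. ?b x y) g" using bsum g by (intro coind_finsum[OF M, symmetric]) auto
   finally show "m f (act ?E \<alpha> w) g = (\<Oplus>\<^sub>?E x\<in>X. \<Oplus>\<^sub>?E y\<in>X. ?b x y) g" .
  qed
 qed
 show ?thesis by (rule H.acyclic[OF P])
qed

lemma equivariant_comp: "equivariant M N f ==> equivariant N L g ==> equivariant M L (\<lambda>x. g (f x))"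
 using klin_closed[of M N f] by (auto simp: equivariant_def klin_compose)

lemma projective_acyc:
 fixes Q :: "('k, 'h => 'k, 'm) bmod"
 assumes Frobenius: "!!f. f : carrier G ==> f [^] (p ^ r) = (counit G f ^ (p ^ r)) \<odot> \<one>"
  and inf: "infinite (UNIV :: 'k set)" and \<iota>: "inj (\<iota> :: 'k => 'm)"
  and Q: "projective B Q" and P: "P : Proj S Sg"
 shows "acyc Q P"
proof -
 let ?E = "coind G Q"
 have fd: "fd_module B Q" using Q by (simp add: projective_def)
 note fdE = fd_coind[OF fd]
 note vE = vspace_coind[OF fd]
 obtain j :: "('h => 'm) => 'm" where j: "inj_on j (carrier ?E)"
  using module_embed[OF inf \<iota> vE] fdE by (auto simp: fd_module_def)
 let ?F = "transport j ?E"
 let ?i = "inv_into (carrier ?E) j"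
 note ts = transport_simps[OF fdE j] and fdF = fd_transport[OF fdE j]
 have ij: "x : carrier ?E ==> ?i (j x) = x" for x by (rule inv_into_f_f[OF j])
 interpret E: vspace ?E by (rule vE)
 have equiv_i: "equivariant ?F ?E ?i"
  unfolding equivariant_def using coind_act[OF fd] E.smult_closed
  by (auto intro!: klinI simp: ts ij)
 have equiv_q: "equivariant ?E Q (coind_map Q)"
  using coind_map_klin[OF fd] coind_map_act[OF fd] by (simp add: equivariant_def)
 let ?g = "\<lambda>x. coind_map Q (?i x)"
 have "?g : mod_hom B ?F Q" by (intro equivariant_mod_hom equivariant_comp[OF equiv_i equiv_q])
 moreover have "?g ` carrier ?F = carrier Q"
  unfolding ts(1) image_image using coind_map_surj[OF fd] by (simp add: ij cong: image_cong)
 moreover have "(\<lambda>x. x) : mod_hom B Q Q" by (simp add: mod_hom_def)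
 moreover have "\<forall>M N g f. fd_module B M \<and> fd_module B N \<and> g : mod_hom B M N \<and> g ` carrier M = carrier N \<and>
   f : mod_hom B Q N \<longrightarrow> (\<exists>h\<in>mod_hom B Q M. \<forall>x\<in>carrier Q. g (h x) = f x)"
  using Q unfolding projective_def by (rule conjunct2)
 ultimately have "\<exists>h\<in>mod_hom B Q ?F. \<forall>x\<in>carrier Q. ?g (h x) = x"
  using fdF fd by (elim allE[of _ ?F] allE[of _ Q] allE[of _ ?g] allE[of _ "\<lambda>x. x"] impE) (intro conjI)
 then obtain h where h: "h : mod_hom B Q ?F" "!!x. x : carrier Q ==> ?g (h x) = x" by blast
 let ?s = "\<lambda>x. ?i (h x)"
 have equiv_s: "equivariant Q ?E ?s" by (rule equivariant_comp[OF mod_hom_equivariant[OF h(1)] equiv_i])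
 interpret Q: vspace Q using fd by (auto simp: fd_module_def vspace_def)
 have act0: "act Q \<alpha> \<zero>\<^sub>Q = \<zero>\<^sub>Q" if "\<alpha> : carrier B" for \<alpha>
  using additive_zero[OF Q.M.ag Q.M.ag klin_additive[OF act_klin(1)[OF fd that]]] .
 have equiv_0: "equivariant ?E Q (\<lambda>_. \<zero>\<^sub>Q)"
  using act0 Q.smult_r_null by (auto simp: equivariant_def intro!: klinI)
 note kE = fd_module_kG_action[OF fdE] and kQ = fd_module_kG_action[OF fd]
 note ac = acyc_coind[OF Frobenius fd P]
 show ?thesis
  by (rule acyc_retract[OF kQ kE kE equiv_s equiv_q equiv_s equiv_0 _ P ac ac]) (simp_all add: h(2))
qed

lemma short_exact_Heller:
 assumes cover: "projective_cover B Q \<pi> M"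
 shows "short_exact B (Heller Q \<pi> M) (\<lambda>x. x) Q \<pi> M"
proof -
 let ?H = "Heller Q \<pi> M"
 have fd: "fd_module B Q" "fd_module B M" and pi: "\<pi> : mod_hom B Q M" "\<pi> ` carrier Q = carrier M"
  using cover by (auto simp: projective_cover_def projective_def)
 have k: "klin Q M \<pi>" using mod_hom_equivariant[OF pi(1)] by (rule equivariant_klin)
 have pa: "\<pi> (act Q \<alpha> x) = act M \<alpha> (\<pi> x)" if "\<alpha> : carrier B" "x : carrier Q" for \<alpha> x
  using mod_hom_equivariant[OF pi(1)] that by (simp add: equivariant_def)
 interpret Q: vspace Q using fd by (auto simp: fd_module_def vspace_def)
 interpret M: vspace M using fd by (auto simp: fd_module_def vspace_def)
 note ag = Q.M.ag M.M.ag
 have act0: "act M \<alpha> \<zero>\<^sub>M = \<zero>\<^sub>M" if "\<alpha> : carrier B" for \<alpha>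
  using additive_zero[OF ag(2,2) klin_additive[OF act_klin(1)[OF fd(2) that]]] .
 have "submodule {x \<in> carrier Q. \<pi> x = \<zero>\<^sub>M} kk Q"
  using additive_zero[OF ag klin_additive[OF k]] additive_minus[OF ag klin_additive[OF k]] klin_add[OF k] klin_smult[OF k]
   Q.smult_closed M.smult_r_null
  by (intro Q.submoduleI) auto
 then have mod: "module kk ?H" unfolding Heller_def by (rule submodule.submodule_is_module[OF _ Q.module_kk])
 interpret H: vspace ?H by (rule vspace.intro) (rule mod)
 obtain s where s: "klin M Q s" "!!l. l : carrier M ==> \<pi> (s l) = l"
  using linear_section[OF Q.vspace_axioms M.vspace_axioms _ k pi(2)] fd(2) by (auto simp: fd_module_def)
 have sp: "klin Q Q (\<lambda>x. s (\<pi> x))" by (rule klin_compose[OF k s(1)])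
 let ?h = "\<lambda>x. x \<ominus>\<^sub>Q s (\<pi> x)"
 have hH: "?h x : carrier ?H" if "x : carrier Q" for x
  using that klin_closed[OF sp that] klin_closed[OF k that] s(2) additive_diff[OF ag klin_additive[OF k], of x "s (\<pi> x)"]
  by (simp add: Heller_def M.M.minus_eq M.M.r_neg)
 have s0: "s \<zero>\<^sub>M = \<zero>\<^sub>Q" using additive_zero[OF ag(2,1) klin_additive[OF s(1)]] .
 have "klin Q ?H ?h"
  using hH klin_closed[OF sp] klin_add[OF sp] klin_smult[OF sp] Q.smult_closed Q.smult_r_distr Q.smult_r_minus
  by (intro klinI) (auto simp: Heller_def Q.M.minus_eq Q.M.minus_add Q.M.a_ac)
 moreover have "?h ` carrier Q = carrier ?H"
 proof
  show "carrier ?H \<subseteq> ?h ` carrier Q"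
   by (auto simp: Heller_def s0 Q.M.minus_eq intro!: image_eqI[of _ _ x for x])
 qed (use hH in blast)
 ultimately have "fin_dim ?H"
  using fin_dim_image[OF Q.vspace_axioms _ H.vspace_axioms] fd(1) by (simp add: fd_module_def)
 then have "fd_module B ?H"
  using fd(1) mod act0 unfolding fd_module_def by (simp add: Heller_def pa)
 then show ?thesis
  using fd pi by (auto simp: short_exact_def mod_hom_def Heller_def)
qed

lemma acyc_stable_retract:
 fixes Y :: "('k, 'h => 'k, 'm) bmod"
 assumes proj: "!!Q :: ('k, 'h => 'k, 'm) bmod. projective B Q ==> acyc Q P"
  and fd: "fd_module B Z" "fd_module B Y" and iq: "i : mod_hom B Y Z" "q : mod_hom B Z Y"
  and id: "stable_eq B Y Y (q \<circ> i) id" and P: "P : Proj S Sg" and Z: "acyc Z P"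
 shows "acyc Y P"
proof -
 obtain Q a b where Q: "projective B Q" and a: "a : mod_hom B Y Q" and b: "b : mod_hom B Q Y"
  and eq: "!!x. x : carrier Y ==> q (i x) \<ominus>\<^sub>Y x = b (a x)"
  using id by (auto simp: stable_eq_def)
 have fdQ: "fd_module B Q" using Q by (simp add: projective_def)
 interpret Y: vspace Y using fd by (auto simp: fd_module_def vspace_def)
 interpret Q: vspace Q using fdQ by (auto simp: fd_module_def vspace_def)
 note e = mod_hom_equivariant
 have kb: "klin Q Y b" by (rule equivariant_klin[OF e[OF b]])
 have act_minus: "act Y \<alpha> (\<ominus>\<^sub>Y x) = \<ominus>\<^sub>Y act Y \<alpha> x" if "\<alpha> : carrier B" "x : carrier Y" for \<alpha> x
  using additive_minus[OF Y.M.ag Y.M.ag klin_additive[OF act_klin(1)[OF fd(2) that(1)]] that(2)] .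
 have "klin Q Y (\<lambda>x. \<ominus>\<^sub>Y b x)"
  using klin_closed[OF kb] klin_add[OF kb] klin_smult[OF kb] Y.smult_r_minus by (intro klinI) (auto simp: Y.M.minus_add)
 then have mb: "equivariant Q Y (\<lambda>x. \<ominus>\<^sub>Y b x)"
  using e[OF b] klin_closed[OF kb] by (auto simp: equivariant_def act_minus)
 have split: "x = q (i x) \<oplus>\<^sub>Y \<ominus>\<^sub>Y b (a x)" if x: "x : carrier Y" for x
 proof -
  have "q (i x) : carrier Y" using iq x by (auto simp: mod_hom_def)
  then show ?thesis using x unfolding eq[OF x, symmetric]
   by (simp add: Y.M.minus_eq Y.M.minus_add Y.M.r_neg1 Y.M.r_neg2)
 qed
 note ac = fd_module_kG_action
 show ?thesis
  by (rule acyc_retract[OF ac[OF fd(2)] ac[OF fd(1)] ac[OF fdQ] e[OF iq(1)] e[OF iq(2)] e[OF a] mb split P Z proj[OF Q]])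
qed

text \<open>
 A stable isomorphism makes each module a retract of the other one up to maps through projectives,
 so acyclicity only depends on the stable class. Shifts and cones come from short exact sequences.
\<close>

lemma thick_acyclic:
 assumes proj: "!!(Q :: ('k, 'h => 'k, 'm) bmod) P. projective B Q ==> P : Proj S Sg ==> acyc Q P"
 shows "thick B {M :: ('k, 'h => 'k, 'm) bmod. fd_module B M \<and> H1_zero p r G A U M}"
proof -
 define ac where "ac M \<longleftrightarrow> (\<forall>P\<in>Proj S Sg. acyc M P)" for M :: "('k, 'h => 'k, 'm) bmod"
 have H1: "fd_module B M \<and> H1_zero p r G A U M \<longleftrightarrow> fd_module B M \<and> ac M" for M :: "('k, 'h => 'k, 'm) bmod"
  using H1_zero_iff[OF fd_module_kG_action] by (auto simp: ac_def)
 have retract: "ac Y" if "ac X" "fd_module B X" "fd_module B Y" "i : mod_hom B Y X" "q : mod_hom B X Y"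
  "stable_eq B Y Y (q \<circ> i) id" for X Y :: "('k, 'h => 'k, 'm) bmod" and i q
  using acyc_stable_retract[OF proj that(2-6)] that(1) by (auto simp: ac_def)
 have iso: "ac Y" if "ac X" "fd_module B X" "fd_module B Y" "stable_iso B X Y f" for X Y :: "('k, 'h => 'k, 'm) bmod" and f
  using that(4) retract[OF that(1-3)] by (auto simp: stable_iso_def)
 have iso': "ac X" if "ac Y" "fd_module B X" "fd_module B Y" "stable_iso B X Y f" for X Y :: "('k, 'h => 'k, 'm) bmod" and f
  using that(4) retract[OF that(1,3,2)] by (auto simp: stable_iso_def)
 have quot: "ac L" if "short_exact B N f M g L" "ac N" "ac M" for N M L :: "('k, 'h => 'k, 'm) bmod" and f g
  using acyc_quotient[OF that(1)] that(2,3) by (auto simp: ac_def)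
 have sub: "ac N" if "short_exact B N f M g L" "ac M" "ac L" for N M L :: "('k, 'h => 'k, 'm) bmod" and f g
  using acyc_sub[OF that(1)] that(2,3) by (auto simp: ac_def)
 have projac: "ac Q" if "projective_cover B Q \<pi> M" for Q M :: "('k, 'h => 'k, 'm) bmod" and \<pi>
  using that proj by (auto simp: ac_def projective_cover_def)
 have fdH: "fd_module B (Heller Q \<pi> M)" if "projective_cover B Q \<pi> M" for Q M :: "('k, 'h => 'k, 'm) bmod" and \<pi>
  using short_exact_Heller[OF that] by (simp add: short_exact_def)
 show ?thesis
  unfolding thick_def H1 mem_Collect_eq
 proof (intro conjI allI impI)
  show "{M :: ('k, 'h => 'k, 'm) bmod. fd_module B M \<and> ac M} \<subseteq> {M. fd_module B M}" by blast
 next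
  fix X Y :: "('k, 'h => 'k, 'm) bmod" and f assume a: "(fd_module B X \<and> ac X) \<and> fd_module B Y \<and> stable_iso B X Y f"
  then show "fd_module B Y" "ac Y" using iso[of X Y f] by auto
 next
  fix X Q :: "('k, 'h => 'k, 'm) bmod" and \<pi> assume a: "(fd_module B X \<and> ac X) \<and> projective_cover B Q \<pi> X"
  then show "fd_module B (Heller Q \<pi> X)" "ac (Heller Q \<pi> X)"
   using sub[OF short_exact_Heller[of Q \<pi> X]] fdH projac by auto
 next
  fix X Q C :: "('k, 'h => 'k, 'm) bmod" and \<pi> \<theta> assume a: "(fd_module B X \<and> ac X) \<and> Omega_inv B X Q \<pi> C \<theta>"
  then have cover: "projective_cover B Q \<pi> C" and st: "stable_iso B (Heller Q \<pi> C) X \<theta>" by (auto simp: Omega_inv_def)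
  then show "fd_module B C" by (simp add: projective_cover_def)
  have "ac (Heller Q \<pi> C)" using iso'[OF _ fdH[OF cover] _ st] a by blast
  then show "ac C" using quot[OF short_exact_Heller[OF cover]] projac[OF cover] by blast
 next
  fix X Y Z :: "('k, 'h => 'k, 'm) bmod"
  assume a: "(fd_module B X \<and> ac X) \<and> fd_module B Y \<and> fd_module B Z \<and> stable_biproduct B X Y Z"
  then show "fd_module B Y" by simp
  show "ac Y" using a retract[of X Y] by (auto simp: stable_biproduct_def)
 next
  fix X Y Z Q C :: "('k, 'h => 'k, 'm) bmod" and \<pi> \<theta> u v w
  assume a: "(fd_module B X \<and> ac X) \<and> (fd_module B Y \<and> ac Y) \<and> triangle B X Y Z Q \<pi> C \<theta> u v w"
  then obtain N f M g L a' b' c' where Z: "fd_module B Z" and ex: "short_exact B N f M g L"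
   and st: "stable_iso B X N a'" "stable_iso B Y M b'" "stable_iso B Z L c'"
   by (auto simp: triangle_def)
  then have fd: "fd_module B N" "fd_module B M" "fd_module B L" by (auto simp: short_exact_def)
  have "ac L" using quot[OF ex] iso[OF _ _ fd(1) st(1)] iso[OF _ _ fd(2) st(2)] a by blast
  then show "ac Z" using iso'[OF _ Z fd(3) st(3)] by blast
  show "fd_module B Z" by (rule Z)
 qed
qed

end

text \<open>
 The augmentation ideal is a maximal ideal, so its elements, such as \<open>f - f(1)\<close>, have vanishing
 \<open>p ^ r\<close>-th power.
\<close>

lemma infinitesimal_Frobenius:
 fixes G :: "('k::field, 'h) hopf"
 assumes G: "infinitesimal_group_scheme p r G" and char: "CHAR('k) = p" "p > 0" and f: "f : carrier G"
 shows "f [^]\<^sub>G (p ^ r) = (counit G f ^ (p ^ r)) \<odot>\<^sub>G \<one>\<^sub>G"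
proof -
 have ag: "affine_group_scheme G" and nil: "!!\<mm> x. maximalideal \<mm> G ==> x : \<mm> ==> x [^]\<^sub>G (p ^ r) = \<zero>\<^sub>G"
  using G by (auto simp: infinitesimal_group_scheme_def)
 have alg: "algebra kk G" and eh: "counit G : alg_hom G kk" using ag by (auto simp: affine_group_scheme_def)
 interpret G: algebra kk G by (rule alg)
 note \<epsilon> = alg_homD[OF eh]
 have one_s: "s \<odot>\<^sub>G \<one>\<^sub>G : carrier G" for s using G.smult_closed by simp
 have eps_one: "counit G (s \<odot>\<^sub>G \<one>\<^sub>G) = s" for s using \<epsilon>(4) \<epsilon>(5)[OF G.one_closed, of s] by simp
 let ?I = "{x \<in> carrier G. counit G x = 0}"
 have eps_zero: "counit G \<zero>\<^sub>G = 0"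
  using additive_zero[OF G.M.ag module_kk_kk_abelian klin_additive[OF alg_hom_klin[OF eh]]] by simp
 have eps_minus: "counit G (\<ominus>\<^sub>G x) = - counit G x" if "x : carrier G" for x
  using additive_minus[OF G.M.ag module_kk_kk_abelian klin_additive[OF alg_hom_klin[OF eh]] that] by simp
 have id: "ideal ?I G"
 proof (rule idealI)
  show "ring G" ..
  show "subgroup ?I (add_monoid G)"
   using \<epsilon>(3) eps_zero eps_minus by (intro G.add.subgroupI) (auto simp: a_inv_def[symmetric])
 qed (use \<epsilon>(2) in auto)
 have "maximalideal ?I G"
 proof (rule maximalidealI[OF id])
  have "\<one>\<^sub>G \<notin> ?I" using \<epsilon>(4) by simp
  then show "carrier G \<noteq> ?I" using G.one_closed by blast
  fix J assume J: "ideal J G" "?I \<subseteq> J" "J \<subseteq> carrier G"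
  interpret J: ideal J G by fact
  show "J = ?I \<or> J = carrier G"
  proof (cases "J \<subseteq> ?I")
   case False
   then obtain x where x: "x : J" "counit G x \<noteq> 0" using J by auto
   let ?s = "counit G x"
   have xc: "x : carrier G" using x J by auto
   have "x \<ominus>\<^sub>G ?s \<odot>\<^sub>G \<one>\<^sub>G : ?I"
    using xc one_s \<epsilon>(3) eps_minus by (simp add: G.minus_eq eps_one)
   then have "x \<ominus>\<^sub>G (x \<ominus>\<^sub>G ?s \<odot>\<^sub>G \<one>\<^sub>G) : J" using J(2) x(1) by (simp add: G.minus_eq J.a_closed J.a_inv_closed subset_iff)
   moreover have "x \<ominus>\<^sub>G (x \<ominus>\<^sub>G ?s \<odot>\<^sub>G \<one>\<^sub>G) = ?s \<odot>\<^sub>G \<one>\<^sub>G"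
    using xc one_s by (simp add: G.minus_eq G.minus_add G.r_neg2 G.r_neg1)
   ultimately have "(1 / ?s \<odot>\<^sub>G \<one>\<^sub>G) \<otimes>\<^sub>G (?s \<odot>\<^sub>G \<one>\<^sub>G) : J" using one_s by (intro J.I_l_closed) auto
   moreover have "(1 / ?s \<odot>\<^sub>G \<one>\<^sub>G) \<otimes>\<^sub>G (?s \<odot>\<^sub>G \<one>\<^sub>G) = \<one>\<^sub>G"
    using x(2) smult_eq_mult_one[OF alg one_s, of "1 / ?s" ?s] G.smult_assoc1[of "1 / ?s" ?s "\<one>\<^sub>G"] G.smult_one[of "\<one>\<^sub>G"]
    by simp
   ultimately show ?thesis using J.one_imp_carrier by simp
  qed (use J(2) in blast)
 qed
 note nilI = nil[OF this]
 let ?s = "counit G f"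
 define h where "h = f \<ominus>\<^sub>G ?s \<odot>\<^sub>G \<one>\<^sub>G"
 have h: "h : carrier G" "h [^]\<^sub>G (p ^ r) = \<zero>\<^sub>G"
  unfolding h_def using f one_s \<epsilon>(3) eps_minus by (auto intro!: nilI simp: G.minus_eq eps_one)
 have fh: "f = h \<oplus>\<^sub>G ?s \<odot>\<^sub>G \<one>\<^sub>G" unfolding h_def using f one_s by (simp add: G.minus_eq G.a_assoc G.l_neg)
 define a where "a b = (if b then h else ?s \<odot>\<^sub>G \<one>\<^sub>G)" for b
 have a: "a b : carrier G" for b using h one_s by (simp add: a_def)
 have pow: "((\<lambda>z. x \<otimes>\<^sub>G z) ^^ n) z = x [^]\<^sub>G n \<otimes>\<^sub>G z" if "x : carrier G" "z : carrier G" for x z n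
  using that by (induction n) (auto simp: G.m_ac)
 have "add_pow G p z = \<zero>\<^sub>G" if "z : carrier G" for z
  using add_pow_smult[OF alg that, of p] of_nat_CHAR[where 'a = 'k] char G.smult_l_null[of z] that by simp
 then have "((\<lambda>z. \<Oplus>\<^sub>G b\<in>{True, False}. a b \<otimes>\<^sub>G z) ^^ (p ^ r)) \<one>\<^sub>G =
   (\<Oplus>\<^sub>G b\<in>{True, False}. ((\<lambda>z. a b \<otimes>\<^sub>G z) ^^ (p ^ r)) \<one>\<^sub>G)"
  using a by (intro G.frobenius_sum char_prime_iff[OF char]) (auto simp: additive_def G.r_distr G.m_ac)
 moreover have "(\<Oplus>\<^sub>G b\<in>{True, False}. a b \<otimes>\<^sub>G z) = f \<otimes>\<^sub>G z" if "z : carrier G" for z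
  using that a[of True] a[of False] arg_cong[OF fh, of "\<lambda>x. x \<otimes>\<^sub>G z"] by (simp add: a_def G.l_distr)
 then have "((\<lambda>z. \<Oplus>\<^sub>G b\<in>{True, False}. a b \<otimes>\<^sub>G z) ^^ n) \<one>\<^sub>G = f [^]\<^sub>G n" for n
  using f by (induction n) (auto simp: G.m_comm)
 ultimately have "f [^]\<^sub>G (p ^ r) = h [^]\<^sub>G (p ^ r) \<oplus>\<^sub>G (?s \<odot>\<^sub>G \<one>\<^sub>G) [^]\<^sub>G (p ^ r)"
  using a[of True] a[of False] by (simp add: pow a_def)
 moreover have "(?s \<odot>\<^sub>G \<one>\<^sub>G) [^]\<^sub>G (n::nat) = (?s ^ n) \<odot>\<^sub>G \<one>\<^sub>G" for n
  using one_s G.smult_one[of "\<one>\<^sub>G"] smult_eq_mult_one[OF alg one_s] G.smult_assoc1[of _ _ "\<one>\<^sub>G"]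
  by (induction n) (auto simp: G.m_comm)
 ultimately show ?thesis using h one_s by simp
qed

theorem theorem4p12:
 fixes G :: "('k::alg_closed_field, 'h) hopf"
  and A :: "('k, 'a) module"
  and U :: "'h \<Rightarrow> nat \<Rightarrow> 'a"
  and p r :: nat
 assumes "CHAR('k) = p" and "p > 0" and "r \<ge> 1"
  and "infinitesimal_group_scheme p r G"
  and "\<exists>\<iota> :: 'k \<Rightarrow> 'a. inj \<iota>"
  and "represents_V p r G A U"
  and "\<exists>\<iota> :: 'k \<Rightarrow> 'm. inj \<iota>"
 shows "thick (group_algebra G)
  {M :: ('k, 'h \<Rightarrow> 'k, 'm) bmod. fd_module (group_algebra G) M \<and> H1_zero p r G A U M}"
proof -
 have ag: "affine_group_scheme G" and fin: "fin_dim G" using assms(4) by (auto simp: infinitesimal_group_scheme_def)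
 have alg: "algebra kk G" using ag by (simp add: affine_group_scheme_def)
 obtain X c where Xc: "coordinates G X c" using vspace.fin_dim_coordinates[OF algebra_vspace[OF alg] fin] by blast
 interpret G: vspace G by (rule algebra_vspace[OF alg])
 define c' where "c' x = restrict (c x) (carrier G)" for x
 have Xc': "coordinates G X c'"
  using Xc G.smult_closed by (auto simp: coordinates_def c'_def klin_def)
 interpret representing G X c' A p r U
 proof (intro representing.intro one_param.intro hopf_coords.intro representing_axioms.intro one_param_axioms.intro)
  show "affine_group_scheme G" by (rule ag)
  show "coordinates G X c'" by (rule Xc')
  show "c' x : extensional (carrier G)" for x by (simp add: c'_def)
 qed (use assms in "auto simp: represents_V_def")
 obtain \<iota> :: "'k => 'm" where \<iota>: "inj \<iota>" using assms(7) by blast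
 show ?thesis
  using projective_acyc[OF infinitesimal_Frobenius[OF assms(4,1,2)] alg_closed_infinite \<iota>] by (intro thick_acyclic)
qed

end
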